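(* Let $(H,A,C)$ be a monoidal Doi-Hopf datum. Then $(A\#C^*,\alpha_A\otimes(\alpha_C^{-1})^* )$ is a Hom-bialgebra (with the tensor coproduct), and consequently ${}_A\mathcal{M}(H)^C$ and ${}_{A\#C^*}\mathcal{M}$ are isomorphic as monoidal categories.
   Context: Work over a field $k$, $\otimes=\otimes_k$. Negative powers of structure maps $\alpha$ denote powers of their inverses, which the formulas presuppose. Hom-algebra $(A,\alpha_A)$: a linear multiplication, a unit $1_A$ and a linear $\alpha_A:A\to A$ with $\alpha_A(ab)=\alpha_A(a)\alpha_A(b)$, $\alpha_A(1_A)=1_A$, $1_Aa=\alpha_A(a)=a1_A$, $\alpha_A(a)(bc)=(ab)\alpha_A(c)$. Hom-coalgebra $(C,\alpha_C)$: linear $\Delta:C\to C\otimes C$, $\Delta(c)=c_1\otimes c_2$, $\varepsilon:C\to k$ and $\alpha_C$ with $\varepsilon\circ\alpha_C=\varepsilon$, $(\alpha_C\otimes\alpha_C)\Delta=\Delta\alpha_C$, $(\varepsilon\otimes id)\Delta=\alpha_C=(id\otimes\varepsilon)\Delta$, $(\Delta\otimes\alpha_C)\Delta=(\alpha_C\otimes\Delta)\Delta$. Hom-bialgebra: a Hom-algebra and Hom-coalgebra with the same $\alpha$ such that $\Delta,\varepsilon$ are Hom-algebra morphisms. Hom-Hopf algebra: a Hom-bialgebra with a linear $S$, $S\alpha=\alpha S$, $S(h_1)h_2=h_1S(h_2)=\varepsilon(h)1$. Left $A$-module $(M,\alpha_M)$: linear $A\otimes M\to M$ with $1_A\cdot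 m=\alpha_M(m)$, $\alpha_M(a\cdot m)=\alpha_A(a)\cdot\alpha_M(m)$, $\alpha_A(a)\cdot(b\cdot m)=(ab)\cdot\alpha_M(m)$. Right $C$-comodule $(M,\alpha_M)$: linear $\rho:M\to M\otimes C$, $\rho(m)=m_{(0)}\otimes m_{(1)}$, with $(id\otimes\varepsilon)\rho=\alpha_M$, $(\alpha_M\otimes\alpha_C)\rho=\rho\alpha_M$, $(\rho\otimes\alpha_C)\rho=(\alpha_M\otimes\Delta)\rho$. (Co)module maps are (co)linear and commute with the $\alpha$'s. A (Hom-type) Doi-Hopf datum $(H,A,C)$ consists of a Hom-Hopf algebra $(H,\alpha_H)$, a right $H$-comodule algebra $(A,\alpha_A)$ (a Hom-algebra and right $H$-comodule, $\rho(a)=a_{(0)}\otimes a_{(1)}$, with $\rho(ab)=\rho(a)\rho(b)$, $\rho(1_A)=1_A\otimes1_H$) and a left $H$-module coalgebra $(C,\alpha_C)$ (a Hom-coalgebra and left $H$-module with $\Delta_C(h\cdot c)=h_1\cdot c_1\otimes h_2\cdot c_2$, $\varepsilon_C(h\cdot c)=\varepsilon_H(h)\varepsilon_C(c)$). A Doi-Hopf module over $(H,A,C)$ is $(M,\alpha_M)$ that is a left $A$-module and a right $C$-comodule with $\rho(a\cdot m)=a_{(0)}\cdot m_{(0)}\otimes a_{(1)}\cdot m_{(1)}$. ${}_A\mathcal{M}(H)^C$ is the category of these, with $A$-linear $C$-colinear maps. The datum is monoidal if $A$ and $C$ are Hom-bialgebras and $a_{(0)1}\otimes a_{(0)2}\otimes\alpha_H^2(a_{(1)})\cdot(cd)=a_{1(0)}\otimes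 a_{2(0)}\otimes(a_{1(1)}\cdot c)(a_{2(1)}\cdot d)$, $\varepsilon(a)1_C=\varepsilon(a_{(0)})a_{(1)}\cdot1_C$ for all $a\in A$, $c,d\in C$. Then ${}_A\mathcal{M}(H)^C$ is monoidal: $(M\otimes N,\alpha_M\otimes\alpha_N)$ has $a\cdot(m\otimes n)=a_1\cdot m\otimes a_2\cdot n$, $\rho(m\otimes n)=m_{(0)}\otimes n_{(0)}\otimes\alpha_C^{-2}(m_{(1)}n_{(1)})$; the associator is $(m\otimes n)\otimes p\mapsto\alpha_M^{-1}(m)\otimes(n\otimes\alpha_P(p))$; the unit is $k$ with trivial structure, and unit constraints $\lambda\otimes m\mapsto\lambda\alpha_M^{-1}(m)$, $m\otimes\lambda\mapsto\lambda\alpha_M^{-1}(m)$. For a Hom-bialgebra $B$, the category ${}_B\mathcal{M}$ of left $B$-modules is monoidal with $b\cdot(m\otimes n)=b_1\cdot m\otimes b_2\cdot n$, unit $k$ (action by $\varepsilon$) and the same constraint formulas. $C^*$ is the linear dual of $C$, with structure map $\alpha_{C^*}=(\alpha_C^{-1})^*$, unit $\varepsilon_C$, product $\langle fg,c\rangle=\langle f,\alpha_C^{-2}(c_1)\rangle\langle g,\alpha_C^{-2}(c_2)\rangle$, coproduct $f\mapsto f_1\otimes f_2$ given by $\langle f_1,c\rangle\langle f_2,d\rangle=\langle f,\alpha_C^{-2}(cd)\rangle$ and counit $f\mapsto f(1_C)$; $H$ acts on it on the right by $\langle f\leftharpoonup h,c\rangle=\langle f,h\cdot\alpha_C^{-2}(c)\rangle$.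 $A\#C^*$ is $A\otimes C^*$ as a space, with unit $1_A\#\varepsilon_C$, product $$(a\#f)(a'\#f')=a\,\alpha_A^{-1}(a'_{(0)})\#\big(\alpha_{C^*}^{-1}(f)\leftharpoonup\alpha_H^{-2}(a'_{(1)})\big)f',$$ coproduct $\Delta(a\#f)=(a_1\#f_1)\otimes(a_2\#f_2)$ and counit $\varepsilon(a\#f)=\varepsilon_A(a)f(1_C)$.
   Formalization: C is additionally assumed finite-dimensional; otherwise the coproduct on C^* need not exist, and even when it does, modules over A#C^* need not come from C-comodules, so the isomorphism of categories fails. *)

theory Defs
  imports "HOL-Algebra.Module" "HOL-Library.FuncSet"
begin

section \<open>Vector spaces and tensor products\<close>

text \<open>
  The ground field is a ring record \<open>K\<close> with \<^term>\<open>field K\<close>, and a vector space is a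
  \<^term>\<open>module K V\<close> in the sense of HOL-Algebra. A linear map out of a tensor product \<open>V \<otimes> W\<close>
  that is part of the data (a multiplication, an action) is given as the corresponding
  bilinear map.
\<close>

definition linear_map ::
  "'k ring \<Rightarrow> ('k,'v,'m) module_scheme \<Rightarrow> ('k,'w,'n) module_scheme \<Rightarrow> ('v \<Rightarrow> 'w) \<Rightarrow> bool" where
  "linear_map K V W f \<longleftrightarrow>
     f \<in> carrier V \<rightarrow> carrier W \<and>
     (\<forall>x\<in>carrier V. \<forall>y\<in>carrier V. f (x \<oplus>\<^bsub>V\<^esub> y) = f x \<oplus>\<^bsub>W\<^esub> f y) \<and>
     (\<forall>r\<in>carrier K. \<forall>x\<in>carrier V. f (r \<odot>\<^bsub>V\<^esub> x) = r \<odot>\<^bsub>W\<^esub> f x)"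

definition bilinear_map ::
  "'k ring \<Rightarrow> ('k,'v,'m) module_scheme \<Rightarrow> ('k,'w,'n) module_scheme \<Rightarrow> ('k,'u,'l) module_scheme
   \<Rightarrow> ('v \<Rightarrow> 'w \<Rightarrow> 'u) \<Rightarrow> bool" where
  "bilinear_map K V W U b \<longleftrightarrow>
     (\<forall>x\<in>carrier V. linear_map K W U (b x)) \<and>
     (\<forall>y\<in>carrier W. linear_map K V U (\<lambda>x. b x y))"

definition finite_dimensional :: "'k ring \<Rightarrow> ('k,'v,'m) module_scheme \<Rightarrow> bool" where
  "finite_dimensional K V \<longleftrightarrow>
     (\<exists>B. finite B \<and> B \<subseteq> carrier V \<and>
        (\<forall>x\<in>carrier V. \<exists>g\<in>B \<rightarrow> carrier K. x = (\<Oplus>\<^bsub>V\<^esub>b\<in>B. g b \<odot>\<^bsub>V\<^esub> b)))"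

definition scalars :: "'k ring \<Rightarrow> ('k,'k) module" where
  "scalars K = \<lparr>carrier = carrier K, mult = mult K, one = \<one>\<^bsub>K\<^esub>, zero = \<zero>\<^bsub>K\<^esub>, add = add K,
     smult = mult K\<rparr>"

text \<open>
  The list \<open>[(x\<^sub>1,y\<^sub>1),\<dots>,(x\<^sub>n,y\<^sub>n)]\<close> stands for the formal sum \<open>x\<^sub>1 \<otimes> y\<^sub>1 + \<dots> + x\<^sub>n \<otimes> y\<^sub>n\<close>;
  \<open>V \<otimes> W\<close> is the set of such lists modulo the congruence generated by commutativity
  and bilinearity. No scalar coefficients are needed, as they can be absorbed into \<open>x\<^sub>i\<close>.
\<close>

definition formal_sums :: "('k,'v,'m) module_scheme \<Rightarrow> ('k,'w,'n) module_scheme \<Rightarrow> ('v \<times> 'w) list set" where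
  "formal_sums V W = lists (carrier V \<times> carrier W)"

inductive_set tensor_rel ::
  "'k ring \<Rightarrow> ('k,'v,'m) module_scheme \<Rightarrow> ('k,'w,'n) module_scheme \<Rightarrow> (('v \<times> 'w) list \<times> ('v \<times> 'w) list) set"
  for K V W where
  refl: "p \<in> formal_sums V W \<Longrightarrow> (p, p) \<in> tensor_rel K V W"
| sym: "(p, q) \<in> tensor_rel K V W \<Longrightarrow> (q, p) \<in> tensor_rel K V W"
| trans: "(p, q) \<in> tensor_rel K V W \<Longrightarrow> (q, r) \<in> tensor_rel K V W \<Longrightarrow> (p, r) \<in> tensor_rel K V W"
| cong: "(p, q) \<in> tensor_rel K V W \<Longrightarrow> (p', q') \<in> tensor_rel K V W \<Longrightarrow>
         (p @ p', q @ q') \<in> tensor_rel K V W"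
| comm: "p \<in> formal_sums V W \<Longrightarrow> q \<in> formal_sums V W \<Longrightarrow> (p @ q, q @ p) \<in> tensor_rel K V W"
| add_left: "x \<in> carrier V \<Longrightarrow> x' \<in> carrier V \<Longrightarrow> y \<in> carrier W \<Longrightarrow>
         ([(x \<oplus>\<^bsub>V\<^esub> x', y)], [(x, y), (x', y)]) \<in> tensor_rel K V W"
| add_right: "x \<in> carrier V \<Longrightarrow> y \<in> carrier W \<Longrightarrow> y' \<in> carrier W \<Longrightarrow>
         ([(x, y \<oplus>\<^bsub>W\<^esub> y')], [(x, y), (x, y')]) \<in> tensor_rel K V W"
| smult: "r \<in> carrier K \<Longrightarrow> x \<in> carrier V \<Longrightarrow> y \<in> carrier W \<Longrightarrow>
         ([(r \<odot>\<^bsub>V\<^esub> x, y)], [(x, r \<odot>\<^bsub>W\<^esub> y)]) \<in> tensor_rel K V W"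
| zero: "y \<in> carrier W \<Longrightarrow> ([(\<zero>\<^bsub>V\<^esub>, y)], []) \<in> tensor_rel K V W"

definition tensor_rep :: "('v \<times> 'w) list set \<Rightarrow> ('v \<times> 'w) list" where
  "tensor_rep X = (SOME p. p \<in> X)"

definition tensor ::
  "'k ring \<Rightarrow> ('k,'v,'m) module_scheme \<Rightarrow> ('k,'w,'n) module_scheme \<Rightarrow> ('k, ('v \<times> 'w) list set) module" where
  "tensor K V W =
     \<lparr>carrier = formal_sums V W // tensor_rel K V W,
      mult = undefined, one = undefined,
      zero = tensor_rel K V W `` {[]},
      add = (\<lambda>X Y. tensor_rel K V W `` {tensor_rep X @ tensor_rep Y}),
      smult = (\<lambda>r X. tensor_rel K V W `` {map (\<lambda>(x, y). (r \<odot>\<^bsub>V\<^esub> x, y)) (tensor_rep X)})\<rparr>"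

definition pure ::
  "'k ring \<Rightarrow> ('k,'v,'m) module_scheme \<Rightarrow> ('k,'w,'n) module_scheme \<Rightarrow> 'v \<Rightarrow> 'w \<Rightarrow> ('v \<times> 'w) list set" where
  "pure K V W x y = tensor_rel K V W `` {[(x, y)]}"

text \<open>
  \<open>sweedler U X (\<lambda>x y. b x y)\<close> is the value at \<open>X = \<Sum>x \<otimes> y\<close> of the linear map to \<open>U\<close> induced
  by \<open>b\<close>, that is \<open>\<Sum> b x y\<close> in Sweedler style. It does not depend on the chosen
  representative of \<open>X\<close> as long as \<open>b\<close> is bilinear.
\<close>

definition formal_eval :: "('k,'u,'l) module_scheme \<Rightarrow> ('v \<times> 'w) list \<Rightarrow> ('v \<Rightarrow> 'w \<Rightarrow> 'u) \<Rightarrow> 'u" where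
  "formal_eval U p b = foldr (\<lambda>(x, y) s. b x y \<oplus>\<^bsub>U\<^esub> s) p \<zero>\<^bsub>U\<^esub>"

definition sweedler :: "('k,'u,'l) module_scheme \<Rightarrow> ('v \<times> 'w) list set \<Rightarrow> ('v \<Rightarrow> 'w \<Rightarrow> 'u) \<Rightarrow> 'u" where
  "sweedler U X b = formal_eval U (tensor_rep X) b"


section \<open>Hom-structures\<close>

record ('k,'v) hom_space = "('k,'v) module" +
  alpha :: "'v \<Rightarrow> 'v" ("\<alpha>\<index>")

text \<open>
  Multiplication and unit are the fields inherited from the ring record. The same record
  serves for Hom-algebras, Hom-coalgebras and Hom-bialgebras; the fields not mentioned by
  the respective predicate are unconstrained.
\<close>

record ('k,'v) hom_bialg = "('k,'v) hom_space" +
  comult :: "'v \<Rightarrow> ('v \<times> 'v) list set" ("\<Delta>\<index>")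
  counit :: "'v \<Rightarrow> 'k" ("\<epsilon>\<index>")

definition bijective_alpha :: "('k,'v,'m) hom_space_scheme \<Rightarrow> bool" where
  "bijective_alpha V \<longleftrightarrow> bij_betw \<alpha>\<^bsub>V\<^esub> (carrier V) (carrier V)"

definition alpha_inv :: "('k,'v,'m) hom_space_scheme \<Rightarrow> 'v \<Rightarrow> 'v" where
  "alpha_inv V = inv_into (carrier V) \<alpha>\<^bsub>V\<^esub>"

definition hom_vector_space :: "'k ring \<Rightarrow> ('k,'v,'m) hom_space_scheme \<Rightarrow> bool" where
  "hom_vector_space K V \<longleftrightarrow> module K V \<and> linear_map K V V \<alpha>\<^bsub>V\<^esub>"

definition hom_algebra :: "'k ring \<Rightarrow> ('k,'v,'m) hom_space_scheme \<Rightarrow> bool" where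
  "hom_algebra K A \<longleftrightarrow>
     hom_vector_space K A \<and> bilinear_map K A A A (mult A) \<and> \<one>\<^bsub>A\<^esub> \<in> carrier A \<and>
     (\<forall>a\<in>carrier A. \<forall>b\<in>carrier A. \<alpha>\<^bsub>A\<^esub> (a \<otimes>\<^bsub>A\<^esub> b) = \<alpha>\<^bsub>A\<^esub> a \<otimes>\<^bsub>A\<^esub> \<alpha>\<^bsub>A\<^esub> b) \<and>
     \<alpha>\<^bsub>A\<^esub> \<one>\<^bsub>A\<^esub> = \<one>\<^bsub>A\<^esub> \<and>
     (\<forall>a\<in>carrier A. \<one>\<^bsub>A\<^esub> \<otimes>\<^bsub>A\<^esub> a = \<alpha>\<^bsub>A\<^esub> a \<and> a \<otimes>\<^bsub>A\<^esub> \<one>\<^bsub>A\<^esub> = \<alpha>\<^bsub>A\<^esub> a) \<and>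
     (\<forall>a\<in>carrier A. \<forall>b\<in>carrier A. \<forall>c\<in>carrier A.
        \<alpha>\<^bsub>A\<^esub> a \<otimes>\<^bsub>A\<^esub> (b \<otimes>\<^bsub>A\<^esub> c) = (a \<otimes>\<^bsub>A\<^esub> b) \<otimes>\<^bsub>A\<^esub> \<alpha>\<^bsub>A\<^esub> c)"

text \<open>
  Here and below \<open>k \<otimes> V\<close> and \<open>V \<otimes> k\<close> are identified with \<open>V\<close>, and \<open>(U \<otimes> V) \<otimes> W\<close> with
  \<open>U \<otimes> (V \<otimes> W)\<close>.
\<close>

definition hom_coalgebra :: "'k ring \<Rightarrow> ('k,'v,'m) hom_bialg_scheme \<Rightarrow> bool" where
  "hom_coalgebra K C \<longleftrightarrow>
     (let CC = tensor K C C; CCC = tensor K C CC in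
     hom_vector_space K C \<and> linear_map K C CC \<Delta>\<^bsub>C\<^esub> \<and> linear_map K C (scalars K) \<epsilon>\<^bsub>C\<^esub> \<and>
     (\<forall>c\<in>carrier C.
        \<epsilon>\<^bsub>C\<^esub> (\<alpha>\<^bsub>C\<^esub> c) = \<epsilon>\<^bsub>C\<^esub> c \<and>
        sweedler CC (\<Delta>\<^bsub>C\<^esub> c) (\<lambda>c1 c2. pure K C C (\<alpha>\<^bsub>C\<^esub> c1) (\<alpha>\<^bsub>C\<^esub> c2)) = \<Delta>\<^bsub>C\<^esub> (\<alpha>\<^bsub>C\<^esub> c) \<and>
        sweedler C (\<Delta>\<^bsub>C\<^esub> c) (\<lambda>c1 c2. \<epsilon>\<^bsub>C\<^esub> c1 \<odot>\<^bsub>C\<^esub> c2) = \<alpha>\<^bsub>C\<^esub> c \<and>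
        sweedler C (\<Delta>\<^bsub>C\<^esub> c) (\<lambda>c1 c2. \<epsilon>\<^bsub>C\<^esub> c2 \<odot>\<^bsub>C\<^esub> c1) = \<alpha>\<^bsub>C\<^esub> c \<and>
        sweedler CCC (\<Delta>\<^bsub>C\<^esub> c) (\<lambda>c1 c2. sweedler CCC (\<Delta>\<^bsub>C\<^esub> c1)
            (\<lambda>c11 c12. pure K C CC c11 (pure K C C c12 (\<alpha>\<^bsub>C\<^esub> c2)))) =
        sweedler CCC (\<Delta>\<^bsub>C\<^esub> c) (\<lambda>c1 c2. pure K C CC (\<alpha>\<^bsub>C\<^esub> c1) (\<Delta>\<^bsub>C\<^esub> c2))))"

definition hom_bialgebra :: "'k ring \<Rightarrow> ('k,'v,'m) hom_bialg_scheme \<Rightarrow> bool" where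
  "hom_bialgebra K B \<longleftrightarrow>
     hom_algebra K B \<and> hom_coalgebra K B \<and>
     (\<forall>a\<in>carrier B. \<forall>b\<in>carrier B.
        \<Delta>\<^bsub>B\<^esub> (a \<otimes>\<^bsub>B\<^esub> b) =
          sweedler (tensor K B B) (\<Delta>\<^bsub>B\<^esub> a) (\<lambda>a1 a2. sweedler (tensor K B B) (\<Delta>\<^bsub>B\<^esub> b)
            (\<lambda>b1 b2. pure K B B (a1 \<otimes>\<^bsub>B\<^esub> b1) (a2 \<otimes>\<^bsub>B\<^esub> b2)))) \<and>
     \<Delta>\<^bsub>B\<^esub> \<one>\<^bsub>B\<^esub> = pure K B B \<one>\<^bsub>B\<^esub> \<one>\<^bsub>B\<^esub> \<and>
     (\<forall>a\<in>carrier B. \<forall>b\<in>carrier B. \<epsilon>\<^bsub>B\<^esub> (a \<otimes>\<^bsub>B\<^esub> b) = \<epsilon>\<^bsub>B\<^esub> a \<otimes>\<^bsub>K\<^esub> \<epsilon>\<^bsub>B\<^esub> b) \<and>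
     \<epsilon>\<^bsub>B\<^esub> \<one>\<^bsub>B\<^esub> = \<one>\<^bsub>K\<^esub>"

definition hom_hopf_algebra :: "'k ring \<Rightarrow> ('k,'v,'m) hom_bialg_scheme \<Rightarrow> ('v \<Rightarrow> 'v) \<Rightarrow> bool" where
  "hom_hopf_algebra K H S \<longleftrightarrow>
     hom_bialgebra K H \<and> linear_map K H H S \<and>
     (\<forall>h\<in>carrier H.
        S (\<alpha>\<^bsub>H\<^esub> h) = \<alpha>\<^bsub>H\<^esub> (S h) \<and>
        sweedler H (\<Delta>\<^bsub>H\<^esub> h) (\<lambda>h1 h2. S h1 \<otimes>\<^bsub>H\<^esub> h2) = \<epsilon>\<^bsub>H\<^esub> h \<odot>\<^bsub>H\<^esub> \<one>\<^bsub>H\<^esub> \<and>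
        sweedler H (\<Delta>\<^bsub>H\<^esub> h) (\<lambda>h1 h2. h1 \<otimes>\<^bsub>H\<^esub> S h2) = \<epsilon>\<^bsub>H\<^esub> h \<odot>\<^bsub>H\<^esub> \<one>\<^bsub>H\<^esub>)"

definition left_hom_module ::
  "'k ring \<Rightarrow> ('k,'a,'m) hom_space_scheme \<Rightarrow> ('k,'v,'n) hom_space_scheme \<Rightarrow> ('a \<Rightarrow> 'v \<Rightarrow> 'v) \<Rightarrow> bool" where
  "left_hom_module K A M act \<longleftrightarrow>
     hom_vector_space K M \<and> bilinear_map K A M M act \<and>
     (\<forall>m\<in>carrier M. act \<one>\<^bsub>A\<^esub> m = \<alpha>\<^bsub>M\<^esub> m) \<and>
     (\<forall>a\<in>carrier A. \<forall>m\<in>carrier M. \<alpha>\<^bsub>M\<^esub> (act a m) = act (\<alpha>\<^bsub>A\<^esub> a) (\<alpha>\<^bsub>M\<^esub> m)) \<and>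
     (\<forall>a\<in>carrier A. \<forall>b\<in>carrier A. \<forall>m\<in>carrier M.
        act (\<alpha>\<^bsub>A\<^esub> a) (act b m) = act (a \<otimes>\<^bsub>A\<^esub> b) (\<alpha>\<^bsub>M\<^esub> m))"

definition right_hom_comodule ::
  "'k ring \<Rightarrow> ('k,'c,'m) hom_bialg_scheme \<Rightarrow> ('k,'v,'n) hom_space_scheme
   \<Rightarrow> ('v \<Rightarrow> ('v \<times> 'c) list set) \<Rightarrow> bool" where
  "right_hom_comodule K C M \<rho> \<longleftrightarrow>
     (let CC = tensor K C C; MC = tensor K M C; MCC = tensor K M CC in
     hom_vector_space K M \<and> linear_map K M MC \<rho> \<and>
     (\<forall>m\<in>carrier M.
        sweedler M (\<rho> m) (\<lambda>m0 m1. \<epsilon>\<^bsub>C\<^esub> m1 \<odot>\<^bsub>M\<^esub> m0) = \<alpha>\<^bsub>M\<^esub> m \<and>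
        sweedler MC (\<rho> m) (\<lambda>m0 m1. pure K M C (\<alpha>\<^bsub>M\<^esub> m0) (\<alpha>\<^bsub>C\<^esub> m1)) = \<rho> (\<alpha>\<^bsub>M\<^esub> m) \<and>
        sweedler MCC (\<rho> m) (\<lambda>m0 m1. sweedler MCC (\<rho> m0)
            (\<lambda>m00 m01. pure K M CC m00 (pure K C C m01 (\<alpha>\<^bsub>C\<^esub> m1)))) =
        sweedler MCC (\<rho> m) (\<lambda>m0 m1. pure K M CC (\<alpha>\<^bsub>M\<^esub> m0) (\<Delta>\<^bsub>C\<^esub> m1))))"


section \<open>Doi-Hopf data\<close>

record ('k,'h,'a,'c) doi_hopf_datum =
  HH :: "('k,'h) hom_bialg"
  antipode :: "'h \<Rightarrow> 'h"
  AA :: "('k,'a) hom_bialg"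
  A_coact :: "'a \<Rightarrow> ('a \<times> 'h) list set"
  CC :: "('k,'c) hom_bialg"
  C_act :: "'h \<Rightarrow> 'c \<Rightarrow> 'c"

definition right_comodule_algebra ::
  "'k ring \<Rightarrow> ('k,'h,'m) hom_bialg_scheme \<Rightarrow> ('k,'a,'n) hom_space_scheme
   \<Rightarrow> ('a \<Rightarrow> ('a \<times> 'h) list set) \<Rightarrow> bool" where
  "right_comodule_algebra K H A \<rho> \<longleftrightarrow>
     hom_algebra K A \<and> right_hom_comodule K H A \<rho> \<and>
     (\<forall>a\<in>carrier A. \<forall>b\<in>carrier A.
        \<rho> (a \<otimes>\<^bsub>A\<^esub> b) =
          sweedler (tensor K A H) (\<rho> a) (\<lambda>a0 a1. sweedler (tensor K A H) (\<rho> b)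
            (\<lambda>b0 b1. pure K A H (a0 \<otimes>\<^bsub>A\<^esub> b0) (a1 \<otimes>\<^bsub>H\<^esub> b1)))) \<and>
     \<rho> \<one>\<^bsub>A\<^esub> = pure K A H \<one>\<^bsub>A\<^esub> \<one>\<^bsub>H\<^esub>"

definition left_module_coalgebra ::
  "'k ring \<Rightarrow> ('k,'h,'m) hom_bialg_scheme \<Rightarrow> ('k,'c,'n) hom_bialg_scheme
   \<Rightarrow> ('h \<Rightarrow> 'c \<Rightarrow> 'c) \<Rightarrow> bool" where
  "left_module_coalgebra K H C act \<longleftrightarrow>
     hom_coalgebra K C \<and> left_hom_module K H C act \<and>
     (\<forall>h\<in>carrier H. \<forall>c\<in>carrier C.
        \<Delta>\<^bsub>C\<^esub> (act h c) =
          sweedler (tensor K C C) (\<Delta>\<^bsub>H\<^esub> h) (\<lambda>h1 h2. sweedler (tensor K C C) (\<Delta>\<^bsub>C\<^esub> c)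
            (\<lambda>c1 c2. pure K C C (act h1 c1) (act h2 c2))) \<and>
        \<epsilon>\<^bsub>C\<^esub> (act h c) = \<epsilon>\<^bsub>H\<^esub> h \<otimes>\<^bsub>K\<^esub> \<epsilon>\<^bsub>C\<^esub> c)"

definition doi_hopf :: "'k ring \<Rightarrow> ('k,'h,'a,'c) doi_hopf_datum \<Rightarrow> bool" where
  "doi_hopf K D \<longleftrightarrow>
     hom_hopf_algebra K (HH D) (antipode D) \<and>
     right_comodule_algebra K (HH D) (AA D) (A_coact D) \<and>
     left_module_coalgebra K (HH D) (CC D) (C_act D)"

definition monoidal_doi_hopf :: "'k ring \<Rightarrow> ('k,'h,'a,'c) doi_hopf_datum \<Rightarrow> bool" where
  "monoidal_doi_hopf K D \<longleftrightarrow>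
     (let H = HH D; A = AA D; C = CC D; \<rho> = A_coact D; act = C_act D;
          AC = tensor K A C; AAC = tensor K A AC in
     doi_hopf K D \<and> hom_bialgebra K A \<and> hom_bialgebra K C \<and>
     (\<forall>a\<in>carrier A. \<forall>c\<in>carrier C. \<forall>d\<in>carrier C.
        sweedler AAC (\<rho> a) (\<lambda>a0 a1. sweedler AAC (\<Delta>\<^bsub>A\<^esub> a0)
            (\<lambda>a01 a02. pure K A AC a01 (pure K A C a02 (act (\<alpha>\<^bsub>H\<^esub> (\<alpha>\<^bsub>H\<^esub> a1)) (c \<otimes>\<^bsub>C\<^esub> d))))) =
        sweedler AAC (\<Delta>\<^bsub>A\<^esub> a) (\<lambda>a1 a2. sweedler AAC (\<rho> a1) (\<lambda>a10 a11.
            sweedler AAC (\<rho> a2) (\<lambda>a20 a21.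
              pure K A AC a10 (pure K A C a20 (act a11 c \<otimes>\<^bsub>C\<^esub> act a21 d)))))) \<and>
     (\<forall>a\<in>carrier A.
        \<epsilon>\<^bsub>A\<^esub> a \<odot>\<^bsub>C\<^esub> \<one>\<^bsub>C\<^esub> = sweedler C (\<rho> a) (\<lambda>a0 a1. \<epsilon>\<^bsub>A\<^esub> a0 \<odot>\<^bsub>C\<^esub> act a1 \<one>\<^bsub>C\<^esub>)))"


section \<open>The dual and the smash product\<close>

text \<open>
  Functionals are extensional on the carrier of \<open>C\<close>. The coproduct of \<open>f\<close> is the element
  \<open>f\<^sub>1 \<otimes> f\<^sub>2\<close> of \<open>C\<^sup>* \<otimes> C\<^sup>*\<close> determined by its values on pairs \<open>(c, d)\<close>; it exists
  for every \<open>f\<close> if \<open>C\<close> is finite-dimensional.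
\<close>

definition dual_space :: "'k ring \<Rightarrow> ('k,'c,'m) module_scheme \<Rightarrow> ('k, 'c \<Rightarrow> 'k) module" where
  "dual_space K C =
     \<lparr>carrier = {f \<in> extensional (carrier C). linear_map K C (scalars K) f},
      mult = undefined, one = undefined,
      zero = (\<lambda>c\<in>carrier C. \<zero>\<^bsub>K\<^esub>),
      add = (\<lambda>f g. \<lambda>c\<in>carrier C. f c \<oplus>\<^bsub>K\<^esub> g c),
      smult = (\<lambda>r f. \<lambda>c\<in>carrier C. r \<otimes>\<^bsub>K\<^esub> f c)\<rparr>"

definition dual_bialg :: "'k ring \<Rightarrow> ('k,'c,'m) hom_bialg_scheme \<Rightarrow> ('k, 'c \<Rightarrow> 'k) hom_bialg" where
  "dual_bialg K C =
     (let V = dual_space K C; \<beta> = alpha_inv C in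
     \<lparr>carrier = carrier V,
      mult = (\<lambda>f g. \<lambda>c\<in>carrier C.
         sweedler (scalars K) (\<Delta>\<^bsub>C\<^esub> c) (\<lambda>c1 c2. f (\<beta> (\<beta> c1)) \<otimes>\<^bsub>K\<^esub> g (\<beta> (\<beta> c2)))),
      one = (\<lambda>c\<in>carrier C. \<epsilon>\<^bsub>C\<^esub> c),
      zero = zero V, add = add V, smult = smult V,
      alpha = (\<lambda>f. \<lambda>c\<in>carrier C. f (\<beta> c)),
      comult = (\<lambda>f. THE X. X \<in> carrier (tensor K V V) \<and>
         (\<forall>c\<in>carrier C. \<forall>d\<in>carrier C.
            sweedler (scalars K) X (\<lambda>f1 f2. f1 c \<otimes>\<^bsub>K\<^esub> f2 d) = f (\<beta> (\<beta> (c \<otimes>\<^bsub>C\<^esub> d))))),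
      counit = (\<lambda>f. f \<one>\<^bsub>C\<^esub>)\<rparr>)"

definition dual_act ::
  "('k,'c,'m) hom_space_scheme \<Rightarrow> ('h \<Rightarrow> 'c \<Rightarrow> 'c) \<Rightarrow> ('c \<Rightarrow> 'k) \<Rightarrow> 'h \<Rightarrow> ('c \<Rightarrow> 'k)" where
  "dual_act C act f h = (\<lambda>c\<in>carrier C. f (act h (alpha_inv C (alpha_inv C c))))"

definition smash ::
  "'k ring \<Rightarrow> ('k,'h,'a,'c) doi_hopf_datum \<Rightarrow> ('k, ('a \<times> ('c \<Rightarrow> 'k)) list set) hom_bialg" where
  "smash K D =
     (let H = HH D; A = AA D; C = CC D; Cd = dual_bialg K C; T = tensor K A Cd;
          sm = pure K A Cd; act = dual_act C (C_act D) in
     \<lparr>carrier = carrier T,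
      mult = (\<lambda>X Y. sweedler T X (\<lambda>a f. sweedler T Y (\<lambda>a' f'.
         sweedler T (A_coact D a') (\<lambda>a'0 a'1.
           sm (a \<otimes>\<^bsub>A\<^esub> alpha_inv A a'0)
              (act (alpha_inv Cd f) (alpha_inv H (alpha_inv H a'1)) \<otimes>\<^bsub>Cd\<^esub> f'))))),
      one = sm \<one>\<^bsub>A\<^esub> \<one>\<^bsub>Cd\<^esub>,
      zero = zero T, add = add T, smult = smult T,
      alpha = (\<lambda>X. sweedler T X (\<lambda>a f. sm (\<alpha>\<^bsub>A\<^esub> a) (\<alpha>\<^bsub>Cd\<^esub> f))),
      comult = (\<lambda>X. sweedler (tensor K T T) X (\<lambda>a f.
         sweedler (tensor K T T) (\<Delta>\<^bsub>A\<^esub> a) (\<lambda>a1 a2. sweedler (tensor K T T) (\<Delta>\<^bsub>Cd\<^esub> f) (\<lambda>f1 f2.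
           pure K T T (sm a1 f1) (sm a2 f2))))),
      counit = (\<lambda>X. sweedler (scalars K) X (\<lambda>a f. \<epsilon>\<^bsub>A\<^esub> a \<otimes>\<^bsub>K\<^esub> \<epsilon>\<^bsub>Cd\<^esub> f))\<rparr>)"


section \<open>Monoidal categories\<close>

record ('o,'m) cat =
  Obj :: "'o set"
  Arr :: "'m set"
  Dom :: "'m \<Rightarrow> 'o"
  Cod :: "'m \<Rightarrow> 'o"
  Id :: "'o \<Rightarrow> 'm"
  Comp :: "'m \<Rightarrow> 'm \<Rightarrow> 'm"  (infixr "\<cdot>\<index>" 70)

record ('o,'m) moncat = "('o,'m) cat" +
  TObj :: "'o \<Rightarrow> 'o \<Rightarrow> 'o"  (infixr "\<boxtimes>\<index>" 75)
  TArr :: "'m \<Rightarrow> 'm \<Rightarrow> 'm"  (infixr "\<star>\<index>" 75)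
  UnitObj :: "'o"
  Assoc :: "'o \<Rightarrow> 'o \<Rightarrow> 'o \<Rightarrow> 'm"
  LUnit :: "'o \<Rightarrow> 'm"
  RUnit :: "'o \<Rightarrow> 'm"

definition in_hom :: "('o,'m,'z) cat_scheme \<Rightarrow> 'm \<Rightarrow> 'o \<Rightarrow> 'o \<Rightarrow> bool" where
  "in_hom \<C> f X Y \<longleftrightarrow> f \<in> Arr \<C> \<and> Dom \<C> f = X \<and> Cod \<C> f = Y"

definition iso_arr :: "('o,'m,'z) cat_scheme \<Rightarrow> 'm \<Rightarrow> 'o \<Rightarrow> 'o \<Rightarrow> bool" where
  "iso_arr \<C> f X Y \<longleftrightarrow>
     in_hom \<C> f X Y \<and> (\<exists>g. in_hom \<C> g Y X \<and> g \<cdot>\<^bsub>\<C>\<^esub> f = Id \<C> X \<and> f \<cdot>\<^bsub>\<C>\<^esub> g = Id \<C> Y)"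

locale category =
  fixes \<C> (structure)
  assumes Dom_in: "f \<in> Arr \<C> \<Longrightarrow> Dom \<C> f \<in> Obj \<C>"
    and Cod_in: "f \<in> Arr \<C> \<Longrightarrow> Cod \<C> f \<in> Obj \<C>"
    and Id_in: "X \<in> Obj \<C> \<Longrightarrow> in_hom \<C> (Id \<C> X) X X"
    and Comp_in: "in_hom \<C> f X Y \<Longrightarrow> in_hom \<C> g Y Z \<Longrightarrow> in_hom \<C> (g \<cdot> f) X Z"
    and Id_left: "in_hom \<C> f X Y \<Longrightarrow> Id \<C> Y \<cdot> f = f"
    and Id_right: "in_hom \<C> f X Y \<Longrightarrow> f \<cdot> Id \<C> X = f"
    and Comp_assoc: "in_hom \<C> f W X \<Longrightarrow> in_hom \<C> g X Y \<Longrightarrow> in_hom \<C> h Y Z \<Longrightarrow>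
          (h \<cdot> g) \<cdot> f = h \<cdot> (g \<cdot> f)"

locale monoidal_category = category +
  assumes UnitObj_in: "UnitObj \<C> \<in> Obj \<C>"
    and TObj_in: "X \<in> Obj \<C> \<Longrightarrow> Y \<in> Obj \<C> \<Longrightarrow> X \<boxtimes> Y \<in> Obj \<C>"
    and TArr_in: "in_hom \<C> f X X' \<Longrightarrow> in_hom \<C> g Y Y' \<Longrightarrow>
          in_hom \<C> (f \<star> g) (X \<boxtimes> Y) (X' \<boxtimes> Y')"
    and TArr_Id: "X \<in> Obj \<C> \<Longrightarrow> Y \<in> Obj \<C> \<Longrightarrow> Id \<C> X \<star> Id \<C> Y = Id \<C> (X \<boxtimes> Y)"
    and TArr_Comp: "in_hom \<C> f X X' \<Longrightarrow> in_hom \<C> f' X' X'' \<Longrightarrow>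
          in_hom \<C> g Y Y' \<Longrightarrow> in_hom \<C> g' Y' Y'' \<Longrightarrow>
          (f' \<cdot> f) \<star> (g' \<cdot> g) = (f' \<star> g') \<cdot> (f \<star> g)"
    and Assoc_iso: "X \<in> Obj \<C> \<Longrightarrow> Y \<in> Obj \<C> \<Longrightarrow> Z \<in> Obj \<C> \<Longrightarrow>
          iso_arr \<C> (Assoc \<C> X Y Z) ((X \<boxtimes> Y) \<boxtimes> Z) (X \<boxtimes> (Y \<boxtimes> Z))"
    and Assoc_natural: "in_hom \<C> f X X' \<Longrightarrow> in_hom \<C> g Y Y' \<Longrightarrow> in_hom \<C> h Z Z' \<Longrightarrow>
          Assoc \<C> X' Y' Z' \<cdot> ((f \<star> g) \<star> h) = (f \<star> (g \<star> h)) \<cdot> Assoc \<C> X Y Z"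
    and LUnit_iso: "X \<in> Obj \<C> \<Longrightarrow> iso_arr \<C> (LUnit \<C> X) (UnitObj \<C> \<boxtimes> X) X"
    and LUnit_natural: "in_hom \<C> f X X' \<Longrightarrow>
          LUnit \<C> X' \<cdot> (Id \<C> (UnitObj \<C>) \<star> f) = f \<cdot> LUnit \<C> X"
    and RUnit_iso: "X \<in> Obj \<C> \<Longrightarrow> iso_arr \<C> (RUnit \<C> X) (X \<boxtimes> UnitObj \<C>) X"
    and RUnit_natural: "in_hom \<C> f X X' \<Longrightarrow>
          RUnit \<C> X' \<cdot> (f \<star> Id \<C> (UnitObj \<C>)) = f \<cdot> RUnit \<C> X"
    and pentagon: "W \<in> Obj \<C> \<Longrightarrow> X \<in> Obj \<C> \<Longrightarrow> Y \<in> Obj \<C> \<Longrightarrow> Z \<in> Obj \<C> \<Longrightarrow>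
          (Id \<C> W \<star> Assoc \<C> X Y Z) \<cdot> (Assoc \<C> W (X \<boxtimes> Y) Z \<cdot> (Assoc \<C> W X Y \<star> Id \<C> Z)) =
          Assoc \<C> W X (Y \<boxtimes> Z) \<cdot> Assoc \<C> (W \<boxtimes> X) Y Z"
    and triangle: "X \<in> Obj \<C> \<Longrightarrow> Y \<in> Obj \<C> \<Longrightarrow>
          (Id \<C> X \<star> LUnit \<C> Y) \<cdot> Assoc \<C> X (UnitObj \<C>) Y = RUnit \<C> X \<star> Id \<C> Y"

text \<open>
  Strong monoidal functors: \<open>\<phi> X Y : F X \<otimes> F Y \<rightarrow> F (X \<otimes> Y)\<close> and \<open>\<phi>0 : I \<rightarrow> F I\<close> are
  invertible.
\<close>

locale monoidal_functor = source: monoidal_category \<C> + target: monoidal_category \<D>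
  for \<C> :: "('o,'m,'z) moncat_scheme" and \<D> :: "('p,'n,'y) moncat_scheme" +
  fixes Fo :: "'o \<Rightarrow> 'p" and Fa :: "'m \<Rightarrow> 'n" and \<phi> :: "'o \<Rightarrow> 'o \<Rightarrow> 'n" and \<phi>0 :: "'n"
  assumes Fo_in: "X \<in> Obj \<C> \<Longrightarrow> Fo X \<in> Obj \<D>"
    and Fa_in: "in_hom \<C> f X Y \<Longrightarrow> in_hom \<D> (Fa f) (Fo X) (Fo Y)"
    and Fa_Id: "X \<in> Obj \<C> \<Longrightarrow> Fa (Id \<C> X) = Id \<D> (Fo X)"
    and Fa_Comp: "in_hom \<C> f X Y \<Longrightarrow> in_hom \<C> g Y Z \<Longrightarrow>
          Fa (g \<cdot>\<^bsub>\<C>\<^esub> f) = Fa g \<cdot>\<^bsub>\<D>\<^esub> Fa f"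
    and \<phi>_iso: "X \<in> Obj \<C> \<Longrightarrow> Y \<in> Obj \<C> \<Longrightarrow>
          iso_arr \<D> (\<phi> X Y) (Fo X \<boxtimes>\<^bsub>\<D>\<^esub> Fo Y) (Fo (X \<boxtimes>\<^bsub>\<C>\<^esub> Y))"
    and \<phi>_natural: "in_hom \<C> f X X' \<Longrightarrow> in_hom \<C> g Y Y' \<Longrightarrow>
          \<phi> X' Y' \<cdot>\<^bsub>\<D>\<^esub> (Fa f \<star>\<^bsub>\<D>\<^esub> Fa g) = Fa (f \<star>\<^bsub>\<C>\<^esub> g) \<cdot>\<^bsub>\<D>\<^esub> \<phi> X Y"
    and \<phi>0_iso: "iso_arr \<D> \<phi>0 (UnitObj \<D>) (Fo (UnitObj \<C>))"
    and coherence_assoc: "X \<in> Obj \<C> \<Longrightarrow> Y \<in> Obj \<C> \<Longrightarrow> Z \<in> Obj \<C> \<Longrightarrow>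
          Fa (Assoc \<C> X Y Z) \<cdot>\<^bsub>\<D>\<^esub> (\<phi> (X \<boxtimes>\<^bsub>\<C>\<^esub> Y) Z \<cdot>\<^bsub>\<D>\<^esub> (\<phi> X Y \<star>\<^bsub>\<D>\<^esub> Id \<D> (Fo Z))) =
          \<phi> X (Y \<boxtimes>\<^bsub>\<C>\<^esub> Z) \<cdot>\<^bsub>\<D>\<^esub> ((Id \<D> (Fo X) \<star>\<^bsub>\<D>\<^esub> \<phi> Y Z) \<cdot>\<^bsub>\<D>\<^esub> Assoc \<D> (Fo X) (Fo Y) (Fo Z))"
    and coherence_left: "X \<in> Obj \<C> \<Longrightarrow>
          Fa (LUnit \<C> X) \<cdot>\<^bsub>\<D>\<^esub> (\<phi> (UnitObj \<C>) X \<cdot>\<^bsub>\<D>\<^esub> (\<phi>0 \<star>\<^bsub>\<D>\<^esub> Id \<D> (Fo X))) = LUnit \<D> (Fo X)"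
    and coherence_right: "X \<in> Obj \<C> \<Longrightarrow>
          Fa (RUnit \<C> X) \<cdot>\<^bsub>\<D>\<^esub> (\<phi> X (UnitObj \<C>) \<cdot>\<^bsub>\<D>\<^esub> (Id \<D> (Fo X) \<star>\<^bsub>\<D>\<^esub> \<phi>0)) = RUnit \<D> (Fo X)"

definition isomorphic_monoidal_categories ::
  "('o,'m,'z) moncat_scheme \<Rightarrow> ('p,'n,'y) moncat_scheme \<Rightarrow> bool" where
  "isomorphic_monoidal_categories \<C> \<D> \<longleftrightarrow>
     (\<exists>Fo Fa \<phi> \<phi>0. monoidal_functor \<C> \<D> Fo Fa \<phi> \<phi>0 \<and>
        bij_betw Fo (Obj \<C>) (Obj \<D>) \<and> bij_betw Fa (Arr \<C>) (Arr \<D>))"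


section \<open>The monoidal categories of modules and of Doi-Hopf modules\<close>

text \<open>
  The objects of these categories have their elements in the type \<open>univ\<close>, which has
  elements \<open>Atom s\<close> for an arbitrary type \<open>'s\<close> and is closed under forming the ground
  field and tensor products, so that both categories are closed under the monoidal structure.
  An element of a tensor product is \<open>Formal p\<close> with \<open>p\<close> the chosen representative
  of the corresponding class of formal sums.
\<close>

datatype ('k,'s) univ =
  Atom 's
| Scalar (scalar_of: 'k)
| Formal (formal_of: "(('k,'s) univ \<times> ('k,'s) univ) list")

definition transport :: "'k ring \<Rightarrow> ('v \<Rightarrow> 'w) \<Rightarrow> ('k,'v,'m) module_scheme \<Rightarrow> ('k,'w) module" where
  "transport K e V =
     (let d = inv_into (carrier V) e; E = e ` carrier V in
     \<lparr>carrier = E, mult = undefined, one = undefined, zero = e \<zero>\<^bsub>V\<^esub>,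
      add = (\<lambda>x\<in>E. \<lambda>y\<in>E. e (d x \<oplus>\<^bsub>V\<^esub> d y)),
      smult = (\<lambda>r\<in>carrier K. \<lambda>x\<in>E. e (r \<odot>\<^bsub>V\<^esub> d x))\<rparr>)"

definition utensor ::
  "'k ring \<Rightarrow> ('k, ('k,'s) univ, 'm) module_scheme \<Rightarrow> ('k, ('k,'s) univ, 'n) module_scheme
   \<Rightarrow> ('k, ('k,'s) univ) module" where
  "utensor K M N = transport K (\<lambda>X. Formal (tensor_rep X)) (tensor K M N)"

definition upure ::
  "'k ring \<Rightarrow> ('k, ('k,'s) univ, 'm) module_scheme \<Rightarrow> ('k, ('k,'s) univ, 'n) module_scheme
   \<Rightarrow> ('k,'s) univ \<Rightarrow> ('k,'s) univ \<Rightarrow> ('k,'s) univ" where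
  "upure K M N x y = Formal (tensor_rep (pure K M N x y))"

definition usweedler ::
  "('k,'u,'l) module_scheme \<Rightarrow> ('k,'s) univ \<Rightarrow> (('k,'s) univ \<Rightarrow> ('k,'s) univ \<Rightarrow> 'u) \<Rightarrow> 'u" where
  "usweedler U z b = formal_eval U (formal_of z) b"

text \<open>
  Two objects or arrows given by the same structure on the same carrier are equal: the
  functions are extensional, and the ring fields without meaning for a vector space are
  undefined.
\<close>

definition normal_space :: "'k ring \<Rightarrow> ('k,'v,'m) module_scheme \<Rightarrow> bool" where
  "normal_space K V \<longleftrightarrow>
     mult V = undefined \<and> one V = undefined \<and>
     add V = (\<lambda>x\<in>carrier V. \<lambda>y\<in>carrier V. x \<oplus>\<^bsub>V\<^esub> y) \<and>
     smult V = (\<lambda>r\<in>carrier K. \<lambda>x\<in>carrier V. r \<odot>\<^bsub>V\<^esub> x)"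

record ('k,'b,'v) hmod = "('k,'v) hom_space" +
  act :: "'b \<Rightarrow> 'v \<Rightarrow> 'v"

record ('k,'b,'c,'v) dhmod = "('k,'b,'v) hmod" +
  coact :: "'v \<Rightarrow> ('v \<times> 'c) list set"

definition is_hmod :: "'k ring \<Rightarrow> ('k,'b,'m) hom_space_scheme \<Rightarrow> ('k,'b,'v,'n) hmod_scheme \<Rightarrow> bool" where
  "is_hmod K B M \<longleftrightarrow>
     left_hom_module K B M (act M) \<and> bijective_alpha M \<and>
     normal_space K M \<and> \<alpha>\<^bsub>M\<^esub> \<in> extensional (carrier M) \<and>
     act M = (\<lambda>b\<in>carrier B. \<lambda>m\<in>carrier M. act M b m)"

definition is_dhmod :: "'k ring \<Rightarrow> ('k,'h,'a,'c) doi_hopf_datum \<Rightarrow> ('k,'a,'c,'v) dhmod \<Rightarrow> bool" where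
  "is_dhmod K D M \<longleftrightarrow>
     is_hmod K (AA D) M \<and> right_hom_comodule K (CC D) M (coact M) \<and>
     coact M \<in> extensional (carrier M) \<and>
     (\<forall>a\<in>carrier (AA D). \<forall>m\<in>carrier M.
        coact M (act M a m) =
          sweedler (tensor K M (CC D)) (A_coact D a) (\<lambda>a0 a1.
            sweedler (tensor K M (CC D)) (coact M m) (\<lambda>m0 m1.
              pure K M (CC D) (act M a0 m0) (C_act D a1 m1))))"

definition hmod_mor ::
  "'k ring \<Rightarrow> ('k,'b,'m) hom_space_scheme \<Rightarrow> ('k,'b,'v,'n) hmod_scheme \<Rightarrow> ('k,'b,'v,'n) hmod_scheme
   \<Rightarrow> ('v \<Rightarrow> 'v) set" where
  "hmod_mor K B M N =
     {f \<in> extensional (carrier M). linear_map K M N f \<and>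
        (\<forall>m\<in>carrier M. f (\<alpha>\<^bsub>M\<^esub> m) = \<alpha>\<^bsub>N\<^esub> (f m)) \<and>
        (\<forall>b\<in>carrier B. \<forall>m\<in>carrier M. f (act M b m) = act N b (f m))}"

definition dhmod_mor ::
  "'k ring \<Rightarrow> ('k,'h,'a,'c) doi_hopf_datum \<Rightarrow> ('k,'a,'c,'v) dhmod \<Rightarrow> ('k,'a,'c,'v) dhmod
   \<Rightarrow> ('v \<Rightarrow> 'v) set" where
  "dhmod_mor K D M N =
     {f \<in> hmod_mor K (AA D) M N. \<forall>m\<in>carrier M.
        coact N (f m) =
          sweedler (tensor K N (CC D)) (coact M m) (\<lambda>m0 m1. pure K N (CC D) (f m0) m1)}"

definition hmod_tensor ::
  "'k ring \<Rightarrow> ('k,'b,'m) hom_bialg_scheme \<Rightarrow> ('k,'b,('k,'s) univ,'n) hmod_scheme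
   \<Rightarrow> ('k,'b,('k,'s) univ,'n) hmod_scheme \<Rightarrow> ('k,'b,('k,'s) univ) hmod" where
  "hmod_tensor K B M N =
     (let T = utensor K M N in
     \<lparr>carrier = carrier T, mult = mult T, one = one T, zero = zero T, add = add T, smult = smult T,
      alpha = (\<lambda>z\<in>carrier T. usweedler T z (\<lambda>m n. upure K M N (\<alpha>\<^bsub>M\<^esub> m) (\<alpha>\<^bsub>N\<^esub> n))),
      act = (\<lambda>b\<in>carrier B. \<lambda>z\<in>carrier T.
         usweedler T z (\<lambda>m n. sweedler T (\<Delta>\<^bsub>B\<^esub> b) (\<lambda>b1 b2. upure K M N (act M b1 m) (act N b2 n))))\<rparr>)"

definition hmod_unit :: "'k ring \<Rightarrow> ('k,'b,'m) hom_bialg_scheme \<Rightarrow> ('k,'b,('k,'s) univ) hmod" where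
  "hmod_unit K B =
     (let T = transport K Scalar (scalars K) in
     \<lparr>carrier = carrier T, mult = mult T, one = one T, zero = zero T, add = add T, smult = smult T,
      alpha = (\<lambda>x\<in>carrier T. x),
      act = (\<lambda>b\<in>carrier B. \<lambda>x\<in>carrier T. \<epsilon>\<^bsub>B\<^esub> b \<odot>\<^bsub>T\<^esub> x)\<rparr>)"

definition dhmod_tensor ::
  "'k ring \<Rightarrow> ('k,'h,'a,'c) doi_hopf_datum \<Rightarrow> ('k,'a,'c,('k,'s) univ) dhmod
   \<Rightarrow> ('k,'a,'c,('k,'s) univ) dhmod \<Rightarrow> ('k,'a,'c,('k,'s) univ) dhmod" where
  "dhmod_tensor K D M N =
     (let C = CC D; T = utensor K M N; TC = tensor K T C; \<beta> = alpha_inv C in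
     hmod.extend (hmod_tensor K (AA D) M N) (dhmod.fields
       (\<lambda>z\<in>carrier T. usweedler TC z (\<lambda>m n.
          sweedler TC (coact M m) (\<lambda>m0 m1. sweedler TC (coact N n) (\<lambda>n0 n1.
            pure K T C (upure K M N m0 n0) (\<beta> (\<beta> (m1 \<otimes>\<^bsub>C\<^esub> n1)))))))))"

definition dhmod_unit ::
  "'k ring \<Rightarrow> ('k,'h,'a,'c) doi_hopf_datum \<Rightarrow> ('k,'a,'c,('k,'s) univ) dhmod" where
  "dhmod_unit K D =
     (let T = transport K Scalar (scalars K) in
     hmod.extend (hmod_unit K (AA D)) (dhmod.fields
       (\<lambda>x\<in>carrier T. pure K T (CC D) x \<one>\<^bsub>CC D\<^esub>)))"

text \<open>
  An arrow \<open>M \<rightarrow> N\<close> is a triple \<open>(M, f, N)\<close>. Composition, the tensor product of arrows and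
  the constraints are given by the same formulas in both categories.
\<close>

definition concrete_moncat ::
  "'k ring \<Rightarrow> ('k,('k,'s) univ,'z) hom_space_scheme set
   \<Rightarrow> (('k,('k,'s) univ,'z) hom_space_scheme \<Rightarrow> ('k,('k,'s) univ,'z) hom_space_scheme
        \<Rightarrow> (('k,'s) univ \<Rightarrow> ('k,'s) univ) set)
   \<Rightarrow> (('k,('k,'s) univ,'z) hom_space_scheme \<Rightarrow> ('k,('k,'s) univ,'z) hom_space_scheme
        \<Rightarrow> ('k,('k,'s) univ,'z) hom_space_scheme)
   \<Rightarrow> ('k,('k,'s) univ,'z) hom_space_scheme
   \<Rightarrow> (('k,('k,'s) univ,'z) hom_space_scheme,
       ('k,('k,'s) univ,'z) hom_space_scheme \<times> (('k,'s) univ \<Rightarrow> ('k,'s) univ)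
         \<times> ('k,('k,'s) univ,'z) hom_space_scheme) moncat" where
  "concrete_moncat K objs mor tens unit =
     \<lparr>Obj = objs,
      Arr = {(M, f, N). M \<in> objs \<and> N \<in> objs \<and> f \<in> mor M N},
      Dom = (\<lambda>(M, f, N). M),
      Cod = (\<lambda>(M, f, N). N),
      Id = (\<lambda>M. (M, \<lambda>m\<in>carrier M. m, M)),
      Comp = (\<lambda>(N', g, P) (M, f, N). (M, compose (carrier M) g f, P)),
      TObj = tens,
      TArr = (\<lambda>(M, f, M') (N, g, N').
         (tens M N,
          \<lambda>z\<in>carrier (tens M N). usweedler (tens M' N') z (\<lambda>m n. upure K M' N' (f m) (g n)),
          tens M' N')),
      UnitObj = unit,
      Assoc = (\<lambda>M N P.
         (tens (tens M N) P,
          \<lambda>w\<in>carrier (tens (tens M N) P).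
            usweedler (tens M (tens N P)) w (\<lambda>z p. usweedler (tens M (tens N P)) z (\<lambda>m n.
              upure K M (tens N P) (alpha_inv M m) (upure K N P n (\<alpha>\<^bsub>P\<^esub> p)))),
          tens M (tens N P))),
      LUnit = (\<lambda>M.
         (tens unit M,
          \<lambda>z\<in>carrier (tens unit M). usweedler M z (\<lambda>x m. scalar_of x \<odot>\<^bsub>M\<^esub> alpha_inv M m),
          M)),
      RUnit = (\<lambda>M.
         (tens M unit,
          \<lambda>z\<in>carrier (tens M unit). usweedler M z (\<lambda>m x. scalar_of x \<odot>\<^bsub>M\<^esub> alpha_inv M m),
          M))\<rparr>"

text \<open>The argument \<open>TYPE('s)\<close> selects the type of atoms of the universe.\<close>

definition module_category ::
  "'s itself \<Rightarrow> 'k ring \<Rightarrow> ('k,'b,'m) hom_bialg_scheme \<Rightarrow>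
   (('k,'b,('k,'s) univ) hmod,
    ('k,'b,('k,'s) univ) hmod \<times> (('k,'s) univ \<Rightarrow> ('k,'s) univ) \<times> ('k,'b,('k,'s) univ) hmod) moncat" where
  "module_category s K B =
     concrete_moncat K {M. is_hmod K B M} (hmod_mor K B) (hmod_tensor K B) (hmod_unit K B)"

definition doi_hopf_category ::
  "'s itself \<Rightarrow> 'k ring \<Rightarrow> ('k,'h,'a,'c) doi_hopf_datum \<Rightarrow>
   (('k,'a,'c,('k,'s) univ) dhmod,
    ('k,'a,'c,('k,'s) univ) dhmod \<times> (('k,'s) univ \<Rightarrow> ('k,'s) univ) \<times> ('k,'a,'c,('k,'s) univ) dhmod) moncat" where
  "doi_hopf_category s K D =
     concrete_moncat K {M. is_dhmod K D M} (dhmod_mor K D) (dhmod_tensor K D) (dhmod_unit K D)"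

end

theory Submission
 imports Defs
begin

text \<open>
 All structure maps are bijective, and this reduces every Hom-structure to an ordinary one. If
 \<open>a b\<close> is a Hom-associative product with structure map \<open>\<alpha>\<close>, then \<open>\<alpha>\<^sup>-\<^sup>1(a b)\<close> is associative
 with the same unit and \<open>\<alpha>\<close> is an automorphism of it; conversely, twisting an associative
 product by an automorphism gives a Hom-algebra. In the same way \<open>c \<mapsto> \<Delta>(\<alpha>\<^sup>-\<^sup>1 c)\<close> is
 coassociative, \<open>m \<mapsto> \<rho>(\<alpha>\<^sup>-\<^sup>1 m)\<close> is a coaction and \<open>\<alpha>\<^sup>-\<^sup>1(a \<cdot> m)\<close> is an action. After this
 untwisting (\<open>umult\<close>, \<open>ucoact\<close>, \<open>uact\<close>) the datum \<open>(H, A, C)\<close> enters only through the entwining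
 \<open>a \<otimes> c \<mapsto> a\<^sub>(\<^sub>0\<^sub>) \<otimes> a\<^sub>(\<^sub>1\<^sub>) \<cdot> c\<close>, which is compatible with the multiplication of \<open>A\<close>, the comultiplication
 of \<open>C\<close>, the units and the counits; the two monoidality conditions say that it is compatible
 with the comultiplication of \<open>A\<close> and the multiplication of \<open>C\<close> as well (\<open>ent_monoidal\<close>, \<open>ent_unit\<close>).

 By means of dual bases of the finite-dimensional space \<open>C\<close>, an element \<open>X\<close> of \<open>A \<otimes> C\<^sup>*\<close> is
 recovered from the function \<open>c \<mapsto> X(c)\<close> from \<open>C\<close> to \<open>A\<close> (\<open>ev_eqI\<close>). In terms of functions the untwisted product of the smash
 product is \<open>(X Y)(c) = X(d) u\<close>, where \<open>u \<otimes> d\<close> is the entwining of \<open>Y(c\<^sub>2)\<close> with \<open>c\<^sub>1\<close> (\<open>ev_umult\<close>); its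
 coproduct satisfies \<open>(\<Delta> X)(c, d) = \<Delta>\<^sub>A(X(c d))\<close> and its counit is \<open>\<epsilon>\<^sub>A(X(1))\<close>, up to powers of the
 structure maps. Associativity is then the compatibility of the entwining with the multiplication
 of \<open>A\<close> and the comultiplication of \<open>C\<close>, coassociativity is inherited from \<open>A\<close> and \<open>C\<close>, and
 multiplicativity of the coproduct is \<open>ent_monoidal\<close>.

 A Doi-Hopf module \<open>M\<close> becomes a module over the smash product on the same space by
 \<open>X \<cdot> m = X(m\<^sub>(\<^sub>1\<^sub>)) \<cdot> m\<^sub>(\<^sub>0\<^sub>)\<close>, again up to structure maps (\<open>Fo\<close>). Conversely, a module over the smash
 product restricts to an action of \<open>A\<close> along \<open>a \<mapsto> a # \<epsilon>\<close>, and the operators of the elements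
 \<open>1 # f\<close> assemble into a coaction by means of dual bases of \<open>C\<close> (\<open>Go\<close>). The two constructions are
 mutually inverse, and the linear maps that are morphisms are the same on both sides (\<open>Fo_Go\<close>,
 \<open>Go_Fo\<close>, \<open>Fo_mor\<close>). The formula for the coproduct makes \<open>Fo\<close> strictly compatible with
 tensor products (\<open>Fo_dtp\<close>), and the constraints of both categories are given by the same formulas.

 The category of modules over a Hom-bialgebra is monoidal by a direct verification on pure
 tensors. For Doi-Hopf modules nothing has to be verified again: all axioms are carried back along
 the isomorphism, whose coherence maps are identities (\<open>monoidal_transport\<close>).
\<close>

section \<open>Linear and bilinear maps\<close>

abbreviation in_carrier :: "'v \<Rightarrow> ('v,'m) partial_object_scheme \<Rightarrow> bool" (infix "\<in>." 50) where
 "x \<in>. V \<equiv> x \<in> carrier V"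

locale ground = field K for K :: "'k ring" (structure)
begin

abbreviation lin ::
 "('k,'v,'m) module_scheme \<Rightarrow> ('k,'w,'n) module_scheme \<Rightarrow> ('v \<Rightarrow> 'w) \<Rightarrow> bool" where
 "lin \<equiv> linear_map K"

abbreviation bil ::
 "('k,'v,'m) module_scheme \<Rightarrow> ('k,'w,'n) module_scheme \<Rightarrow> ('k,'u,'l) module_scheme
  \<Rightarrow> ('v \<Rightarrow> 'w \<Rightarrow> 'u) \<Rightarrow> bool" where
 "bil \<equiv> bilinear_map K"

abbreviation tens :: "('k,'v,'m) module_scheme \<Rightarrow> ('k,'w,'n) module_scheme \<Rightarrow> ('k, ('v \<times> 'w) list set) module" where
 "tens \<equiv> tensor K"

text \<open>
 \<open>sw U X (\<lambda>x y. t x y)\<close> is Sweedler notation: with \<open>X = \<Delta> c\<close> it reads \<open>\<Sum> t c\<^sub>1 c\<^sub>2\<close>. Nested sums are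
 sums over iterated coproducts.
\<close>

abbreviation (input) sw :: "('k,'u,'l) module_scheme \<Rightarrow> ('v \<times> 'w) list set \<Rightarrow> ('v \<Rightarrow> 'w \<Rightarrow> 'u) \<Rightarrow> 'u" where
 "sw \<equiv> sweedler"

lemma linI:
 assumes "\<And>x. x \<in>. V \<Longrightarrow> f x \<in>. W"
  and "\<And>x y. x \<in>. V \<Longrightarrow> y \<in>. V \<Longrightarrow> f (x \<oplus>\<^bsub>V\<^esub> y) = f x \<oplus>\<^bsub>W\<^esub> f y"
  and "\<And>r x. r \<in>. K \<Longrightarrow> x \<in>. V \<Longrightarrow> f (r \<odot>\<^bsub>V\<^esub> x) = r \<odot>\<^bsub>W\<^esub> f x"
 shows "lin V W f"
 using assms by (auto simp: linear_map_def)

lemma lin_closed: "lin V W f \<Longrightarrow> x \<in>. V \<Longrightarrow> f x \<in>. W"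
 by (auto simp: linear_map_def)

lemma lin_add: "lin V W f \<Longrightarrow> x \<in>. V \<Longrightarrow> y \<in>. V \<Longrightarrow> f (x \<oplus>\<^bsub>V\<^esub> y) = f x \<oplus>\<^bsub>W\<^esub> f y"
 by (auto simp: linear_map_def)

lemma lin_smult: "lin V W f \<Longrightarrow> r \<in>. K \<Longrightarrow> x \<in>. V \<Longrightarrow> f (r \<odot>\<^bsub>V\<^esub> x) = r \<odot>\<^bsub>W\<^esub> f x"
 by (auto simp: linear_map_def)

lemma bilI:
 assumes "\<And>x. x \<in>. V \<Longrightarrow> lin W U (b x)"
  and "\<And>y. y \<in>. W \<Longrightarrow> lin V U (\<lambda>x. b x y)"
 shows "bil V W U b"
 using assms by (auto simp: bilinear_map_def)

lemma bil_right: "bil V W U b \<Longrightarrow> x \<in>. V \<Longrightarrow> lin W U (b x)"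
 by (auto simp: bilinear_map_def)

lemma bil_left: "bil V W U b \<Longrightarrow> y \<in>. W \<Longrightarrow> lin V U (\<lambda>x. b x y)"
 by (auto simp: bilinear_map_def)

lemma bil_closed: "bil V W U b \<Longrightarrow> x \<in>. V \<Longrightarrow> y \<in>. W \<Longrightarrow> b x y \<in>. U"
 by (rule lin_closed[OF bil_right])

lemma lin_zero:
 assumes "module K V" "module K W" "lin V W f"
 shows "f (zero V) = zero W"
proof -
 interpret V: module K V by fact
 interpret W: module K W by fact
 have "f (zero V) = f (\<zero> \<odot>\<^bsub>V\<^esub> zero V)" by simp
 also have "... = \<zero> \<odot>\<^bsub>W\<^esub> f (zero V)" using assms(3) by (rule lin_smult) simp_all
 also have "... = zero W" using lin_closed[OF assms(3), of "zero V"] by simp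
 finally show ?thesis .
qed

lemma lin_id: "lin V V (\<lambda>x. x)"
 by (simp add: linear_map_def)

lemma lin_comp:
 assumes "lin V W g" "lin T V f"
 shows "lin T W (\<lambda>x. g (f x))"
 using assms by (auto simp: linear_map_def Pi_iff)

lemma lin_bil_left:
 assumes "bil V W U b" "lin T V f" "y \<in>. W"
 shows "lin T U (\<lambda>x. b (f x) y)"
 using lin_comp[OF bil_left[OF assms(1,3)] assms(2)] .

lemma lin_bil_right:
 assumes "bil V W U b" "x \<in>. V" "lin T W f"
 shows "lin T U (\<lambda>y. b x (f y))"
 using lin_comp[OF bil_right[OF assms(1,2)] assms(3)] .

lemma lin_cong:
 assumes "module K V" "lin V W f" "\<And>x. x \<in>. V \<Longrightarrow> f x = g x"
 shows "lin V W g"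
proof -
 interpret V: module K V by fact
 show ?thesis
  using assms(2) by (auto simp: linear_map_def Pi_iff assms(3)[symmetric])
qed

lemma lin_zero_fun:
 assumes "module K W" shows "lin V W (\<lambda>_. zero W)"
proof -
 interpret W: module K W by fact
 show ?thesis by (rule linI) auto
qed

lemma lin_plus:
 assumes "module K W" "lin V W f" "lin V W g"
 shows "lin V W (\<lambda>x. f x \<oplus>\<^bsub>W\<^esub> g x)"
proof -
 interpret W: module K W by fact
 show ?thesis
  using assms(2,3) by (intro linI) (auto simp: linear_map_def Pi_iff W.a_ac W.smult_r_distr)
qed

lemma bil_smult:
 assumes "module K W" shows "bil (scalars K) W W (\<lambda>r x. r \<odot>\<^bsub>W\<^esub> x)"
proof -
 interpret W: module K W by fact
 show ?thesis
  by (intro bilI linI)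
   (auto simp: scalars_def W.smult_l_distr W.smult_r_distr W.smult_assoc1[symmetric] m_comm)
qed

lemma scalars_module: "module K (scalars K)"
proof (rule moduleI)
 show "cring K" by (rule is_cring)
 show "abelian_group (scalars K)"
 proof (rule abelian_groupI)
  fix x assume "x \<in>. scalars K"
  then show "\<exists>y\<in>carrier (scalars K). y \<oplus>\<^bsub>scalars K\<^esub> x = zero (scalars K)"
   by (auto simp: scalars_def intro!: bexI[of _ "\<ominus> x"] l_neg)
 qed (auto simp: scalars_def a_ac)
qed (auto simp: scalars_def l_distr r_distr m_assoc)

lemma scalars_simps [simp]:
 "carrier (scalars K) = carrier K" "add (scalars K) = add K" "smult (scalars K) = mult K"
 "zero (scalars K) = \<zero>"
 by (simp_all add: scalars_def)

section \<open>Tensor products of vector spaces\<close>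

lemma formal_sums_simps [simp]:
 "[] \<in> formal_sums V W"
 "z # p \<in> formal_sums V W \<longleftrightarrow> fst z \<in>. V \<and> snd z \<in>. W \<and> p \<in> formal_sums V W"
 "p @ q \<in> formal_sums V W \<longleftrightarrow> p \<in> formal_sums V W \<and> q \<in> formal_sums V W"
 by (auto simp: formal_sums_def) (cases z; auto)+

lemma formal_eval_simps [simp]:
 "formal_eval U [] b = zero U"
 "formal_eval U (z # p) b = b (fst z) (snd z) \<oplus>\<^bsub>U\<^esub> formal_eval U p b"
 by (auto simp: formal_eval_def split: prod.splits)

lemma formal_eval_closed:
 assumes "module K U" "\<And>x y. x \<in>. V \<Longrightarrow> y \<in>. W \<Longrightarrow> b x y \<in>. U"
 shows "p \<in> formal_sums V W \<Longrightarrow> formal_eval U p b \<in>. U"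
proof (induction p)
 case Nil
 interpret U: module K U by fact
 show ?case by simp
next
 case (Cons z p)
 interpret U: module K U by fact
 show ?case using Cons assms by auto
qed

lemma formal_eval_append:
 assumes "module K U" "\<And>x y. x \<in>. V \<Longrightarrow> y \<in>. W \<Longrightarrow> b x y \<in>. U"
  and "p \<in> formal_sums V W" "q \<in> formal_sums V W"
 shows "formal_eval U (p @ q) b = formal_eval U p b \<oplus>\<^bsub>U\<^esub> formal_eval U q b"
proof -
 interpret U: module K U by fact
 note cl = formal_eval_closed[OF assms(1,2), simplified]
 from assms(3) show ?thesis
  using assms(2,4) by (induction p) (auto simp: U.a_assoc cl)
qed

lemma formal_eval_hom:
 assumes "module K U" "module K U'" "lin U U' g"
  and "\<And>x y. x \<in>. V \<Longrightarrow> y \<in>. W \<Longrightarrow> b x y \<in>. U"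
 shows "p \<in> formal_sums V W \<Longrightarrow> g (formal_eval U p b) = formal_eval U' p (\<lambda>x y. g (b x y))"
proof (induction p)
 case Nil
 then show ?case using assms by (simp add: lin_zero)
next
 case (Cons z p)
 have z: "fst z \<in>. V" "snd z \<in>. W" and p: "p \<in> formal_sums V W" using Cons by auto
 have "formal_eval U p b \<in>. U"
  by (rule formal_eval_closed[OF assms(1) _ p]) (rule assms(4))
 then show ?case
  using assms(4)[OF z] Cons.IH[OF p] by (simp add: lin_add[OF assms(3)])
qed

lemma formal_eval_cong:
 assumes "\<And>x y. x \<in>. V \<Longrightarrow> y \<in>. W \<Longrightarrow> b x y = b' x y"
 shows "p \<in> formal_sums V W \<Longrightarrow> formal_eval U p b = formal_eval U p b'"
 using assms by (induction p) auto

lemma formal_eval_lin: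
 assumes "module K U" "\<And>x y. x \<in>. V \<Longrightarrow> y \<in>. W \<Longrightarrow> lin T U (\<lambda>v. b v x y)"
 shows "p \<in> formal_sums V W \<Longrightarrow> lin T U (\<lambda>v. formal_eval U p (b v))"
proof (induction p)
 case Nil
 then show ?case using assms(1) by (simp add: lin_zero_fun)
next
 case (Cons z p)
 then show ?case using assms by (simp add: lin_plus)
qed

lemma formal_eval_plus:
 assumes "module K U" "\<And>x y. x \<in>. V \<Longrightarrow> y \<in>. W \<Longrightarrow> b x y \<in>. U"
  "\<And>x y. x \<in>. V \<Longrightarrow> y \<in>. W \<Longrightarrow> b' x y \<in>. U"
 shows "p \<in> formal_sums V W \<Longrightarrow>
  formal_eval U p (\<lambda>x y. b x y \<oplus>\<^bsub>U\<^esub> b' x y) = formal_eval U p b \<oplus>\<^bsub>U\<^esub> formal_eval U p b'"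
proof (induction p)
 case Nil
 interpret U: module K U by fact
 show ?case by simp
next
 case (Cons z p)
 interpret U: module K U by fact
 have "formal_eval U p b \<in>. U" "formal_eval U p b' \<in>. U"
  using formal_eval_closed[OF assms(1,2)] formal_eval_closed[OF assms(1,3)] Cons by auto
 moreover have "b (fst z) (snd z) \<in>. U" "b' (fst z) (snd z) \<in>. U"
  using Cons assms by auto
 ultimately show ?case using Cons by (simp add: U.a_ac)
qed

lemma formal_eval_swap:
 assumes "module K U"
  and "\<And>x y z w. x \<in>. V \<Longrightarrow> y \<in>. W \<Longrightarrow> z \<in>. V' \<Longrightarrow> w \<in>. W' \<Longrightarrow>
     b x y z w \<in>. U"
  and q: "q \<in> formal_sums V' W'"
 shows "p \<in> formal_sums V W \<Longrightarrow>
  formal_eval U p (\<lambda>x y. formal_eval U q (b x y)) =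
  formal_eval U q (\<lambda>z w. formal_eval U p (\<lambda>x y. b x y z w))"
proof (induction p)
 case Nil
 interpret U: module K U by fact
 from q show ?case by (induction q) auto
next
 case (Cons u p)
 have u: "fst u \<in>. V" "snd u \<in>. W" and p: "p \<in> formal_sums V W" using Cons by auto
 have "formal_eval U q (\<lambda>z w. b (fst u) (snd u) z w \<oplus>\<^bsub>U\<^esub> formal_eval U p (\<lambda>x y. b x y z w)) =
   formal_eval U q (b (fst u) (snd u)) \<oplus>\<^bsub>U\<^esub> formal_eval U q (\<lambda>z w. formal_eval U p (\<lambda>x y. b x y z w))"
  by (rule formal_eval_plus[OF assms(1) _ _ q])
   (auto intro!: assms(2) u formal_eval_closed[OF assms(1) _ p])
 then show ?case using Cons.IH[OF p] by simp
qed

lemma tensor_rel_formal_sums: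
 assumes "module K V" "module K W" "(p, q) \<in> tensor_rel K V W"
 shows "p \<in> formal_sums V W \<and> q \<in> formal_sums V W"
proof -
 interpret V: module K V by fact
 interpret W: module K W by fact
 from assms(3) show ?thesis by induction auto
qed

lemma tensor_rel_equiv:
 assumes "module K V" "module K W"
 shows "equiv (formal_sums V W) (tensor_rel K V W)"
 using tensor_rel_formal_sums[OF assms]
 by (auto simp: equiv_def refl_on_def sym_def trans_def
   intro: tensor_rel.refl tensor_rel.sym tensor_rel.trans)

text \<open>
 The universal property of the tensor product: each generator of the congruence is respected by
 the evaluation of formal sums on a bilinear map.
\<close>

lemma formal_eval_respects:
 assumes "module K V" "module K W" "module K U" "bil V W U b" "(p, q) \<in> tensor_rel K V W"
 shows "formal_eval U p b = formal_eval U q b"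
proof -
 interpret V: module K V by fact
 interpret W: module K W by fact
 interpret U: module K U by fact
 note b = bil_closed[OF assms(4)]
 have app: "formal_eval U (p @ q) b = formal_eval U p b \<oplus>\<^bsub>U\<^esub> formal_eval U q b"
  if "p \<in> formal_sums V W" "q \<in> formal_sums V W" for p q
  using that by (intro formal_eval_append[OF assms(3), of V W]) (auto intro: b)
 have cl: "formal_eval U p b \<in>. U" if "p \<in> formal_sums V W" for p
  using that by (intro formal_eval_closed[OF assms(3), of V W]) (auto intro: b)
 from assms(5) show ?thesis
 proof induction
  case (cong p q p' q')
  then show ?case
   using tensor_rel_formal_sums[OF assms(1,2)] by (metis app)
 next
  case (comm p q)
  then show ?case by (simp add: app cl U.a_comm)
 next
  case (add_left x x' y)
  then show ?case by (simp add: lin_add[OF bil_left[OF assms(4)]] b)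
 next
  case (add_right x y y')
  then show ?case by (simp add: lin_add[OF bil_right[OF assms(4)]] b)
 next
  case (smult r x y)
  then show ?case
   by (simp add: lin_smult[OF bil_right[OF assms(4)]] lin_smult[OF bil_left[OF assms(4)]] b)
 next
  case (zero y)
  then show ?case
   using lin_zero[OF assms(1,3) bil_left[OF assms(4)]] by simp
 qed (simp_all add: b)
qed

abbreviation tensor_class ::
 "('k,'v,'m) module_scheme \<Rightarrow> ('k,'w,'n) module_scheme \<Rightarrow> ('v \<times> 'w) list \<Rightarrow> ('v \<times> 'w) list set" where
 "tensor_class V W p \<equiv> tensor_rel K V W `` {p}"

context
 fixes V :: "('k,'v,'m) module_scheme" and W :: "('k,'w,'n) module_scheme"
 assumes V: "module K V" and W: "module K W"
begin

interpretation V: module K V by (rule V)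
interpretation W: module K W by (rule W)

lemma class_eq_iff:
 "p \<in> formal_sums V W \<Longrightarrow> q \<in> formal_sums V W \<Longrightarrow>
  tensor_class V W p = tensor_class V W q \<longleftrightarrow> (p, q) \<in> tensor_rel K V W"
 using eq_equiv_class_iff[OF tensor_rel_equiv[OF V W]] by blast

lemma class_in_tensor: "p \<in> formal_sums V W \<Longrightarrow> tensor_class V W p \<in>. tens V W"
 by (simp add: tensor_def quotientI)

lemma tensor_rep:
 assumes "X \<in>. tens V W"
 shows "tensor_rep X \<in> formal_sums V W" "tensor_class V W (tensor_rep X) = X"
proof -
 from assms obtain p where p: "p \<in> formal_sums V W" "X = tensor_class V W p"
  by (auto simp: tensor_def elim!: quotientE)
 have "tensor_rep X \<in> X"
  unfolding tensor_rep_def by (rule someI[of _ p]) (use p in \<open>auto intro: tensor_rel.refl\<close>)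
 then have "(p, tensor_rep X) \<in> tensor_rel K V W" using p by auto
 then show "tensor_rep X \<in> formal_sums V W" "tensor_class V W (tensor_rep X) = X"
  using tensor_rel_formal_sums[OF V W] equiv_class_eq[OF tensor_rel_equiv[OF V W]] p by metis+
qed

lemma tensor_rep_class:
 "p \<in> formal_sums V W \<Longrightarrow> (tensor_rep (tensor_class V W p), p) \<in> tensor_rel K V W"
 using tensor_rep class_in_tensor class_eq_iff by blast

lemma tensor_induct_class:
 assumes "X \<in>. tens V W" "\<And>p. p \<in> formal_sums V W \<Longrightarrow> P (tensor_class V W p)"
 shows "P X"
 using assms tensor_rep by metis

lemma tensor_add_class:
 assumes "p \<in> formal_sums V W" "q \<in> formal_sums V W"
 shows "tensor_class V W p \<oplus>\<^bsub>tens V W\<^esub> tensor_class V W q = tensor_class V W (p @ q)"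
proof -
 have "(tensor_rep (tensor_class V W p) @ tensor_rep (tensor_class V W q), p @ q) \<in> tensor_rel K V W"
  using tensor_rep_class assms by (blast intro: tensor_rel.cong)
 then show ?thesis
  unfolding tensor_def using equiv_class_eq[OF tensor_rel_equiv[OF V W]] by simp
qed

definition scale_sum :: "'k \<Rightarrow> ('v \<times> 'w) list \<Rightarrow> ('v \<times> 'w) list" where
 "scale_sum r = map (\<lambda>(x, y). (r \<odot>\<^bsub>V\<^esub> x, y))"

lemma scale_sum_simps [simp]:
 "scale_sum r [] = []" "scale_sum r (z # p) = (r \<odot>\<^bsub>V\<^esub> fst z, snd z) # scale_sum r p"
 "scale_sum r (p @ q) = scale_sum r p @ scale_sum r q"
 by (auto simp: scale_sum_def split: prod.splits)

lemma scale_sum_closed: "r \<in>. K \<Longrightarrow> p \<in> formal_sums V W \<Longrightarrow> scale_sum r p \<in> formal_sums V W"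
 by (induction p) auto

lemma scale_sum_respects:
 assumes r: "r \<in>. K" and "(p, q) \<in> tensor_rel K V W"
 shows "(scale_sum r p, scale_sum r q) \<in> tensor_rel K V W"
 using assms(2)
proof induction
 case (smult s x y)
 then have "r \<odot>\<^bsub>V\<^esub> (s \<odot>\<^bsub>V\<^esub> x) = s \<odot>\<^bsub>V\<^esub> (r \<odot>\<^bsub>V\<^esub> x)"
  using r by (metis V.smult_assoc1 m_comm)
 then show ?case using smult r tensor_rel.smult[of s K "r \<odot>\<^bsub>V\<^esub> x" V y W] by simp
qed (auto intro: tensor_rel.intros simp: r scale_sum_closed V.smult_r_distr)

lemma tensor_smult_class:
 assumes "r \<in>. K" "p \<in> formal_sums V W"
 shows "r \<odot>\<^bsub>tens V W\<^esub> tensor_class V W p = tensor_class V W (scale_sum r p)"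
 using equiv_class_eq[OF tensor_rel_equiv[OF V W] scale_sum_respects[OF assms(1) tensor_rep_class[OF assms(2)]]]
 by (simp add: tensor_def scale_sum_def)

lemma tensor_zero_class: "zero (tens V W) = tensor_class V W []"
 by (simp add: tensor_def)

lemma class_eqI: "(p, q) \<in> tensor_rel K V W \<Longrightarrow> tensor_class V W p = tensor_class V W q"
 by (rule equiv_class_eq[OF tensor_rel_equiv[OF V W]])

lemma scale_sum_add:
 assumes r: "r \<in>. K" and s: "s \<in>. K"
 shows "p \<in> formal_sums V W \<Longrightarrow> (scale_sum (r \<oplus> s) p, scale_sum r p @ scale_sum s p) \<in> tensor_rel K V W"
proof (induction p)
 case Nil
 then show ?case by (simp add: tensor_rel.refl)
next
 case (Cons z p)
 let ?r = "(r \<odot>\<^bsub>V\<^esub> fst z, snd z)" and ?s = "(s \<odot>\<^bsub>V\<^esub> fst z, snd z)"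
 have z: "fst z \<in>. V" "snd z \<in>. W" and p: "p \<in> formal_sums V W" using Cons by auto
 have "([((r \<oplus> s) \<odot>\<^bsub>V\<^esub> fst z, snd z)], [?r, ?s]) \<in> tensor_rel K V W"
  using z r s by (auto simp: V.smult_l_distr intro: tensor_rel.add_left)
 from tensor_rel.cong[OF this Cons.IH[OF p]]
 have 1: "(scale_sum (r \<oplus> s) (z # p), [?r] @ ([?s] @ scale_sum r p) @ scale_sum s p) \<in> tensor_rel K V W"
  by simp
 have "([?s] @ scale_sum r p, scale_sum r p @ [?s]) \<in> tensor_rel K V W"
  by (rule tensor_rel.comm) (simp_all add: z s r p scale_sum_closed)
 then have "(([?s] @ scale_sum r p) @ scale_sum s p, (scale_sum r p @ [?s]) @ scale_sum s p) \<in> tensor_rel K V W"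
  by (rule tensor_rel.cong) (simp add: s p scale_sum_closed tensor_rel.refl)
 from tensor_rel.cong[OF tensor_rel.refl this, of "[?r]"]
 have "([?r] @ ([?s] @ scale_sum r p) @ scale_sum s p,
   [?r] @ (scale_sum r p @ [?s]) @ scale_sum s p) \<in> tensor_rel K V W"
  by (simp add: r z)
 from tensor_rel.trans[OF 1 this] show ?case by simp
qed

lemma scale_sum_mult:
 "r \<in>. K \<Longrightarrow> s \<in>. K \<Longrightarrow> p \<in> formal_sums V W \<Longrightarrow>
  scale_sum (r \<otimes> s) p = scale_sum r (scale_sum s p)"
 by (induction p) (auto simp: V.smult_assoc1)

lemma scale_sum_one: "p \<in> formal_sums V W \<Longrightarrow> scale_sum \<one> p = p"
 by (induction p) auto

lemma scale_sum_zero: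
 "p \<in> formal_sums V W \<Longrightarrow> (scale_sum \<zero> p, []) \<in> tensor_rel K V W"
proof (induction p)
 case Nil
 then show ?case by (simp add: tensor_rel.refl)
next
 case (Cons z p)
 then have "([(zero V, snd z)] @ scale_sum \<zero> p, [] @ []) \<in> tensor_rel K V W"
  by (intro tensor_rel.cong tensor_rel.zero) auto
 then show ?case using Cons by simp
qed

lemma tensor_module: "module K (tens V W)"
proof (rule moduleI)
 show "cring K" by (rule is_cring)
 show "abelian_group (tens V W)"
 proof (rule abelian_groupI)
  fix X Y assume X: "X \<in>. tens V W" and Y: "Y \<in>. tens V W"
  show "X \<oplus>\<^bsub>tens V W\<^esub> Y \<in>. tens V W"
   by (rule tensor_induct_class[OF X], rule tensor_induct_class[OF Y])
    (simp add: tensor_add_class class_in_tensor)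
  show "X \<oplus>\<^bsub>tens V W\<^esub> Y = Y \<oplus>\<^bsub>tens V W\<^esub> X"
   by (rule tensor_induct_class[OF X], rule tensor_induct_class[OF Y])
    (simp add: tensor_add_class class_eqI tensor_rel.comm)
  fix Z assume Z: "Z \<in>. tens V W"
  show "X \<oplus>\<^bsub>tens V W\<^esub> Y \<oplus>\<^bsub>tens V W\<^esub> Z = X \<oplus>\<^bsub>tens V W\<^esub> (Y \<oplus>\<^bsub>tens V W\<^esub> Z)"
   by (rule tensor_induct_class[OF X], rule tensor_induct_class[OF Y], rule tensor_induct_class[OF Z])
    (simp add: tensor_add_class)
 next
  show "zero (tens V W) \<in>. tens V W" by (simp add: tensor_zero_class class_in_tensor)
  fix X assume X: "X \<in>. tens V W"
  show "zero (tens V W) \<oplus>\<^bsub>tens V W\<^esub> X = X"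
   by (rule tensor_induct_class[OF X]) (simp add: tensor_zero_class tensor_add_class)
  show "\<exists>Y\<in>carrier (tens V W). Y \<oplus>\<^bsub>tens V W\<^esub> X = zero (tens V W)"
  proof (rule tensor_induct_class[OF X])
   fix p assume p: "p \<in> formal_sums V W"
   have "(scale_sum (\<ominus> \<one>) p @ scale_sum \<one> p, scale_sum (\<ominus> \<one> \<oplus> \<one>) p) \<in> tensor_rel K V W"
    using scale_sum_add[of "\<ominus> \<one>" \<one> p] p by (auto intro: tensor_rel.sym)
   then have "(scale_sum (\<ominus> \<one>) p @ p, []) \<in> tensor_rel K V W"
    using scale_sum_zero[OF p] scale_sum_one[OF p] by (auto simp: l_neg intro: tensor_rel.trans)
   then show "\<exists>Y\<in>carrier (tens V W). Y \<oplus>\<^bsub>tens V W\<^esub> tensor_class V W p = zero (tens V W)"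
    using p by (intro bexI[of _ "tensor_class V W (scale_sum (\<ominus> \<one>) p)"])
     (simp_all add: tensor_add_class tensor_zero_class class_in_tensor class_eqI scale_sum_closed)
  qed
 qed
next
 fix r X assume r: "r \<in>. K" and X: "X \<in>. tens V W"
 show "r \<odot>\<^bsub>tens V W\<^esub> X \<in>. tens V W"
  by (rule tensor_induct_class[OF X]) (simp add: r tensor_smult_class class_in_tensor scale_sum_closed)
 fix s assume s: "s \<in>. K"
 show "(r \<oplus> s) \<odot>\<^bsub>tens V W\<^esub> X = r \<odot>\<^bsub>tens V W\<^esub> X \<oplus>\<^bsub>tens V W\<^esub> s \<odot>\<^bsub>tens V W\<^esub> X"
  by (rule tensor_induct_class[OF X])
   (simp add: r s tensor_smult_class tensor_add_class scale_sum_closed class_eqI scale_sum_add)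
 show "r \<otimes> s \<odot>\<^bsub>tens V W\<^esub> X = r \<odot>\<^bsub>tens V W\<^esub> (s \<odot>\<^bsub>tens V W\<^esub> X)"
  by (rule tensor_induct_class[OF X])
   (simp add: r s tensor_smult_class scale_sum_closed scale_sum_mult)
next
 fix r X Y assume r: "r \<in>. K" and X: "X \<in>. tens V W" and Y: "Y \<in>. tens V W"
 show "r \<odot>\<^bsub>tens V W\<^esub> (X \<oplus>\<^bsub>tens V W\<^esub> Y) = r \<odot>\<^bsub>tens V W\<^esub> X \<oplus>\<^bsub>tens V W\<^esub> r \<odot>\<^bsub>tens V W\<^esub> Y"
  by (rule tensor_induct_class[OF X], rule tensor_induct_class[OF Y])
   (simp add: r tensor_smult_class tensor_add_class scale_sum_closed)
next
 fix X assume X: "X \<in>. tens V W"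
 show "\<one> \<odot>\<^bsub>tens V W\<^esub> X = X"
  by (rule tensor_induct_class[OF X]) (simp add: tensor_smult_class scale_sum_one)
qed

lemma pure_bil: "bil V W (tens V W) (pure K V W)"
proof (intro bilI linI)
 fix x y assume x: "x \<in>. V" and y: "y \<in>. W"
 then show "pure K V W x y \<in>. tens V W" "pure K V W x y \<in>. tens V W"
  by (simp_all add: pure_def class_in_tensor)
 show "pure K V W (x \<oplus>\<^bsub>V\<^esub> x') y = pure K V W x y \<oplus>\<^bsub>tens V W\<^esub> pure K V W x' y" if "x' \<in>. V" for x'
  using x y that by (simp add: pure_def tensor_add_class class_eqI tensor_rel.add_left)
 show "pure K V W x (y \<oplus>\<^bsub>W\<^esub> y') = pure K V W x y \<oplus>\<^bsub>tens V W\<^esub> pure K V W x y'" if "y' \<in>. W" for y'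
  using x y that by (simp add: pure_def tensor_add_class class_eqI tensor_rel.add_right)
 show "pure K V W (r \<odot>\<^bsub>V\<^esub> x) y = r \<odot>\<^bsub>tens V W\<^esub> pure K V W x y" if "r \<in>. K" for r
  using x y that by (simp add: pure_def tensor_smult_class)
 show "pure K V W x (r \<odot>\<^bsub>W\<^esub> y) = r \<odot>\<^bsub>tens V W\<^esub> pure K V W x y" if "r \<in>. K" for r
  using x y that
  by (simp add: pure_def tensor_smult_class class_eqI tensor_rel.sym[OF tensor_rel.smult])
qed

lemma sw_class:
 assumes "module K U" "bil V W U b" "p \<in> formal_sums V W"
 shows "sw U (tensor_class V W p) b = formal_eval U p b"
 unfolding sweedler_def
 by (rule formal_eval_respects[OF V W assms(1,2) tensor_rep_class[OF assms(3)]])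

lemma sw_lin:
 assumes U: "module K U" and b: "bil V W U b"
 shows "lin (tens V W) U (\<lambda>X. sw U X b)"
proof (rule linI)
 interpret U: module K U by (rule U)
 note bc = bil_closed[OF b]
 note cl = formal_eval_closed[OF U bc]
 fix X assume X: "X \<in>. tens V W"
 show "sw U X b \<in>. U"
  unfolding sweedler_def using tensor_rep[OF X] by (intro cl) auto
 show "sw U (X \<oplus>\<^bsub>tens V W\<^esub> Y) b = sw U X b \<oplus>\<^bsub>U\<^esub> sw U Y b"
  if Y: "Y \<in>. tens V W" for Y
  by (rule tensor_induct_class[OF X], rule tensor_induct_class[OF Y])
   (simp add: tensor_add_class sw_class[OF U b] formal_eval_append[OF U bc])
 show "sw U (r \<odot>\<^bsub>tens V W\<^esub> X) b = r \<odot>\<^bsub>U\<^esub> sw U X b" if r: "r \<in>. K" for r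
 proof (rule tensor_induct_class[OF X])
  fix p assume p: "p \<in> formal_sums V W"
  then have "formal_eval U (scale_sum r p) b = r \<odot>\<^bsub>U\<^esub> formal_eval U p b"
  proof (induction p)
   case (Cons z p)
   then have "b (r \<odot>\<^bsub>V\<^esub> fst z) (snd z) = r \<odot>\<^bsub>U\<^esub> b (fst z) (snd z)"
    using r by (intro lin_smult[OF bil_left[OF b]]) auto
   moreover have "formal_eval U p b \<in>. U" using Cons by (intro cl) auto
   ultimately show ?case using Cons bc by (simp add: r U.smult_r_distr)
  qed (simp add: r)
  then show "sw U (r \<odot>\<^bsub>tens V W\<^esub> tensor_class V W p) b =
    r \<odot>\<^bsub>U\<^esub> sw U (tensor_class V W p) b"
   using p by (simp add: r tensor_smult_class sw_class[OF U b] scale_sum_closed)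
 qed
qed

lemma sw_pure:
 assumes "module K U" "bil V W U b" "x \<in>. V" "y \<in>. W"
 shows "sw U (pure K V W x y) b = b x y"
proof -
 interpret U: module K U by fact
 show ?thesis
  unfolding pure_def by (subst sw_class) (use assms bil_closed[OF assms(2)] in auto)
qed

lemma sw_closed:
 assumes "X \<in>. tens V W" "module K U"
  "\<And>x y. x \<in>. V \<Longrightarrow> y \<in>. W \<Longrightarrow> b x y \<in>. U"
 shows "sw U X b \<in>. U"
 unfolding sweedler_def
 by (rule formal_eval_closed[OF assms(2) _ tensor_rep(1)[OF assms(1)]]) (rule assms(3))

lemma sw_hom:
 assumes "X \<in>. tens V W" "module K U" "module K U'" "lin U U' g"
  "\<And>x y. x \<in>. V \<Longrightarrow> y \<in>. W \<Longrightarrow> b x y \<in>. U"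
 shows "g (sw U X b) = sw U' X (\<lambda>x y. g (b x y))"
 unfolding sweedler_def
 by (rule formal_eval_hom[OF assms(2-4) _ tensor_rep(1)[OF assms(1)]]) (rule assms(5))

lemma sw_cong:
 assumes "X \<in>. tens V W"
  "\<And>x y. x \<in>. V \<Longrightarrow> y \<in>. W \<Longrightarrow> b x y = b' x y"
 shows "sw U X b = sw U X b'"
 unfolding sweedler_def
 by (rule formal_eval_cong[OF _ tensor_rep(1)[OF assms(1)]]) (rule assms(2))

lemma sw_lin_inner:
 assumes "X \<in>. tens V W" "module K U"
  "\<And>x y. x \<in>. V \<Longrightarrow> y \<in>. W \<Longrightarrow> lin T U (\<lambda>v. b v x y)"
 shows "lin T U (\<lambda>v. sw U X (b v))"
 unfolding sweedler_def
 by (rule formal_eval_lin[OF assms(2) _ tensor_rep(1)[OF assms(1)]]) (rule assms(3))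

lemma sw_pure_id:
 assumes X: "X \<in>. tens V W"
 shows "sw (tens V W) X (pure K V W) = X"
proof (rule tensor_induct_class[OF X])
 fix p assume "p \<in> formal_sums V W"
 then have "formal_eval (tens V W) p (pure K V W) = tensor_class V W p"
 proof (induction p)
  case (Cons z p)
  have "tensor_class V W [z] \<oplus>\<^bsub>tens V W\<^esub> tensor_class V W p = tensor_class V W (z # p)"
   using Cons by (subst tensor_add_class) auto
  then show ?case using Cons by (simp add: pure_def)
 qed (simp add: tensor_zero_class)
 then show "sw (tens V W) (tensor_class V W p) (pure K V W) = tensor_class V W p"
  using sw_class[OF tensor_module pure_bil] \<open>p \<in> formal_sums V W\<close> by simp
qed

text \<open>
 Linear maps on a tensor product are compared on pure tensors, because every tensor is the sum of
 its own pure constituents.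
\<close>

lemma tensor_ext:
 assumes X: "X \<in>. tens V W" and U: "module K U"
  and f: "lin (tens V W) U f" and g: "lin (tens V W) U g"
  and eq: "\<And>x y. x \<in>. V \<Longrightarrow> y \<in>. W \<Longrightarrow> f (pure K V W x y) = g (pure K V W x y)"
 shows "f X = g X"
proof -
 have *: "h X = sw U X (\<lambda>x y. h (pure K V W x y))" if "lin (tens V W) U h" for h
  using sw_hom[OF X tensor_module U that, of "pure K V W"] sw_pure_id[OF X]
   bil_closed[OF pure_bil] by simp
 show ?thesis
  unfolding *[OF f] *[OF g] by (rule sw_cong[OF X]) (rule eq)
qed

end

lemma sw_swap:
 assumes X: "X \<in>. tens V W" and Y: "Y \<in>. tens V' W'"
  and V: "module K V" and W: "module K W" and V': "module K V'" and W': "module K W'" and U: "module K U"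
  and "\<And>x y z w. x \<in>. V \<Longrightarrow> y \<in>. W \<Longrightarrow> z \<in>. V' \<Longrightarrow> w \<in>. W' \<Longrightarrow>
     b x y z w \<in>. U"
 shows "sw U X (\<lambda>x y. sw U Y (\<lambda>z w. b x y z w)) =
  sw U Y (\<lambda>z w. sw U X (\<lambda>x y. b x y z w))"
 unfolding sweedler_def
 by (rule formal_eval_swap[OF U _ tensor_rep(1)[OF V' W' Y] tensor_rep(1)[OF V W X]]) (rule assms(8))

lemma sw_lin_arg:
 assumes f: "lin T (tens V W) f" and mods: "module K V" "module K W" "module K U"
  and "\<And>x. x \<in>. V \<Longrightarrow> lin W U (b x)"
  and "\<And>y. y \<in>. W \<Longrightarrow> lin V U (\<lambda>x. b x y)"
 shows "lin T U (\<lambda>v. sw U (f v) b)"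
 by (rule lin_comp[OF sw_lin[OF mods] f]) (rule bilI; fact)

end

text \<open>
 Rules deciding that an expression lies in a carrier or is linear in a variable. Almost every step
 below has side conditions of this kind, which the syntax of the expression decides.
\<close>

named_theorems lin

text \<open>
 The value of a functional as a constant. A rule about the application \<open>f c\<close> of a variable would
 match every term under higher-order unification and could not direct a resolution proof.
\<close>

definition dp :: "('c \<Rightarrow> 'k) \<Rightarrow> 'c \<Rightarrow> 'k" where
 "dp f c = f c"

context ground
begin

lemma pure_closed:
 "x \<in>. V \<Longrightarrow> y \<in>. W \<Longrightarrow> module K V \<Longrightarrow> module K W \<Longrightarrow> pure K V W x y \<in>. tens V W"
 by (rule bil_closed[OF pure_bil])

lemma lin_pure_left:
 "lin T V f \<Longrightarrow> y \<in>. W \<Longrightarrow> module K V \<Longrightarrow> module K W \<Longrightarrow> lin T (tens V W) (\<lambda>x. pure K V W (f x) y)"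
 by (rule lin_bil_left[OF pure_bil])

lemma lin_pure_right:
 "x \<in>. V \<Longrightarrow> lin T W f \<Longrightarrow> module K V \<Longrightarrow> module K W \<Longrightarrow> lin T (tens V W) (\<lambda>y. pure K V W x (f y))"
 by (rule lin_bil_right[OF pure_bil])

lemma smult_closed': "r \<in>. K \<Longrightarrow> x \<in>. V \<Longrightarrow> module K V \<Longrightarrow> r \<odot>\<^bsub>V\<^esub> x \<in>. V"
 using bil_closed[OF bil_smult] by auto

lemma lin_smult_left: "lin T (scalars K) f \<Longrightarrow> x \<in>. V \<Longrightarrow> module K V \<Longrightarrow> lin T V (\<lambda>r. f r \<odot>\<^bsub>V\<^esub> x)"
 by (rule lin_bil_left[OF bil_smult])

lemma lin_smult_right: "r \<in>. K \<Longrightarrow> lin T V f \<Longrightarrow> module K V \<Longrightarrow> lin T V (\<lambda>x. r \<odot>\<^bsub>V\<^esub> f x)"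
 by (rule lin_bil_right[OF bil_smult, of V r T f]) simp_all

lemma lin_mult_left: "lin T (scalars K) f \<Longrightarrow> s \<in>. K \<Longrightarrow> lin T (scalars K) (\<lambda>r. f r \<otimes> s)"
 using lin_smult_left[OF _ _ scalars_module, of T f s] by simp

lemma lin_mult_right: "r \<in>. K \<Longrightarrow> lin T (scalars K) f \<Longrightarrow> lin T (scalars K) (\<lambda>s. r \<otimes> f s)"
 using lin_smult_right[OF _ _ scalars_module, of r T f] by simp

lemma scalars_carrierI: "x \<in>. K \<Longrightarrow> x \<in>. scalars K"
 by simp

lemma sw_closed_scalars:
 assumes "X \<in>. tens V W" "module K V" "module K W"
  "\<And>x y. x \<in>. V \<Longrightarrow> y \<in>. W \<Longrightarrow> b x y \<in>. K"
 shows "sw (scalars K) X b \<in>. K"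
 using sw_closed[OF assms(2,3,1) scalars_module, of b] assms(4) by simp

lemma lin_smult_const: "module K V \<Longrightarrow> r \<in>. K \<Longrightarrow> lin V V (\<lambda>x. r \<odot>\<^bsub>V\<^esub> x)"
 by (rule lin_smult_right[OF _ lin_id])

lemmas [lin] =
 scalars_module tensor_module
 m_closed pure_closed smult_closed' sw_closed_scalars sw_closed[rotated 2] scalars_carrierI
 lin_id lin_pure_left lin_pure_right lin_smult_left lin_smult_right lin_mult_left lin_mult_right
 sw_lin_inner[rotated 2] sw_lin_arg

lemma sw_pureI:
 assumes "x \<in>. V" "y \<in>. W" "module K V" "module K W" "module K U"
  "\<And>x. x \<in>. V \<Longrightarrow> lin W U (b x)" "\<And>y. y \<in>. W \<Longrightarrow> lin V U (\<lambda>x. b x y)"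
 shows "sw U (pure K V W x y) b = b x y"
 by (rule sw_pure[OF assms(3,4,5) bilI]) (use assms in auto)

section \<open>The dual space and dual bases\<close>

abbreviation dual :: "('k,'c,'m) module_scheme \<Rightarrow> ('k, 'c \<Rightarrow> 'k) module" where
 "dual \<equiv> dual_space K"

lemma dual_simps:
 "f \<in>. dual C \<longleftrightarrow> f \<in> extensional (carrier C) \<and> lin C (scalars K) f"
 "f \<oplus>\<^bsub>dual C\<^esub> g = (\<lambda>c\<in>carrier C. f c \<oplus> g c)"
 "r \<odot>\<^bsub>dual C\<^esub> f = (\<lambda>c\<in>carrier C. r \<otimes> f c)"
 "zero (dual C) = (\<lambda>c\<in>carrier C. \<zero>)"
 by (simp_all add: dual_space_def)

lemma dp_closed: "f \<in>. dual C \<Longrightarrow> c \<in>. C \<Longrightarrow> dp f c \<in>. K"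
 using lin_closed[of C "scalars K" f c] by (simp add: dual_simps dp_def)

lemma dual_ext: "f \<in>. dual C \<Longrightarrow> g \<in>. dual C \<Longrightarrow> (\<And>c. c \<in>. C \<Longrightarrow> dp f c = dp g c) \<Longrightarrow> f = g"
 by (rule extensionalityI[of _ "carrier C"]) (auto simp: dual_simps dp_def)

lemma restrict_dual:
 assumes "module K C" "lin C (scalars K) g"
 shows "(\<lambda>c\<in>carrier C. g c) \<in>. dual C"
 using lin_cong[OF assms, of "\<lambda>c\<in>carrier C. g c"] by (simp add: dual_simps)

lemma dual_module:
 assumes C: "module K C" shows "module K (dual C)"
proof (rule moduleI)
 interpret S: module K "scalars K" by (rule scalars_module)
 note scalars_simps [simp]
 have plus: "f \<oplus>\<^bsub>dual C\<^esub> g \<in>. dual C" if "f \<in>. dual C" "g \<in>. dual C" for f g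
  using restrict_dual[OF C lin_plus[OF scalars_module, of C f g]] that by (simp add: dual_simps)
 have sm: "r \<odot>\<^bsub>dual C\<^esub> f \<in>. dual C" if "r \<in>. K" "f \<in>. dual C" for r f
  using restrict_dual[OF C lin_mult_right[of r C f]] that by (simp add: dual_simps)
 have cl: "f c \<in>. K" if "f \<in>. dual C" "c \<in>. C" for f c
  using dp_closed[OF that] by (simp add: dp_def)
 have ext: "f = g" if "f \<in>. dual C" "g \<in>. dual C" "\<And>c. c \<in>. C \<Longrightarrow> f c = g c" for f g
  using dual_ext[OF that(1,2)] that(3) by (simp add: dp_def)
 have zero: "zero (dual C) \<in>. dual C"
  using restrict_dual[OF C lin_zero_fun[OF scalars_module]] by (simp add: dual_simps)
 show "cring K" by (rule is_cring)
 show "abelian_group (dual C)"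
 proof (rule abelian_groupI)
  fix f assume f: "f \<in>. dual C"
  show "\<exists>g\<in>carrier (dual C). g \<oplus>\<^bsub>dual C\<^esub> f = zero (dual C)"
  proof (intro bexI[of _ "(\<ominus> \<one>) \<odot>\<^bsub>dual C\<^esub> f"])
   show "(\<ominus> \<one>) \<odot>\<^bsub>dual C\<^esub> f \<oplus>\<^bsub>dual C\<^esub> f = zero (dual C)"
   proof (rule ext)
    fix c assume "c \<in>. C"
    then show "((\<ominus> \<one>) \<odot>\<^bsub>dual C\<^esub> f \<oplus>\<^bsub>dual C\<^esub> f) c = zero (dual C) c"
     using cl[OF f] by (simp add: dual_simps l_minus l_neg)
   qed (auto intro: plus sm f zero)
  qed (auto intro: sm f)
 next
  fix f g h
  assume fgh: "f \<in>. dual C" "g \<in>. dual C" "h \<in>. dual C"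
  show "f \<oplus>\<^bsub>dual C\<^esub> g \<oplus>\<^bsub>dual C\<^esub> h = f \<oplus>\<^bsub>dual C\<^esub> (g \<oplus>\<^bsub>dual C\<^esub> h)"
   by (rule ext, (intro plus sm zero fgh)+, simp add: dual_simps(2) a_assoc cl fgh)
 next
  fix f g
  assume fg: "f \<in>. dual C" "g \<in>. dual C"
  show "f \<oplus>\<^bsub>dual C\<^esub> g = g \<oplus>\<^bsub>dual C\<^esub> f"
   by (rule ext, (intro plus sm zero fg)+, simp add: dual_simps(2) a_comm cl fg)
 next
  fix f
  assume f: "f \<in>. dual C"
  show "zero (dual C) \<oplus>\<^bsub>dual C\<^esub> f = f"
   by (rule ext, (intro plus sm zero f)+, simp add: dual_simps(2,4) cl f)
 qed (auto intro: plus zero)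
 fix f assume f: "f \<in>. dual C"
 show "\<one> \<odot>\<^bsub>dual C\<^esub> f = f"
  by (rule ext, intro sm one_closed f, rule f, simp add: dual_simps(3) cl f)
 fix r s g
 assume r: "r \<in>. K"
 show "r \<odot>\<^bsub>dual C\<^esub> f \<in>. dual C" by (rule sm[OF r f])
 show "r \<odot>\<^bsub>dual C\<^esub> (f \<oplus>\<^bsub>dual C\<^esub> g) = r \<odot>\<^bsub>dual C\<^esub> f \<oplus>\<^bsub>dual C\<^esub> r \<odot>\<^bsub>dual C\<^esub> g" if g: "g \<in>. dual C"
  by (rule ext, (intro plus sm zero r f g)+, simp add: dual_simps(2,3) cl r_distr r f g)
 assume s: "s \<in>. K"
 show "(r \<oplus> s) \<odot>\<^bsub>dual C\<^esub> f = r \<odot>\<^bsub>dual C\<^esub> f \<oplus>\<^bsub>dual C\<^esub> s \<odot>\<^bsub>dual C\<^esub> f"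
  by (rule ext, (intro plus sm zero r s f a_closed m_closed)+, simp add: dual_simps(2,3) cl l_distr r s f)
 show "r \<otimes> s \<odot>\<^bsub>dual C\<^esub> f = r \<odot>\<^bsub>dual C\<^esub> (s \<odot>\<^bsub>dual C\<^esub> f)"
  by (rule ext, (intro plus sm zero r s f a_closed m_closed)+, simp add: dual_simps(2,3) cl m_assoc r s f)
qed

lemma dp_bil: "module K C \<Longrightarrow> bil (dual C) C (scalars K) dp"
 by (rule bilI) (auto simp: dual_simps dp_def linear_map_def extensional_def Pi_iff)

lemma lin_dp_left: "lin T (dual C) f \<Longrightarrow> c \<in>. C \<Longrightarrow> module K C \<Longrightarrow> lin T (scalars K) (\<lambda>t. dp (f t) c)"
 by (rule lin_bil_left[OF dp_bil])

lemma lin_dp_right: "f \<in>. dual C \<Longrightarrow> lin T C g \<Longrightarrow> module K C \<Longrightarrow> lin T (scalars K) (\<lambda>t. dp f (g t))"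
 by (rule lin_bil_right[OF dp_bil])

lemma dp_restrict: "c \<in>. C \<Longrightarrow> dp (\<lambda>c\<in>carrier C. g c) c = g c"
 by (simp add: dp_def)

lemma lin_restrict_dual:
 assumes C: "module K C" and T: "module K T"
  and "\<And>t. t \<in>. T \<Longrightarrow> lin C (scalars K) (g t)"
  and "\<And>c. c \<in>. C \<Longrightarrow> lin T (scalars K) (\<lambda>t. g t c)"
 shows "lin T (dual C) (\<lambda>t. \<lambda>c\<in>carrier C. g t c)"
proof -
 interpret T: module K T by fact
 show ?thesis
 proof (rule linI)
  show "(\<lambda>c\<in>carrier C. g t c) \<in>. dual C" if "t \<in>. T" for t
   by (rule restrict_dual[OF C assms(3)[OF that]])
 qed (auto simp: dual_simps lin_add[OF assms(4)] lin_smult[OF assms(4)] intro!: restrict_ext)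
qed

lemmas [lin] = dual_module dp_closed lin_dp_left lin_dp_right restrict_dual lin_restrict_dual

text \<open>
 \<open>\<Omega> = \<Sum> x\<^sub>i \<otimes> f\<^sub>i\<close> with dual bases \<open>x\<^sub>i\<close> and \<open>f\<^sub>i\<close>. Sums over the bases become Sweedler
 sums over this tensor.
\<close>

definition coevaluation :: "('k,'c,'m) module_scheme \<Rightarrow> ('c \<times> ('c \<Rightarrow> 'k)) list set \<Rightarrow> bool" where
 "coevaluation C \<Omega> \<longleftrightarrow> \<Omega> \<in>. tens C (dual C) \<and>
   (\<forall>c\<in>carrier C. sw C \<Omega> (\<lambda>x f. dp f c \<odot>\<^bsub>C\<^esub> x) = c)"

lemma lin_finsum:
 assumes "module K V" "module K W" "lin V W f"
 shows "finite B \<Longrightarrow> v \<in> B \<rightarrow> carrier V \<Longrightarrow> f (\<Oplus>\<^bsub>V\<^esub>b\<in>B. v b) = (\<Oplus>\<^bsub>W\<^esub>b\<in>B. f (v b))"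
proof (induction B rule: finite_induct)
 case empty
 interpret V: module K V by fact
 interpret W: module K W by fact
 show ?case using lin_zero[OF assms] by simp
next
 case (insert b B)
 interpret V: module K V by fact
 interpret W: module K W by fact
 have "f (v x) \<in>. W" if "x \<in> insert b B" for x
  using insert.prems that by (intro lin_closed[OF assms(3)]) auto
 then show ?case using insert by (simp add: lin_add[OF assms(3)] Pi_iff)
qed

text \<open>
 A spanning set with the least number of elements is linearly independent, so that the coordinates
 are well-defined linear functionals.
\<close>

lemma coevaluation_exists:
 assumes C: "module K C" and fin: "finite_dimensional K C"
 obtains \<Omega> where "coevaluation C \<Omega>"
proof -
 interpret C: module K C by (rule C)
 define comb where "comb B g = (\<Oplus>\<^bsub>C\<^esub>b\<in>B. g b \<odot>\<^bsub>C\<^esub> b)" for B g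
 define spans where "spans B \<longleftrightarrow> finite B \<and> B \<subseteq> carrier C \<and>
   (\<forall>x\<in>carrier C. \<exists>g\<in>B \<rightarrow> carrier K. x = comb B g)" for B
 from fin obtain B\<^sub>0 where "spans B\<^sub>0"
  unfolding finite_dimensional_def spans_def comb_def by blast
 then obtain B where B: "spans B" and minimal: "\<And>B'. spans B' \<Longrightarrow> card B \<le> card B'"
  using ex_has_least_nat[of spans B\<^sub>0 card] by blast
 have finB: "finite B" and BC: "B \<subseteq> carrier C" using B by (auto simp: spans_def)
 have comb_diff: "comb B (\<lambda>b. g b \<oplus> t \<otimes> h b) = comb B g \<oplus>\<^bsub>C\<^esub> t \<odot>\<^bsub>C\<^esub> comb B h"
  if "g \<in> B \<rightarrow> carrier K" "h \<in> B \<rightarrow> carrier K" "t \<in>. K" for g h t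
 proof -
  have "comb B (\<lambda>b. g b \<oplus> t \<otimes> h b) = (\<Oplus>\<^bsub>C\<^esub>b\<in>B. g b \<odot>\<^bsub>C\<^esub> b \<oplus>\<^bsub>C\<^esub> t \<odot>\<^bsub>C\<^esub> (h b \<odot>\<^bsub>C\<^esub> b))"
   unfolding comb_def using that BC
   by (intro C.finsum_cong') (auto simp: C.smult_l_distr C.smult_assoc1 Pi_iff subset_iff)
  also have "... = comb B g \<oplus>\<^bsub>C\<^esub> (\<Oplus>\<^bsub>C\<^esub>b\<in>B. t \<odot>\<^bsub>C\<^esub> (h b \<odot>\<^bsub>C\<^esub> b))"
   unfolding comb_def using that BC by (intro C.finsum_addf) (auto simp: Pi_iff subset_iff)
  also have "(\<Oplus>\<^bsub>C\<^esub>b\<in>B. t \<odot>\<^bsub>C\<^esub> (h b \<odot>\<^bsub>C\<^esub> b)) = t \<odot>\<^bsub>C\<^esub> comb B h"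
   unfolding comb_def using that BC finB
   by (intro lin_finsum[OF C C lin_smult_const[OF C], symmetric]) (auto simp: Pi_iff subset_iff)
  finally show ?thesis .
 qed
 have indep: "g b = \<zero>" if g: "g \<in> B \<rightarrow> carrier K" "comb B g = zero C" and b: "b \<in> B" for g b
 proof (rule ccontr)
  assume nz: "g b \<noteq> \<zero>"
  then have unit: "g b \<in> Units K" using g b field_Units by auto
  have "spans (B - {b})"
   unfolding spans_def
  proof (intro conjI ballI)
   fix x assume "x \<in>. C"
   then obtain h where h: "h \<in> B \<rightarrow> carrier K" "x = comb B h" using B unfolding spans_def by blast
   \<comment> \<open>Subtract the multiple of the relation \<open>g\<close> that cancels the coefficient of \<open>b\<close>.\<close>
   let ?t = "\<ominus> (h b \<otimes> inv (g b))"
   let ?k = "\<lambda>c. h c \<oplus> ?t \<otimes> g c"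
   have hb: "h b \<in>. K" "g b \<in>. K" using h g b by auto
   then have t: "?t \<in>. K" using unit by simp
   have k: "?k c \<in>. K" if "c \<in> B" for c using that h g t by (auto simp: Pi_iff)
   have "(h b \<otimes> inv (g b)) \<otimes> g b = h b" using hb unit by (simp add: m_assoc Units_l_inv)
   then have kb: "?k b = \<zero>" using hb unit by (simp add: l_minus r_neg)
   have "x = comb B ?k"
    using comb_diff[OF h(1) g(1) t] h(2) g(2) t \<open>x \<in>. C\<close> by simp
   also have "... = comb (insert b (B - {b})) ?k" using b by (simp add: insert_absorb)
   also have "... = ?k b \<odot>\<^bsub>C\<^esub> b \<oplus>\<^bsub>C\<^esub> comb (B - {b}) ?k"
    unfolding comb_def using finB BC b k
    by (intro C.finsum_insert) (auto simp: Pi_iff subset_iff)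
   also have "... = comb (B - {b}) ?k"
    unfolding kb comb_def using BC b k
    by (subst C.smult_l_null) (auto intro!: C.l_zero C.finsum_closed simp: Pi_iff subset_iff)
   finally show "\<exists>k\<in>B - {b} \<rightarrow> carrier K. x = comb (B - {b}) k"
    using k by (intro bexI[of _ ?k]) auto
  qed (use finB BC in auto)
  from minimal[OF this] b finB show False
   by (metis card_Diff1_less linorder_not_le)
 qed
 have "\<forall>x. \<exists>g. x \<in>. C \<longrightarrow> g \<in> B \<rightarrow> carrier K \<and> x = comb B g"
  using B unfolding spans_def by blast
 then obtain crd where crd: "\<And>x. x \<in>. C \<Longrightarrow> crd x \<in> B \<rightarrow> carrier K"
  and comb_crd: "\<And>x. x \<in>. C \<Longrightarrow> comb B (crd x) = x"
  by metis
 have crd_comb: "crd (comb B g) b = g b" if g: "g \<in> B \<rightarrow> carrier K" and b: "b \<in> B" for g b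
 proof -
  have cg: "comb B g \<in>. C"
   unfolding comb_def using g BC by (intro C.finsum_closed) (auto simp: Pi_iff subset_iff)
  note c = crd[OF cg]
  have "comb B (\<lambda>b. crd (comb B g) b \<oplus> (\<ominus> \<one>) \<otimes> g b) = comb B g \<oplus>\<^bsub>C\<^esub> (\<ominus> \<one>) \<odot>\<^bsub>C\<^esub> comb B g"
   using comb_diff[OF c g, of "\<ominus> \<one>"] comb_crd[OF cg] by simp
  also have "... = zero C" using cg by (simp add: C.smult_l_minus C.r_neg)
  finally have "crd (comb B g) b \<oplus> (\<ominus> \<one>) \<otimes> g b = \<zero>"
   using c g b by (intro indep) (auto simp: Pi_iff)
  moreover have "crd (comb B g) b \<in>. K" "g b \<in>. K" using c g b by auto
  ultimately show ?thesis
   using minus_equality[of "crd (comb B g) b" "\<ominus> g b"] by (simp add: l_minus)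
 qed
 have lin_crd: "lin C (scalars K) (\<lambda>x. crd x b)" if b: "b \<in> B" for b
 proof (rule linI)
  fix x assume x: "x \<in>. C"
  show "crd x b \<in>. scalars K" using crd[OF x] b by auto
  show "crd (x \<oplus>\<^bsub>C\<^esub> y) b = crd x b \<oplus>\<^bsub>scalars K\<^esub> crd y b" if y: "y \<in>. C" for y
  proof -
   have "x \<oplus>\<^bsub>C\<^esub> y = comb B (\<lambda>b. crd x b \<oplus> \<one> \<otimes> crd y b)"
    using comb_diff[OF crd[OF x] crd[OF y], of \<one>] comb_crd x y by simp
   then have "crd (x \<oplus>\<^bsub>C\<^esub> y) b = crd x b \<oplus> \<one> \<otimes> crd y b"
    using crd[OF x] crd[OF y] b by (simp only:) (rule crd_comb, auto simp: Pi_iff)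
   then show ?thesis using crd[OF y] b by (auto simp: Pi_iff)
  qed
  show "crd (r \<odot>\<^bsub>C\<^esub> x) b = r \<odot>\<^bsub>scalars K\<^esub> crd x b" if r: "r \<in>. K" for r
  proof -
   have z: "(\<lambda>_. \<zero>) \<in> B \<rightarrow> carrier K" by auto
   have "comb B (\<lambda>_. \<zero>) = zero C"
    unfolding comb_def using BC by (intro C.add.finprod_one_eqI) auto
   then have "r \<odot>\<^bsub>C\<^esub> x = comb B (\<lambda>b. \<zero> \<oplus> r \<otimes> crd x b)"
    using comb_diff[OF z crd[OF x] r] comb_crd x r by simp
   then have "crd (r \<odot>\<^bsub>C\<^esub> x) b = \<zero> \<oplus> r \<otimes> crd x b"
    using crd[OF x] r b by (simp only:) (rule crd_comb, auto simp: Pi_iff)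
   then show ?thesis using crd[OF x] r b by (auto simp: Pi_iff)
  qed
 qed
 define \<phi> where "\<phi> b = (\<lambda>x\<in>carrier C. crd x b)" for b
 have \<phi>: "\<phi> b \<in>. dual C" if "b \<in> B" for b
  unfolding \<phi>_def by (rule restrict_dual[OF C lin_crd[OF that]])
 define \<Omega> where "\<Omega> = (\<Oplus>\<^bsub>tens C (dual C)\<^esub>b\<in>B. pure K C (dual C) b (\<phi> b))"
 interpret T: module K "tens C (dual C)" by (intro tensor_module dual_module C)
 have p: "(\<lambda>b. pure K C (dual C) b (\<phi> b)) \<in> B \<rightarrow> carrier (tens C (dual C))"
  using BC \<phi> by (auto intro!: pure_closed C dual_module)
 have "coevaluation C \<Omega>"
  unfolding coevaluation_def
 proof (intro conjI ballI)
  show "\<Omega> \<in>. tens C (dual C)"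
   unfolding \<Omega>_def by (rule T.finsum_closed[OF p])
  fix c assume c: "c \<in>. C"
  note [lin] = C c
  have b: "bil C (dual C) C (\<lambda>x f. dp f c \<odot>\<^bsub>C\<^esub> x)"
   by (rule bilI) (rule lin|assumption)+
  have l: "lin (tens C (dual C)) C (\<lambda>X. sw C X (\<lambda>x f. dp f c \<odot>\<^bsub>C\<^esub> x))"
   by (rule sw_lin[OF C dual_module[OF C] C b])
  have "sw C \<Omega> (\<lambda>x f. dp f c \<odot>\<^bsub>C\<^esub> x) =
    (\<Oplus>\<^bsub>C\<^esub>d\<in>B. sw C (pure K C (dual C) d (\<phi> d)) (\<lambda>x f. dp f c \<odot>\<^bsub>C\<^esub> x))"
   unfolding \<Omega>_def by (rule lin_finsum[OF T.module_axioms C l finB p, unfolded comp_def])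
  also have "... = comb B (crd c)"
   unfolding comb_def
  proof (rule C.finsum_cong')
   fix d assume d: "d \<in> B"
   then show "sw C (pure K C (dual C) d (\<phi> d)) (\<lambda>x f. dp f c \<odot>\<^bsub>C\<^esub> x) = crd c d \<odot>\<^bsub>C\<^esub> d"
    using BC \<phi> sw_pure[OF C dual_module[OF C] C b] c by (auto simp: dp_def \<phi>_def)
  qed (use BC crd[OF c] in auto)
  also have "... = c" by (rule comb_crd[OF c])
  finally show "sw C \<Omega> (\<lambda>x f. dp f c \<odot>\<^bsub>C\<^esub> x) = c" .
 qed
 then show ?thesis by (rule that)
qed

section \<open>Separating the elements of tensor products\<close>

definition tmap ::
 "('k,'v,'m) module_scheme \<Rightarrow> ('k,'w,'n) module_scheme \<Rightarrow> ('x \<Rightarrow> 'v) \<Rightarrow> ('y \<Rightarrow> 'w) \<Rightarrow>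
  ('x \<times> 'y) list set \<Rightarrow> ('v \<times> 'w) list set" where
 "tmap V W f g X = sw (tens V W) X (\<lambda>x y. pure K V W (f x) (g y))"

lemma tmap_lin:
 assumes "lin V V' f" "lin W W' g" "module K V" "module K W" "module K V'" "module K W'"
 shows "lin (tens V W) (tens V' W') (tmap V' W' f g)"
proof -
 note [lin] = assms lin_closed[OF assms(1)] lin_closed[OF assms(2)] lin_comp[OF assms(1)] lin_comp[OF assms(2)]
 show ?thesis unfolding tmap_def by (rule lin|assumption)+
qed

lemma tmap_pure:
 assumes "x \<in>. V" "y \<in>. W"
  "lin V V' f" "lin W W' g" "module K V" "module K W" "module K V'" "module K W'"
 shows "tmap V' W' f g (pure K V W x y) = pure K V' W' (f x) (g y)"
proof -
 note [lin] = assms lin_closed[OF assms(3)] lin_closed[OF assms(4)] lin_comp[OF assms(3)] lin_comp[OF assms(4)]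
 show ?thesis unfolding tmap_def by (rule sw_pureI) (rule lin|assumption)+
qed

lemma tmap_closed:
 assumes "X \<in>. tens V W" "lin V V' f" "lin W W' g" "module K V" "module K W" "module K V'" "module K W'"
 shows "tmap V' W' f g X \<in>. tens V' W'"
 by (rule lin_closed[OF tmap_lin]) fact+

lemma tmap_lin_comp:
 assumes "lin T (tens V W) h" "lin V V' f" "lin W W' g" "module K V" "module K W" "module K V'" "module K W'"
 shows "lin T (tens V' W') (\<lambda>t. tmap V' W' f g (h t))"
 by (rule lin_comp[OF tmap_lin]) fact+

text \<open>
 Every \<open>v\<close> is a combination of the images \<open>L p v\<close>, by a formula linear in them. In this
 form the joint injectivity of the maps \<open>L p\<close> passes to tensor products, where the formula is applied
 to one factor.
\<close>

definition recovers where
 "recovers P Q \<Omega> V V' L R \<longleftrightarrow>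
   module K P \<and> module K Q \<and> module K V \<and> module K V' \<and> \<Omega> \<in>. tens P Q \<and>
   bil P V V' L \<and> bil V' Q V R \<and> (\<forall>v\<in>carrier V. sw V \<Omega> (\<lambda>p q. R (L p v) q) = v)"

lemma recovers_separates:
 assumes "recovers P Q \<Omega> V V' L R" "v \<in>. V" "v' \<in>. V"
  and "\<And>p. p \<in>. P \<Longrightarrow> L p v = L p v'"
 shows "v = v'"
proof -
 have "module K P" "module K Q" "\<Omega> \<in>. tens P Q" using assms(1) by (auto simp: recovers_def)
 then have "sw V \<Omega> (\<lambda>p q. R (L p v) q) = sw V \<Omega> (\<lambda>p q. R (L p v') q)"
  by (rule sw_cong) (simp add: assms(4))
 then show ?thesis using assms(1-3) by (simp add: recovers_def)
qed

lemma recovers_tensor_right: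
 assumes "recovers P Q \<Omega> V V' L R" and W: "module K W"
 shows "recovers P Q \<Omega> (tens W V) (tens W V') (\<lambda>p. tmap W V' (\<lambda>w. w) (L p))
  (\<lambda>Z q. tmap W V (\<lambda>w. w) (\<lambda>v'. R v' q) Z)"
proof -
 have mods: "module K P" "module K Q" "module K V" "module K V'" "\<Omega> \<in>. tens P Q"
  and L: "bil P V V' L" and R: "bil V' Q V R"
  and rec: "\<And>v. v \<in>. V \<Longrightarrow> sw V \<Omega> (\<lambda>p q. R (L p v) q) = v"
  using assms(1) by (auto simp: recovers_def)
 note [lin] = mods W bil_closed[OF L] bil_closed[OF R] lin_bil_left[OF L] lin_bil_right[OF L]
  lin_bil_left[OF R] lin_bil_right[OF R] tmap_closed tmap_lin_comp
 have L': "lin P (tens W V') (\<lambda>p. tmap W V' (\<lambda>w. w) (L p) Z)" if [lin]: "Z \<in>. tens W V" for Z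
  unfolding tmap_def by (rule lin|assumption)+
 have R': "lin Q (tens W V) (\<lambda>q. tmap W V (\<lambda>w. w) (\<lambda>v'. R v' q) Z)" if [lin]: "Z \<in>. tens W V'" for Z
  unfolding tmap_def by (rule lin|assumption)+
 have 1: "bil P (tens W V) (tens W V') (\<lambda>p. tmap W V' (\<lambda>w. w) (L p))"
  by (rule bilI) (rule L' lin|assumption)+
 have 2: "bil (tens W V') Q (tens W V) (\<lambda>Z q. tmap W V (\<lambda>w. w) (\<lambda>v'. R v' q) Z)"
  by (rule bilI) (rule R' lin|assumption)+
 have "sw (tens W V) \<Omega> (\<lambda>p q. tmap W V (\<lambda>w. w) (\<lambda>v'. R v' q) (tmap W V' (\<lambda>w. w) (L p) Z)) = Z"
  if Z: "Z \<in>. tens W V" for Z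
 proof (rule tensor_ext[OF W _ Z, where U="tens W V"])
  fix w v assume [lin]: "w \<in>. W" "v \<in>. V"
  have "sw (tens W V) \<Omega> (\<lambda>p q. tmap W V (\<lambda>w. w) (\<lambda>v'. R v' q) (tmap W V' (\<lambda>w. w) (L p) (pure K W V w v)))
    = sw (tens W V) \<Omega> (\<lambda>p q. pure K W V w (R (L p v) q))"
  proof (rule sw_cong, (rule lin|assumption)+, goal_cases)
   case [lin]: (1 p q)
   have "tmap W V' (\<lambda>w. w) (L p) (pure K W V w v) = pure K W V' w (L p v)"
    by (rule tmap_pure) (rule lin|assumption)+
   moreover have "tmap W V (\<lambda>w. w) (\<lambda>v'. R v' q) (pure K W V' w (L p v)) = pure K W V w (R (L p v) q)"
    by (rule tmap_pure) (rule lin|assumption)+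
   ultimately show ?case by simp
  qed
  also have "... = pure K W V w (sw V \<Omega> (\<lambda>p q. R (L p v) q))"
   by (rule sw_hom[where g="pure K W V w", symmetric]) (rule lin|assumption)+
  also have "sw V \<Omega> (\<lambda>p q. R (L p v) q) = v" by (rule rec) fact
  finally show "sw (tens W V) \<Omega> (\<lambda>p q. tmap W V (\<lambda>w. w) (\<lambda>v'. R v' q)
    (tmap W V' (\<lambda>w. w) (L p) (pure K W V w v))) = pure K W V w v" .
 qed (rule lin|assumption)+
 with mods W L R 1 2 show ?thesis
  by (auto simp: recovers_def intro: tensor_module)
qed

lemma recovers_tensor_left:
 assumes "recovers P Q \<Omega> V V' L R" and W: "module K W"
 shows "recovers P Q \<Omega> (tens V W) (tens V' W) (\<lambda>p. tmap V' W (L p) (\<lambda>w. w))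
  (\<lambda>Z q. tmap V W (\<lambda>v'. R v' q) (\<lambda>w. w) Z)"
proof -
 have mods: "module K P" "module K Q" "module K V" "module K V'" "\<Omega> \<in>. tens P Q"
  and L: "bil P V V' L" and R: "bil V' Q V R"
  and rec: "\<And>v. v \<in>. V \<Longrightarrow> sw V \<Omega> (\<lambda>p q. R (L p v) q) = v"
  using assms(1) by (auto simp: recovers_def)
 note [lin] = mods W bil_closed[OF L] bil_closed[OF R] lin_bil_left[OF L] lin_bil_right[OF L]
  lin_bil_left[OF R] lin_bil_right[OF R] tmap_closed tmap_lin_comp
 have L': "lin P (tens V' W) (\<lambda>p. tmap V' W (L p) (\<lambda>w. w) Z)" if [lin]: "Z \<in>. tens V W" for Z
  unfolding tmap_def by (rule lin|assumption)+
 have R': "lin Q (tens V W) (\<lambda>q. tmap V W (\<lambda>v'. R v' q) (\<lambda>w. w) Z)" if [lin]: "Z \<in>. tens V' W" for Z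
  unfolding tmap_def by (rule lin|assumption)+
 have 1: "bil P (tens V W) (tens V' W) (\<lambda>p. tmap V' W (L p) (\<lambda>w. w))"
  by (rule bilI) (rule L' lin|assumption)+
 have 2: "bil (tens V' W) Q (tens V W) (\<lambda>Z q. tmap V W (\<lambda>v'. R v' q) (\<lambda>w. w) Z)"
  by (rule bilI) (rule R' lin|assumption)+
 have "sw (tens V W) \<Omega> (\<lambda>p q. tmap V W (\<lambda>v'. R v' q) (\<lambda>w. w) (tmap V' W (L p) (\<lambda>w. w) Z)) = Z"
  if Z: "Z \<in>. tens V W" for Z
 proof (rule tensor_ext[OF _ W Z, where U="tens V W"])
  fix v w assume [lin]: "v \<in>. V" "w \<in>. W"
  have "sw (tens V W) \<Omega> (\<lambda>p q. tmap V W (\<lambda>v'. R v' q) (\<lambda>w. w) (tmap V' W (L p) (\<lambda>w. w) (pure K V W v w)))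
    = sw (tens V W) \<Omega> (\<lambda>p q. pure K V W (R (L p v) q) w)"
  proof (rule sw_cong, (rule lin|assumption)+, goal_cases)
   case [lin]: (1 p q)
   have "tmap V' W (L p) (\<lambda>w. w) (pure K V W v w) = pure K V' W (L p v) w"
    by (rule tmap_pure) (rule lin|assumption)+
   moreover have "tmap V W (\<lambda>v'. R v' q) (\<lambda>w. w) (pure K V' W (L p v) w) = pure K V W (R (L p v) q) w"
    by (rule tmap_pure) (rule lin|assumption)+
   ultimately show ?case by simp
  qed
  also have "... = (\<lambda>u. pure K V W u w) (sw V \<Omega> (\<lambda>p q. R (L p v) q))"
   by (rule sw_hom[where g="\<lambda>u. pure K V W u w", symmetric]) (rule lin|assumption)+
  also have "sw V \<Omega> (\<lambda>p q. R (L p v) q) = v" by (rule rec) fact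
  finally show "sw (tens V W) \<Omega> (\<lambda>p q. tmap V W (\<lambda>v'. R v' q) (\<lambda>w. w)
    (tmap V' W (L p) (\<lambda>w. w) (pure K V W v w))) = pure K V W v w" .
 qed (rule lin|assumption)+
 with mods W L R 1 2 show ?thesis
  by (auto simp: recovers_def intro: tensor_module)
qed

text \<open>
 \<open>evl\<close> evaluates the functionals in \<open>W \<otimes> C\<^sup>*\<close> at a vector of \<open>C\<close>, and \<open>con\<close> contracts \<open>W \<otimes> C\<close> with a
 functional.
\<close>

definition evl :: "('k,'v,'m) module_scheme \<Rightarrow> 'c \<Rightarrow> ('v \<times> ('c \<Rightarrow> 'k)) list set \<Rightarrow> 'v" where
 "evl W c X = sw W X (\<lambda>w f. dp f c \<odot>\<^bsub>W\<^esub> w)"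

definition con :: "('k,'v,'m) module_scheme \<Rightarrow> ('c \<Rightarrow> 'k) \<Rightarrow> ('v \<times> 'c) list set \<Rightarrow> 'v" where
 "con W f Z = sw W Z (\<lambda>w c. dp f c \<odot>\<^bsub>W\<^esub> w)"

lemma evl_bil:
 assumes [lin]: "module K W" "module K C"
 shows "bil C (tens W (dual C)) W (evl W)"
 unfolding evl_def by (rule bilI) (rule lin|assumption)+

lemma con_bil:
 assumes [lin]: "module K W" "module K C"
 shows "bil (dual C) (tens W C) W (con W)"
 unfolding con_def by (rule bilI) (rule lin|assumption)+

lemma evl_pure:
 assumes [lin]: "module K W" "module K C" "w \<in>. W" "f \<in>. dual C" "c \<in>. C"
 shows "evl W c (pure K W (dual C) w f) = dp f c \<odot>\<^bsub>W\<^esub> w"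
 unfolding evl_def by (rule sw_pureI) (rule lin|assumption)+

lemma con_pure:
 assumes [lin]: "module K W" "module K C" "w \<in>. W" "f \<in>. dual C" "c \<in>. C"
 shows "con W f (pure K W C w c) = dp f c \<odot>\<^bsub>W\<^esub> w"
 unfolding con_def by (rule sw_pureI) (rule lin|assumption)+

lemma dp_smult: "module K C \<Longrightarrow> r \<in>. K \<Longrightarrow> f \<in>. dual C \<Longrightarrow> c \<in>. C \<Longrightarrow>
  dp (r \<odot>\<^bsub>dual C\<^esub> f) c = r \<otimes> dp f c"
 using lin_smult[OF bil_left[OF dp_bil]] by fastforce

lemma dp_smult_right: "module K C \<Longrightarrow> r \<in>. K \<Longrightarrow> f \<in>. dual C \<Longrightarrow> c \<in>. C \<Longrightarrow>
  dp f (r \<odot>\<^bsub>C\<^esub> c) = r \<otimes> dp f c"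
 using lin_smult[OF bil_right[OF dp_bil]] by fastforce

lemma pure_smult_left: "module K V \<Longrightarrow> module K W \<Longrightarrow> r \<in>. K \<Longrightarrow> x \<in>. V \<Longrightarrow> y \<in>. W \<Longrightarrow>
  pure K V W (r \<odot>\<^bsub>V\<^esub> x) y = r \<odot>\<^bsub>tens V W\<^esub> pure K V W x y"
 using lin_smult[OF bil_left[OF pure_bil]] by fastforce

lemma pure_smult_right: "module K V \<Longrightarrow> module K W \<Longrightarrow> r \<in>. K \<Longrightarrow> x \<in>. V \<Longrightarrow> y \<in>. W \<Longrightarrow>
  pure K V W x (r \<odot>\<^bsub>W\<^esub> y) = r \<odot>\<^bsub>tens V W\<^esub> pure K V W x y"
 using lin_smult[OF bil_right[OF pure_bil]] by fastforce

context
 fixes C :: "('k,'c,'m) module_scheme" and \<Omega>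
 assumes C [lin]: "module K C" and \<Omega>: "coevaluation C \<Omega>"
begin

lemma coev_closed [lin]: "\<Omega> \<in>. tens C (dual C)"
 using \<Omega> by (simp add: coevaluation_def)

lemma coev: "c \<in>. C \<Longrightarrow> sw C \<Omega> (\<lambda>x f. dp f c \<odot>\<^bsub>C\<^esub> x) = c"
 using \<Omega> by (simp add: coevaluation_def)

lemma coev_dual:
 assumes [lin]: "g \<in>. dual C"
 shows "sw (dual C) \<Omega> (\<lambda>x f. dp g x \<odot>\<^bsub>dual C\<^esub> f) = g"
proof (rule dual_ext)
 show "sw (dual C) \<Omega> (\<lambda>x f. dp g x \<odot>\<^bsub>dual C\<^esub> f) \<in>. dual C"
  by (rule lin|assumption)+
 fix c assume c [lin]: "c \<in>. C"
 have "dp (sw (dual C) \<Omega> (\<lambda>x f. dp g x \<odot>\<^bsub>dual C\<^esub> f)) c =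
   sw (scalars K) \<Omega> (\<lambda>x f. dp (dp g x \<odot>\<^bsub>dual C\<^esub> f) c)"
  by (rule sw_hom[where g="\<lambda>f. dp f c"]) (rule lin|assumption)+
 also have "... = sw (scalars K) \<Omega> (\<lambda>x f. dp g (dp f c \<odot>\<^bsub>C\<^esub> x))"
  by (rule sw_cong[OF C dual_module[OF C] coev_closed])
   (simp add: dp_smult dp_smult_right C c assms dp_closed[of _ C] m_comm)
 also have "... = dp g (sw C \<Omega> (\<lambda>x f. dp f c \<odot>\<^bsub>C\<^esub> x))"
  by (rule sw_hom[where g="dp g", symmetric]) (rule lin|assumption)+
 also have "... = dp g c" by (simp add: coev c)
 finally show "dp (sw (dual C) \<Omega> (\<lambda>x f. dp g x \<odot>\<^bsub>dual C\<^esub> f)) c = dp g c" .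
qed fact

lemma coev_pure_dual:
 assumes [lin]: "module K W" and X: "X \<in>. tens W (dual C)"
 shows "sw (tens W (dual C)) \<Omega> (\<lambda>x f. pure K W (dual C) (evl W x X) f) = X"
proof (rule tensor_ext[OF _ _ X, where U="tens W (dual C)"])
 note [lin] = bil_closed[OF evl_bil] lin_bil_left[OF evl_bil] lin_bil_right[OF evl_bil]
 show "lin (tens W (dual C)) (tens W (dual C))
   (\<lambda>X. sw (tens W (dual C)) \<Omega> (\<lambda>x f. pure K W (dual C) (evl W x X) f))"
  by (rule lin|assumption)+
 fix w g assume wg [lin]: "w \<in>. W" "g \<in>. dual C"
 have "sw (tens W (dual C)) \<Omega> (\<lambda>x f. pure K W (dual C) (evl W x (pure K W (dual C) w g)) f) =
   sw (tens W (dual C)) \<Omega> (\<lambda>x f. pure K W (dual C) w (dp g x \<odot>\<^bsub>dual C\<^esub> f))"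
  by (rule sw_cong[OF C dual_module[OF C] coev_closed])
   (simp add: evl_pure assms C wg dp_closed[of _ C] pure_smult_left pure_smult_right dual_module)
 also have "... = pure K W (dual C) w (sw (dual C) \<Omega> (\<lambda>x f. dp g x \<odot>\<^bsub>dual C\<^esub> f))"
  by (rule sw_hom[where g="pure K W (dual C) w", symmetric]) (rule lin|assumption)+
 finally show "sw (tens W (dual C)) \<Omega> (\<lambda>x f. pure K W (dual C) (evl W x (pure K W (dual C) w g)) f) =
   pure K W (dual C) w g" by (simp add: coev_dual wg)
qed (rule lin|assumption)+

text \<open>
 Expanding the second factor in dual bases recovers a tensor from its values, both in \<open>W \<otimes> C\<^sup>*\<close>
 and, by \<open>recovers_con\<close>, in \<open>W \<otimes> C\<close>.
\<close>

lemma recovers_evl: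
 assumes W: "module K W"
 shows "recovers C (dual C) \<Omega> (tens W (dual C)) W (evl W) (pure K W (dual C))"
 using evl_bil[OF W C] pure_bil[OF W dual_module[OF C]] coev_pure_dual[OF W]
 by (simp add: recovers_def C W dual_module tensor_module coev_closed)

lemma coev_pure:
 assumes [lin]: "module K W" and Z: "Z \<in>. tens W C"
 shows "sw (tens W C) \<Omega> (\<lambda>x f. pure K W C (con W f Z) x) = Z"
proof (rule tensor_ext[OF _ _ Z, where U="tens W C"])
 note [lin] = bil_closed[OF con_bil] lin_bil_left[OF con_bil] lin_bil_right[OF con_bil]
 show "lin (tens W C) (tens W C) (\<lambda>Z. sw (tens W C) \<Omega> (\<lambda>x f. pure K W C (con W f Z) x))"
  by (rule lin|assumption)+
 fix w c assume wc [lin]: "w \<in>. W" "c \<in>. C"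
 have "sw (tens W C) \<Omega> (\<lambda>x f. pure K W C (con W f (pure K W C w c)) x) =
   sw (tens W C) \<Omega> (\<lambda>x f. pure K W C w (dp f c \<odot>\<^bsub>C\<^esub> x))"
  by (rule sw_cong[OF C dual_module[OF C] coev_closed])
   (simp add: con_pure assms C wc dp_closed[of _ C] pure_smult_left pure_smult_right)
 also have "... = pure K W C w (sw C \<Omega> (\<lambda>x f. dp f c \<odot>\<^bsub>C\<^esub> x))"
  by (rule sw_hom[where g="pure K W C w", symmetric]) (rule lin|assumption)+
 finally show "sw (tens W C) \<Omega> (\<lambda>x f. pure K W C (con W f (pure K W C w c)) x) = pure K W C w c"
  by (simp add: coev wc)
qed (rule lin|assumption)+

lemma recovers_con:
 assumes W [lin]: "module K W"
 shows "recovers (dual C) C (sw (tens (dual C) C) \<Omega> (\<lambda>x f. pure K (dual C) C f x))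
  (tens W C) W (con W) (pure K W C)"
proof -
 let ?\<Omega> = "sw (tens (dual C) C) \<Omega> (\<lambda>x f. pure K (dual C) C f x)"
 note [lin] = bil_closed[OF con_bil] lin_bil_left[OF con_bil] lin_bil_right[OF con_bil]
 have "?\<Omega> \<in>. tens (dual C) C" by (rule lin|assumption)+
 moreover have "sw (tens W C) ?\<Omega> (\<lambda>f x. pure K W C (con W f Z) x) = Z"
  if [lin]: "Z \<in>. tens W C" for Z
 proof -
  let ?g = "\<lambda>Y. sw (tens W C) Y (\<lambda>f x. pure K W C (con W f Z) x)"
  have "?g ?\<Omega> = sw (tens W C) \<Omega> (\<lambda>x f. ?g (pure K (dual C) C f x))"
   by (rule sw_hom[where g="?g"]) (rule lin|assumption)+
  also have "... = sw (tens W C) \<Omega> (\<lambda>x f. pure K W C (con W f Z) x)"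
  proof (rule sw_cong[OF C dual_module[OF C] coev_closed])
   fix x f assume [lin]: "x \<in>. C" "f \<in>. dual C"
   show "?g (pure K (dual C) C f x) = pure K W C (con W f Z) x"
    by (rule sw_pureI) (rule lin|assumption)+
  qed
  also have "... = Z" by (rule coev_pure) fact+
  finally show ?thesis .
 qed
 ultimately show ?thesis
  using con_bil[OF W C] pure_bil[OF W C]
  by (simp add: recovers_def C W dual_module tensor_module)
qed

end

section \<open>Untwisting\<close>

definition tril where
 "tril V W X U t \<longleftrightarrow>
   (\<forall>x\<in>carrier V. \<forall>y\<in>carrier W. lin X U (t x y)) \<and>
   (\<forall>x\<in>carrier V. \<forall>z\<in>carrier X. lin W U (\<lambda>y. t x y z)) \<and>
   (\<forall>y\<in>carrier W. \<forall>z\<in>carrier X. lin V U (\<lambda>x. t x y z))"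

lemma trilI:
 assumes "\<And>x y. x \<in>. V \<Longrightarrow> y \<in>. W \<Longrightarrow> lin X U (t x y)"
  "\<And>x z. x \<in>. V \<Longrightarrow> z \<in>. X \<Longrightarrow> lin W U (\<lambda>y. t x y z)"
  "\<And>y z. y \<in>. W \<Longrightarrow> z \<in>. X \<Longrightarrow> lin V U (\<lambda>x. t x y z)"
 shows "tril V W X U t"
 using assms by (simp add: tril_def)

lemma tril_multilin:
 assumes "tril V W X U t"
 shows "x \<in>. V \<Longrightarrow> y \<in>. W \<Longrightarrow> z \<in>. X \<Longrightarrow> t x y z \<in>. U"
  "lin T V f \<Longrightarrow> y \<in>. W \<Longrightarrow> z \<in>. X \<Longrightarrow> lin T U (\<lambda>s. t (f s) y z)"
  "x \<in>. V \<Longrightarrow> lin T W g \<Longrightarrow> z \<in>. X \<Longrightarrow> lin T U (\<lambda>s. t x (g s) z)"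
  "x \<in>. V \<Longrightarrow> y \<in>. W \<Longrightarrow> lin T X h \<Longrightarrow> lin T U (\<lambda>s. t x y (h s))"
proof -
 assume "x \<in>. V" "y \<in>. W" "z \<in>. X"
 then show "t x y z \<in>. U" using assms lin_closed[of X U "t x y" z] by (simp add: tril_def)
next
 assume "lin T V f" "y \<in>. W" "z \<in>. X"
 then show "lin T U (\<lambda>s. t (f s) y z)" using assms lin_comp[of V U "\<lambda>x. t x y z" T f] by (simp add: tril_def)
next
 assume "x \<in>. V" "lin T W g" "z \<in>. X"
 then show "lin T U (\<lambda>s. t x (g s) z)" using assms lin_comp[of W U "\<lambda>y. t x y z" T g] by (simp add: tril_def)
next
 assume "x \<in>. V" "y \<in>. W" "lin T X h"
 then show "lin T U (\<lambda>s. t x y (h s))" using assms lin_comp[of X U "t x y" T h] by (simp add: tril_def)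
qed

lemma bil_multilin:
 assumes "bil V W U t"
 shows "x \<in>. V \<Longrightarrow> y \<in>. W \<Longrightarrow> t x y \<in>. U"
  "lin T V f \<Longrightarrow> y \<in>. W \<Longrightarrow> lin T U (\<lambda>s. t (f s) y)"
  "x \<in>. V \<Longrightarrow> lin T W g \<Longrightarrow> lin T U (\<lambda>s. t x (g s))"
 using bil_closed[OF assms] lin_bil_left[OF assms] lin_bil_right[OF assms] by auto

lemma lin_multilin:
 assumes "lin V W f"
 shows "x \<in>. V \<Longrightarrow> f x \<in>. W" "lin T V g \<Longrightarrow> lin T W (\<lambda>s. f (g s))"
 using lin_closed[OF assms] lin_comp[OF assms] by auto

lemmas [lin] = bilI trilI

text \<open>
 The spaces with bijective structure map; the definitions \<open>halg\<close>, \<open>hcomod\<close>, \<open>hcoalg\<close>, \<open>hmodule\<close> and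
 \<open>hbialg\<close> below combine a Hom-structure with this bijectivity.
\<close>

definition hs :: "('k,'v,'m) hom_space_scheme \<Rightarrow> bool" where
 "hs V \<longleftrightarrow> hom_vector_space K V \<and> bijective_alpha V"

lemma hs_module: "hs V \<Longrightarrow> module K V"
 by (simp add: hs_def hom_vector_space_def)

lemma hs_alpha: "hs V \<Longrightarrow> lin V V (alpha V)"
 by (simp add: hs_def hom_vector_space_def)

lemma hs_bij: "hs V \<Longrightarrow> bij_betw (alpha V) (carrier V) (carrier V)"
 by (simp add: hs_def bijective_alpha_def)

lemma alpha_inv_alpha: "hs V \<Longrightarrow> x \<in>. V \<Longrightarrow> alpha_inv V (alpha V x) = x"
 unfolding alpha_inv_def by (rule bij_betw_inv_into_left[OF hs_bij])

lemma alpha_alpha_inv: "hs V \<Longrightarrow> x \<in>. V \<Longrightarrow> alpha V (alpha_inv V x) = x"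
 unfolding alpha_inv_def by (rule bij_betw_inv_into_right[OF hs_bij])

lemma alpha_closed: "x \<in>. V \<Longrightarrow> hs V \<Longrightarrow> alpha V x \<in>. V"
 by (rule lin_closed[OF hs_alpha])

lemma alpha_inv_closed: "x \<in>. V \<Longrightarrow> hs V \<Longrightarrow> alpha_inv V x \<in>. V"
 using hs_bij[of V] unfolding alpha_inv_def bij_betw_def by (metis inv_into_into)

lemma alpha_inj: "hs V \<Longrightarrow> x \<in>. V \<Longrightarrow> y \<in>. V \<Longrightarrow> alpha V x = alpha V y \<longleftrightarrow> x = y"
 using alpha_inv_alpha by metis

lemma alpha_inv_eqI: "hs V \<Longrightarrow> y \<in>. V \<Longrightarrow> alpha V y = x \<Longrightarrow> alpha_inv V x = y"
 by (drule alpha_inv_alpha) auto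

lemma hs_alpha_inv:
 assumes V: "hs V" shows "lin V V (alpha_inv V)"
proof (rule linI)
 interpret V: module K V by (rule hs_module[OF V])
 note cl = alpha_closed[OF _ V] alpha_inv_closed[OF _ V]
 fix x assume x: "x \<in>. V"
 show "alpha_inv V x \<in>. V" by (rule cl(2)[OF x])
 show "alpha_inv V (x \<oplus>\<^bsub>V\<^esub> y) = alpha_inv V x \<oplus>\<^bsub>V\<^esub> alpha_inv V y" if "y \<in>. V" for y
  using x that by (intro alpha_inv_eqI[OF V]) (simp_all add: cl lin_add[OF hs_alpha[OF V]] alpha_alpha_inv[OF V])
 show "alpha_inv V (r \<odot>\<^bsub>V\<^esub> x) = r \<odot>\<^bsub>V\<^esub> alpha_inv V x" if "r \<in>. K" for r
  using x that by (intro alpha_inv_eqI[OF V]) (simp_all add: cl lin_smult[OF hs_alpha[OF V]] alpha_alpha_inv[OF V])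
qed

lemma lin_alpha: "lin T V f \<Longrightarrow> hs V \<Longrightarrow> lin T V (\<lambda>t. alpha V (f t))"
 by (rule lin_comp[OF hs_alpha])

lemma lin_alpha_inv: "lin T V f \<Longrightarrow> hs V \<Longrightarrow> lin T V (\<lambda>t. alpha_inv V (f t))"
 by (rule lin_comp[OF hs_alpha_inv])

lemmas [lin] = alpha_closed alpha_inv_closed lin_alpha lin_alpha_inv

lemmas hs_simps = alpha_closed alpha_inv_closed alpha_inv_alpha alpha_alpha_inv

text \<open>The untwisted product, associative by \<open>umult_assoc\<close> and unital by \<open>umult_one\<close>.\<close>

definition umult :: "('k,'v,'m) hom_space_scheme \<Rightarrow> 'v \<Rightarrow> 'v \<Rightarrow> 'v" where
 "umult A a b = alpha_inv A (a \<otimes>\<^bsub>A\<^esub> b)"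

definition halg :: "('k,'v,'m) hom_space_scheme \<Rightarrow> bool" where
 "halg A \<longleftrightarrow> hom_algebra K A \<and> bijective_alpha A"

lemma halg_hs: "halg A \<Longrightarrow> hs A"
 by (simp add: halg_def hs_def hom_algebra_def)

lemma halg_mult: "halg A \<Longrightarrow> bil A A A (mult A)"
 by (simp add: halg_def hom_algebra_def)

lemma halg_one: "halg A \<Longrightarrow> one A \<in>. A"
 by (simp add: halg_def hom_algebra_def)

lemma halg_alpha_mult:
 "halg A \<Longrightarrow> a \<in>. A \<Longrightarrow> b \<in>. A \<Longrightarrow> alpha A (a \<otimes>\<^bsub>A\<^esub> b) = alpha A a \<otimes>\<^bsub>A\<^esub> alpha A b"
 by (simp add: halg_def hom_algebra_def)

lemma halg_alpha_one: "halg A \<Longrightarrow> alpha A (one A) = one A"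
 by (simp add: halg_def hom_algebra_def)

lemma halg_mult_multilin:
 "a \<in>. A \<Longrightarrow> b \<in>. A \<Longrightarrow> halg A \<Longrightarrow> a \<otimes>\<^bsub>A\<^esub> b \<in>. A"
 "lin T A f \<Longrightarrow> b \<in>. A \<Longrightarrow> halg A \<Longrightarrow> lin T A (\<lambda>t. f t \<otimes>\<^bsub>A\<^esub> b)"
 "a \<in>. A \<Longrightarrow> lin T A g \<Longrightarrow> halg A \<Longrightarrow> lin T A (\<lambda>t. a \<otimes>\<^bsub>A\<^esub> g t)"
 by (rule bil_multilin(1)[OF halg_mult] bil_multilin(2)[OF halg_mult] bil_multilin(3)[OF halg_mult]; assumption)+

lemma halg_inv_mult:
 "halg A \<Longrightarrow> a \<in>. A \<Longrightarrow> b \<in>. A \<Longrightarrow>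
  alpha_inv A (a \<otimes>\<^bsub>A\<^esub> b) = alpha_inv A a \<otimes>\<^bsub>A\<^esub> alpha_inv A b"
 by (rule alpha_inv_eqI) (simp_all add: halg_hs hs_simps halg_mult_multilin halg_alpha_mult)

lemma halg_inv_one: "halg A \<Longrightarrow> alpha_inv A (one A) = one A"
 by (rule alpha_inv_eqI) (simp_all add: halg_hs halg_one halg_alpha_one)

lemma umult_multilin:
 "a \<in>. A \<Longrightarrow> b \<in>. A \<Longrightarrow> halg A \<Longrightarrow> umult A a b \<in>. A"
 "lin T A f \<Longrightarrow> b \<in>. A \<Longrightarrow> halg A \<Longrightarrow> lin T A (\<lambda>t. umult A (f t) b)"
 "a \<in>. A \<Longrightarrow> lin T A g \<Longrightarrow> halg A \<Longrightarrow> lin T A (\<lambda>t. umult A a (g t))"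
 unfolding umult_def by (rule lin halg_mult_multilin halg_hs | assumption)+

lemma alpha_umult: "halg A \<Longrightarrow> a \<in>. A \<Longrightarrow> b \<in>. A \<Longrightarrow> alpha A (umult A a b) = a \<otimes>\<^bsub>A\<^esub> b"
 by (simp add: umult_def hs_simps halg_hs halg_mult_multilin)

lemma alpha_umult_distrib:
 "halg A \<Longrightarrow> a \<in>. A \<Longrightarrow> b \<in>. A \<Longrightarrow> alpha A (umult A a b) = umult A (alpha A a) (alpha A b)"
 by (simp add: umult_def halg_inv_mult hs_simps halg_hs halg_alpha_mult)

lemma umult_one: "halg A \<Longrightarrow> a \<in>. A \<Longrightarrow> umult A (one A) a = a"
 "halg A \<Longrightarrow> a \<in>. A \<Longrightarrow> umult A a (one A) = a"
proof -
 assume A: "halg A" and a: "a \<in>. A"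
 then have "one A \<otimes>\<^bsub>A\<^esub> a = alpha A a \<and> a \<otimes>\<^bsub>A\<^esub> one A = alpha A a" by (simp add: halg_def hom_algebra_def)
 with A a show "umult A (one A) a = a" "umult A a (one A) = a"
  by (simp_all add: umult_def alpha_inv_alpha halg_hs)
qed

lemma umult_assoc:
 assumes A: "halg A" and abc: "a \<in>. A" "b \<in>. A" "c \<in>. A"
 shows "umult A (umult A a b) c = umult A a (umult A b c)"
proof -
 have assoc: "alpha A a \<otimes>\<^bsub>A\<^esub> (b \<otimes>\<^bsub>A\<^esub> c) = (a \<otimes>\<^bsub>A\<^esub> b) \<otimes>\<^bsub>A\<^esub> alpha A c"
  using A abc by (simp add: halg_def hom_algebra_def)
 note simps = halg_hs[OF A] hs_simps halg_mult_multilin A abc umult_multilin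
 have "alpha A (alpha A (umult A (umult A a b) c)) = (a \<otimes>\<^bsub>A\<^esub> b) \<otimes>\<^bsub>A\<^esub> alpha A c"
  by (simp add: simps alpha_umult halg_alpha_mult)
 also have "... = alpha A (alpha A (umult A a (umult A b c)))"
  by (simp add: simps alpha_umult halg_alpha_mult assoc)
 finally show ?thesis by (simp add: alpha_inj simps)
qed

text \<open>
 A Hom-algebra is the twist of an associative algebra by an automorphism, so it suffices to check
 the axioms of the untwisted product.
\<close>

lemma hom_algebraI:
 assumes V: "hs B" and one: "one B \<in>. B" and bil: "bil B B B (mult B)"
  and alpha: "\<And>x y. x \<in>. B \<Longrightarrow> y \<in>. B \<Longrightarrow> alpha B (umult B x y) = umult B (alpha B x) (alpha B y)"
  and alpha_one: "alpha B (one B) = one B"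
  and unit: "\<And>x. x \<in>. B \<Longrightarrow> umult B (one B) x = x" "\<And>x. x \<in>. B \<Longrightarrow> umult B x (one B) = x"
  and assoc: "\<And>x y z. x \<in>. B \<Longrightarrow> y \<in>. B \<Longrightarrow> z \<in>. B \<Longrightarrow>
   umult B (umult B x y) z = umult B x (umult B y z)"
 shows "hom_algebra K B"
proof -
 have m: "x \<otimes>\<^bsub>B\<^esub> y \<in>. B" if "x \<in>. B" "y \<in>. B" for x y
  by (rule bil_closed[OF bil that])
 have um: "umult B x y \<in>. B" if "x \<in>. B" "y \<in>. B" for x y
  using that by (simp add: umult_def hs_simps V m)
 have twist: "x \<otimes>\<^bsub>B\<^esub> y = alpha B (umult B x y)" if "x \<in>. B" "y \<in>. B" for x y
  using that by (simp add: umult_def hs_simps V m)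
 have "hom_vector_space K B" using V by (simp add: hs_def)
 then show ?thesis
  unfolding hom_algebra_def
  using one bil alpha_one by (auto simp: twist unit hs_simps V um alpha assoc)
qed

text \<open>
 The untwisted coaction, and with \<open>\<rho> = \<Delta>\<close> the untwisted coproduct. It is counital and
 coassociative without structure maps (\<open>ucoact_counit\<close>, \<open>ucoact_coassoc\<close>).
\<close>

definition ucoact :: "('k,'v,'m) hom_space_scheme \<Rightarrow> ('v \<Rightarrow> ('v \<times> 'c) list set) \<Rightarrow> 'v \<Rightarrow> ('v \<times> 'c) list set" where
 "ucoact M \<rho> m = \<rho> (alpha_inv M m)"

definition hcomod where
 "hcomod C M \<rho> \<longleftrightarrow> right_hom_comodule K C M \<rho> \<and> bijective_alpha M \<and> hs C \<and>
   linear_map K C (tens C C) (comult C) \<and> linear_map K C (scalars K) (counit C)"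

definition hcoalg :: "('k,'v,'m) hom_bialg_scheme \<Rightarrow> bool" where
 "hcoalg C \<longleftrightarrow> hom_coalgebra K C \<and> bijective_alpha C"

lemma hcoalg_hs: "hcoalg C \<Longrightarrow> hs C"
 by (simp add: hcoalg_def hs_def hom_coalgebra_def Let_def)

lemma hcoalg_lin:
 "hcoalg C \<Longrightarrow> lin C (tens C C) (comult C)" "hcoalg C \<Longrightarrow> lin C (scalars K) (counit C)"
 by (simp_all add: hcoalg_def hom_coalgebra_def Let_def)

lemma hcoalg_hcomod: "hcoalg C \<Longrightarrow> hcomod C C (comult C)"
 by (simp add: hcomod_def right_hom_comodule_def hcoalg_hs hcoalg_lin)
  (simp add: hcoalg_def hom_coalgebra_def Let_def)

lemma hcomod_hs: "hcomod C M \<rho> \<Longrightarrow> hs M" "hcomod C M \<rho> \<Longrightarrow> hs C"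
 by (simp_all add: hcomod_def hs_def right_hom_comodule_def Let_def)

lemma hcomod_modules: "hcomod C M \<rho> \<Longrightarrow> module K M" "hcomod C M \<rho> \<Longrightarrow> module K C"
 by (simp_all add: hcomod_hs hs_module)

lemma hcomod_coact: "hcomod C M \<rho> \<Longrightarrow> lin M (tens M C) \<rho>"
 by (simp add: hcomod_def right_hom_comodule_def Let_def)

lemma hcomod_coalg: "hcomod C M \<rho> \<Longrightarrow> lin C (tens C C) (comult C)" "hcomod C M \<rho> \<Longrightarrow> lin C (scalars K) (counit C)"
 by (simp_all add: hcomod_def)

text \<open>
 The comodule axioms are equations between tensors. Here and in the following lemmas they are
 applied to an arbitrary multilinear map \<open>t\<close>, which is the form in which nested sums are rewritten.
\<close>

lemma coact_alpha:
 assumes cm: "hcomod C M \<rho>" and m: "m \<in>. M" and t: "bil M C U t" and U: "module K U"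
 shows "sw U (\<rho> (alpha M m)) t = sw U (\<rho> m) (\<lambda>x c. t (alpha M x) (alpha C c))"
proof -
 note [lin] = hcomod_hs[OF cm] hcomod_modules[OF cm] lin_multilin[OF hcomod_coact[OF cm]] m U bil_multilin[OF t]
 have eq: "\<rho> (alpha M m) = sw (tens M C) (\<rho> m) (\<lambda>x c. pure K M C (alpha M x) (alpha C c))"
  using cm m by (simp add: hcomod_def right_hom_comodule_def Let_def)
 have "sw U (\<rho> (alpha M m)) t =
   sw U (\<rho> m) (\<lambda>x c. sw U (pure K M C (alpha M x) (alpha C c)) t)"
  unfolding eq by (rule sw_hom[where g="\<lambda>Z. sw U Z t"]) (rule lin|assumption)+
 also have "... = sw U (\<rho> m) (\<lambda>x c. t (alpha M x) (alpha C c))"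
 proof (rule sw_cong, (rule lin|assumption)+, goal_cases)
  case [lin]: (1 x c)
  show ?case
   by (rule sw_pureI) (rule lin|assumption)+
 qed
 finally show ?thesis .
qed

lemma coact_alpha_inv:
 assumes cm: "hcomod C M \<rho>" and m: "m \<in>. M" and t: "bil M C U t" and U: "module K U"
 shows "sw U (\<rho> (alpha_inv M m)) t = sw U (\<rho> m) (\<lambda>x c. t (alpha_inv M x) (alpha_inv C c))"
proof -
 note hs = hcomod_hs[OF cm]
 note [lin] = hs hcomod_modules[OF cm] lin_multilin[OF hcomod_coact[OF cm]] m U bil_multilin[OF t]
 have m': "alpha_inv M m \<in>. M" by (rule lin)+
 have "sw U (\<rho> m) (\<lambda>x c. t (alpha_inv M x) (alpha_inv C c)) =
   sw U (\<rho> (alpha_inv M m)) (\<lambda>x c. t (alpha_inv M (alpha M x)) (alpha_inv C (alpha C c)))"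
 proof -
  have "bil M C U (\<lambda>x c. t (alpha_inv M x) (alpha_inv C c))" by (rule lin|assumption)+
  from coact_alpha[OF cm m' this U] show ?thesis by (simp add: alpha_alpha_inv hs m)
 qed
 also have "... = sw U (\<rho> (alpha_inv M m)) t"
  by (rule sw_cong) (rule lin | assumption | simp add: alpha_inv_alpha hs)+
 finally show ?thesis by simp
qed

lemma coact_coassoc:
 assumes cm: "hcomod C M \<rho>" and m: "m \<in>. M" and t: "tril M C C U t" and U: "module K U"
 shows "sw U (\<rho> m) (\<lambda>m0 m1. sw U (\<rho> m0) (\<lambda>m00 m01. t m00 m01 (alpha C m1))) =
  sw U (\<rho> m) (\<lambda>m0 m1. sw U (comult C m1) (\<lambda>m11 m12. t (alpha M m0) m11 m12))"
proof -
 note [lin] = hcomod_hs[OF cm] hcomod_modules[OF cm] lin_multilin[OF hcomod_coact[OF cm]]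
  lin_multilin[OF hcomod_coalg(1)[OF cm]] m U tril_multilin[OF t]
 let ?g = "\<lambda>Z. sw U Z (\<lambda>x Y. sw U Y (t x))"
 let ?T = "tens M (tens C C)"
 have g: "lin ?T U ?g" by (rule lin|assumption)+
 have gp: "?g (pure K M (tens C C) x Y) = sw U Y (t x)"
  if [lin]: "x \<in>. M" "Y \<in>. tens C C" for x Y
  by (rule sw_pureI) (rule lin|assumption)+
 have gpp: "?g (pure K M (tens C C) x (pure K C C c d)) = t x c d"
  if [lin]: "x \<in>. M" "c \<in>. C" "d \<in>. C" for x c d
 proof -
  have "sw U (pure K C C c d) (t x) = t x c d"
   by (rule sw_pureI) (rule lin|assumption)+
  then show ?thesis by (subst gp) (rule lin|assumption)+
 qed
 have eq: "sw ?T (\<rho> m) (\<lambda>m0 m1. sw ?T (\<rho> m0)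
      (\<lambda>m00 m01. pure K M (tens C C) m00 (pure K C C m01 (alpha C m1)))) =
    sw ?T (\<rho> m) (\<lambda>m0 m1. pure K M (tens C C) (alpha M m0) (comult C m1))"
  using cm m by (simp add: hcomod_def right_hom_comodule_def Let_def)
 have "?g (sw ?T (\<rho> m) (\<lambda>m0 m1. sw ?T (\<rho> m0)
      (\<lambda>m00 m01. pure K M (tens C C) m00 (pure K C C m01 (alpha C m1))))) =
   sw U (\<rho> m) (\<lambda>m0 m1. ?g (sw ?T (\<rho> m0)
      (\<lambda>m00 m01. pure K M (tens C C) m00 (pure K C C m01 (alpha C m1)))))"
  by (rule sw_hom[where g="?g"]) (rule lin|assumption)+
 also have "... = sw U (\<rho> m) (\<lambda>m0 m1. sw U (\<rho> m0) (\<lambda>m00 m01. t m00 m01 (alpha C m1)))"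
 proof (rule sw_cong, (rule lin|assumption)+, goal_cases)
  case [lin]: (1 m0 m1)
  have "?g (sw ?T (\<rho> m0) (\<lambda>m00 m01. pure K M (tens C C) m00 (pure K C C m01 (alpha C m1)))) =
    sw U (\<rho> m0) (\<lambda>m00 m01. ?g (pure K M (tens C C) m00 (pure K C C m01 (alpha C m1))))"
   by (rule sw_hom[where g="?g"]) (rule lin|assumption)+
  also have "... = sw U (\<rho> m0) (\<lambda>m00 m01. t m00 m01 (alpha C m1))"
   by (rule sw_cong) (rule gpp lin|assumption)+
  finally show ?case .
 qed
 finally have 1: "?g (sw ?T (\<rho> m) (\<lambda>m0 m1. sw ?T (\<rho> m0)
      (\<lambda>m00 m01. pure K M (tens C C) m00 (pure K C C m01 (alpha C m1))))) =
   sw U (\<rho> m) (\<lambda>m0 m1. sw U (\<rho> m0) (\<lambda>m00 m01. t m00 m01 (alpha C m1)))" .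
 have "?g (sw ?T (\<rho> m) (\<lambda>m0 m1. pure K M (tens C C) (alpha M m0) (comult C m1))) =
   sw U (\<rho> m) (\<lambda>m0 m1. ?g (pure K M (tens C C) (alpha M m0) (comult C m1)))"
  by (rule sw_hom[where g="?g"]) (rule lin|assumption)+
 also have "... = sw U (\<rho> m) (\<lambda>m0 m1. sw U (comult C m1) (t (alpha M m0)))"
  by (rule sw_cong) (rule gp lin|assumption)+
 finally show ?thesis using 1 eq by simp
qed

lemma coact_counit:
 assumes cm: "hcomod C M \<rho>" and m: "m \<in>. M"
 shows "sw M (\<rho> m) (\<lambda>m0 m1. counit C m1 \<odot>\<^bsub>M\<^esub> m0) = alpha M m"
 using cm m by (simp add: hcomod_def right_hom_comodule_def Let_def)

lemma ucoact_multilin: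
 "m \<in>. M \<Longrightarrow> hcomod C M \<rho> \<Longrightarrow> ucoact M \<rho> m \<in>. tens M C"
 "lin T M f \<Longrightarrow> hcomod C M \<rho> \<Longrightarrow> lin T (tens M C) (\<lambda>t. ucoact M \<rho> (f t))"
proof -
 assume cm: "hcomod C M \<rho>"
 note [lin] = hcomod_hs[OF cm] lin_multilin[OF hcomod_coact[OF cm]]
 show "m \<in>. M \<Longrightarrow> ucoact M \<rho> m \<in>. tens M C"
  "lin T M f \<Longrightarrow> lin T (tens M C) (\<lambda>t. ucoact M \<rho> (f t))"
  unfolding ucoact_def by (rule lin|assumption)+
qed

lemma ucoact_alpha:
 assumes cm: "hcomod C M \<rho>" and m: "m \<in>. M" and t: "bil M C U t" and U: "module K U"
 shows "sw U (ucoact M \<rho> (alpha M m)) t = sw U (ucoact M \<rho> m) (\<lambda>x c. t (alpha M x) (alpha C c))"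
 using coact_alpha[OF cm alpha_inv_closed[OF m] t U] hcomod_hs[OF cm] m
 by (simp add: ucoact_def alpha_inv_alpha alpha_alpha_inv)

lemma coact_ucoact:
 assumes cm: "hcomod C M \<rho>" and m: "m \<in>. M" and t: "bil M C U t" and U: "module K U"
 shows "sw U (\<rho> m) t = sw U (ucoact M \<rho> m) (\<lambda>x c. t (alpha M x) (alpha C c))"
 using ucoact_alpha[OF assms] hcomod_hs[OF cm] m by (simp add: ucoact_def alpha_inv_alpha)

lemma ucoact_counit:
 assumes cm: "hcomod C M \<rho>" and m: "m \<in>. M"
 shows "sw M (ucoact M \<rho> m) (\<lambda>m0 m1. counit C m1 \<odot>\<^bsub>M\<^esub> m0) = m"
 unfolding ucoact_def using coact_counit[OF cm] hcomod_hs[OF cm] m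
 by (simp add: alpha_alpha_inv alpha_inv_closed)

lemma ucoact_coassoc:
 assumes cm: "hcomod C M \<rho>" and coalg: "hcomod C C (comult C)"
  and m: "m \<in>. M" and t: "tril M C C U t" and U: "module K U"
 shows "sw U (ucoact M \<rho> m) (\<lambda>m0 m1. sw U (ucoact M \<rho> m0) (\<lambda>m00 m01. t m00 m01 m1)) =
  sw U (ucoact M \<rho> m) (\<lambda>m0 m1. sw U (ucoact C (comult C) m1) (\<lambda>m11 m12. t m0 m11 m12))"
proof -
 note hs = hcomod_hs[OF cm]
 note [lin] = hs hcomod_modules[OF cm] lin_multilin[OF hcomod_coact[OF cm]]
  lin_multilin[OF hcomod_coalg(1)[OF cm]] m U tril_multilin[OF t]
 let ?t = "\<lambda>x c d. t (alpha_inv M x) (alpha_inv C c) (alpha_inv C d)"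
 have t': "tril M C C U ?t" by (rule lin|assumption)+
 have "sw U (ucoact M \<rho> m) (\<lambda>m0 m1. sw U (ucoact M \<rho> m0) (\<lambda>m00 m01. t m00 m01 m1)) =
   sw U (\<rho> (alpha_inv M m)) (\<lambda>m0 m1. sw U (\<rho> m0) (\<lambda>m00 m01. ?t m00 m01 (alpha C m1)))"
  unfolding ucoact_def
 proof (rule sw_cong, (rule lin|assumption)+, goal_cases)
  case [lin]: (1 m0 m1)
  show ?case
   unfolding alpha_inv_alpha[OF hs(2) \<open>m1 \<in>. C\<close>]
   by (rule coact_alpha_inv[OF cm]) (rule lin|assumption)+
 qed
 also have "... = sw U (\<rho> (alpha_inv M m)) (\<lambda>m0 m1. sw U (comult C m1) (\<lambda>m11 m12. ?t (alpha M m0) m11 m12))"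
  by (rule coact_coassoc[OF cm]) (rule t' lin|assumption)+
 also have "... = sw U (ucoact M \<rho> m) (\<lambda>m0 m1. sw U (ucoact C (comult C) m1) (\<lambda>m11 m12. t m0 m11 m12))"
  unfolding ucoact_def
 proof (rule sw_cong, (rule lin|assumption)+, goal_cases)
  case [lin]: (1 m0 m1)
  show ?case
   unfolding alpha_inv_alpha[OF hs(1) \<open>m0 \<in>. M\<close>]
   by (rule coact_alpha_inv[OF coalg, symmetric]) (rule lin|assumption)+
 qed
 finally show ?thesis .
qed

definition uact :: "('k,'v,'m) hom_space_scheme \<Rightarrow> ('a \<Rightarrow> 'v \<Rightarrow> 'v) \<Rightarrow> 'a \<Rightarrow> 'v \<Rightarrow> 'v" where
 "uact M ac a m = alpha_inv M (ac a m)"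

definition hmodule where
 "hmodule A M ac \<longleftrightarrow> left_hom_module K A M ac \<and> bijective_alpha M \<and> halg A"

lemma hmodule_hs: "hmodule A M ac \<Longrightarrow> hs M" "hmodule A M ac \<Longrightarrow> hs A" "hmodule A M ac \<Longrightarrow> halg A"
 by (simp_all add: hmodule_def hs_def left_hom_module_def halg_hs[unfolded hs_def])

lemma hmodule_act: "hmodule A M ac \<Longrightarrow> bil A M M ac"
 by (simp add: hmodule_def left_hom_module_def)

lemma hmodule_alpha:
 "hmodule A M ac \<Longrightarrow> a \<in>. A \<Longrightarrow> m \<in>. M \<Longrightarrow> alpha M (ac a m) = ac (alpha A a) (alpha M m)"
 by (simp add: hmodule_def left_hom_module_def)

lemma hmodule_assoc:
 "hmodule A M ac \<Longrightarrow> a \<in>. A \<Longrightarrow> b \<in>. A \<Longrightarrow> m \<in>. M \<Longrightarrow>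
  ac (alpha A a) (ac b m) = ac (a \<otimes>\<^bsub>A\<^esub> b) (alpha M m)"
 by (simp add: hmodule_def left_hom_module_def)

lemma hmodule_one: "hmodule A M ac \<Longrightarrow> m \<in>. M \<Longrightarrow> ac (one A) m = alpha M m"
 by (simp add: hmodule_def left_hom_module_def)

lemma uact_multilin:
 "a \<in>. A \<Longrightarrow> m \<in>. M \<Longrightarrow> hmodule A M ac \<Longrightarrow> uact M ac a m \<in>. M"
 "lin T A f \<Longrightarrow> m \<in>. M \<Longrightarrow> hmodule A M ac \<Longrightarrow> lin T M (\<lambda>t. uact M ac (f t) m)"
 "a \<in>. A \<Longrightarrow> lin T M g \<Longrightarrow> hmodule A M ac \<Longrightarrow> lin T M (\<lambda>t. uact M ac a (g t))"
proof -
 assume M: "hmodule A M ac"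
 note [lin] = hmodule_hs[OF M] bil_multilin[OF hmodule_act[OF M]]
 show "a \<in>. A \<Longrightarrow> m \<in>. M \<Longrightarrow> uact M ac a m \<in>. M"
  "lin T A f \<Longrightarrow> m \<in>. M \<Longrightarrow> lin T M (\<lambda>t. uact M ac (f t) m)"
  "a \<in>. A \<Longrightarrow> lin T M g \<Longrightarrow> lin T M (\<lambda>t. uact M ac a (g t))"
  unfolding uact_def by (rule lin|assumption)+
qed

lemma hmodule_inv:
 assumes M: "hmodule A M ac" and "a \<in>. A" "m \<in>. M"
 shows "alpha_inv M (ac a m) = ac (alpha_inv A a) (alpha_inv M m)"
 by (rule alpha_inv_eqI[OF hmodule_hs(1)[OF M]])
  (use assms hmodule_hs[OF M] in \<open>simp_all add: hs_simps bil_closed[OF hmodule_act[OF M]] hmodule_alpha[OF M]\<close>)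

lemma uact_alpha:
 assumes M: "hmodule A M ac" and "a \<in>. A" "m \<in>. M"
 shows "alpha M (uact M ac a m) = uact M ac (alpha A a) (alpha M m)"
 using assms hmodule_hs[OF M]
 by (simp add: uact_def hmodule_inv hs_simps hmodule_alpha bil_closed[OF hmodule_act[OF M]])

lemma uact_one:
 assumes M: "hmodule A M ac" and "m \<in>. M"
 shows "uact M ac (one A) m = m"
 using assms hmodule_hs[OF M] by (simp add: uact_def hmodule_one alpha_inv_alpha)

lemma uact_assoc:
 assumes M: "hmodule A M ac" and ab: "a \<in>. A" "b \<in>. A" and m: "m \<in>. M"
 shows "uact M ac a (uact M ac b m) = uact M ac (umult A a b) m"
proof -
 note hs = hmodule_hs[OF M]
 note cl = hs_simps hs ab m bil_closed[OF hmodule_act[OF M]] halg_mult_multilin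
 let ?a = "alpha_inv A a" and ?b = "alpha_inv A b" and ?m = "alpha_inv M m"
 have "uact M ac a (uact M ac b m) = alpha_inv M (ac (alpha A ?a) (ac ?b ?m))"
  by (simp add: uact_def cl hmodule_inv[OF M])
 also have "... = alpha_inv M (ac (?a \<otimes>\<^bsub>A\<^esub> ?b) m)"
  by (subst hmodule_assoc[OF M]) (simp_all add: cl)
 also have "... = uact M ac (umult A a b) m"
  by (simp add: uact_def umult_def halg_inv_mult cl)
 finally show ?thesis .
qed

lemma sw_sweedler_pure:
 assumes P: "P \<in>. tens V1 W1" and mods: "module K V1" "module K W1" "module K V" "module K W" "module K U"
  and f: "\<And>x y. x \<in>. V1 \<Longrightarrow> y \<in>. W1 \<Longrightarrow> f x y \<in>. V"
  and g: "\<And>x y. x \<in>. V1 \<Longrightarrow> y \<in>. W1 \<Longrightarrow> g x y \<in>. W"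
  and t: "bil V W U t"
 shows "sw U (sw (tens V W) P (\<lambda>x y. pure K V W (f x y) (g x y))) t =
  sw U P (\<lambda>x y. t (f x y) (g x y))"
proof -
 note [lin] = P mods f g bil_multilin[OF t]
 have "sw U (sw (tens V W) P (\<lambda>x y. pure K V W (f x y) (g x y))) t =
   sw U P (\<lambda>x y. sw U (pure K V W (f x y) (g x y)) t)"
  by (rule sw_hom[where g="\<lambda>Z. sw U Z t"]) (rule lin|assumption)+
 also have "... = sw U P (\<lambda>x y. t (f x y) (g x y))"
  by (rule sw_cong) (rule sw_pureI lin|assumption)+
 finally show ?thesis .
qed

lemma sw_double_pure:
 assumes P: "P \<in>. tens V1 W1" and Q: "Q \<in>. tens V2 W2"
  and mods: "module K V1" "module K W1" "module K V2" "module K W2" "module K V" "module K W" "module K U"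
  and f: "\<And>x y. x \<in>. V1 \<Longrightarrow> y \<in>. V2 \<Longrightarrow> f x y \<in>. V"
  and g: "\<And>x y. x \<in>. W1 \<Longrightarrow> y \<in>. W2 \<Longrightarrow> g x y \<in>. W"
  and t: "bil V W U t"
 shows "sw U (sw (tens V W) P (\<lambda>p1 p2. sw (tens V W) Q
   (\<lambda>q1 q2. pure K V W (f p1 q1) (g p2 q2)))) t =
  sw U P (\<lambda>p1 p2. sw U Q (\<lambda>q1 q2. t (f p1 q1) (g p2 q2)))"
proof -
 note [lin] = P Q mods f g bil_multilin[OF t]
 have "sw U (sw (tens V W) P (\<lambda>p1 p2. sw (tens V W) Q
   (\<lambda>q1 q2. pure K V W (f p1 q1) (g p2 q2)))) t =
   sw U P (\<lambda>p1 p2. sw U (sw (tens V W) Q (\<lambda>q1 q2. pure K V W (f p1 q1) (g p2 q2))) t)"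
  by (rule sw_hom[where g="\<lambda>Z. sw U Z t"]) (rule lin|assumption)+
 also have "... = sw U P (\<lambda>p1 p2. sw U Q (\<lambda>q1 q2. t (f p1 q1) (g p2 q2)))"
  by (rule sw_cong) (rule sw_sweedler_pure t lin|assumption)+
 finally show ?thesis .
qed

text \<open>
 An operation that commutes with coactions up to operations on the coefficients, such as a
 comultiplicative product, still does so after untwisting. This covers the coproduct of a product,
 the coaction on a product or on an action, and the coproduct of an action.
\<close>

lemma ucoact_op:
 assumes A: "hcomod P A \<rho>A" and B: "hcomod Q B \<rho>B" and V: "hcomod R V \<rho>V"
  and f: "bil A B V f" and g: "bil P Q R g"
  and f\<alpha>: "\<And>x y. x \<in>. A \<Longrightarrow> y \<in>. B \<Longrightarrow>
   alpha_inv V (f x y) = f (alpha_inv A x) (alpha_inv B y)"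
  and g\<alpha>: "\<And>x y. x \<in>. P \<Longrightarrow> y \<in>. Q \<Longrightarrow>
   alpha_inv R (g x y) = g (alpha_inv P x) (alpha_inv Q y)"
  and eq: "\<And>x y. x \<in>. A \<Longrightarrow> y \<in>. B \<Longrightarrow>
   \<rho>V (f x y) = sw (tens V R) (\<rho>A x) (\<lambda>a0 a1. sw (tens V R) (\<rho>B y)
    (\<lambda>b0 b1. pure K V R (f a0 b0) (g a1 b1)))"
  and a: "a \<in>. A" and b: "b \<in>. B" and t: "bil V R U t" and U: "module K U"
 shows "sw U (ucoact V \<rho>V (alpha_inv V (f a b))) t =
  sw U (ucoact A \<rho>A a) (\<lambda>a0 a1. sw U (ucoact B \<rho>B b)
   (\<lambda>b0 b1. t (alpha_inv V (f a0 b0)) (alpha_inv R (g a1 b1))))"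
proof -
 note hs = hcomod_hs[OF A] hcomod_hs[OF B] hcomod_hs[OF V]
 note [lin] = hs hcomod_modules[OF A] hcomod_modules[OF B] hcomod_modules[OF V]
  lin_multilin[OF hcomod_coact[OF A]] lin_multilin[OF hcomod_coact[OF B]]
  a b U bil_multilin[OF t] bil_multilin[OF f] bil_multilin[OF g]
 let ?a = "alpha_inv A a" and ?b = "alpha_inv B b"
 have cl: "?a \<in>. A" "?b \<in>. B" by (rule lin)+
 have "ucoact V \<rho>V (alpha_inv V (f a b)) = \<rho>V (f (alpha_inv A ?a) (alpha_inv B ?b))"
  by (simp add: ucoact_def f\<alpha> a b cl)
 also have "... = sw (tens V R) (\<rho>A (alpha_inv A ?a)) (\<lambda>a0 a1. sw (tens V R) (\<rho>B (alpha_inv B ?b))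
    (\<lambda>b0 b1. pure K V R (f a0 b0) (g a1 b1)))"
  by (rule eq) (rule lin)+
 finally have "sw U (ucoact V \<rho>V (alpha_inv V (f a b))) t =
   sw U (\<rho>A (alpha_inv A ?a)) (\<lambda>a0 a1. sw U (\<rho>B (alpha_inv B ?b)) (\<lambda>b0 b1. t (f a0 b0) (g a1 b1)))"
  by (simp only:) (rule sw_double_pure, (rule t lin|assumption)+)
 also have "... = sw U (\<rho>A ?a) (\<lambda>a0 a1. sw U (\<rho>B (alpha_inv B ?b))
   (\<lambda>b0 b1. t (f (alpha_inv A a0) b0) (g (alpha_inv P a1) b1)))"
  by (rule coact_alpha_inv[OF A]) (rule lin|assumption)+
 also have "... = sw U (\<rho>A ?a) (\<lambda>a0 a1. sw U (\<rho>B ?b)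
   (\<lambda>b0 b1. t (f (alpha_inv A a0) (alpha_inv B b0)) (g (alpha_inv P a1) (alpha_inv Q b1))))"
 proof (rule sw_cong, (rule lin|assumption)+, goal_cases)
  case [lin]: (1 a0 a1)
  show ?case
   by (rule coact_alpha_inv[OF B]) (rule lin|assumption)+
 qed
 also have "... = sw U (\<rho>A ?a) (\<lambda>a0 a1. sw U (\<rho>B ?b)
   (\<lambda>b0 b1. t (alpha_inv V (f a0 b0)) (alpha_inv R (g a1 b1))))"
 proof (rule sw_cong, (rule lin|assumption)+, goal_cases)
  case a01 [lin]: (1 a0 a1)
  show ?case
   by (rule sw_cong) ((rule lin|assumption)+, simp add: f\<alpha> g\<alpha> a01)
 qed
 finally show ?thesis by (simp add: ucoact_def)
qed

definition hbialg :: "('k,'v,'m) hom_bialg_scheme \<Rightarrow> bool" where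
 "hbialg B \<longleftrightarrow> hom_bialgebra K B \<and> bijective_alpha B"

lemma hbialg_parts: "hbialg B \<Longrightarrow> halg B" "hbialg B \<Longrightarrow> hcoalg B"
 by (simp_all add: hbialg_def hom_bialgebra_def halg_def hcoalg_def)

lemma hbialg_counit:
 "hbialg B \<Longrightarrow> a \<in>. B \<Longrightarrow> b \<in>. B \<Longrightarrow> counit B (a \<otimes>\<^bsub>B\<^esub> b) = counit B a \<otimes> counit B b"
 "hbialg B \<Longrightarrow> counit B (one B) = \<one>"
 by (simp_all add: hbialg_def hom_bialgebra_def)

lemma hcoalg_counit_alpha: "hcoalg C \<Longrightarrow> c \<in>. C \<Longrightarrow> counit C (alpha C c) = counit C c"
 by (simp add: hcoalg_def hom_coalgebra_def Let_def)

lemma hcoalg_counit_alpha_inv: "hcoalg C \<Longrightarrow> c \<in>. C \<Longrightarrow> counit C (alpha_inv C c) = counit C c"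
 using hcoalg_counit_alpha[of C "alpha_inv C c"] by (simp add: hcoalg_hs hs_simps)

lemma hcoalg_counit_left:
 assumes C: "hcoalg C" and c: "c \<in>. C"
 shows "sw C (ucoact C (comult C) c) (\<lambda>c1 c2. counit C c1 \<odot>\<^bsub>C\<^esub> c2) = c"
proof -
 have "alpha_inv C c \<in>. C" using C c by (simp add: alpha_inv_closed hcoalg_hs)
 then have "sw C (comult C (alpha_inv C c)) (\<lambda>c1 c2. counit C c1 \<odot>\<^bsub>C\<^esub> c2) = alpha C (alpha_inv C c)"
  using C by (simp add: hcoalg_def hom_coalgebra_def Let_def)
 then show ?thesis using C c by (simp add: ucoact_def alpha_alpha_inv hcoalg_hs)
qed

lemma hbialg_comult_mult:
 assumes B: "hbialg B" and ab: "a \<in>. B" "b \<in>. B" and t: "bil B B U t" and U: "module K U"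
 shows "sw U (comult B (a \<otimes>\<^bsub>B\<^esub> b)) t =
  sw U (comult B a) (\<lambda>a1 a2. sw U (comult B b) (\<lambda>b1 b2. t (a1 \<otimes>\<^bsub>B\<^esub> b1) (a2 \<otimes>\<^bsub>B\<^esub> b2)))"
proof -
 note alg = hbialg_parts(1)[OF B] and coalg = hbialg_parts(2)[OF B]
 note [lin] = alg coalg hs_module[OF halg_hs[OF alg]] lin_multilin[OF hcoalg_lin(1)[OF coalg]]
  halg_mult_multilin ab U
 have "comult B (a \<otimes>\<^bsub>B\<^esub> b) =
     sw (tens B B) (comult B a) (\<lambda>a1 a2. sw (tens B B) (comult B b)
      (\<lambda>b1 b2. pure K B B (a1 \<otimes>\<^bsub>B\<^esub> b1) (a2 \<otimes>\<^bsub>B\<^esub> b2)))"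
  using B ab by (simp add: hbialg_def hom_bialgebra_def)
 then show ?thesis by (simp only:) (rule sw_double_pure, (rule t lin|assumption)+)
qed

lemma hbialg_ucomult_umult:
 assumes B: "hbialg B" and ab: "a \<in>. B" "b \<in>. B" and t: "bil B B U t" and U: "module K U"
 shows "sw U (ucoact B (comult B) (umult B a b)) t =
  sw U (ucoact B (comult B) a) (\<lambda>a1 a2. sw U (ucoact B (comult B) b)
   (\<lambda>b1 b2. t (umult B a1 b1) (umult B a2 b2)))"
proof -
 note alg = hbialg_parts(1)[OF B]
 note cm = hcoalg_hcomod[OF hbialg_parts(2)[OF B]]
 show ?thesis
  unfolding umult_def
  by (rule ucoact_op[OF cm cm cm halg_mult[OF alg] halg_mult[OF alg]])
   (use B ab t U in \<open>simp_all add: halg_inv_mult alg hbialg_def hom_bialgebra_def\<close>)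
qed

end

section \<open>The entwining of a monoidal Doi-Hopf datum\<close>

locale monoidal_datum = ground K for K :: "'k ring" (structure) +
 fixes D :: "('k,'h,'a,'c) doi_hopf_datum"
 assumes datum: "monoidal_doi_hopf K D"
  and bij: "bijective_alpha (HH D)" "bijective_alpha (AA D)" "bijective_alpha (CC D)"
begin

abbreviation "H \<equiv> HH D"
abbreviation "A \<equiv> AA D"
abbreviation "C \<equiv> CC D"
abbreviation "\<rho>A \<equiv> A_coact D"
abbreviation "\<delta>A \<equiv> ucoact A (comult A)"
abbreviation "\<delta>C \<equiv> ucoact C (comult C)"
abbreviation "hact \<equiv> C_act D"

lemma A: "hbialg A" and C: "hbialg C" and H: "hbialg H"
 using datum bij
 by (simp_all add: monoidal_doi_hopf_def Let_def hbialg_def doi_hopf_def hom_hopf_algebra_def)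

lemmas alg [lin] = hbialg_parts(1)[OF A] hbialg_parts(1)[OF C] hbialg_parts(1)[OF H]
lemmas coalg [lin] = hbialg_parts(2)[OF A] hbialg_parts(2)[OF C] hbialg_parts(2)[OF H]
lemmas hs [lin] = alg[THEN halg_hs]
lemmas mods [lin] = hs[THEN hs_module]
lemmas comod [lin] = coalg[THEN hcoalg_hcomod]
lemmas [lin] = alg[THEN halg_one] halg_mult_multilin umult_multilin
 coalg(1)[THEN hcoalg_lin(1), THEN lin_multilin(1)] coalg(1)[THEN hcoalg_lin(1), THEN lin_multilin(2)]
 coalg(2)[THEN hcoalg_lin(1), THEN lin_multilin(1)] coalg(2)[THEN hcoalg_lin(1), THEN lin_multilin(2)]
 coalg(3)[THEN hcoalg_lin(1), THEN lin_multilin(1)] coalg(3)[THEN hcoalg_lin(1), THEN lin_multilin(2)]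
 coalg(1)[THEN hcoalg_lin(2), THEN lin_multilin(1), simplified] coalg(1)[THEN hcoalg_lin(2), THEN lin_multilin(2)]
 coalg(2)[THEN hcoalg_lin(2), THEN lin_multilin(1), simplified] coalg(2)[THEN hcoalg_lin(2), THEN lin_multilin(2)]
 coalg(3)[THEN hcoalg_lin(2), THEN lin_multilin(1), simplified] coalg(3)[THEN hcoalg_lin(2), THEN lin_multilin(2)]
 ucoact_multilin uact_multilin

lemma comodA [lin]: "hcomod H A \<rho>A"
 using datum bij coalg hs
 by (simp add: monoidal_doi_hopf_def Let_def doi_hopf_def right_comodule_algebra_def hcomod_def hcoalg_lin)

lemma actC [lin]: "hmodule H C hact"
 using datum bij alg
 by (simp add: monoidal_doi_hopf_def Let_def doi_hopf_def left_module_coalgebra_def hmodule_def)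

lemmas [lin] = lin_multilin[OF hcomod_coact[OF comodA]] bil_multilin[OF hmodule_act[OF actC]]

lemma coact_umult:
 assumes ab: "a \<in>. A" "b \<in>. A" and t: "bil A H U t" and U: "module K U"
 shows "sw U (ucoact A \<rho>A (umult A a b)) t =
  sw U (ucoact A \<rho>A a) (\<lambda>a0 a1. sw U (ucoact A \<rho>A b)
   (\<lambda>b0 b1. t (umult A a0 b0) (umult H a1 b1)))"
 unfolding umult_def
 by (rule ucoact_op[OF comodA comodA comodA halg_mult[OF alg(1)] halg_mult[OF alg(3)]])
  (use ab t U datum in \<open>simp_all add: halg_inv_mult alg monoidal_doi_hopf_def doi_hopf_def
    right_comodule_algebra_def Let_def\<close>)

lemma ucomult_uact:
 assumes hc: "h \<in>. H" "c \<in>. C" and t: "bil C C U t" and U: "module K U"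
 shows "sw U (\<delta>C (uact C hact h c)) t =
  sw U (ucoact H (comult H) h) (\<lambda>h1 h2. sw U (\<delta>C c)
   (\<lambda>c1 c2. t (uact C hact h1 c1) (uact C hact h2 c2)))"
 unfolding uact_def
 by (rule ucoact_op[OF comod(3) comod(2) comod(2) hmodule_act[OF actC] hmodule_act[OF actC]])
  (use hc t U datum in \<open>simp_all add: hmodule_inv[OF actC] monoidal_doi_hopf_def doi_hopf_def
    left_module_coalgebra_def Let_def\<close>)

text \<open>
 The entwining \<open>a\<^sub>(\<^sub>0\<^sub>) \<otimes> a\<^sub>(\<^sub>1\<^sub>) \<cdot> c\<close>, formed with the untwisted coaction and action. It satisfies the
 axioms of an ordinary entwining structure.
\<close>

definition ent :: "'a \<Rightarrow> 'c \<Rightarrow> ('a \<times> 'c) list set" where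
 "ent a c = sw (tens A C) (ucoact A \<rho>A a) (\<lambda>u h. pure K A C u (uact C hact h c))"

lemma ent_bil: "bil A C (tens A C) ent"
 unfolding ent_def by (rule lin|assumption)+

lemmas ent_multilin [lin] = bil_multilin[OF ent_bil]

lemma sw_ent:
 assumes ac [lin]: "a \<in>. A" "c \<in>. C" and t: "bil A C U t" and U [lin]: "module K U"
 shows "sw U (ent a c) t = sw U (ucoact A \<rho>A a) (\<lambda>u h. t u (uact C hact h c))"
 unfolding ent_def by (rule sw_sweedler_pure) (rule t lin|assumption)+

text \<open>
 Entwining a product is entwining its factors one after the other: \<open>H\<close> coacts multiplicatively
 on \<open>A\<close> and acts associatively on \<open>C\<close>.
\<close>

lemma ent_mult:
 assumes abc [lin]: "a \<in>. A" "b \<in>. A" "c \<in>. C"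
  and t: "bil A C U t" and U [lin]: "module K U"
 shows "sw U (ent (umult A a b) c) t =
  sw U (ent b c) (\<lambda>v d. sw U (ent a d) (\<lambda>u e. t (umult A u v) e))"
proof -
 note [lin] = bil_multilin[OF t]
 have "sw U (ent (umult A a b) c) t =
   sw U (ucoact A \<rho>A (umult A a b)) (\<lambda>u h. t u (uact C hact h c))"
  by (rule sw_ent) (rule t lin|assumption)+
 also have "... = sw U (ucoact A \<rho>A a) (\<lambda>a0 a1. sw U (ucoact A \<rho>A b)
   (\<lambda>b0 b1. t (umult A a0 b0) (uact C hact (umult H a1 b1) c)))"
  by (rule coact_umult) (rule lin|assumption)+
 also have "... = sw U (ucoact A \<rho>A b) (\<lambda>b0 b1. sw U (ucoact A \<rho>A a)
   (\<lambda>a0 a1. t (umult A a0 b0) (uact C hact (umult H a1 b1) c)))"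
  by (rule sw_swap) (rule lin|assumption)+
 also have "... = sw U (ucoact A \<rho>A b) (\<lambda>b0 b1. sw U (ent a (uact C hact b1 c)) (\<lambda>u e. t (umult A u b0) e))"
 proof (rule sw_cong, (rule lin|assumption)+, goal_cases)
  case b [lin]: (1 b0 b1)
  have "sw U (ent a (uact C hact b1 c)) (\<lambda>u e. t (umult A u b0) e) =
    sw U (ucoact A \<rho>A a) (\<lambda>u h. t (umult A u b0) (uact C hact h (uact C hact b1 c)))"
   by (rule sw_ent) (rule lin|assumption)+
  also have "... = sw U (ucoact A \<rho>A a) (\<lambda>a0 a1. t (umult A a0 b0) (uact C hact (umult H a1 b1) c))"
   by (rule sw_cong) ((rule lin|assumption)+, simp add: uact_assoc[OF actC] b abc)
  finally show ?case by simp
 qed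
 also have "... = sw U (ent b c) (\<lambda>v d. sw U (ent a d) (\<lambda>u e. t (umult A u v) e))"
  by (rule sw_ent[symmetric]) (rule lin|assumption)+
 finally show ?thesis .
qed

lemma ent_one:
 assumes c [lin]: "c \<in>. C"
 shows "ent (one A) c = pure K A C (one A) c"
proof -
 have "\<rho>A (one A) = pure K A H (one A) (one H)"
  using datum by (simp add: monoidal_doi_hopf_def Let_def doi_hopf_def right_comodule_algebra_def)
 then have "ent (one A) c = sw (tens A C) (pure K A H (one A) (one H)) (\<lambda>u h. pure K A C u (uact C hact h c))"
  by (simp add: ent_def ucoact_def halg_inv_one alg)
 also have "... = pure K A C (one A) (uact C hact (one H) c)"
  by (rule sw_pureI) (rule lin|assumption)+
 finally show ?thesis by (simp add: uact_one[OF actC] c)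
qed

text \<open>Dually, \<open>C\<close> is a module coalgebra and the coaction of \<open>H\<close> on \<open>A\<close> is coassociative.\<close>

lemma ent_comult:
 assumes ac [lin]: "a \<in>. A" "c \<in>. C"
  and t: "tril A C C U t" and U [lin]: "module K U"
 shows "sw U (ent a c) (\<lambda>u d. sw U (\<delta>C d) (\<lambda>d1 d2. t u d1 d2)) =
  sw U (\<delta>C c) (\<lambda>c1 c2. sw U (ent a c2) (\<lambda>v d2.
   sw U (ent v c1) (\<lambda>u d1. t u d1 d2)))"
proof -
 note [lin] = tril_multilin[OF t]
 have "sw U (ent a c) (\<lambda>u d. sw U (\<delta>C d) (\<lambda>d1 d2. t u d1 d2)) =
   sw U (ucoact A \<rho>A a) (\<lambda>u h. sw U (\<delta>C (uact C hact h c)) (\<lambda>d1 d2. t u d1 d2))"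
  by (rule sw_ent) (rule lin|assumption)+
 also have "... = sw U (ucoact A \<rho>A a) (\<lambda>u h. sw U (ucoact H (comult H) h) (\<lambda>h1 h2.
   sw U (\<delta>C c) (\<lambda>c1 c2. t u (uact C hact h1 c1) (uact C hact h2 c2))))"
  by (rule sw_cong) (rule ucomult_uact lin|assumption)+
 also have "... = sw U (ucoact A \<rho>A a) (\<lambda>v h2. sw U (ucoact A \<rho>A v) (\<lambda>u h1.
   sw U (\<delta>C c) (\<lambda>c1 c2. t u (uact C hact h1 c1) (uact C hact h2 c2))))"
  by (rule ucoact_coassoc[OF comodA comod(3), symmetric]) (rule lin|assumption)+
 also have "... = sw U (ucoact A \<rho>A a) (\<lambda>v h2. sw U (\<delta>C c) (\<lambda>c1 c2.
   sw U (ucoact A \<rho>A v) (\<lambda>u h1. t u (uact C hact h1 c1) (uact C hact h2 c2))))"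
  by (rule sw_cong) (rule sw_swap lin|assumption)+
 also have "... = sw U (\<delta>C c) (\<lambda>c1 c2. sw U (ucoact A \<rho>A a) (\<lambda>v h2.
   sw U (ucoact A \<rho>A v) (\<lambda>u h1. t u (uact C hact h1 c1) (uact C hact h2 c2))))"
  by (rule sw_swap) (rule lin|assumption)+
 also have "... = sw U (\<delta>C c) (\<lambda>c1 c2. sw U (ucoact A \<rho>A a) (\<lambda>v h2.
   sw U (ent v c1) (\<lambda>u d1. t u d1 (uact C hact h2 c2))))"
  by (rule sw_cong, (rule lin|assumption)+, rule sw_cong,
    (rule sw_ent[symmetric] lin|assumption)+)
 also have "... = sw U (\<delta>C c) (\<lambda>c1 c2. sw U (ent a c2) (\<lambda>v d2.
   sw U (ent v c1) (\<lambda>u d1. t u d1 d2)))"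
  by (rule sw_cong) (rule sw_ent[symmetric] lin|assumption)+
 finally show ?thesis .
qed

lemma counit_uact:
 assumes "h \<in>. H" "c \<in>. C"
 shows "counit C (uact C hact h c) = counit H h \<otimes> counit C c"
proof -
 have "counit C (hact h c) = counit H h \<otimes> counit C c"
  using datum assms
  by (simp add: monoidal_doi_hopf_def Let_def doi_hopf_def left_module_coalgebra_def)
 then show ?thesis
  using assms bil_closed[OF hmodule_act[OF actC]]
  by (simp add: uact_def hcoalg_counit_alpha_inv coalg)
qed

lemma ent_counit:
 assumes ac [lin]: "a \<in>. A" "c \<in>. C"
 shows "sw A (ent a c) (\<lambda>u d. counit C d \<odot>\<^bsub>A\<^esub> u) = counit C c \<odot>\<^bsub>A\<^esub> a"
proof -
 interpret A: module K A by (rule mods)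
 have \<epsilon>: "\<And>h. h \<in>. H \<Longrightarrow> counit H h \<in>. K" "counit C c \<in>. K"
  by (rule lin|assumption)+
 have "sw A (ent a c) (\<lambda>u d. counit C d \<odot>\<^bsub>A\<^esub> u) =
   sw A (ucoact A \<rho>A a) (\<lambda>u h. counit C (uact C hact h c) \<odot>\<^bsub>A\<^esub> u)"
  by (rule sw_ent) (rule lin|assumption)+
 also have "... = sw A (ucoact A \<rho>A a) (\<lambda>u h. counit C c \<odot>\<^bsub>A\<^esub> (counit H h \<odot>\<^bsub>A\<^esub> u))"
  by (rule sw_cong)
   ((rule lin|assumption)+, simp add: counit_uact ac \<epsilon> A.smult_assoc1[symmetric] m_comm)
 also have "... = counit C c \<odot>\<^bsub>A\<^esub> sw A (ucoact A \<rho>A a) (\<lambda>u h. counit H h \<odot>\<^bsub>A\<^esub> u)"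
  by (rule sw_hom[where g="\<lambda>x. counit C c \<odot>\<^bsub>A\<^esub> x", symmetric]) (rule lin|assumption)+
 also have "... = counit C c \<odot>\<^bsub>A\<^esub> a"
  by (simp add: ucoact_counit[OF comodA] ac)
 finally show ?thesis .
qed

lemma ent_alpha:
 assumes ac [lin]: "a \<in>. A" "c \<in>. C" and t: "bil A C U t" and U [lin]: "module K U"
 shows "sw U (ent (alpha A a) (alpha C c)) t = sw U (ent a c) (\<lambda>u d. t (alpha A u) (alpha C d))"
proof -
 note [lin] = bil_multilin[OF t]
 have "sw U (ent (alpha A a) (alpha C c)) t =
   sw U (ucoact A \<rho>A (alpha A a)) (\<lambda>u h. t u (uact C hact h (alpha C c)))"
  by (rule sw_ent) (rule lin|assumption)+
 also have "... = sw U (ucoact A \<rho>A a) (\<lambda>u h. t (alpha A u) (uact C hact (alpha H h) (alpha C c)))"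
  by (rule ucoact_alpha[OF comodA]) (rule lin|assumption)+
 also have "... = sw U (ucoact A \<rho>A a) (\<lambda>u h. t (alpha A u) (alpha C (uact C hact h c)))"
  by (rule sw_cong) ((rule lin|assumption)+, simp add: uact_alpha[OF actC] ac)
 also have "... = sw U (ent a c) (\<lambda>u d. t (alpha A u) (alpha C d))"
  by (rule sw_ent[symmetric]) (rule lin|assumption)+
 finally show ?thesis .
qed

lemma monoidal_sweedler:
 assumes acd [lin]: "a \<in>. A" "c \<in>. C" "d \<in>. C"
  and t: "tril A A C U t" and U [lin]: "module K U"
 shows "sw U (\<rho>A a) (\<lambda>a0 a1. sw U (comult A a0) (\<lambda>a01 a02.
   t a01 a02 (hact (alpha H (alpha H a1)) (c \<otimes>\<^bsub>C\<^esub> d)))) =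
  sw U (comult A a) (\<lambda>a1 a2. sw U (\<rho>A a1) (\<lambda>a10 a11. sw U (\<rho>A a2) (\<lambda>a20 a21.
   t a10 a20 (hact a11 c \<otimes>\<^bsub>C\<^esub> hact a21 d))))"
proof -
 note [lin] = tril_multilin[OF t]
 let ?T = "tens A (tens A C)" and ?p = "\<lambda>x y z. pure K A (tens A C) x (pure K A C y z)"
 let ?g = "\<lambda>Z. sw U Z (\<lambda>x Y. sw U Y (t x))"
 have g: "lin ?T U ?g" by (rule lin|assumption)+
 have gp: "?g (pure K A (tens A C) x Y) = sw U Y (t x)"
  if [lin]: "x \<in>. A" "Y \<in>. tens A C" for x Y
  by (rule sw_pureI) (rule lin|assumption)+
 have gpp: "?g (?p x y z) = t x y z"
  if [lin]: "x \<in>. A" "y \<in>. A" "z \<in>. C" for x y z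
 proof -
  have "sw U (pure K A C y z) (t x) = t x y z"
   by (rule sw_pureI) (rule lin|assumption)+
  then show ?thesis by (subst gp) (rule lin|assumption)+
 qed
 let ?l = "\<lambda>a1. hact (alpha H (alpha H a1)) (c \<otimes>\<^bsub>C\<^esub> d)"
 let ?L = "\<lambda>a0 a1. sw ?T (comult A a0) (\<lambda>a01 a02. ?p a01 a02 (?l a1))"
 let ?R2 = "\<lambda>a10 a11 a2. sw ?T (\<rho>A a2) (\<lambda>a20 a21. ?p a10 a20 (hact a11 c \<otimes>\<^bsub>C\<^esub> hact a21 d))"
 let ?R = "\<lambda>a1 a2. sw ?T (\<rho>A a1) (\<lambda>a10 a11. ?R2 a10 a11 a2)"
 have eq: "sw ?T (\<rho>A a) ?L = sw ?T (comult A a) ?R"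
  using datum acd by (simp add: monoidal_doi_hopf_def Let_def)
 have L1: "?g (?L a0 a1) = sw U (comult A a0) (\<lambda>a01 a02. t a01 a02 (?l a1))"
  if [lin]: "a0 \<in>. A" "a1 \<in>. H" for a0 a1
 proof -
  have "?g (?L a0 a1) = sw U (comult A a0) (\<lambda>a01 a02. ?g (?p a01 a02 (?l a1)))"
   by (rule sw_hom[where g="?g"]) (rule lin|assumption)+
  also have "... = sw U (comult A a0) (\<lambda>a01 a02. t a01 a02 (?l a1))"
   by (rule sw_cong) (rule gpp lin|assumption)+
  finally show ?thesis .
 qed
 have "?g (sw ?T (\<rho>A a) ?L) = sw U (\<rho>A a) (\<lambda>a0 a1. ?g (?L a0 a1))"
  by (rule sw_hom[where g="?g"]) (rule lin|assumption)+
 also have "... = sw U (\<rho>A a) (\<lambda>a0 a1. sw U (comult A a0) (\<lambda>a01 a02. t a01 a02 (?l a1)))"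
  by (rule sw_cong) (rule L1 lin|assumption)+
 finally have L: "?g (sw ?T (\<rho>A a) ?L) =
   sw U (\<rho>A a) (\<lambda>a0 a1. sw U (comult A a0) (\<lambda>a01 a02. t a01 a02 (?l a1)))" .
 have R2: "?g (?R2 a10 a11 a2) = sw U (\<rho>A a2) (\<lambda>a20 a21. t a10 a20 (hact a11 c \<otimes>\<^bsub>C\<^esub> hact a21 d))"
  if [lin]: "a10 \<in>. A" "a11 \<in>. H" "a2 \<in>. A" for a10 a11 a2
 proof -
  have "?g (?R2 a10 a11 a2) = sw U (\<rho>A a2) (\<lambda>a20 a21. ?g (?p a10 a20 (hact a11 c \<otimes>\<^bsub>C\<^esub> hact a21 d)))"
   by (rule sw_hom[where g="?g"]) (rule lin|assumption)+
  also have "... = sw U (\<rho>A a2) (\<lambda>a20 a21. t a10 a20 (hact a11 c \<otimes>\<^bsub>C\<^esub> hact a21 d))"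
   by (rule sw_cong) (rule gpp lin|assumption)+
  finally show ?thesis .
 qed
 have R1: "?g (?R a1 a2) = sw U (\<rho>A a1) (\<lambda>a10 a11. sw U (\<rho>A a2) (\<lambda>a20 a21.
   t a10 a20 (hact a11 c \<otimes>\<^bsub>C\<^esub> hact a21 d)))"
  if [lin]: "a1 \<in>. A" "a2 \<in>. A" for a1 a2
 proof -
  have "?g (?R a1 a2) = sw U (\<rho>A a1) (\<lambda>a10 a11. ?g (?R2 a10 a11 a2))"
   by (rule sw_hom[where g="?g"]) (rule lin|assumption)+
  also have "... = sw U (\<rho>A a1) (\<lambda>a10 a11. sw U (\<rho>A a2) (\<lambda>a20 a21.
   t a10 a20 (hact a11 c \<otimes>\<^bsub>C\<^esub> hact a21 d)))"
   by (rule sw_cong) (rule R2 lin|assumption)+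
  finally show ?thesis .
 qed
 have "?g (sw ?T (comult A a) ?R) = sw U (comult A a) (\<lambda>a1 a2. ?g (?R a1 a2))"
  by (rule sw_hom[where g="?g"]) (rule lin|assumption)+
 also have "... = sw U (comult A a) (\<lambda>a1 a2. sw U (\<rho>A a1) (\<lambda>a10 a11. sw U (\<rho>A a2) (\<lambda>a20 a21.
   t a10 a20 (hact a11 c \<otimes>\<^bsub>C\<^esub> hact a21 d))))"
  by (rule sw_cong) (rule R1 lin|assumption)+
 finally show ?thesis using L eq by simp
qed

text \<open>
 This is the first monoidality condition. The factor \<open>\<alpha>\<^sub>H\<^sup>2\<close> in it is exactly what the
 untwisting of the product of \<open>C\<close> and of the coactions absorbs.
\<close>

lemma ent_monoidal:
 assumes acd [lin]: "a \<in>. A" "c \<in>. C" "d \<in>. C"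
  and t: "tril A A C U t" and U [lin]: "module K U"
 shows "sw U (ent a (umult C c d)) (\<lambda>u q. sw U (\<delta>A u) (\<lambda>u1 u2. t u1 u2 q)) =
  sw U (\<delta>A a) (\<lambda>a1 a2. sw U (ent a1 c) (\<lambda>u1 q1. sw U (ent a2 d)
   (\<lambda>u2 q2. t u1 u2 (umult C q1 q2))))"
proof -
 note [lin] = tril_multilin[OF t]
 let ?i = "alpha_inv A" and ?j = "alpha_inv C"
 let ?t = "\<lambda>x y z. t x y (?j (?j z))"
 let ?a = "?i (?i a)"
 have a': "?i a \<in>. A" "?a \<in>. A" by (rule lin)+
 have cl: "\<And>h c. h \<in>. H \<Longrightarrow> c \<in>. C \<Longrightarrow> hact h c \<in>. C"
  by (rule lin|assumption)+
 have "sw U (ent a (umult C c d)) (\<lambda>u q. sw U (\<delta>A u) (\<lambda>u1 u2. t u1 u2 q)) =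
   sw U (ucoact A \<rho>A a) (\<lambda>u h. sw U (\<delta>A u) (\<lambda>u1 u2. t u1 u2 (uact C hact h (umult C c d))))"
  by (rule sw_ent) (rule lin|assumption)+
 also have "... = sw U (\<rho>A ?a) (\<lambda>u h. sw U (\<delta>A (alpha A u)) (\<lambda>u1 u2.
   t u1 u2 (uact C hact (alpha H h) (umult C c d))))"
 proof -
  have "\<rho>A (?i a) = \<rho>A (alpha A ?a)" using a' by (simp add: hs_simps hs)
  then show ?thesis
   unfolding ucoact_def[of A \<rho>A] by (simp only:) (rule coact_alpha[OF comodA], (rule lin|assumption)+)
 qed
 also have "... = sw U (\<rho>A ?a) (\<lambda>u h. sw U (comult A u) (\<lambda>u1 u2.
   ?t u1 u2 (hact (alpha H (alpha H h)) (c \<otimes>\<^bsub>C\<^esub> d))))"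
 proof (rule sw_cong, (rule lin|assumption)+, goal_cases)
  case uh: (1 u h)
  have "uact C hact (alpha H h) (umult C c d) = ?j (?j (hact (alpha H (alpha H h)) (c \<otimes>\<^bsub>C\<^esub> d)))"
  proof -
   have "hact (alpha H (alpha H h)) (c \<otimes>\<^bsub>C\<^esub> d) = alpha C (hact (alpha H h) (umult C c d))"
    using uh acd by (simp add: hmodule_alpha[OF actC] alpha_closed hs alpha_umult alg umult_multilin)
   then show ?thesis
    using uh acd by (simp add: uact_def alpha_inv_alpha hs cl alpha_closed umult_multilin alg)
  qed
  then show ?case
   using uh by (simp add: ucoact_def alpha_inv_alpha hs)
 qed
 also have "... = sw U (comult A ?a) (\<lambda>a1 a2. sw U (\<rho>A a1) (\<lambda>a10 a11. sw U (\<rho>A a2) (\<lambda>a20 a21.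
   ?t a10 a20 (hact a11 c \<otimes>\<^bsub>C\<^esub> hact a21 d))))"
  by (rule monoidal_sweedler) (rule lin|assumption)+
 also have "... = sw U (comult A (?i a)) (\<lambda>a1 a2. sw U (\<rho>A (?i a1)) (\<lambda>a10 a11. sw U (\<rho>A (?i a2)) (\<lambda>a20 a21.
   ?t a10 a20 (hact a11 c \<otimes>\<^bsub>C\<^esub> hact a21 d))))"
  by (rule coact_alpha_inv[OF comod(1)]) (rule lin|assumption)+
 also have "... = sw U (\<delta>A a) (\<lambda>a1 a2. sw U (ucoact A \<rho>A a1) (\<lambda>a10 a11.
   sw U (ucoact A \<rho>A a2) (\<lambda>a20 a21. t a10 a20 (umult C (uact C hact a11 c) (uact C hact a21 d)))))"
  unfolding ucoact_def
  by (rule sw_cong, (rule lin|assumption)+, rule sw_cong, (rule lin|assumption)+,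
    rule sw_cong, (rule lin|assumption)+)
   (simp add: uact_def umult_def halg_inv_mult alg cl acd)
 also have "... = sw U (\<delta>A a) (\<lambda>a1 a2. sw U (ucoact A \<rho>A a1) (\<lambda>u1 a11.
   sw U (ent a2 d) (\<lambda>u2 q2. t u1 u2 (umult C (uact C hact a11 c) q2))))"
  by (rule sw_cong, (rule lin|assumption)+, rule sw_cong)
   (rule sw_ent[symmetric] lin|assumption)+
 also have "... = sw U (\<delta>A a) (\<lambda>a1 a2. sw U (ent a1 c) (\<lambda>u1 q1. sw U (ent a2 d)
   (\<lambda>u2 q2. t u1 u2 (umult C q1 q2))))"
  by (rule sw_cong) (rule sw_ent[symmetric] lin|assumption)+
 finally show ?thesis .
qed

text \<open>The second monoidality condition, untwisted.\<close>

lemma ent_unit: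
 assumes a [lin]: "a \<in>. A"
 shows "sw C (ent a (one C)) (\<lambda>u d. counit A u \<odot>\<^bsub>C\<^esub> d) = counit A a \<odot>\<^bsub>C\<^esub> one C"
proof -
 let ?a = "alpha_inv A a" and ?j = "alpha_inv C"
 have "?a \<in>. A" by (rule lin)+
 then have eq: "counit A ?a \<odot>\<^bsub>C\<^esub> one C = sw C (\<rho>A ?a) (\<lambda>a0 a1. counit A a0 \<odot>\<^bsub>C\<^esub> hact a1 (one C))"
  using datum by (simp add: monoidal_doi_hopf_def Let_def)
 have \<epsilon>: "\<And>u. u \<in>. A \<Longrightarrow> counit A u \<in>. K"
  and cl: "\<And>h. h \<in>. H \<Longrightarrow> hact h (one C) \<in>. C" by (rule lin|assumption)+
 have "sw C (ent a (one C)) (\<lambda>u d. counit A u \<odot>\<^bsub>C\<^esub> d) =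
   sw C (ucoact A \<rho>A a) (\<lambda>u h. counit A u \<odot>\<^bsub>C\<^esub> uact C hact h (one C))"
  by (rule sw_ent) (rule lin|assumption)+
 also have "... = sw C (\<rho>A ?a) (\<lambda>u h. ?j (counit A u \<odot>\<^bsub>C\<^esub> hact h (one C)))"
  unfolding ucoact_def uact_def
  by (rule sw_cong) ((rule lin|assumption)+, simp add: \<epsilon> cl lin_smult[OF hs_alpha_inv[OF hs(2)]])
 also have "... = ?j (sw C (\<rho>A ?a) (\<lambda>u h. counit A u \<odot>\<^bsub>C\<^esub> hact h (one C)))"
  by (rule sw_hom[where g="?j", symmetric]) (rule lin|assumption)+
 also have "... = counit A a \<odot>\<^bsub>C\<^esub> one C"
  using a by (simp add: eq[symmetric] lin_smult[OF hs_alpha_inv[OF hs(2)]] \<epsilon> halg_one alg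
    halg_inv_one hcoalg_counit_alpha_inv coalg)
 finally show ?thesis .
qed

end

section \<open>Structures on the same vector space\<close>

context ground
begin

text \<open>
 Tensor products, Sweedler sums and linearity depend only on the underlying vector space and not on
 the rest of a record. The smash product and \<open>A \<otimes> C\<^sup>*\<close> are related in this way, and so are a
 Doi-Hopf module and its associated module.
\<close>

definition same_space :: "('k,'v,'m) module_scheme \<Rightarrow> ('k,'v,'n) module_scheme \<Rightarrow> bool" where
 "same_space V V' \<longleftrightarrow> carrier V = carrier V' \<and> add V = add V' \<and> zero V = zero V' \<and> smult V = smult V'"

lemma same_space_refl: "same_space V V"
 by (simp add: same_space_def)

lemma same_space_sym: "same_space V V' \<Longrightarrow> same_space V' V"
 by (auto simp: same_space_def)

lemma tensor_rel_same_space_subset: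
 assumes "same_space V V'" "same_space W W'" "(p, q) \<in> tensor_rel K V W"
 shows "(p, q) \<in> tensor_rel K V' W'"
 using assms(3)
proof induction
 case (trans p q r)
 then show ?case by (blast intro: tensor_rel.trans)
next
 case (add_left x x' y)
 then show ?case using tensor_rel.add_left[of x V' x' y W' K] assms(1,2) by (simp add: same_space_def)
next
 case (add_right x y y')
 then show ?case using tensor_rel.add_right[of x V' y W' y' K] assms(1,2) by (simp add: same_space_def)
next
 case (smult r x y)
 then show ?case using tensor_rel.smult[of r K x V' y W'] assms(1,2) by (simp add: same_space_def)
next
 case (zero y)
 then show ?case using tensor_rel.zero[where K=K and V=V' and W=W' and y=y] assms(1,2) by (simp add: same_space_def)
qed (use assms(1,2) in \<open>auto simp: same_space_def formal_sums_def intro: tensor_rel.intros\<close>)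

lemma tensor_same_space:
 assumes "same_space V V'" "same_space W W'"
 shows "tensor_rel K V W = tensor_rel K V' W'" "tens V W = tens V' W'" "pure K V W = pure K V' W'"
proof -
 show *: "tensor_rel K V W = tensor_rel K V' W'"
  using tensor_rel_same_space_subset[OF assms]
   tensor_rel_same_space_subset[OF assms[THEN same_space_sym]] by auto
 have fs: "formal_sums V W = formal_sums V' W'" using assms by (simp add: same_space_def formal_sums_def)
 show "tens V W = tens V' W'" unfolding tensor_def * fs using assms by (simp add: same_space_def)
 show "pure K V W = pure K V' W'" unfolding pure_def * ..
qed

lemma sw_same_space: "same_space U U' \<Longrightarrow> sw U X b = sw U' X b"
 by (simp add: sweedler_def formal_eval_def same_space_def)

lemma lin_same_space: "same_space V V' \<Longrightarrow> same_space W W' \<Longrightarrow> lin V W f \<longleftrightarrow> lin V' W' f"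
 by (simp add: linear_map_def same_space_def)

lemma bil_same_space:
 "same_space V V' \<Longrightarrow> same_space W W' \<Longrightarrow> same_space U U' \<Longrightarrow> bil V W U f \<longleftrightarrow> bil V' W' U' f"
 unfolding bilinear_map_def
 using lin_same_space[of W W' U U'] lin_same_space[of V V' U U'] by (simp add: same_space_def)

lemma module_same_space:
 assumes "same_space V V'" "module K V" shows "module K V'"
proof -
 interpret V: module K V by fact
 have "abelian_group V'"
 proof (rule abelian_groupI)
  fix x assume x: "x \<in>. V'"
  then have "\<ominus>\<^bsub>V\<^esub> x \<in>. V'" "\<ominus>\<^bsub>V\<^esub> x \<oplus>\<^bsub>V'\<^esub> x = zero V'"
   using assms(1) V.M.a_inv_closed[of x] V.M.l_neg[of x] by (simp_all add: same_space_def)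
  then show "\<exists>y\<in>carrier V'. y \<oplus>\<^bsub>V'\<^esub> x = zero V'" by blast
 qed (use assms(1) V.M.a_assoc V.M.a_comm V.M.a_closed V.M.zero_closed V.M.l_zero in \<open>auto simp: same_space_def\<close>)
 then show ?thesis
  by (rule moduleI[OF is_cring])
   (use assms(1) V.smult_closed V.smult_l_distr V.smult_r_distr V.smult_assoc1 V.smult_one in
    \<open>auto simp: same_space_def\<close>)
qed

end

section \<open>The smash product as a space of functions\<close>

locale smash_datum = monoidal_datum K D
 for K :: "'k ring" (structure) and D :: "('k,'h,'a,'c) doi_hopf_datum" +
 fixes \<Omega> assumes \<Omega>: "coevaluation (CC D) \<Omega>"
begin

abbreviation "Cd \<equiv> dual_bialg K C"
abbreviation "sm \<equiv> pure K A (dual C)"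
abbreviation "T \<equiv> tens A (dual C)"
abbreviation "B \<equiv> smash K D"

lemma same_Cd: "same_space Cd (dual C)"
 by (simp add: same_space_def dual_bialg_def Let_def)

lemma tens_Cd: "tens A Cd = T" "pure K A Cd = sm"
 by (rule tensor_same_space[OF same_space_refl same_Cd])+

lemma Cd_simps:
 "carrier Cd = carrier (dual C)"
 "mult Cd f g = (\<lambda>c\<in>carrier C. sw (scalars K) (comult C c)
   (\<lambda>c1 c2. dp f (alpha_inv C (alpha_inv C c1)) \<otimes> dp g (alpha_inv C (alpha_inv C c2))))"
 "one Cd = (\<lambda>c\<in>carrier C. counit C c)"
 "alpha Cd f = (\<lambda>c\<in>carrier C. dp f (alpha_inv C c))"
 "counit Cd f = dp f (one C)"
 by (simp_all add: dual_bialg_def Let_def dp_def)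

lemma alpha_Cd_lin: "lin (dual C) (dual C) (alpha Cd)"
proof -
 have "alpha Cd = (\<lambda>f. \<lambda>c\<in>carrier C. dp f (alpha_inv C c))" by (rule ext) (rule Cd_simps)
 then show ?thesis by (simp only:) (rule lin|assumption)+
qed

lemma alpha_Cd_bij: "bij_betw (alpha Cd) (carrier (dual C)) (carrier (dual C))"
proof (rule bij_betw_byWitness[where f' = "\<lambda>f. \<lambda>c\<in>carrier C. dp f (alpha C c)"])
 show "alpha Cd ` carrier (dual C) \<subseteq> carrier (dual C)"
  using lin_closed[OF alpha_Cd_lin] by auto
 have r: "(\<lambda>c\<in>carrier C. dp f (alpha C c)) \<in>. dual C" if "f \<in>. dual C" for f
  using that by - (rule lin|assumption)+
 then show "(\<lambda>f. \<lambda>c\<in>carrier C. dp f (alpha C c)) ` carrier (dual C) \<subseteq> carrier (dual C)" by auto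
 have a: "alpha Cd f \<in>. dual C" if "f \<in>. dual C" for f
  by (rule lin_closed[OF alpha_Cd_lin that])
 show "\<forall>f\<in>carrier (dual C). (\<lambda>c\<in>carrier C. dp (alpha Cd f) (alpha C c)) = f"
  by (intro ballI dual_ext[of _ C]) (simp_all add: r a, simp add: dp_def Cd_simps hs_simps hs)
 show "\<forall>f\<in>carrier (dual C). alpha Cd (\<lambda>c\<in>carrier C. dp f (alpha C c)) = f"
  by (intro ballI dual_ext[of _ C]) (simp_all add: r a, simp add: dp_def Cd_simps hs_simps hs)
qed

lemma hs_Cd [lin]: "hs Cd"
proof -
 have "module K Cd" by (rule module_same_space[OF same_space_sym[OF same_Cd]]) (rule lin)+
 then show ?thesis
  using alpha_Cd_lin alpha_Cd_bij lin_same_space[OF same_Cd same_Cd]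
  by (simp add: hs_def hom_vector_space_def bijective_alpha_def Cd_simps)
qed

lemma dp_alpha_Cd: "f \<in>. dual C \<Longrightarrow> c \<in>. C \<Longrightarrow> dp (alpha Cd f) c = dp f (alpha_inv C c)"
 by (simp add: Cd_simps) (simp add: dp_def)

lemma alpha_inv_Cd: "f \<in>. dual C \<Longrightarrow> alpha_inv Cd f = (\<lambda>c\<in>carrier C. dp f (alpha C c))"
proof (rule alpha_inv_eqI[OF hs_Cd])
 assume f: "f \<in>. dual C"
 then have r: "(\<lambda>c\<in>carrier C. dp f (alpha C c)) \<in>. dual C"
  by - (rule lin|assumption)+
 then show "(\<lambda>c\<in>carrier C. dp f (alpha C c)) \<in>. Cd" by (simp add: Cd_simps)
 show "alpha Cd (\<lambda>c\<in>carrier C. dp f (alpha C c)) = f"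
  by (intro dual_ext[of _ C] lin_closed[OF alpha_Cd_lin] r f)
   (simp add: dp_alpha_Cd r, simp add: dp_def hs_simps hs)
qed

lemma Cd_multilin [lin]:
 "f \<in>. dual C \<Longrightarrow> alpha Cd f \<in>. dual C"
 "lin X (dual C) g \<Longrightarrow> lin X (dual C) (\<lambda>x. alpha Cd (g x))"
 "f \<in>. dual C \<Longrightarrow> alpha_inv Cd f \<in>. dual C"
 "lin X (dual C) g \<Longrightarrow> lin X (dual C) (\<lambda>x. alpha_inv Cd (g x))"
 using lin_multilin[OF alpha_Cd_lin] alpha_inv_closed[OF _ hs_Cd] lin_alpha_inv[OF _ hs_Cd]
 unfolding lin_same_space[OF same_space_refl same_Cd] Cd_simps(1) by blast+

lemma dp_alpha_inv_Cd: "f \<in>. dual C \<Longrightarrow> c \<in>. C \<Longrightarrow> dp (alpha_inv Cd f) c = dp f (alpha C c)"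
 by (simp add: alpha_inv_Cd) (simp add: dp_def)

lemma Cd_mult_bil: "bil (dual C) (dual C) (dual C) (mult Cd)"
proof -
 have "mult Cd = (\<lambda>f g. \<lambda>c\<in>carrier C. sw (scalars K) (comult C c)
   (\<lambda>c1 c2. dp f (alpha_inv C (alpha_inv C c1)) \<otimes> dp g (alpha_inv C (alpha_inv C c2))))"
  by (rule ext, rule ext, rule Cd_simps)
 then show ?thesis by (simp only:) (rule lin|assumption)+
qed

lemmas [lin] = bil_multilin[OF Cd_mult_bil]

lemma one_Cd [lin]: "one Cd \<in>. dual C"
 unfolding Cd_simps by (rule lin|assumption)+

abbreviation "dact \<equiv> dual_act C hact"

lemma dact_bil: "bil (dual C) H (dual C) dact"
proof -
 have "dact = (\<lambda>f h. \<lambda>c\<in>carrier C. dp f (hact h (alpha_inv C (alpha_inv C c))))"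
  by (rule ext, rule ext) (simp add: dual_act_def dp_def)
 then show ?thesis by (simp only:) (rule lin|assumption)+
qed

lemmas [lin] = bil_multilin[OF dact_bil]

lemma same_B: "same_space B T"
 by (simp add: same_space_def smash_def Let_def tens_Cd)

lemma B_simps:
 "carrier B = carrier T"
 "alpha B = tmap A (dual C) (alpha A) (alpha Cd)"
 "mult B X Y = sw T X (\<lambda>a f. sw T Y (\<lambda>a' f'. sw T (\<rho>A a') (\<lambda>a0 h.
   sm (a \<otimes>\<^bsub>A\<^esub> alpha_inv A a0)
    (dact (alpha_inv Cd f) (alpha_inv H (alpha_inv H h)) \<otimes>\<^bsub>Cd\<^esub> f'))))"
 "one B = sm (one A) (one Cd)"
 by (simp_all add: smash_def Let_def tens_Cd tmap_def[abs_def])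

lemma B_module [lin]: "module K B"
 by (rule module_same_space[OF same_space_sym[OF same_B]]) (rule lin)+

lemma T_mult_bil: "bil T T T (mult B)"
proof -
 have "mult B = (\<lambda>X Y. sw T X (\<lambda>a f. sw T Y (\<lambda>a' f'. sw T (\<rho>A a') (\<lambda>a0 h.
   sm (a \<otimes>\<^bsub>A\<^esub> alpha_inv A a0)
    (dact (alpha_inv Cd f) (alpha_inv H (alpha_inv H h)) \<otimes>\<^bsub>Cd\<^esub> f')))))"
  by (intro ext) (rule B_simps)
 then show ?thesis by (simp only:) (rule lin|assumption)+
qed

lemma T_alpha_lin: "lin T T (alpha B)"
 unfolding B_simps by (rule tmap_lin[OF hs_alpha[OF hs(1)] alpha_Cd_lin]) (rule lin)+

lemma T_alpha_pure:
 assumes [lin]: "a \<in>. A" "f \<in>. dual C"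
 shows "alpha B (sm a f) = sm (alpha A a) (alpha Cd f)"
 unfolding B_simps by (rule tmap_pure[OF _ _ hs_alpha[OF hs(1)] alpha_Cd_lin]) (rule lin)+

lemma T_alpha_bij: "bij_betw (alpha B) (carrier T) (carrier T)"
proof -
 let ?i = "tmap A (dual C) (alpha_inv A) (alpha_inv Cd)"
 have iCd: "lin (dual C) (dual C) (alpha_inv Cd)" by (rule lin)+
 have i: "lin T T ?i" by (rule tmap_lin[OF hs_alpha_inv[OF hs(1)] iCd]) (rule lin)+
 have ip: "?i (sm a f) = sm (alpha_inv A a) (alpha_inv Cd f)"
  if [lin]: "a \<in>. A" "f \<in>. dual C" for a f
  by (rule tmap_pure[OF _ _ hs_alpha_inv[OF hs(1)] iCd]) (rule lin)+
 note cl = alpha_closed[OF _ hs(1)] alpha_inv_closed[OF _ hs(1)] Cd_multilin(1,3)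
 have Cd: "alpha_inv Cd (alpha Cd f) = f" "alpha Cd (alpha_inv Cd f) = f" if "f \<in>. dual C" for f
  using that hs_Cd by (simp_all add: alpha_inv_alpha alpha_alpha_inv Cd_simps(1))
 show ?thesis
 proof (rule bij_betw_byWitness[where f' = ?i])
  show "\<forall>X\<in>carrier T. ?i (alpha B X) = X"
   by (intro ballI, rule tensor_ext[OF mods(1) dual_module[OF mods(2)], where U=T])
    (rule lin lin_comp[OF i T_alpha_lin] | assumption |
     simp add: T_alpha_pure ip cl hs_simps hs Cd)+
  show "\<forall>X\<in>carrier T. alpha B (?i X) = X"
   by (intro ballI, rule tensor_ext[OF mods(1) dual_module[OF mods(2)], where U=T])
    (rule lin lin_comp[OF T_alpha_lin i] | assumption |
     simp add: T_alpha_pure ip cl hs_simps hs Cd)+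
 qed (use lin_closed[OF T_alpha_lin] lin_closed[OF i] in auto)
qed

lemma hs_B [lin]: "hs B"
 using B_module T_alpha_lin T_alpha_bij lin_same_space[OF same_B same_B]
 by (simp add: hs_def hom_vector_space_def bijective_alpha_def B_simps(1))

text \<open>
 The function on \<open>C\<close> given by an element of \<open>A \<otimes> C\<^sup>*\<close>. The shift by \<open>\<alpha>\<close> is chosen such that the
 untwisted product becomes the product of functions \<open>smul\<close> without further structure maps.
\<close>

definition ev :: "('a \<times> ('c \<Rightarrow> 'k)) list set \<Rightarrow> 'c \<Rightarrow> 'a" where
 "ev X c = evl A (alpha C c) X"

lemma ev_bil: "bil T C A ev"
proof -
 note [lin] = bil_multilin[OF evl_bil[OF mods(1) mods(2)]]
 show ?thesis unfolding ev_def by (rule lin|assumption)+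
qed

lemmas ev_multilin [lin] = bil_multilin[OF ev_bil]

lemma ev_pure: "a \<in>. A \<Longrightarrow> f \<in>. dual C \<Longrightarrow> c \<in>. C \<Longrightarrow>
  ev (sm a f) c = dp f (alpha C c) \<odot>\<^bsub>A\<^esub> a"
 unfolding ev_def by (rule evl_pure) (rule lin|assumption)+

text \<open>By dual bases of \<open>C\<close>, elements of the smash product are determined by their functions.\<close>

lemma ev_eqI:
 assumes X: "X \<in>. T" and Y: "Y \<in>. T" and eq: "\<And>c. c \<in>. C \<Longrightarrow> ev X c = ev Y c"
 shows "X = Y"
proof (rule recovers_separates[OF recovers_evl[OF mods(2) \<Omega> mods(1)] X Y])
 fix c assume "c \<in>. C"
 then show "evl A c X = evl A c Y"
  using eq[of "alpha_inv C c"] by (simp add: ev_def hs_simps hs)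
qed

lemma ev_alpha:
 assumes X: "X \<in>. T" and c [lin]: "c \<in>. C"
 shows "ev (alpha B X) c = alpha A (ev X (alpha_inv C c))"
proof (rule tensor_ext[OF mods(1) dual_module[OF mods(2)] X, where U=A])
 note [lin] = lin_multilin[OF T_alpha_lin]
 fix a f assume af: "a \<in>. A" "f \<in>. dual C"
 then have "dp f c \<in>. K" using c by - (rule lin)+
 then show "ev (alpha B (sm a f)) c = alpha A (ev (sm a f) (alpha_inv C c))"
  using af c by (simp add: T_alpha_pure ev_pure hs_simps hs Cd_multilin dp_alpha_Cd
    lin_smult[OF hs_alpha[OF hs(1)]])
qed (rule lin lin_multilin[OF T_alpha_lin] | assumption)+

lemma ev_one: "c \<in>. C \<Longrightarrow> ev (one B) c = counit C c \<odot>\<^bsub>A\<^esub> one A"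
 by (simp add: B_simps ev_pure halg_one alg one_Cd) (simp add: Cd_simps dp_def alpha_closed hs hcoalg_counit_alpha coalg)

section \<open>The smash product is a Hom-algebra\<close>

text \<open>
 The product of functions of the smash product: \<open>Y(c\<^sub>2)\<close> moves past \<open>c\<^sub>1\<close> by the entwining before \<open>X\<close>
 is evaluated.
\<close>

abbreviation "act_on X b c \<equiv> sw A (ent b c) (\<lambda>u d. umult A (ev X d) u)"

definition smul :: "('a \<times> ('c \<Rightarrow> 'k)) list set \<Rightarrow> ('a \<times> ('c \<Rightarrow> 'k)) list set \<Rightarrow> 'c \<Rightarrow> 'a" where
 "smul X Y c = sw A (\<delta>C c) (\<lambda>c1 c2. act_on X (ev Y c2) c1)"

lemma smul_tril: "tril T T C A smul"
 unfolding smul_def by (rule lin|assumption)+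

lemmas [lin] = tril_multilin[OF smul_tril] bil_multilin[OF T_mult_bil] lin_multilin[OF T_alpha_lin]

lemma umult_smult:
 assumes "r \<in>. K" "a \<in>. A" "b \<in>. A"
 shows "umult A (r \<odot>\<^bsub>A\<^esub> a) b = r \<odot>\<^bsub>A\<^esub> umult A a b"
proof -
 have "lin A A (\<lambda>a. umult A a b)" using assms by - (rule lin|assumption)+
 from lin_smult[OF this] assms show ?thesis by simp
qed

text \<open>
 The structure maps in the product, the action on \<open>C\<^sup>*\<close> and the evaluation collect into
 \<open>\<alpha>\<^sub>C\<^sup>-\<^sup>2\<close> on \<open>c\<close>, \<open>\<alpha>\<^sub>A\<^sup>-\<^sup>1\<close> on \<open>a'\<close> and \<open>\<alpha>\<^sub>C\<close> in the argument of \<open>f'\<close>.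
\<close>

lemma ev_mult_pure:
 assumes [lin]: "a \<in>. A" "f \<in>. dual C" "a' \<in>. A" "f' \<in>. dual C" "c \<in>. C"
 shows "ev (sm a f \<otimes>\<^bsub>B\<^esub> sm a' f') c =
  sw A (comult C (alpha_inv C (alpha_inv C c))) (\<lambda>c1 c2. sw A (\<rho>A (alpha_inv A a'))
   (\<lambda>a0 h. (dp f (hact h c1) \<otimes> dp f' (alpha C c2)) \<odot>\<^bsub>A\<^esub> (a \<otimes>\<^bsub>A\<^esub> a0)))"
proof -
 note ass = assms
 interpret A: module K A by (rule mods)
 let ?p = "sm" and ?j = "alpha_inv C" and ?i = "alpha_inv H"
 let ?g = "\<lambda>h. dact (alpha_inv Cd f) (?i (?i h)) \<otimes>\<^bsub>Cd\<^esub> f'"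
 have "?p a f \<otimes>\<^bsub>B\<^esub> ?p a' f' = sw T (?p a' f') (\<lambda>a' f'. sw T (\<rho>A a') (\<lambda>a0 h.
   ?p (a \<otimes>\<^bsub>A\<^esub> alpha_inv A a0) (dact (alpha_inv Cd f) (?i (?i h)) \<otimes>\<^bsub>Cd\<^esub> f')))"
  unfolding B_simps by (rule sw_pureI) (rule lin|assumption)+
 also have "... = sw T (\<rho>A a') (\<lambda>a0 h. ?p (a \<otimes>\<^bsub>A\<^esub> alpha_inv A a0) (?g h))"
  by (rule sw_pureI) (rule lin|assumption)+
 finally have "ev (?p a f \<otimes>\<^bsub>B\<^esub> ?p a' f') c =
   ev (sw T (\<rho>A a') (\<lambda>a0 h. ?p (a \<otimes>\<^bsub>A\<^esub> alpha_inv A a0) (?g h))) c" by simp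
 also have "... = sw A (\<rho>A a') (\<lambda>a0 h. ev (?p (a \<otimes>\<^bsub>A\<^esub> alpha_inv A a0) (?g h)) c)"
  by (rule sw_hom[where g="\<lambda>X. ev X c"]) (rule lin|assumption)+
 also have "... = sw A (\<rho>A a') (\<lambda>a0 h. sw A (comult C (?j (?j c))) (\<lambda>c1 c2.
   (dp f (hact (?i h) c1) \<otimes> dp f' (alpha C c2)) \<odot>\<^bsub>A\<^esub> (a \<otimes>\<^bsub>A\<^esub> alpha_inv A a0)))"
 proof (rule sw_cong, (rule lin|assumption)+, goal_cases)
  case ah [lin]: (1 a0 h)
  let ?d = "\<lambda>x. dp f (hact (?i h) x)"
  let ?q = "dact (alpha_inv Cd f) (?i (?i h))"
  \<comment> \<open>The three powers of \<open>\<alpha>\<close> appear when \<open>\<alpha> c\<close> is written as \<open>\<alpha>\<^sup>3\<close> of \<open>\<alpha>\<^sup>-\<^sup>2 c\<close>.\<close>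
  have g: "dp ?q (?j (?j (alpha C (alpha C (alpha C x))))) = ?d x" if x [lin]: "x \<in>. C" for x
  proof -
   have y: "?j x \<in>. C" by (rule lin)+
   have cl: "hact (?i (?i h)) (?j x) \<in>. C" by (rule lin)+
   have "dp ?q (alpha C x) = dp (alpha_inv Cd f) (hact (?i (?i h)) (?j x))"
    using x by (simp add: dual_act_def dp_def hs_simps hs)
   also have "... = dp f (hact (?i h) x)"
    using ass cl by (simp add: dp_alpha_inv_Cd hmodule_alpha[OF actC] hs_simps hs ah x)
   finally show ?thesis using x by (simp add: hs_simps hs)
  qed
  have "dp (?g h) (alpha C c) = sw (scalars K) (comult C (alpha C c)) (\<lambda>c1 c2. dp ?q (?j (?j c1)) \<otimes> dp f' (?j (?j c2)))"
   unfolding Cd_simps using ass by (simp add: dp_restrict alpha_closed hs)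
  also have "... = sw (scalars K) (comult C (alpha C (alpha C (alpha C (?j (?j c))))))
     (\<lambda>c1 c2. dp ?q (?j (?j c1)) \<otimes> dp f' (?j (?j c2)))" using ass by (simp add: hs_simps hs)
  also have "sw (scalars K) (comult C (alpha C (alpha C (alpha C (?j (?j c))))))
     (\<lambda>c1 c2. dp ?q (?j (?j c1)) \<otimes> dp f' (?j (?j c2))) =
    sw (scalars K) (comult C (alpha C (alpha C (?j (?j c)))))
     (\<lambda>c1 c2. dp ?q (?j (?j (alpha C c1))) \<otimes> dp f' (?j (?j (alpha C c2))))"
   by (rule coact_alpha[OF comod(2)]) (rule lin|assumption)+
  also have "... = sw (scalars K) (comult C (alpha C (?j (?j c))))
     (\<lambda>c1 c2. dp ?q (?j (?j (alpha C (alpha C c1)))) \<otimes> dp f' (?j (?j (alpha C (alpha C c2)))))"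
   by (rule coact_alpha[OF comod(2)]) (rule lin|assumption)+
  also have "... = sw (scalars K) (comult C (?j (?j c)))
     (\<lambda>c1 c2. dp ?q (?j (?j (alpha C (alpha C (alpha C c1))))) \<otimes> dp f' (?j (?j (alpha C (alpha C (alpha C c2))))))"
   by (rule coact_alpha[OF comod(2)]) (rule lin|assumption)+
  also have "... = sw (scalars K) (comult C (?j (?j c))) (\<lambda>c1 c2. ?d c1 \<otimes> dp f' (alpha C c2))"
   by (rule sw_cong) ((rule lin|assumption)+, simp add: g, simp add: hs_simps hs)
  finally have dp: "dp (?g h) (alpha C c) = sw (scalars K) (comult C (?j (?j c))) (\<lambda>c1 c2. ?d c1 \<otimes> dp f' (alpha C c2))" .
  have "ev (?p (a \<otimes>\<^bsub>A\<^esub> alpha_inv A a0) (?g h)) c = dp (?g h) (alpha C c) \<odot>\<^bsub>A\<^esub> (a \<otimes>\<^bsub>A\<^esub> alpha_inv A a0)"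
   by (rule ev_pure) (rule lin|assumption)+
  also have "... = sw A (comult C (?j (?j c))) (\<lambda>c1 c2. (?d c1 \<otimes> dp f' (alpha C c2)) \<odot>\<^bsub>A\<^esub> (a \<otimes>\<^bsub>A\<^esub> alpha_inv A a0))"
   unfolding dp by (rule sw_hom[where g="\<lambda>r. r \<odot>\<^bsub>A\<^esub> (a \<otimes>\<^bsub>A\<^esub> alpha_inv A a0)"]) (rule lin|assumption)+
  finally show ?case .
 qed
 also have "... = sw A (\<rho>A (alpha_inv A a')) (\<lambda>a0 h. sw A (comult C (?j (?j c))) (\<lambda>c1 c2.
   (dp f (hact h c1) \<otimes> dp f' (alpha C c2)) \<odot>\<^bsub>A\<^esub> (a \<otimes>\<^bsub>A\<^esub> a0)))"
  by (rule coact_alpha_inv[OF comodA, symmetric]) (rule lin|assumption)+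
 also have "... = sw A (comult C (?j (?j c))) (\<lambda>c1 c2. sw A (\<rho>A (alpha_inv A a')) (\<lambda>a0 h.
   (dp f (hact h c1) \<otimes> dp f' (alpha C c2)) \<odot>\<^bsub>A\<^esub> (a \<otimes>\<^bsub>A\<^esub> a0)))"
  by (rule sw_swap) (rule lin|assumption)+
 finally show ?thesis .
qed

lemma smul_pure:
 assumes [lin]: "a \<in>. A" "f \<in>. dual C" "a' \<in>. A" "f' \<in>. dual C" "c \<in>. C"
 shows "smul (sm a f) (sm a' f') c =
  sw A (comult C (alpha_inv C c)) (\<lambda>c1 c2. sw A (\<rho>A (alpha_inv A a'))
   (\<lambda>a0 h. (dp f (hact h c1) \<otimes> dp f' (alpha C c2)) \<odot>\<^bsub>A\<^esub> umult A a a0))"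
 unfolding smul_def ucoact_def
proof (rule sw_cong)
 interpret A: module K A by (rule mods)
 let ?p = "sm"
 fix c1 c2 assume c12 [lin]: "c1 \<in>. C" "c2 \<in>. C"
 have r [lin]: "dp f' (alpha C c2) \<in>. K" by (rule lin)+
 have cl: "\<And>d. d \<in>. C \<Longrightarrow> dp f (alpha C d) \<in>. K" "\<And>u. u \<in>. A \<Longrightarrow> umult A a u \<in>. A"
  "\<And>h. h \<in>. H \<Longrightarrow> uact C hact h c1 \<in>. C" "\<And>h. h \<in>. H \<Longrightarrow> hact h c1 \<in>. C"
  "\<And>h. h \<in>. H \<Longrightarrow> dp f (hact h c1) \<in>. K"
  by (rule lin|assumption)+
 have "act_on (?p a f) (ev (?p a' f') c2) c1 =
   dp f' (alpha C c2) \<odot>\<^bsub>A\<^esub> sw A (ent a' c1) (\<lambda>u d. umult A (ev (?p a f) d) u)"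
  unfolding ev_pure[OF assms(3,4) c12(2)]
  by (rule lin_smult[where f="\<lambda>b. act_on (?p a f) b c1"])
   (rule lin|assumption)+
 also have "sw A (ent a' c1) (\<lambda>u d. umult A (ev (?p a f) d) u) =
   sw A (ucoact A \<rho>A a') (\<lambda>u h. umult A (ev (?p a f) (uact C hact h c1)) u)"
  by (rule sw_ent) (rule lin|assumption)+
 also have "... = sw A (\<rho>A (alpha_inv A a')) (\<lambda>u h. dp f (hact h c1) \<odot>\<^bsub>A\<^esub> umult A a u)"
  unfolding ucoact_def
  by (rule sw_cong) ((rule lin|assumption)+, simp add: ev_pure assms cl umult_smult,
   simp add: uact_def hs_simps hs cl)
 also have "dp f' (alpha C c2) \<odot>\<^bsub>A\<^esub> ... =
   sw A (\<rho>A (alpha_inv A a')) (\<lambda>u h. dp f' (alpha C c2) \<odot>\<^bsub>A\<^esub> (dp f (hact h c1) \<odot>\<^bsub>A\<^esub> umult A a u))"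
  by (rule sw_hom[where g="\<lambda>x. dp f' (alpha C c2) \<odot>\<^bsub>A\<^esub> x"]) (rule lin|assumption)+
 also have "... = sw A (\<rho>A (alpha_inv A a')) (\<lambda>u h. (dp f (hact h c1) \<otimes> dp f' (alpha C c2)) \<odot>\<^bsub>A\<^esub> umult A a u)"
  by (rule sw_cong) ((rule lin|assumption)+, simp add: A.smult_assoc1[symmetric] cl r m_comm)
 finally show "act_on (?p a f) (ev (?p a' f') c2) c1 =
   sw A (\<rho>A (alpha_inv A a')) (\<lambda>u h. (dp f (hact h c1) \<otimes> dp f' (alpha C c2)) \<odot>\<^bsub>A\<^esub> umult A a u)" .
qed (rule lin|assumption)+

lemma ev_mult_smul_pure:
 assumes [lin]: "a \<in>. A" "f \<in>. dual C" "a' \<in>. A" "f' \<in>. dual C" "c \<in>. C"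
 shows "ev (sm a f \<otimes>\<^bsub>B\<^esub> sm a' f') (alpha C c) =
  alpha A (smul (sm a f) (sm a' f') c)"
proof -
 have cl: "\<And>h c1. h \<in>. H \<Longrightarrow> c1 \<in>. C \<Longrightarrow> dp f (hact h c1) \<in>. K"
  "\<And>c2. c2 \<in>. C \<Longrightarrow> dp f' (alpha C c2) \<in>. K"
  "\<And>u. u \<in>. A \<Longrightarrow> umult A a u \<in>. A"
  by (rule lin|assumption)+
 have "alpha A (smul (sm a f) (sm a' f') c) =
   sw A (comult C (alpha_inv C c)) (\<lambda>c1 c2. alpha A (sw A (\<rho>A (alpha_inv A a'))
   (\<lambda>a0 h. (dp f (hact h c1) \<otimes> dp f' (alpha C c2)) \<odot>\<^bsub>A\<^esub> umult A a a0)))"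
  unfolding smul_pure[OF assms]
  by (rule sw_hom[where g="alpha A"]) (rule lin|assumption)+
 also have "... = sw A (comult C (alpha_inv C c)) (\<lambda>c1 c2. sw A (\<rho>A (alpha_inv A a'))
   (\<lambda>a0 h. alpha A ((dp f (hact h c1) \<otimes> dp f' (alpha C c2)) \<odot>\<^bsub>A\<^esub> umult A a a0)))"
  by (rule sw_cong) (rule sw_hom[where g="alpha A"] lin|assumption)+
 also have "... = sw A (comult C (alpha_inv C c)) (\<lambda>c1 c2. sw A (\<rho>A (alpha_inv A a'))
   (\<lambda>a0 h. (dp f (hact h c1) \<otimes> dp f' (alpha C c2)) \<odot>\<^bsub>A\<^esub> (a \<otimes>\<^bsub>A\<^esub> a0)))"
  by (rule sw_cong, (rule lin|assumption)+, rule sw_cong)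
   ((rule lin|assumption)+, simp add: lin_smult[OF hs_alpha[OF hs(1)]] cl alpha_umult alg assms)
 also have "... = ev (sm a f \<otimes>\<^bsub>B\<^esub> sm a' f') (alpha C c)"
  using ev_mult_pure[OF assms(1-4), of "alpha C c"] assms(5) by (simp add: hs_simps hs)
 finally show ?thesis by simp
qed

lemma ev_mult:
 assumes X [lin]: "X \<in>. T" and Y [lin]: "Y \<in>. T" and c [lin]: "c \<in>. C"
 shows "ev (X \<otimes>\<^bsub>B\<^esub> Y) (alpha C c) = alpha A (smul X Y c)"
proof (rule tensor_ext[OF mods(1) dual_module[OF mods(2)] X, where U=A])
 fix a f assume [lin]: "a \<in>. A" "f \<in>. dual C"
 show "ev (sm a f \<otimes>\<^bsub>B\<^esub> Y) (alpha C c) = alpha A (smul (sm a f) Y c)"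
  by (rule tensor_ext[OF mods(1) dual_module[OF mods(2)] Y, where U=A])
   (rule ev_mult_smul_pure lin|assumption)+
qed (rule lin|assumption)+

lemma umult_B_closed [lin]:
 assumes [lin]: "X \<in>. T" "Y \<in>. T" shows "umult B X Y \<in>. T"
proof -
 have "X \<otimes>\<^bsub>B\<^esub> Y \<in>. B" unfolding B_simps(1) by (rule lin)+
 then show ?thesis unfolding umult_def B_simps(1)[symmetric] by (rule alpha_inv_closed) (rule hs_B)
qed

lemma alpha_umult_B: "X \<in>. T \<Longrightarrow> Y \<in>. T \<Longrightarrow> alpha B (umult B X Y) = X \<otimes>\<^bsub>B\<^esub> Y"
proof -
 assume [lin]: "X \<in>. T" "Y \<in>. T"
 have "X \<otimes>\<^bsub>B\<^esub> Y \<in>. B" unfolding B_simps(1) by (rule lin)+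
 then show ?thesis by (simp add: umult_def alpha_alpha_inv hs_B)
qed

text \<open>
 Untwisting turns the product of the smash product into the product of functions. All further
 properties of the product are proved for functions.
\<close>

lemma ev_umult:
 assumes X [lin]: "X \<in>. T" and Y [lin]: "Y \<in>. T" and c [lin]: "c \<in>. C"
 shows "ev (umult B X Y) c = smul X Y c"
proof -
 have cl: "ev (umult B X Y) c \<in>. A" "smul X Y c \<in>. A" "alpha C c \<in>. C" "umult B X Y \<in>. T"
  by (rule lin)+
 have "alpha A (ev (umult B X Y) c) = ev (alpha B (umult B X Y)) (alpha C c)"
  using cl c by (simp add: ev_alpha alpha_inv_alpha hs)
 also have "... = alpha A (smul X Y c)" by (simp add: alpha_umult_B X Y ev_mult c)
 finally show ?thesis using cl by (simp add: alpha_inj hs)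
qed

lemma umult_B_alpha:
 assumes X [lin]: "X \<in>. T" and Y [lin]: "Y \<in>. T"
 shows "alpha B (umult B X Y) = umult B (alpha B X) (alpha B Y)"
proof (rule ev_eqI)
 fix c assume c [lin]: "c \<in>. C"
 let ?c = "alpha_inv C c"
 have cl: "?c \<in>. C" "alpha B X \<in>. T" "alpha B Y \<in>. T" "umult B X Y \<in>. T"
  "\<And>d. d \<in>. C \<Longrightarrow> ev X d \<in>. A"
  by (rule lin|assumption)+
 have "ev (umult B (alpha B X) (alpha B Y)) c =
   sw A (\<delta>C (alpha C ?c)) (\<lambda>c1 c2. act_on (alpha B X) (ev (alpha B Y) c2) c1)"
  using cl c by (simp add: ev_umult) (simp add: smul_def hs_simps hs)
 also have "... = sw A (\<delta>C ?c) (\<lambda>c1 c2.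
   sw A (ent (ev (alpha B Y) (alpha C c2)) (alpha C c1)) (\<lambda>u d. umult A (ev (alpha B X) d) u))"
  by (rule ucoact_alpha[OF comod(2)]) (rule lin|assumption)+
 also have "... = sw A (\<delta>C ?c) (\<lambda>c1 c2. alpha A (act_on X (ev Y c2) c1))"
 proof (rule sw_cong, (rule lin|assumption)+, goal_cases)
  case c12 [lin]: (1 c1 c2)
  have "sw A (ent (ev (alpha B Y) (alpha C c2)) (alpha C c1)) (\<lambda>u d. umult A (ev (alpha B X) d) u) =
    sw A (ent (alpha A (ev Y c2)) (alpha C c1)) (\<lambda>u d. umult A (ev (alpha B X) d) u)"
   using c12 by (simp add: ev_alpha Y hs_simps hs)
  also have "... = sw A (ent (ev Y c2) c1) (\<lambda>u d. umult A (ev (alpha B X) (alpha C d)) (alpha A u))"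
   by (rule ent_alpha) (rule lin|assumption)+
  also have "... = sw A (ent (ev Y c2) c1) (\<lambda>u d. alpha A (umult A (ev X d) u))"
   by (rule sw_cong) ((rule lin|assumption)+, simp add: ev_alpha X hs_simps hs alpha_umult_distrib alg cl)
  also have "... = alpha A (act_on X (ev Y c2) c1)"
   by (rule sw_hom[symmetric]) (rule hs_alpha lin|assumption)+
  finally show ?case .
 qed
 also have "... = alpha A (smul X Y ?c)"
  unfolding smul_def by (rule sw_hom[symmetric]) (rule hs_alpha lin|assumption)+
 also have "... = ev (alpha B (umult B X Y)) c"
  using cl c by (simp add: ev_alpha ev_umult X Y)
 finally show "ev (alpha B (umult B X Y)) c = ev (umult B (alpha B X) (alpha B Y)) c" by simp
qed (rule lin|assumption)+

lemma one_B [lin]: "one B \<in>. T"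
 unfolding B_simps by (rule lin)+

lemma umult_B_one_left:
 assumes X [lin]: "X \<in>. T"
 shows "umult B (one B) X = X"
proof (rule ev_eqI)
 fix c assume c [lin]: "c \<in>. C"
 have "ev (umult B (one B) X) c =
   sw A (\<delta>C c) (\<lambda>c1 c2. act_on (one B) (ev X c2) c1)"
  by (simp add: ev_umult one_B X c smul_def)
 also have "... = sw A (\<delta>C c) (\<lambda>c1 c2. ev X (counit C c1 \<odot>\<^bsub>C\<^esub> c2))"
 proof (rule sw_cong, (rule lin|assumption)+, goal_cases)
  case c12 [lin]: (1 c1 c2)
  have "\<And>d. d \<in>. C \<Longrightarrow> counit C d \<in>. K" by (rule lin|assumption)+
  then have "act_on (one B) (ev X c2) c1 =
    sw A (ent (ev X c2) c1) (\<lambda>u d. counit C d \<odot>\<^bsub>A\<^esub> u)"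
   by - (rule sw_cong, (rule lin|assumption)+, simp add: ev_one umult_smult umult_one alg halg_one)
  also have "... = counit C c1 \<odot>\<^bsub>A\<^esub> ev X c2" by (rule ent_counit) (rule lin)+
  also have "... = ev X (counit C c1 \<odot>\<^bsub>C\<^esub> c2)"
   by (rule lin_smult[OF bil_right[OF ev_bil], symmetric]) (rule lin)+
  finally show ?case .
 qed
 also have "... = ev X (sw C (\<delta>C c) (\<lambda>c1 c2. counit C c1 \<odot>\<^bsub>C\<^esub> c2))"
  by (rule sw_hom[where g="ev X", symmetric]) (rule bil_right[OF ev_bil] lin|assumption)+
 finally show "ev (umult B (one B) X) c = ev X c"
  by (simp add: hcoalg_counit_left coalg c)
qed (rule lin|assumption)+

lemma umult_B_one_right:
 assumes X [lin]: "X \<in>. T"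
 shows "umult B X (one B) = X"
proof (rule ev_eqI)
 fix c assume c [lin]: "c \<in>. C"
 have "ev (umult B X (one B)) c =
   sw A (\<delta>C c) (\<lambda>c1 c2. act_on X (ev (one B) c2) c1)"
  by (simp add: ev_umult one_B X c smul_def)
 also have "... = sw A (\<delta>C c) (\<lambda>c1 c2. ev X (counit C c2 \<odot>\<^bsub>C\<^esub> c1))"
 proof (rule sw_cong, (rule lin|assumption)+, goal_cases)
  case c12 [lin]: (1 c1 c2)
  have "act_on X (counit C c2 \<odot>\<^bsub>A\<^esub> one A) c1 =
    counit C c2 \<odot>\<^bsub>A\<^esub> act_on X (one A) c1"
   by (rule lin_smult[where f="\<lambda>b. act_on X b c1"]) (rule lin|assumption)+
  also have "act_on X (one A) c1 = umult A (ev X c1) (one A)"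
   unfolding ent_one[OF c12(1)] by (rule sw_pureI) (rule lin|assumption)+
  also have "... = ev X c1" by (rule umult_one(2)) (rule lin)+
  also have "counit C c2 \<odot>\<^bsub>A\<^esub> ev X c1 = ev X (counit C c2 \<odot>\<^bsub>C\<^esub> c1)"
   by (rule lin_smult[OF bil_right[OF ev_bil], symmetric]) (rule lin)+
  finally show ?case
   by (simp add: ev_one c12)
 qed
 also have "... = ev X (sw C (\<delta>C c) (\<lambda>c1 c2. counit C c2 \<odot>\<^bsub>C\<^esub> c1))"
  by (rule sw_hom[where g="ev X", symmetric]) (rule bil_right[OF ev_bil] lin|assumption)+
 finally show "ev (umult B X (one B)) c = ev X c"
  by (simp add: ucoact_counit[OF comod(2)] c)
qed (rule lin|assumption)+

text \<open>
 Bracketing to the left splits \<open>d\<close> after entwining with \<open>Z(c\<^sub>2)\<close>, and \<open>ent_comult\<close> moves the coproduct in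
 front of the entwining. Bracketing to the right entwines a product, which \<open>ent_mult\<close> resolves. Both
 give the same threefold sum.
\<close>

lemma umult_B_assoc:
 assumes X [lin]: "X \<in>. T" and Y [lin]: "Y \<in>. T" and Z [lin]: "Z \<in>. T"
 shows "umult B (umult B X Y) Z = umult B X (umult B Y Z)"
proof (rule ev_eqI)
 fix c assume c [lin]: "c \<in>. C"
 let ?\<Delta> = "\<delta>C"
 let ?t = "\<lambda>u d1 d2. sw A (ent (ev Y d2) d1) (\<lambda>v e. umult A (umult A (ev X e) v) u)"
 note um = umult_B_closed[OF X Y] umult_B_closed[OF Y Z]
 have cl: "\<And>d. d \<in>. C \<Longrightarrow> ev X d \<in>. A" by (rule lin|assumption)+
 have "ev (umult B (umult B X Y) Z) c =
   sw A (?\<Delta> c) (\<lambda>c1 c2. act_on (umult B X Y) (ev Z c2) c1)"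
  by (simp add: ev_umult um Z c) (simp add: smul_def)
 also have "... = sw A (?\<Delta> c) (\<lambda>c1 c2. sw A (ent (ev Z c2) c1) (\<lambda>u d.
   sw A (?\<Delta> d) (\<lambda>d1 d2. ?t u d1 d2)))"
 proof (rule sw_cong, (rule lin|assumption)+, rule sw_cong)
  fix c1 c2 u d assume [lin]: "c1 \<in>. C" "c2 \<in>. C" "u \<in>. A" and d [lin]: "d \<in>. C"
  have "umult A (ev (umult B X Y) d) u =
    umult A (sw A (?\<Delta> d) (\<lambda>d1 d2. act_on X (ev Y d2) d1)) u"
   by (simp add: ev_umult X Y d smul_def)
  also have "... = sw A (?\<Delta> d) (\<lambda>d1 d2. umult A (act_on X (ev Y d2) d1) u)"
   by (rule sw_hom[where g="\<lambda>x. umult A x u"]) (rule lin|assumption)+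
  also have "... = sw A (?\<Delta> d) (\<lambda>d1 d2. ?t u d1 d2)"
   by (rule sw_cong) (rule sw_hom[where g="\<lambda>x. umult A x u"] lin|assumption)+
  finally show "umult A (ev (umult B X Y) d) u = sw A (?\<Delta> d) (\<lambda>d1 d2. ?t u d1 d2)" .
 qed (rule lin|assumption)+
 also have "... = sw A (?\<Delta> c) (\<lambda>c1 c2. sw A (?\<Delta> c1) (\<lambda>c11 c12. sw A (ent (ev Z c2) c12) (\<lambda>v d2.
   sw A (ent v c11) (\<lambda>u d1. ?t u d1 d2))))"
  by (rule sw_cong) (rule ent_comult lin|assumption)+
 also have "... = sw A (?\<Delta> c) (\<lambda>c1 c2. sw A (?\<Delta> c2) (\<lambda>c21 c22. sw A (ent (ev Z c22) c21) (\<lambda>v d2.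
   sw A (ent v c1) (\<lambda>u d1. ?t u d1 d2))))"
  by (rule ucoact_coassoc[OF comod(2) comod(2)]) (rule lin|assumption)+
 also have "... = sw A (?\<Delta> c) (\<lambda>c1 c2. sw A (?\<Delta> c2) (\<lambda>c21 c22. sw A (ent (ev Z c22) c21) (\<lambda>v d2.
   act_on X (umult A (ev Y d2) v) c1)))"
 proof (rule sw_cong, (rule lin|assumption)+, rule sw_cong, (rule lin|assumption)+, rule sw_cong)
  fix c1 c2 c21 c22 v d2 assume [lin]: "c1 \<in>. C" "c2 \<in>. C" "c21 \<in>. C" "c22 \<in>. C"
   "v \<in>. A" "d2 \<in>. C"
  have "act_on X (umult A (ev Y d2) v) c1 =
    sw A (ent v c1) (\<lambda>u d1. sw A (ent (ev Y d2) d1) (\<lambda>w e. umult A (ev X e) (umult A w u)))"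
   by (rule ent_mult) (rule lin|assumption)+
  also have "... = sw A (ent v c1) (\<lambda>u d1. ?t u d1 d2)"
   by (rule sw_cong, (rule lin|assumption)+, rule sw_cong)
    ((rule lin|assumption)+, simp add: umult_assoc alg cl)
  finally show "sw A (ent v c1) (\<lambda>u d1. ?t u d1 d2) =
    act_on X (umult A (ev Y d2) v) c1" by simp
 qed (rule lin|assumption)+
 also have "... = sw A (?\<Delta> c) (\<lambda>c1 c2. act_on X (ev (umult B Y Z) c2) c1)"
 proof (rule sw_cong)
  fix c1 c2 assume [lin]: "c1 \<in>. C" and c2 [lin]: "c2 \<in>. C"
  let ?g = "\<lambda>b. act_on X b c1"
  have "?g (ev (umult B Y Z) c2) = ?g (sw A (?\<Delta> c2) (\<lambda>c21 c22. act_on Y (ev Z c22) c21))"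
   by (simp add: ev_umult Y Z c2 smul_def)
  also have "... = sw A (?\<Delta> c2) (\<lambda>c21 c22. ?g (act_on Y (ev Z c22) c21))"
   by (rule sw_hom[where g="?g"]) (rule lin|assumption)+
  also have "... = sw A (?\<Delta> c2) (\<lambda>c21 c22. sw A (ent (ev Z c22) c21) (\<lambda>v d2. ?g (umult A (ev Y d2) v)))"
   by (rule sw_cong) (rule sw_hom[where g="?g"] lin|assumption)+
  finally show "sw A (?\<Delta> c2) (\<lambda>c21 c22. sw A (ent (ev Z c22) c21) (\<lambda>v d2. ?g (umult A (ev Y d2) v))) =
   ?g (ev (umult B Y Z) c2)" by simp
 qed (rule lin|assumption)+
 also have "... = ev (umult B X (umult B Y Z)) c"
  by (simp add: ev_umult um X c) (simp add: smul_def)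
 finally show "ev (umult B (umult B X Y) Z) c = ev (umult B X (umult B Y Z)) c" .
qed (rule lin|assumption)+

lemma one_B_alpha: "alpha B (one B) = one B"
proof (rule ev_eqI)
 fix c assume c: "c \<in>. C"
 have "\<And>d. d \<in>. C \<Longrightarrow> counit C d \<in>. K" by (rule lin|assumption)+
 with c show "ev (alpha B (one B)) c = ev (one B) c"
  by (simp add: ev_alpha one_B ev_one hs_simps hs lin_smult[OF hs_alpha[OF hs(1)]] halg_one alg halg_alpha_one
    hcoalg_counit_alpha_inv coalg)
qed (rule lin)+

lemma smash_hom_algebra: "hom_algebra K B"
proof (rule hom_algebraI[OF hs_B])
 show "bil B B B (mult B)"
  using T_mult_bil bil_same_space[OF same_B same_B same_B] by blast
qed (simp_all add: B_simps(1) one_B umult_B_alpha one_B_alpha umult_B_one_left umult_B_one_right umult_B_assoc)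

end

section \<open>The coproduct of the smash product\<close>

context ground
begin

lemma tmap_tmap:
 assumes [lin]: "Z \<in>. tens V W"
  and f: "lin V V' f" and g: "lin W W' g" and f': "lin V' V'' f'" and g': "lin W' W'' g'"
  and [lin]: "module K V" "module K W" "module K V'" "module K W'" "module K V''" "module K W''"
 shows "tmap V'' W'' f' g' (tmap V' W' f g Z) = tmap V'' W'' (\<lambda>x. f' (f x)) (\<lambda>y. g' (g y)) Z"
proof -
 note [lin] = lin_multilin[OF f] lin_multilin[OF g] lin_multilin[OF f'] lin_multilin[OF g']
 show ?thesis unfolding tmap_def by (rule sw_sweedler_pure) (rule lin|assumption)+
qed

lemma sw_tmap:
 assumes [lin]: "Z \<in>. tens V W"
  and f: "lin V V' f" and g: "lin W W' g"
  and [lin]: "module K V" "module K W" "module K V'" "module K W'" "module K U"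
  and t: "bil V' W' U t"
 shows "sw U (tmap V' W' f g Z) t = sw U Z (\<lambda>x y. t (f x) (g y))"
proof -
 note [lin] = lin_multilin[OF f] lin_multilin[OF g]
 show ?thesis unfolding tmap_def by (rule sw_sweedler_pure) (rule t lin|assumption)+
qed

lemma hcomod_alpha_tmap:
 assumes "hcomod C M \<rho>" "m \<in>. M"
 shows "\<rho> (alpha M m) = tmap M C (alpha M) (alpha C) (\<rho> m)"
 using assms by (simp add: hcomod_def right_hom_comodule_def Let_def tmap_def)

end

context smash_datum
begin

abbreviation "dual2 \<equiv> tens (dual C) (dual C)"
abbreviation "TT \<equiv> tens T T"

lemma dual2_eqI:
 assumes [lin]: "X \<in>. dual2" "Y \<in>. dual2"
  and eq: "\<And>c d. c \<in>. C \<Longrightarrow> d \<in>. C \<Longrightarrow>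
   sw (scalars K) X (\<lambda>f g. dp f c \<otimes> dp g d) = sw (scalars K) Y (\<lambda>f g. dp f c \<otimes> dp g d)"
 shows "X = Y"
proof (rule recovers_separates[OF recovers_evl[OF mods(2) \<Omega> dual_module[OF mods(2)]]])
 note [lin] = bil_multilin[OF evl_bil[OF dual_module[OF mods(2)] mods(2)]]
 fix d assume d [lin]: "d \<in>. C"
 have *: "dp (evl (dual C) d Z) c = sw (scalars K) Z (\<lambda>f g. dp f c \<otimes> dp g d)"
  if [lin]: "Z \<in>. dual2" and c [lin]: "c \<in>. C" for Z c
 proof -
  have "dp (evl (dual C) d Z) c = sw (scalars K) Z (\<lambda>f g. dp (dp g d \<odot>\<^bsub>dual C\<^esub> f) c)"
   unfolding evl_def by (rule sw_hom[where g="\<lambda>f. dp f c"]) (rule lin|assumption)+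
  also have "... = sw (scalars K) Z (\<lambda>f g. dp f c \<otimes> dp g d)"
   by (rule sw_cong) ((rule lin|assumption)+, simp add: dp_smult mods dp_closed[of _ C] c d m_comm)
  finally show ?thesis .
 qed
 show "evl (dual C) d X = evl (dual C) d Y"
  by (rule dual_ext[of _ C]) ((rule lin|assumption)+, simp add: * assms(1,2) eq d)
qed fact+

text \<open>
 The coproduct of \<open>C\<^sup>*\<close> is defined by its pairing with \<open>C \<otimes> C\<close>; its expansion in dual bases shows
 that it exists.
\<close>

definition cop :: "('c \<Rightarrow> 'k) \<Rightarrow> (('c \<Rightarrow> 'k) \<times> ('c \<Rightarrow> 'k)) list set" where
 "cop f = sweedler dual2 \<Omega> (\<lambda>x g. sweedler dual2 \<Omega> (\<lambda>y h.
   dp f (alpha_inv C (alpha_inv C (x \<otimes>\<^bsub>C\<^esub> y))) \<odot>\<^bsub>dual2\<^esub> pure K (dual C) (dual C) g h))"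

lemma \<Omega>_closed [lin]: "\<Omega> \<in>. tens C (dual C)"
 using \<Omega> by (simp add: coevaluation_def)

lemma cop_lin: "lin (dual C) dual2 cop"
 unfolding cop_def by (rule lin|assumption)+

lemmas [lin] = lin_multilin[OF cop_lin]

lemma cop_pairing:
 assumes f [lin]: "f \<in>. dual C" and c [lin]: "c \<in>. C" and d [lin]: "d \<in>. C"
 shows "sw (scalars K) (cop f) (\<lambda>g h. dp g c \<otimes> dp h d) = dp f (alpha_inv C (alpha_inv C (c \<otimes>\<^bsub>C\<^esub> d)))"
proof -
 interpret C: module K C by (rule mods)
 let ?j = "\<lambda>x. alpha_inv C (alpha_inv C x)"
 let ?g = "\<lambda>Z. sw (scalars K) Z (\<lambda>g h. dp g c \<otimes> dp h d)"
 let ?s = "scalars K" and ?p = "pure K (dual C) (dual C)"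
 have p: "?g (?p g h) = dp g c \<otimes> dp h d" if [lin]: "g \<in>. dual C" "h \<in>. dual C" for g h
  by (rule sw_pureI) (rule lin|assumption)+
 have gs: "?g (r \<odot>\<^bsub>dual2\<^esub> ?p g h) = r \<otimes> (dp g c \<otimes> dp h d)"
  if [lin]: "r \<in>. K" "g \<in>. dual C" "h \<in>. dual C" for r g h
 proof -
  have "?g (r \<odot>\<^bsub>dual2\<^esub> ?p g h) = r \<odot>\<^bsub>?s\<^esub> ?g (?p g h)"
   by (rule lin_smult[where f="?g"]) (rule lin|assumption)+
  then show ?thesis by (simp add: p that)
 qed
 have "?g (cop f) = sw ?s \<Omega> (\<lambda>x g. ?g (sweedler dual2 \<Omega> (\<lambda>y h. dp f (?j (x \<otimes>\<^bsub>C\<^esub> y)) \<odot>\<^bsub>dual2\<^esub> ?p g h)))"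
  unfolding cop_def by (rule sw_hom[where g="?g"]) (rule lin|assumption)+
 also have "... = sw ?s \<Omega> (\<lambda>x g. sw ?s \<Omega> (\<lambda>y h. ?g (dp f (?j (x \<otimes>\<^bsub>C\<^esub> y)) \<odot>\<^bsub>dual2\<^esub> ?p g h)))"
  by (rule sw_cong) (rule sw_hom[where g="?g"] lin|assumption)+
 also have "... = sw ?s \<Omega> (\<lambda>x g. sw ?s \<Omega> (\<lambda>y h. dp f (?j ((dp g c \<odot>\<^bsub>C\<^esub> x) \<otimes>\<^bsub>C\<^esub> (dp h d \<odot>\<^bsub>C\<^esub> y)))))"
 proof (rule sw_cong, (rule lin|assumption)+, rule sw_cong)
  fix x y g h assume xy [lin]: "x \<in>. C" "g \<in>. dual C" "y \<in>. C" "h \<in>. dual C"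
  have r [lin]: "dp g c \<in>. K" "dp h d \<in>. K" "dp f (?j (x \<otimes>\<^bsub>C\<^esub> y)) \<in>. K"
   "dp f (?j (x \<otimes>\<^bsub>C\<^esub> (dp h d \<odot>\<^bsub>C\<^esub> y))) \<in>. K" by (rule lin)+
  have "dp f (?j ((dp g c \<odot>\<^bsub>C\<^esub> x) \<otimes>\<^bsub>C\<^esub> (dp h d \<odot>\<^bsub>C\<^esub> y))) = dp g c \<odot>\<^bsub>?s\<^esub> dp f (?j (x \<otimes>\<^bsub>C\<^esub> (dp h d \<odot>\<^bsub>C\<^esub> y)))"
   by (rule lin_smult[where f="\<lambda>x. dp f (?j (x \<otimes>\<^bsub>C\<^esub> (dp h d \<odot>\<^bsub>C\<^esub> y)))"]) (rule lin|assumption)+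
  also have "dp f (?j (x \<otimes>\<^bsub>C\<^esub> (dp h d \<odot>\<^bsub>C\<^esub> y))) = dp h d \<odot>\<^bsub>?s\<^esub> dp f (?j (x \<otimes>\<^bsub>C\<^esub> y))"
   by (rule lin_smult[where f="\<lambda>y. dp f (?j (x \<otimes>\<^bsub>C\<^esub> y))"]) (rule lin|assumption)+
  finally show "?g (dp f (?j (x \<otimes>\<^bsub>C\<^esub> y)) \<odot>\<^bsub>dual2\<^esub> ?p g h) = dp f (?j ((dp g c \<odot>\<^bsub>C\<^esub> x) \<otimes>\<^bsub>C\<^esub> (dp h d \<odot>\<^bsub>C\<^esub> y)))"
   using r by (simp add: gs xy m_ac)
 qed (rule lin|assumption)+
 also have "... = sw ?s \<Omega> (\<lambda>x g. dp f (?j ((dp g c \<odot>\<^bsub>C\<^esub> x) \<otimes>\<^bsub>C\<^esub> sw C \<Omega> (\<lambda>y h. dp h d \<odot>\<^bsub>C\<^esub> y))))"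
 proof (rule sw_cong)
  fix x g assume [lin]: "x \<in>. C" "g \<in>. dual C"
  show "sw ?s \<Omega> (\<lambda>y h. dp f (?j ((dp g c \<odot>\<^bsub>C\<^esub> x) \<otimes>\<^bsub>C\<^esub> (dp h d \<odot>\<^bsub>C\<^esub> y)))) =
    dp f (?j ((dp g c \<odot>\<^bsub>C\<^esub> x) \<otimes>\<^bsub>C\<^esub> sw C \<Omega> (\<lambda>y h. dp h d \<odot>\<^bsub>C\<^esub> y)))"
   by (rule sw_hom[where g="\<lambda>z. dp f (?j ((dp g c \<odot>\<^bsub>C\<^esub> x) \<otimes>\<^bsub>C\<^esub> z))", symmetric]) (rule lin|assumption)+
 qed (rule lin|assumption)+
 also have "... = dp f (?j (sw C \<Omega> (\<lambda>x g. dp g c \<odot>\<^bsub>C\<^esub> x) \<otimes>\<^bsub>C\<^esub> d))"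
  unfolding coev[OF mods(2) \<Omega> d]
  by (rule sw_hom[where g="\<lambda>z. dp f (?j (z \<otimes>\<^bsub>C\<^esub> d))", symmetric]) (rule lin|assumption)+
 finally show ?thesis by (simp add: coev[OF mods(2) \<Omega>] c)
qed

lemma comult_Cd:
 assumes f [lin]: "f \<in>. dual C"
 shows "comult Cd f = cop f"
proof -
 have "comult Cd f = (THE X. X \<in>. dual2 \<and> (\<forall>c\<in>carrier C. \<forall>d\<in>carrier C.
   sw (scalars K) X (\<lambda>f1 f2. dp f1 c \<otimes> dp f2 d) = dp f (alpha_inv C (alpha_inv C (c \<otimes>\<^bsub>C\<^esub> d)))))"
  by (simp add: dual_bialg_def Let_def dp_def)
 also have "... = cop f"
 proof (rule the_equality)
  show "cop f \<in>. dual2 \<and> (\<forall>c\<in>carrier C. \<forall>d\<in>carrier C.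
   sw (scalars K) (cop f) (\<lambda>f1 f2. dp f1 c \<otimes> dp f2 d) = dp f (alpha_inv C (alpha_inv C (c \<otimes>\<^bsub>C\<^esub> d))))"
   by (intro conjI ballI cop_pairing f lin_closed[OF cop_lin])
  then show "X = cop f" if "X \<in>. dual2 \<and> (\<forall>c\<in>carrier C. \<forall>d\<in>carrier C.
   sw (scalars K) X (\<lambda>f1 f2. dp f1 c \<otimes> dp f2 d) = dp f (alpha_inv C (alpha_inv C (c \<otimes>\<^bsub>C\<^esub> d))))" for X
   using that by (intro dual2_eqI) auto
 qed
 finally show ?thesis .
qed

lemma tens_B: "tens B B = TT" "pure K B B = pure K T T" "tens B TT = tens T TT" "pure K B TT = pure K T TT"
 by (rule tensor_same_space[OF same_B same_B] tensor_same_space[OF same_B same_space_refl])+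

lemma comult_B:
 assumes X: "X \<in>. T"
 shows "comult B X = sw TT X (\<lambda>a f. sw TT (comult A a) (\<lambda>a1 a2. sw TT (cop f) (\<lambda>f1 f2.
  pure K T T (sm a1 f1) (sm a2 f2))))"
proof -
 have "comult B X = sw TT X (\<lambda>a f. sw TT (comult A a) (\<lambda>a1 a2. sw TT (comult Cd f) (\<lambda>f1 f2.
   pure K T T (sm a1 f1) (sm a2 f2))))"
  by (simp add: smash_def Let_def tens_Cd)
 also have "... = sw TT X (\<lambda>a f. sw TT (comult A a) (\<lambda>a1 a2. sw TT (cop f) (\<lambda>f1 f2.
  pure K T T (sm a1 f1) (sm a2 f2))))"
  by (rule sw_cong[OF mods(1) dual_module[OF mods(2)] X]) (simp add: comult_Cd)
 finally show ?thesis .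
qed

lemma comult_B_lin: "lin T TT (comult B)"
 by (rule lin_cong[where f="\<lambda>X. sw TT X (\<lambda>a f. sw TT (comult A a) (\<lambda>a1 a2. sw TT (cop f) (\<lambda>f1 f2.
  pure K T T (sm a1 f1) (sm a2 f2))))"])
  (rule lin comult_B[symmetric] | assumption)+

lemmas [lin] = lin_multilin[OF comult_B_lin]

text \<open>An element of \<open>T \<otimes> T\<close> as a function of two variables with values in \<open>A \<otimes> A\<close>.\<close>

definition ev2 where
 "ev2 Z c d = tmap A A (\<lambda>X. ev X c) (\<lambda>X. ev X d) Z"

lemma ev2_multilin [lin]:
 "Z \<in>. TT \<Longrightarrow> c \<in>. C \<Longrightarrow> d \<in>. C \<Longrightarrow> ev2 Z c d \<in>. tens A A"
 "lin X TT f \<Longrightarrow> c \<in>. C \<Longrightarrow> d \<in>. C \<Longrightarrow> lin X (tens A A) (\<lambda>x. ev2 (f x) c d)"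
 unfolding ev2_def tmap_def by (rule lin|assumption)+

lemma ev2_pure:
 assumes [lin]: "X \<in>. T" "Y \<in>. T" "c \<in>. C" "d \<in>. C"
 shows "ev2 (pure K T T X Y) c d = pure K A A (ev X c) (ev Y d)"
 unfolding ev2_def by (rule tmap_pure) (rule lin|assumption)+

lemma sw_ev2:
 assumes "Z \<in>. TT" "c \<in>. C" "d \<in>. C" "bil A A U t" "module K U"
 shows "sw U (ev2 Z c d) t = sw U Z (\<lambda>X Y. t (ev X c) (ev Y d))"
 unfolding ev2_def by (rule sw_tmap) (rule assms lin|assumption)+

lemma tmap_ev_alpha_inv:
 "Z \<in>. TT \<Longrightarrow> c \<in>. C \<Longrightarrow> d \<in>. C \<Longrightarrow>
  tmap A A (evl A c) (evl A d) Z = ev2 Z (alpha_inv C c) (alpha_inv C d)"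
 by (simp add: ev2_def ev_def hs_simps hs)

lemma ev2_eqI:
 assumes Z: "Z \<in>. TT" and Z': "Z' \<in>. TT"
  and eq: "\<And>c d. c \<in>. C \<Longrightarrow> d \<in>. C \<Longrightarrow> ev2 Z c d = ev2 Z' c d"
 shows "Z = Z'"
proof -
 note rec = recovers_evl[OF mods(2) \<Omega> mods(1)]
 note [lin] = bil_multilin[OF evl_bil[OF mods(1) mods(2)]]
 note recl = recovers_tensor_left[OF rec tensor_module[OF mods(1) dual_module[OF mods(2)]]]
 note recr = recovers_tensor_right[OF rec mods(1)]
 show ?thesis
 proof (rule recovers_separates[OF recl Z Z'])
  fix c assume [lin]: "c \<in>. C"
  note c = this
  have cl: "tmap A T (evl A c) (\<lambda>x. x) Y \<in>. tens A T" if "Y \<in>. TT" for Y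
   by (rule tmap_closed[OF that]) (rule lin|assumption)+
  show "tmap A T (evl A c) (\<lambda>w. w) Z = tmap A T (evl A c) (\<lambda>w. w) Z'"
  proof (rule recovers_separates[OF recr cl[OF Z] cl[OF Z']])
   fix d assume d [lin]: "d \<in>. C"
   have "tmap A A (\<lambda>w. w) (evl A d) (tmap A T (evl A c) (\<lambda>w. w) Y) = tmap A A (evl A c) (evl A d) Y"
    if "Y \<in>. TT" for Y
    by (rule tmap_tmap[OF that]) (rule lin|assumption)+
   then show "tmap A A (\<lambda>w. w) (evl A d) (tmap A T (evl A c) (\<lambda>w. w) Z) =
     tmap A A (\<lambda>w. w) (evl A d) (tmap A T (evl A c) (\<lambda>w. w) Z')"
    using eq[of "alpha_inv C c" "alpha_inv C d"] c d Z Z' by (simp add: tmap_ev_alpha_inv hs_simps hs)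
  qed
 qed
qed

text \<open>
 The coproduct of \<open>C\<^sup>*\<close> is dual to the product of \<open>C\<close>, so that the coproduct of a function is
 the coproduct of its value at a product.
\<close>

lemma ev2_comult:
 assumes X: "X \<in>. T" and c [lin]: "c \<in>. C" and d [lin]: "d \<in>. C"
 shows "ev2 (comult B X) c d = comult A (ev X (alpha_inv C (umult C c d)))"
proof (rule tensor_ext[OF mods(1) dual_module[OF mods(2)] X, where U="tens A A"])
 let ?pa = "sm"
 fix a f assume [lin]: "a \<in>. A" and f [lin]: "f \<in>. dual C"
 interpret AA: module K "tens A A" by (rule lin)+
 let ?r = "dp f (umult C c d)"
 have [lin]: "?r \<in>. K" by (rule lin)+
 have inner: "ev2 (sw TT (cop f) (\<lambda>f1 f2. pure K T T (?pa a1 f1) (?pa a2 f2))) c d = ?r \<odot>\<^bsub>tens A A\<^esub> pure K A A a1 a2"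
  if a12 [lin]: "a1 \<in>. A" "a2 \<in>. A" for a1 a2
 proof -
  have p: "pure K A A a1 a2 \<in>. tens A A" by (rule lin)+
  have "ev2 (sw TT (cop f) (\<lambda>f1 f2. pure K T T (?pa a1 f1) (?pa a2 f2))) c d =
    sw (tens A A) (cop f) (\<lambda>f1 f2. ev2 (pure K T T (?pa a1 f1) (?pa a2 f2)) c d)"
   by (rule sw_hom[where g="\<lambda>Z. ev2 Z c d"]) (rule lin|assumption)+
  also have "... = sw (tens A A) (cop f) (\<lambda>f1 f2. (dp f1 (alpha C c) \<otimes> dp f2 (alpha C d)) \<odot>\<^bsub>tens A A\<^esub> pure K A A a1 a2)"
  proof (rule sw_cong, (rule lin|assumption)+, goal_cases)
   case f12 [lin]: (1 f1 f2)
   have r [lin]: "dp f1 (alpha C c) \<in>. K" "dp f2 (alpha C d) \<in>. K" by (rule lin)+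
   have sm: "dp f2 (alpha C d) \<odot>\<^bsub>A\<^esub> a2 \<in>. A" by (rule lin)+
   have "ev2 (pure K T T (?pa a1 f1) (?pa a2 f2)) c d = pure K A A (dp f1 (alpha C c) \<odot>\<^bsub>A\<^esub> a1) (dp f2 (alpha C d) \<odot>\<^bsub>A\<^esub> a2)"
    using f12 a12 c d by (simp add: ev2_pure ev_pure pure_closed mods dual_module)
   then show ?case
    using r a12 sm p by (simp add: pure_smult_left pure_smult_right mods AA.smult_assoc1)
  qed
  also have "... = sw (scalars K) (cop f) (\<lambda>f1 f2. dp f1 (alpha C c) \<otimes> dp f2 (alpha C d)) \<odot>\<^bsub>tens A A\<^esub> pure K A A a1 a2"
   by (rule sw_hom[where g="\<lambda>r. r \<odot>\<^bsub>tens A A\<^esub> pure K A A a1 a2", symmetric]) (rule lin|assumption)+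
  also have "sw (scalars K) (cop f) (\<lambda>f1 f2. dp f1 (alpha C c) \<otimes> dp f2 (alpha C d)) =
    dp f (alpha_inv C (alpha_inv C (alpha C c \<otimes>\<^bsub>C\<^esub> alpha C d)))"
   by (rule cop_pairing) (rule lin)+
  also have "alpha_inv C (alpha_inv C (alpha C c \<otimes>\<^bsub>C\<^esub> alpha C d)) = umult C c d"
   using c d by (simp add: umult_def halg_alpha_mult[symmetric] alg hs_simps hs halg_mult_multilin)
  finally show ?thesis .
 qed
 have "comult B (?pa a f) = sw TT (comult A a) (\<lambda>a1 a2. sw TT (cop f) (\<lambda>f1 f2. pure K T T (?pa a1 f1) (?pa a2 f2)))"
  by (subst comult_B) ((rule lin)+, rule sw_pureI, (rule lin|assumption)+)
 then have "ev2 (comult B (?pa a f)) c d = sw (tens A A) (comult A a) (\<lambda>a1 a2.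
   ev2 (sw TT (cop f) (\<lambda>f1 f2. pure K T T (?pa a1 f1) (?pa a2 f2))) c d)"
  by (simp only:) (rule sw_hom[where g="\<lambda>Z. ev2 Z c d"], (rule lin|assumption)+)
 also have "... = sw (tens A A) (comult A a) (\<lambda>a1 a2. ?r \<odot>\<^bsub>tens A A\<^esub> pure K A A a1 a2)"
  by (rule sw_cong) (rule inner lin|assumption)+
 also have "... = ?r \<odot>\<^bsub>tens A A\<^esub> sw (tens A A) (comult A a) (pure K A A)"
  by (rule sw_hom[where g="\<lambda>x. ?r \<odot>\<^bsub>tens A A\<^esub> x", symmetric]) (rule lin|assumption)+
 also have "sw (tens A A) (comult A a) (pure K A A) = comult A a"
  by (rule sw_pure_id) (rule lin)+
 also have "?r \<odot>\<^bsub>tens A A\<^esub> comult A a = comult A (?r \<odot>\<^bsub>A\<^esub> a)"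
  by (rule lin_smult[OF hcoalg_lin(1)[OF coalg(1)], symmetric]) (rule lin)+
 also have "?r \<odot>\<^bsub>A\<^esub> a = ev (?pa a f) (alpha_inv C (umult C c d))"
  using c d by (simp add: ev_pure f \<open>a \<in>. A\<close> hs_simps hs umult_multilin alg)
 finally show "ev2 (comult B (?pa a f)) c d = comult A (ev (?pa a f) (alpha_inv C (umult C c d)))" .
qed (rule lin|assumption)+

lemma counit_B:
 assumes X: "X \<in>. T"
 shows "counit B X = counit A (ev X (one C))"
proof -
 have "counit B X = sw (scalars K) X (\<lambda>a f. counit A a \<otimes> dp f (one C))"
  by (simp add: smash_def Let_def dual_bialg_def dp_def)
 also have "... = counit A (ev X (one C))"
 proof (rule tensor_ext[OF mods(1) dual_module[OF mods(2)] X, where U="scalars K"])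
  fix a f assume af [lin]: "a \<in>. A" "f \<in>. dual C"
  have r: "dp f (one C) \<in>. K" "counit A a \<in>. K" by (rule lin)+
  have "sw (scalars K) (sm a f) (\<lambda>a f. counit A a \<otimes> dp f (one C)) = counit A a \<otimes> dp f (one C)"
   by (rule sw_pureI) (rule lin|assumption)+
  also have "... = counit A (ev (sm a f) (one C))"
   using r af by (simp add: ev_pure halg_one alg halg_alpha_one lin_smult[OF hcoalg_lin(2)[OF coalg(1)]] m_comm)
  finally show "sw (scalars K) (sm a f) (\<lambda>a f. counit A a \<otimes> dp f (one C)) =
    counit A (ev (sm a f) (one C))" .
 qed (rule lin|assumption)+
 finally show ?thesis .
qed

lemma counit_B_lin: "lin T (scalars K) (counit B)"
 by (rule lin_cong[where f="\<lambda>X. counit A (ev X (one C))"]) (rule lin counit_B[symmetric] | assumption)+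

lemmas [lin] = lin_multilin(1)[OF counit_B_lin, simplified] lin_multilin[OF counit_B_lin]

section \<open>The smash product is a Hom-coalgebra\<close>

abbreviation "AA2 \<equiv> tens A A"
abbreviation "T3 \<equiv> tens T TT"
abbreviation "A3 \<equiv> tens A AA2"

definition ev3 where
 "ev3 Z b c d = tmap A AA2 (\<lambda>X. ev X b) (\<lambda>Y. ev2 Y c d) Z"

lemma umult_alpha_inv:
 "c \<in>. C \<Longrightarrow> d \<in>. C \<Longrightarrow>
  umult C (alpha_inv C c) (alpha_inv C d) = alpha_inv C (umult C c d)"
 by (simp add: umult_def halg_inv_mult alg halg_mult_multilin hs_simps hs)

lemma ev3_pure:
 assumes [lin]: "X \<in>. T" "Y \<in>. TT" "b \<in>. C" "c \<in>. C" "d \<in>. C"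
 shows "ev3 (pure K T TT X Y) b c d = pure K A AA2 (ev X b) (ev2 Y c d)"
 unfolding ev3_def by (rule tmap_pure) (rule lin|assumption)+

lemma ev3_lin:
 assumes [lin]: "b \<in>. C" "c \<in>. C" "d \<in>. C"
 shows "lin T3 A3 (\<lambda>Z. ev3 Z b c d)"
 unfolding ev3_def by (rule tmap_lin) (rule lin|assumption)+

lemma ev3_eqI:
 assumes Z: "Z \<in>. T3" and Z': "Z' \<in>. T3"
  and eq: "\<And>b c d. b \<in>. C \<Longrightarrow> c \<in>. C \<Longrightarrow> d \<in>. C \<Longrightarrow> ev3 Z b c d = ev3 Z' b c d"
 shows "Z = Z'"
proof -
 have TTm: "module K TT" by (rule lin)+
 note rec = recovers_evl[OF mods(2) \<Omega> mods(1)]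
 note [lin] = bil_multilin[OF evl_bil[OF mods(1) mods(2)]]
 note rec1 = recovers_tensor_left[OF rec TTm]
 note rec2 = recovers_tensor_right[OF recovers_tensor_left[OF rec tensor_module[OF mods(1) dual_module[OF mods(2)]]] mods(1)]
 note rec3 = recovers_tensor_right[OF recovers_tensor_right[OF rec mods(1)] mods(1)]
 show ?thesis
 proof (rule recovers_separates[OF rec1 Z Z'])
  fix b assume b [lin]: "b \<in>. C"
  let ?f = "\<lambda>Y. tmap A TT (evl A b) (\<lambda>w. w) Y"
  have cl1: "?f Y \<in>. tens A TT" if "Y \<in>. T3" for Y
   by (rule tmap_closed[OF that]) (rule lin|assumption)+
  show "?f Z = ?f Z'"
  proof (rule recovers_separates[OF rec2 cl1[OF Z] cl1[OF Z']])
   fix c assume c [lin]: "c \<in>. C"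
   let ?g' = "tmap A T (evl A c) (\<lambda>w. w)"
   let ?g = "\<lambda>Y. tmap A (tens A T) (\<lambda>w. w) ?g' Y"
   have g': "lin TT (tens A T) ?g'"
    by (rule tmap_lin) (rule lin|assumption)+
   have cl2: "?g (?f Y) \<in>. tens A (tens A T)" if "Y \<in>. T3" for Y
    by (rule tmap_closed[OF cl1[OF that] _ g']) (rule lin|assumption)+
   show "?g (?f Z) = ?g (?f Z')"
   proof (rule recovers_separates[OF rec3 cl2[OF Z] cl2[OF Z']])
    fix d assume d [lin]: "d \<in>. C"
    let ?h' = "tmap A A (\<lambda>w. w) (evl A d)"
    let ?h = "\<lambda>Y. tmap A AA2 (\<lambda>w. w) ?h' Y"
    have h': "lin (tens A T) AA2 ?h'"
     by (rule tmap_lin) (rule lin|assumption)+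
    have *: "?h (?g (?f Y)) = ev3 Y (alpha_inv C b) (alpha_inv C c) (alpha_inv C d)"
     if Y: "Y \<in>. T3" for Y
    proof -
     have "?g (?f Y) = tmap A (tens A T) (evl A b) ?g' Y"
      by (rule tmap_tmap[OF Y _ _ _ g']) (rule lin|assumption)+
     then have "?h (?g (?f Y)) = ?h (tmap A (tens A T) (evl A b) ?g' Y)" by simp
     also have "... = tmap A AA2 (evl A b) (\<lambda>V. ?h' (?g' V)) Y"
      by (rule tmap_tmap[OF Y _ g' _ h']) (rule lin|assumption)+
     also have "... = tmap A AA2 (evl A b) (\<lambda>V. ev2 V (alpha_inv C c) (alpha_inv C d)) Y"
      unfolding tmap_def[of A AA2]
     proof (rule sw_cong[OF _ TTm Y])
      fix V assume V: "V \<in>. TT"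
      have "?h' (?g' V) = tmap A A (evl A c) (evl A d) V"
       by (rule tmap_tmap[OF V]) (rule lin|assumption)+
      then show "pure K A AA2 (evl A b x) (?h' (?g' V)) =
        pure K A AA2 (evl A b x) (ev2 V (alpha_inv C c) (alpha_inv C d))" for x
       using V c d by (simp add: tmap_ev_alpha_inv)
     qed (rule lin|assumption)+
     finally show ?thesis using b by (simp add: ev3_def ev_def hs_simps hs)
    qed
    show "?h (?g (?f Z)) = ?h (?g (?f Z'))"
     using b c d by (simp add: * Z Z' eq alpha_inv_closed hs)
   qed
  qed
 qed
qed

lemma comult_B_alpha:
 assumes X [lin]: "X \<in>. T"
 shows "sw TT (comult B X) (\<lambda>X1 X2. pure K T T (alpha B X1) (alpha B X2)) = comult B (alpha B X)"
proof (rule ev2_eqI)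
 fix c d assume cd [lin]: "c \<in>. C" "d \<in>. C"
 let ?j = "alpha_inv C"
 have j: "?j c \<in>. C" "?j d \<in>. C" by (rule lin)+
 have "ev2 (sw TT (comult B X) (\<lambda>X1 X2. pure K T T (alpha B X1) (alpha B X2))) c d =
   sw AA2 (comult B X) (\<lambda>X1 X2. ev2 (pure K T T (alpha B X1) (alpha B X2)) c d)"
  by (rule sw_hom[where g="\<lambda>Z. ev2 Z c d"]) (rule lin|assumption)+
 also have "... = sw AA2 (comult B X) (\<lambda>X1 X2. pure K A A (alpha A (ev X1 (?j c))) (alpha A (ev X2 (?j d))))"
  by (rule sw_cong) ((rule lin|assumption)+, simp add: ev2_pure cd lin_closed[OF T_alpha_lin] ev_alpha)
 also have "... = sw AA2 (ev2 (comult B X) (?j c) (?j d)) (\<lambda>a1 a2. pure K A A (alpha A a1) (alpha A a2))"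
  by (rule sw_ev2[symmetric]) (rule lin|assumption)+
 also have "... = comult A (alpha A (ev X (?j (umult C (?j c) (?j d)))))"
  unfolding ev2_comult[OF X j] tmap_def[symmetric]
  by (rule hcomod_alpha_tmap[OF comod(1), symmetric]) (rule lin)+
 also have "umult C (?j c) (?j d) = ?j (umult C c d)"
  using cd by (rule umult_alpha_inv)
 also have "comult A (alpha A (ev X (?j (?j (umult C c d))))) = ev2 (comult B (alpha B X)) c d"
  using cd by (simp add: ev2_comult lin_closed[OF T_alpha_lin] X ev_alpha hs_simps hs umult_multilin alg)
 finally show "ev2 (sw TT (comult B X) (\<lambda>X1 X2. pure K T T (alpha B X1) (alpha B X2))) c d = ev2 (comult B (alpha B X)) c d" .
qed (rule lin|assumption)+

lemma counit_B_left:
 assumes X [lin]: "X \<in>. T"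
 shows "sw T (comult B X) (\<lambda>X1 X2. counit B X1 \<odot>\<^bsub>T\<^esub> X2) = alpha B X"
proof (rule ev_eqI)
 fix c assume c [lin]: "c \<in>. C"
 have one [lin]: "one C \<in>. C" by (rule lin)+
 have cl: "ev X (alpha_inv C c) \<in>. A" by (rule lin)+
 have "ev (sw T (comult B X) (\<lambda>X1 X2. counit B X1 \<odot>\<^bsub>T\<^esub> X2)) c = sw A (comult B X) (\<lambda>X1 X2. ev (counit B X1 \<odot>\<^bsub>T\<^esub> X2) c)"
  by (rule sw_hom[where g="\<lambda>X. ev X c"]) (rule lin|assumption)+
 also have "... = sw A (comult B X) (\<lambda>X1 X2. counit A (ev X1 (one C)) \<odot>\<^bsub>A\<^esub> ev X2 c)"
 proof (rule sw_cong, (rule lin|assumption)+, goal_cases)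
  case X12 [lin]: (1 X1 X2)
  have "ev (counit B X1 \<odot>\<^bsub>T\<^esub> X2) c = counit B X1 \<odot>\<^bsub>A\<^esub> ev X2 c"
   by (rule lin_smult[OF bil_left[OF ev_bil]]) (rule lin)+
  then show ?case by (simp add: counit_B X12)
 qed
 also have "... = sw A (ev2 (comult B X) (one C) c) (\<lambda>a1 a2. counit A a1 \<odot>\<^bsub>A\<^esub> a2)"
  by (rule sw_ev2[symmetric]) (rule lin|assumption)+
 also have "... = sw A (comult A (ev X (alpha_inv C c))) (\<lambda>a1 a2. counit A a1 \<odot>\<^bsub>A\<^esub> a2)"
  by (simp add: ev2_comult X one c umult_one alg)
 also have "... = alpha A (ev X (alpha_inv C c))"
  using coalg(1) cl by (simp add: hcoalg_def hom_coalgebra_def Let_def)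
 finally show "ev (sw T (comult B X) (\<lambda>X1 X2. counit B X1 \<odot>\<^bsub>T\<^esub> X2)) c = ev (alpha B X) c"
  by (simp add: ev_alpha X c)
qed (rule lin|assumption)+

lemma counit_B_right:
 assumes X [lin]: "X \<in>. T"
 shows "sw T (comult B X) (\<lambda>X1 X2. counit B X2 \<odot>\<^bsub>T\<^esub> X1) = alpha B X"
proof (rule ev_eqI)
 fix c assume c [lin]: "c \<in>. C"
 have one [lin]: "one C \<in>. C" by (rule lin)+
 have cl: "ev X (alpha_inv C c) \<in>. A" by (rule lin)+
 have "ev (sw T (comult B X) (\<lambda>X1 X2. counit B X2 \<odot>\<^bsub>T\<^esub> X1)) c = sw A (comult B X) (\<lambda>X1 X2. ev (counit B X2 \<odot>\<^bsub>T\<^esub> X1) c)"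
  by (rule sw_hom[where g="\<lambda>X. ev X c"]) (rule lin|assumption)+
 also have "... = sw A (comult B X) (\<lambda>X1 X2. counit A (ev X2 (one C)) \<odot>\<^bsub>A\<^esub> ev X1 c)"
 proof (rule sw_cong, (rule lin|assumption)+, goal_cases)
  case X12 [lin]: (1 X1 X2)
  have "ev (counit B X2 \<odot>\<^bsub>T\<^esub> X1) c = counit B X2 \<odot>\<^bsub>A\<^esub> ev X1 c"
   by (rule lin_smult[OF bil_left[OF ev_bil]]) (rule lin)+
  then show ?case by (simp add: counit_B X12)
 qed
 also have "... = sw A (ev2 (comult B X) c (one C)) (\<lambda>a1 a2. counit A a2 \<odot>\<^bsub>A\<^esub> a1)"
  by (rule sw_ev2[symmetric]) (rule lin|assumption)+
 also have "... = sw A (comult A (ev X (alpha_inv C c))) (\<lambda>a1 a2. counit A a2 \<odot>\<^bsub>A\<^esub> a1)"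
  by (simp add: ev2_comult X one c umult_one alg)
 also have "... = alpha A (ev X (alpha_inv C c))"
  using coalg(1) cl by (simp add: hcoalg_def hom_coalgebra_def Let_def)
 finally show "ev (sw T (comult B X) (\<lambda>X1 X2. counit B X2 \<odot>\<^bsub>T\<^esub> X1)) c = ev (alpha B X) c"
  by (simp add: ev_alpha X c)
qed (rule lin|assumption)+

text \<open>
 Evaluated at \<open>(b, c, d)\<close>, both sides are iterated coproducts of the value at the product of \<open>b\<close>,
 \<open>c\<close> and \<open>d\<close>, so that the associativity of \<open>C\<close> and the coassociativity of \<open>A\<close> are what remains.
\<close>

lemma comult_B_coassoc:
 assumes X [lin]: "X \<in>. T"
 shows "sw T3 (comult B X) (\<lambda>X1 X2. sw T3 (comult B X1) (\<lambda>X11 X12. pure K T TT X11 (pure K T T X12 (alpha B X2)))) =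
  sw T3 (comult B X) (\<lambda>X1 X2. pure K T TT (alpha B X1) (comult B X2))"
proof (rule ev3_eqI)
 fix b c d assume bcd [lin]: "b \<in>. C" "c \<in>. C" "d \<in>. C"
 let ?j = "alpha_inv C"
 note [lin] = lin_multilin[OF ev3_lin[OF bcd]]
 have j: "?j b \<in>. C" "?j d \<in>. C" "?j (umult C b c) \<in>. C" "?j (umult C c d) \<in>. C"
  by (rule lin)+
 let ?e = "\<lambda>Z. ev3 Z b c d"
 let ?y = "ev X (?j (?j (umult C (umult C b c) d)))"
 have y: "?y \<in>. A" by (rule lin)+
 have arg: "umult C (?j (umult C b c)) (?j d) = ?j (umult C (umult C b c) d)"
  "umult C (?j b) (?j (umult C c d)) = ?j (umult C (umult C b c) d)"
  using bcd by (simp_all add: umult_alpha_inv umult_multilin alg umult_assoc)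
 let ?G = "\<lambda>y1 y2. sw A3 (comult A y1) (\<lambda>a1 a2. pure K A AA2 a1 (pure K A A a2 (alpha A y2)))"
 have "?e (sw T3 (comult B X) (\<lambda>X1 X2. sw T3 (comult B X1) (\<lambda>X11 X12. pure K T TT X11 (pure K T T X12 (alpha B X2))))) =
   sw A3 (comult B X) (\<lambda>X1 X2. ?e (sw T3 (comult B X1) (\<lambda>X11 X12. pure K T TT X11 (pure K T T X12 (alpha B X2)))))"
  by (rule sw_hom[where g="?e"]) (rule lin|assumption)+
 also have "... = sw A3 (comult B X) (\<lambda>X1 X2. ?G (ev X1 (?j (umult C b c))) (ev X2 (?j d)))"
 proof (rule sw_cong, (rule lin|assumption)+, goal_cases)
  case X12 [lin]: (1 X1 X2)
  have "?e (sw T3 (comult B X1) (\<lambda>X11 X12. pure K T TT X11 (pure K T T X12 (alpha B X2)))) =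
    sw A3 (comult B X1) (\<lambda>X11 X12. ?e (pure K T TT X11 (pure K T T X12 (alpha B X2))))"
   by (rule sw_hom[where g="?e"]) (rule lin|assumption)+
  also have "... = sw A3 (comult B X1) (\<lambda>X11 X12. pure K A AA2 (ev X11 b) (pure K A A (ev X12 c) (alpha A (ev X2 (?j d)))))"
  proof (rule sw_cong, (rule lin|assumption)+, goal_cases)
   case [lin]: (1 X11 X12)
   have "?e (pure K T TT X11 (pure K T T X12 (alpha B X2))) = pure K A AA2 (ev X11 b) (ev2 (pure K T T X12 (alpha B X2)) c d)"
    by (rule ev3_pure) (rule lin)+
   also have "ev2 (pure K T T X12 (alpha B X2)) c d = pure K A A (ev X12 c) (ev (alpha B X2) d)"
    by (rule ev2_pure) (rule lin)+
   finally show ?case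
    by (simp add: ev_alpha X12 bcd)
  qed
  also have "... = sw A3 (ev2 (comult B X1) b c) (\<lambda>a1 a2. pure K A AA2 a1 (pure K A A a2 (alpha A (ev X2 (?j d)))))"
   by (rule sw_ev2[symmetric]) (rule lin|assumption)+
  finally show ?case by (simp add: ev2_comult X12 bcd)
 qed
 also have "... = sw A3 (ev2 (comult B X) (?j (umult C b c)) (?j d)) ?G"
  by (rule sw_ev2[symmetric]) (rule lin|assumption)+
 finally have L: "?e (sw T3 (comult B X) (\<lambda>X1 X2. sw T3 (comult B X1) (\<lambda>X11 X12. pure K T TT X11 (pure K T T X12 (alpha B X2))))) =
   sw A3 (comult A ?y) ?G" by (simp add: ev2_comult X j arg)
 let ?H = "\<lambda>y1 y2. pure K A AA2 (alpha A y1) (comult A y2)"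
 have "?e (sw T3 (comult B X) (\<lambda>X1 X2. pure K T TT (alpha B X1) (comult B X2))) =
   sw A3 (comult B X) (\<lambda>X1 X2. ?e (pure K T TT (alpha B X1) (comult B X2)))"
  by (rule sw_hom[where g="?e"]) (rule lin|assumption)+
 also have "... = sw A3 (comult B X) (\<lambda>X1 X2. ?H (ev X1 (?j b)) (ev X2 (?j (umult C c d))))"
 proof (rule sw_cong, (rule lin|assumption)+, goal_cases)
  case X12 [lin]: (1 X1 X2)
  have "?e (pure K T TT (alpha B X1) (comult B X2)) = pure K A AA2 (ev (alpha B X1) b) (ev2 (comult B X2) c d)"
   by (rule ev3_pure) (rule lin)+
  then show ?case
   by (simp add: ev_alpha ev2_comult X12 bcd)
 qed
 also have "... = sw A3 (ev2 (comult B X) (?j b) (?j (umult C c d))) ?H"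
  by (rule sw_ev2[symmetric]) (rule lin|assumption)+
 also have "... = sw A3 (comult A ?y) ?H" by (simp add: ev2_comult X j arg)
 also have "... = sw A3 (comult A ?y) ?G"
  using coalg(1) y by (simp add: hcoalg_def hom_coalgebra_def Let_def)
 finally show "?e (sw T3 (comult B X) (\<lambda>X1 X2. sw T3 (comult B X1) (\<lambda>X11 X12. pure K T TT X11 (pure K T T X12 (alpha B X2))))) =
   ?e (sw T3 (comult B X) (\<lambda>X1 X2. pure K T TT (alpha B X1) (comult B X2)))" using L by simp
qed (rule lin|assumption)+

lemma counit_B_alpha: "X \<in>. T \<Longrightarrow> counit B (alpha B X) = counit B X"
 by (simp add: counit_B lin_closed[OF T_alpha_lin] ev_alpha halg_one alg halg_inv_one hcoalg_counit_alpha coalg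
   ev_multilin(1))

lemma smash_hom_coalgebra: "hom_coalgebra K B"
proof -
 have "hom_vector_space K B" using hs_B by (simp add: hs_def)
 moreover have "smult B = smult T" using same_B by (simp add: same_space_def)
 ultimately show ?thesis
  unfolding hom_coalgebra_def Let_def tens_B B_simps(1) sw_same_space[OF same_B]
   lin_same_space[OF same_B same_space_refl]
  by (simp add: comult_B_lin counit_B_lin counit_B_alpha comult_B_alpha counit_B_left counit_B_right comult_B_coassoc)
qed

lemma B_halg: "halg B"
 using smash_hom_algebra hs_B by (simp add: halg_def hs_def)

lemma alpha_inv_B_multilin [lin]:
 "X \<in>. T \<Longrightarrow> alpha_inv B X \<in>. T"
 "lin U T f \<Longrightarrow> lin U T (\<lambda>x. alpha_inv B (f x))"
 using alpha_inv_closed[OF _ hs_B, of X] lin_alpha_inv[OF _ hs_B, of U f]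
 by (simp_all add: B_simps(1) lin_same_space[OF same_space_refl same_B])

section \<open>The smash product is a Hom-bialgebra\<close>

abbreviation "\<delta>B \<equiv> ucoact B (comult B)"

lemma \<delta>B_multilin [lin]:
 "X \<in>. T \<Longrightarrow> \<delta>B X \<in>. TT"
 "lin U T f \<Longrightarrow> lin U TT (\<lambda>x. \<delta>B (f x))"
 unfolding ucoact_def by (rule lin|assumption)+

lemma ev_alpha_inv:
 assumes X: "X \<in>. T" and c: "c \<in>. C"
 shows "ev (alpha_inv B X) (alpha_inv C c) = alpha_inv A (ev X c)"
proof (rule alpha_inv_eqI[OF hs(1), symmetric])
 have Y: "alpha_inv B X \<in>. T" by (rule lin X)+
 show "ev (alpha_inv B X) (alpha_inv C c) \<in>. A" by (rule lin X c)+
 show "alpha A (ev (alpha_inv B X) (alpha_inv C c)) = ev X c"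
  using alpha_alpha_inv[OF hs_B, of X] X by (simp add: ev_alpha[OF Y c, symmetric] B_simps(1))
qed

lemma ev2_\<delta>B:
 assumes X: "X \<in>. T" and "c \<in>. C" "d \<in>. C"
 shows "ev2 (\<delta>B X) c d = \<delta>A (ev X (umult C c d))"
 using assms by (simp add: ucoact_def ev2_comult alpha_inv_B_multilin ev_alpha_inv umult_multilin alg)

lemma umult_B_tril: "bil T T T (umult B)"
 unfolding umult_def[abs_def] by (rule lin|assumption)+

lemmas [lin] = bil_multilin[OF umult_B_tril]

lemma \<delta>A_umult:
 assumes [lin]: "x \<in>. A" "u \<in>. A"
 shows "\<delta>A (umult A x u) = sw AA2 (\<delta>A u) (\<lambda>u1 u2. sw AA2 (\<delta>A x)
  (\<lambda>x1 x2. pure K A A (umult A x1 u1) (umult A x2 u2)))"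
proof -
 have "\<delta>A (umult A x u) = sw AA2 (\<delta>A (umult A x u)) (pure K A A)"
  by (rule sw_pure_id[symmetric]) (rule lin|assumption)+
 also have "... = sw AA2 (\<delta>A x) (\<lambda>x1 x2. sw AA2 (\<delta>A u)
  (\<lambda>u1 u2. pure K A A (umult A x1 u1) (umult A x2 u2)))"
  by (rule hbialg_ucomult_umult[OF A]) (rule lin|assumption)+
 also have "... = sw AA2 (\<delta>A u) (\<lambda>u1 u2. sw AA2 (\<delta>A x)
  (\<lambda>x1 x2. pure K A A (umult A x1 u1) (umult A x2 u2)))"
  by (rule sw_swap) (rule lin|assumption)+
 finally show ?thesis .
qed

lemma pure_smul_smul:
 assumes [lin]: "X1 \<in>. T" "X2 \<in>. T" "Y1 \<in>. T" "Y2 \<in>. T"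
  "k \<in>. C" "l \<in>. C"
 shows "pure K A A (smul X1 Y1 k) (smul X2 Y2 l) =
  sw AA2 (\<delta>C k) (\<lambda>k1 k2. sw AA2 (\<delta>C l) (\<lambda>l1 l2.
   sw AA2 (ent (ev Y1 k2) k1) (\<lambda>u1 q1. sw AA2 (ent (ev Y2 l2) l1) (\<lambda>u2 q2.
    pure K A A (umult A (ev X1 q1) u1) (umult A (ev X2 q2) u2)))))"
proof -
 let ?s1 = "\<lambda>k1 k2. act_on X1 (ev Y1 k2) k1"
 let ?s2 = "\<lambda>l1 l2. act_on X2 (ev Y2 l2) l1"
 have "pure K A A (smul X1 Y1 k) (smul X2 Y2 l) =
   sw AA2 (\<delta>C k) (\<lambda>k1 k2. pure K A A (?s1 k1 k2) (smul X2 Y2 l))"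
  unfolding smul_def[of X1] by (rule sw_hom[where g="\<lambda>x. pure K A A x (smul X2 Y2 l)"]) (rule lin|assumption)+
 also have "... = sw AA2 (\<delta>C k) (\<lambda>k1 k2. sw AA2 (\<delta>C l) (\<lambda>l1 l2. pure K A A (?s1 k1 k2) (?s2 l1 l2)))"
 proof (rule sw_cong, (rule lin|assumption)+, goal_cases)
  case [lin]: (1 k1 k2)
  show ?case
   unfolding smul_def by (rule sw_hom[where g="\<lambda>x. pure K A A (?s1 k1 k2) x"]) (rule lin|assumption)+
 qed
 also have "... = sw AA2 (\<delta>C k) (\<lambda>k1 k2. sw AA2 (\<delta>C l) (\<lambda>l1 l2.
   sw AA2 (ent (ev Y1 k2) k1) (\<lambda>u1 q1. sw AA2 (ent (ev Y2 l2) l1) (\<lambda>u2 q2.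
    pure K A A (umult A (ev X1 q1) u1) (umult A (ev X2 q2) u2)))))"
 proof (rule sw_cong, (rule lin|assumption)+, rule sw_cong, (rule lin|assumption)+, goal_cases)
  case [lin]: (1 k1 k2 l1 l2)
  have "pure K A A (?s1 k1 k2) (?s2 l1 l2) =
    sw AA2 (ent (ev Y1 k2) k1) (\<lambda>u1 q1. pure K A A (umult A (ev X1 q1) u1) (?s2 l1 l2))"
   by (rule sw_hom[where g="\<lambda>x. pure K A A x (?s2 l1 l2)"]) (rule lin|assumption)+
  also have "... = sw AA2 (ent (ev Y1 k2) k1) (\<lambda>u1 q1. sw AA2 (ent (ev Y2 l2) l1) (\<lambda>u2 q2.
    pure K A A (umult A (ev X1 q1) u1) (umult A (ev X2 q2) u2)))"
   by (rule sw_cong) (rule sw_hom lin bil_right[OF pure_bil] | assumption)+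
  finally show ?case .
 qed
 finally show ?thesis .
qed

text \<open>
 At \<open>(k, l)\<close> the left-hand side is the coproduct in \<open>A\<close> of \<open>(X Y)(k l)\<close>. The coproduct of \<open>k l\<close> is the
 product of the coproducts, and \<open>ent_monoidal\<close> splits the entwining of \<open>Y(k\<^sub>2 l\<^sub>2)\<close> with \<open>k\<^sub>1 l\<^sub>1\<close> into
 the entwinings of the components of \<open>\<Delta> Y\<close> with \<open>k\<^sub>1\<close> and \<open>l\<^sub>1\<close>.
\<close>

lemma \<delta>B_umult:
 assumes X [lin]: "X \<in>. T" and Y [lin]: "Y \<in>. T"
 shows "\<delta>B (umult B X Y) = sw TT (\<delta>B X) (\<lambda>X1 X2. sw TT (\<delta>B Y) (\<lambda>Y1 Y2.
  pure K T T (umult B X1 Y1) (umult B X2 Y2)))"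
proof (rule ev2_eqI)
 fix k l assume kl [lin]: "k \<in>. C" "l \<in>. C"
 let ?p = "\<lambda>X1 X2 u1 u2 q1 q2. pure K A A (umult A (ev X1 q1) u1) (umult A (ev X2 q2) u2)"
 let ?t = "\<lambda>u1 u2 q. sw AA2 (\<delta>A (ev X q)) (\<lambda>x1 x2. pure K A A (umult A x1 u1) (umult A x2 u2))"
 let ?F = "\<lambda>c1 c2. sw AA2 (ent (ev Y c2) c1) (\<lambda>u q. \<delta>A (umult A (ev X q) u))"
 have G: "lin A AA2 \<delta>A" by (rule lin|assumption)+
 have "ev2 (\<delta>B (umult B X Y)) k l = \<delta>A (smul X Y (umult C k l))"
  by (simp add: ev2_\<delta>B umult_B_closed X Y kl ev_umult umult_multilin alg)
 also have "... = sw AA2 (\<delta>C (umult C k l)) (\<lambda>c1 c2. \<delta>A (act_on X (ev Y c2) c1))"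
  unfolding smul_def by (rule sw_hom[where g=\<delta>A]) (rule G lin|assumption)+
 also have "... = sw AA2 (\<delta>C (umult C k l)) ?F"
  by (rule sw_cong) (rule sw_hom[where g=\<delta>A] G lin|assumption)+
 also have "... = sw AA2 (\<delta>C k) (\<lambda>k1 k2. sw AA2 (\<delta>C l) (\<lambda>l1 l2. ?F (umult C k1 l1) (umult C k2 l2)))"
  by (rule hbialg_ucomult_umult[OF C]) (rule lin|assumption)+
 also have "... = sw AA2 (\<delta>C k) (\<lambda>k1 k2. sw AA2 (\<delta>C l) (\<lambda>l1 l2. sw AA2 (\<delta>B Y) (\<lambda>Y1 Y2.
   sw AA2 (ent (ev Y1 k2) k1) (\<lambda>u1 q1. sw AA2 (ent (ev Y2 l2) l1) (\<lambda>u2 q2.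
    sw AA2 (\<delta>B X) (\<lambda>X1 X2. ?p X1 X2 u1 u2 q1 q2))))))"
 proof (rule sw_cong, (rule lin|assumption)+, rule sw_cong, (rule lin|assumption)+, goal_cases)
  case k12 [lin]: (1 k1 k2 l1 l2)
  have "?F (umult C k1 l1) (umult C k2 l2) = sw AA2 (ent (ev Y (umult C k2 l2)) (umult C k1 l1))
    (\<lambda>u q. sw AA2 (\<delta>A u) (\<lambda>u1 u2. ?t u1 u2 q))"
   by (rule sw_cong) (rule \<delta>A_umult lin|assumption)+
  also have "... = sw AA2 (\<delta>A (ev Y (umult C k2 l2))) (\<lambda>y1 y2. sw AA2 (ent y1 k1) (\<lambda>u1 q1.
    sw AA2 (ent y2 l1) (\<lambda>u2 q2. ?t u1 u2 (umult C q1 q2))))"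
   by (rule ent_monoidal) (rule lin|assumption)+
  also have "... = sw AA2 (\<delta>B Y) (\<lambda>Y1 Y2. sw AA2 (ent (ev Y1 k2) k1) (\<lambda>u1 q1.
    sw AA2 (ent (ev Y2 l2) l1) (\<lambda>u2 q2. ?t u1 u2 (umult C q1 q2))))"
   unfolding ev2_\<delta>B[OF Y k12(2,4), symmetric] by (rule sw_ev2) (rule lin|assumption)+
  also have "... = sw AA2 (\<delta>B Y) (\<lambda>Y1 Y2. sw AA2 (ent (ev Y1 k2) k1) (\<lambda>u1 q1.
    sw AA2 (ent (ev Y2 l2) l1) (\<lambda>u2 q2. sw AA2 (\<delta>B X) (\<lambda>X1 X2. ?p X1 X2 u1 u2 q1 q2))))"
  proof (rule sw_cong, (rule lin|assumption)+, rule sw_cong, (rule lin|assumption)+, rule sw_cong)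
   fix Y1 Y2 u1 q1 u2 q2 assume [lin]: "Y1 \<in>. T" "Y2 \<in>. T" "u1 \<in>. A" "u2 \<in>. A"
    and q [lin]: "q1 \<in>. C" "q2 \<in>. C"
   show "?t u1 u2 (umult C q1 q2) = sw AA2 (\<delta>B X) (\<lambda>X1 X2. ?p X1 X2 u1 u2 q1 q2)"
    unfolding ev2_\<delta>B[OF X q, symmetric] by (rule sw_ev2) (rule lin|assumption)+
  qed (rule lin|assumption)+
  finally show ?case .
 qed
 also have "... = sw AA2 (\<delta>C k) (\<lambda>k1 k2. sw AA2 (\<delta>C l) (\<lambda>l1 l2. sw AA2 (\<delta>B Y) (\<lambda>Y1 Y2.
   sw AA2 (ent (ev Y1 k2) k1) (\<lambda>u1 q1. sw AA2 (\<delta>B X) (\<lambda>X1 X2.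
    sw AA2 (ent (ev Y2 l2) l1) (\<lambda>u2 q2. ?p X1 X2 u1 u2 q1 q2))))))"
  by (rule sw_cong, (rule lin|assumption)+, rule sw_cong, (rule lin|assumption)+,
    rule sw_cong, (rule lin|assumption)+, rule sw_cong) (rule sw_swap lin|assumption)+
 also have "... = sw AA2 (\<delta>C k) (\<lambda>k1 k2. sw AA2 (\<delta>C l) (\<lambda>l1 l2. sw AA2 (\<delta>B Y) (\<lambda>Y1 Y2.
   sw AA2 (\<delta>B X) (\<lambda>X1 X2. sw AA2 (ent (ev Y1 k2) k1) (\<lambda>u1 q1.
    sw AA2 (ent (ev Y2 l2) l1) (\<lambda>u2 q2. ?p X1 X2 u1 u2 q1 q2))))))"
  by (rule sw_cong, (rule lin|assumption)+, rule sw_cong, (rule lin|assumption)+,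
    rule sw_cong) (rule sw_swap lin|assumption)+
 also have "... = sw AA2 (\<delta>C k) (\<lambda>k1 k2. sw AA2 (\<delta>C l) (\<lambda>l1 l2. sw AA2 (\<delta>B X) (\<lambda>X1 X2.
   sw AA2 (\<delta>B Y) (\<lambda>Y1 Y2. sw AA2 (ent (ev Y1 k2) k1) (\<lambda>u1 q1.
    sw AA2 (ent (ev Y2 l2) l1) (\<lambda>u2 q2. ?p X1 X2 u1 u2 q1 q2))))))"
  by (rule sw_cong, (rule lin|assumption)+, rule sw_cong) (rule sw_swap lin|assumption)+
 also have "... = sw AA2 (\<delta>C k) (\<lambda>k1 k2. sw AA2 (\<delta>B X) (\<lambda>X1 X2. sw AA2 (\<delta>C l) (\<lambda>l1 l2.
   sw AA2 (\<delta>B Y) (\<lambda>Y1 Y2. sw AA2 (ent (ev Y1 k2) k1) (\<lambda>u1 q1.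
    sw AA2 (ent (ev Y2 l2) l1) (\<lambda>u2 q2. ?p X1 X2 u1 u2 q1 q2))))))"
  by (rule sw_cong) (rule sw_swap lin|assumption)+
 also have "... = sw AA2 (\<delta>B X) (\<lambda>X1 X2. sw AA2 (\<delta>C k) (\<lambda>k1 k2. sw AA2 (\<delta>C l) (\<lambda>l1 l2.
   sw AA2 (\<delta>B Y) (\<lambda>Y1 Y2. sw AA2 (ent (ev Y1 k2) k1) (\<lambda>u1 q1.
    sw AA2 (ent (ev Y2 l2) l1) (\<lambda>u2 q2. ?p X1 X2 u1 u2 q1 q2))))))"
  by (rule sw_swap) (rule lin|assumption)+
 also have "... = sw AA2 (\<delta>B X) (\<lambda>X1 X2. sw AA2 (\<delta>C k) (\<lambda>k1 k2. sw AA2 (\<delta>B Y) (\<lambda>Y1 Y2.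
   sw AA2 (\<delta>C l) (\<lambda>l1 l2. sw AA2 (ent (ev Y1 k2) k1) (\<lambda>u1 q1.
    sw AA2 (ent (ev Y2 l2) l1) (\<lambda>u2 q2. ?p X1 X2 u1 u2 q1 q2))))))"
  by (rule sw_cong, (rule lin|assumption)+, rule sw_cong) (rule sw_swap lin|assumption)+
 also have "... = sw AA2 (\<delta>B X) (\<lambda>X1 X2. sw AA2 (\<delta>B Y) (\<lambda>Y1 Y2. sw AA2 (\<delta>C k) (\<lambda>k1 k2.
   sw AA2 (\<delta>C l) (\<lambda>l1 l2. sw AA2 (ent (ev Y1 k2) k1) (\<lambda>u1 q1.
    sw AA2 (ent (ev Y2 l2) l1) (\<lambda>u2 q2. ?p X1 X2 u1 u2 q1 q2))))))"
  by (rule sw_cong) (rule sw_swap lin|assumption)+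
 also have "... = sw AA2 (\<delta>B X) (\<lambda>X1 X2. sw AA2 (\<delta>B Y) (\<lambda>Y1 Y2.
   pure K A A (smul X1 Y1 k) (smul X2 Y2 l)))"
  by (rule sw_cong, (rule lin|assumption)+, rule sw_cong)
   (rule pure_smul_smul[symmetric] lin|assumption)+
 also have "... = sw AA2 (\<delta>B X) (\<lambda>X1 X2. sw AA2 (\<delta>B Y) (\<lambda>Y1 Y2.
   ev2 (pure K T T (umult B X1 Y1) (umult B X2 Y2)) k l))"
  by (rule sw_cong, (rule lin|assumption)+, rule sw_cong)
   ((rule lin|assumption)+, simp add: ev2_pure umult_B_closed ev_umult kl)
 also have "... = sw AA2 (\<delta>B X) (\<lambda>X1 X2. ev2 (sw TT (\<delta>B Y) (\<lambda>Y1 Y2.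
   pure K T T (umult B X1 Y1) (umult B X2 Y2))) k l)"
  by (rule sw_cong) (rule sw_hom[where g="\<lambda>Z. ev2 Z k l", symmetric] lin|assumption)+
 also have "... = ev2 (sw TT (\<delta>B X) (\<lambda>X1 X2. sw TT (\<delta>B Y) (\<lambda>Y1 Y2.
   pure K T T (umult B X1 Y1) (umult B X2 Y2)))) k l"
  by (rule sw_hom[where g="\<lambda>Z. ev2 Z k l", symmetric]) (rule lin|assumption)+
 finally show "ev2 (\<delta>B (umult B X Y)) k l = ev2 (sw TT (\<delta>B X) (\<lambda>X1 X2. sw TT (\<delta>B Y) (\<lambda>Y1 Y2.
  pure K T T (umult B X1 Y1) (umult B X2 Y2)))) k l" .
qed (rule lin|assumption)+

lemma \<delta>B_alpha: "X \<in>. T \<Longrightarrow> \<delta>B (alpha B X) = comult B X"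
 by (simp add: ucoact_def alpha_inv_alpha hs_B B_simps(1))

lemma comult_B_mult:
 assumes X [lin]: "X \<in>. T" and Y [lin]: "Y \<in>. T"
 shows "comult B (X \<otimes>\<^bsub>B\<^esub> Y) = sw TT (comult B X) (\<lambda>X1 X2. sw TT (comult B Y) (\<lambda>Y1 Y2.
  pure K T T (X1 \<otimes>\<^bsub>B\<^esub> Y1) (X2 \<otimes>\<^bsub>B\<^esub> Y2)))"
proof -
 let ?p = "\<lambda>X1 X2 Y1 Y2. pure K T T (umult B X1 Y1) (umult B X2 Y2)"
 have cl: "X \<otimes>\<^bsub>B\<^esub> Y \<in>. T" "alpha B X \<in>. T" "alpha B Y \<in>. T" by (rule lin)+
 have "X \<otimes>\<^bsub>B\<^esub> Y = umult B (alpha B X) (alpha B Y)"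
  by (simp add: umult_B_alpha[symmetric] alpha_umult_B X Y)
 then have \<delta>: "\<delta>B (X \<otimes>\<^bsub>B\<^esub> Y) = sw TT (comult B X) (\<lambda>X1 X2. sw TT (comult B Y) (\<lambda>Y1 Y2. ?p X1 X2 Y1 Y2))"
  using \<delta>B_umult[OF cl(2,3)] by (simp add: \<delta>B_alpha X Y)
 have XY': "alpha_inv B (X \<otimes>\<^bsub>B\<^esub> Y) \<in>. T" by (rule lin)+
 have tB: "lin TT TT (tmap T T (alpha B) (alpha B))" by (rule tmap_lin[OF T_alpha_lin T_alpha_lin]) (rule lin)+
 have "comult B (X \<otimes>\<^bsub>B\<^esub> Y) = tmap T T (alpha B) (alpha B) (\<delta>B (X \<otimes>\<^bsub>B\<^esub> Y))"
  using comult_B_alpha[OF XY'] alpha_alpha_inv[OF hs_B, of "X \<otimes>\<^bsub>B\<^esub> Y"] cl(1)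
  by (simp add: tmap_def ucoact_def B_simps(1))
 also have "... = sw TT (comult B X) (\<lambda>X1 X2. tmap T T (alpha B) (alpha B) (sw TT (comult B Y) (\<lambda>Y1 Y2. ?p X1 X2 Y1 Y2)))"
  unfolding \<delta> by (rule sw_hom[OF _ _ _ _ _ tB]) (rule lin|assumption)+
 also have "... = sw TT (comult B X) (\<lambda>X1 X2. sw TT (comult B Y) (\<lambda>Y1 Y2. tmap T T (alpha B) (alpha B) (?p X1 X2 Y1 Y2)))"
  by (rule sw_cong) (rule sw_hom[OF _ _ _ _ _ tB] lin|assumption)+
 also have "... = sw TT (comult B X) (\<lambda>X1 X2. sw TT (comult B Y) (\<lambda>Y1 Y2. pure K T T (X1 \<otimes>\<^bsub>B\<^esub> Y1) (X2 \<otimes>\<^bsub>B\<^esub> Y2)))"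
 proof (rule sw_cong, (rule lin|assumption)+, rule sw_cong, (rule lin|assumption)+, goal_cases)
  case XY [lin]: (1 X1 X2 Y1 Y2)
  have "tmap T T (alpha B) (alpha B) (?p X1 X2 Y1 Y2) = pure K T T (alpha B (umult B X1 Y1)) (alpha B (umult B X2 Y2))"
   by (rule tmap_pure[OF _ _ T_alpha_lin T_alpha_lin]) (rule lin)+
  then show ?case
   by (simp add: alpha_umult_B XY)
 qed
 finally show ?thesis .
qed

lemma comult_B_one: "comult B (one B) = pure K T T (one B) (one B)"
proof (rule ev2_eqI)
 fix c d assume cd [lin]: "c \<in>. C" "d \<in>. C"
 interpret AA2: module K AA2 by (rule lin)+
 have \<epsilon> [lin]: "counit C c \<in>. K" "counit C d \<in>. K" by (rule lin)+
 have one: "one A \<in>. A" "counit C d \<odot>\<^bsub>A\<^esub> one A \<in>. A" "pure K A A (one A) (one A) \<in>. AA2"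
  "umult C c d \<in>. C" by (rule lin)+
 have "counit C (umult C c d) = counit C c \<otimes> counit C d"
  by (simp add: umult_def hcoalg_counit_alpha_inv coalg halg_mult_multilin alg cd hbialg_counit[OF C])
 then have "ev2 (comult B (one B)) c d = (counit C c \<otimes> counit C d) \<odot>\<^bsub>AA2\<^esub> comult A (one A)"
  using one \<epsilon> by (simp add: ev2_comult one_B cd ev_one alpha_inv_closed hs hcoalg_counit_alpha_inv coalg
    lin_smult[OF hcoalg_lin(1)[OF coalg(1)]])
 also have "comult A (one A) = pure K A A (one A) (one A)"
  using A by (simp add: hbialg_def hom_bialgebra_def)
 finally show "ev2 (comult B (one B)) c d = ev2 (pure K T T (one B) (one B)) c d"
  using one \<epsilon> by (simp add: ev2_pure one_B cd ev_one pure_smult_left pure_smult_right mods AA2.smult_assoc1)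
qed (rule lin)+

lemma counit_B_one: "counit B (one B) = \<one>"
 using halg_one[OF alg(1)] hbialg_counit(2)[OF C] hbialg_counit(2)[OF A]
  lin_smult[OF hcoalg_lin(2)[OF coalg(1)], of \<one> "one A"]
 by (simp add: counit_B one_B ev_one halg_one alg)

text \<open>
 The counit is the value at the unit of \<open>C\<close> followed by the counit of \<open>A\<close>, and \<open>ent_unit\<close> removes the
 entwining with the unit.
\<close>

lemma counit_B_mult:
 assumes X [lin]: "X \<in>. T" and Y [lin]: "Y \<in>. T"
 shows "counit B (X \<otimes>\<^bsub>B\<^esub> Y) = counit B X \<otimes> counit B Y"
proof -
 let ?y = "ev Y (one C)"
 have y [lin]: "?y \<in>. A" and one [lin]: "one C \<in>. C" by (rule lin)+
 have cl: "X \<otimes>\<^bsub>B\<^esub> Y \<in>. T" "smul X Y (one C) \<in>. A" "counit A ?y \<in>. K"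
  "counit A (ev X (one C)) \<in>. K" "ev X (one C) \<in>. A" by (rule lin)+
 have evX: "\<And>d. d \<in>. C \<Longrightarrow> ev X d \<in>. A" "\<And>u. u \<in>. A \<Longrightarrow> counit A u \<in>. K"
  by (rule lin|assumption)+
 have "comult C (one C) = pure K C C (one C) (one C)"
  using C by (simp add: hbialg_def hom_bialgebra_def)
 then have "smul X Y (one C) = sw A (pure K C C (one C) (one C)) (\<lambda>c1 c2. act_on X (ev Y c2) c1)"
  by (simp add: smul_def ucoact_def halg_inv_one alg)
 also have "... = sw A (ent ?y (one C)) (\<lambda>u d. umult A (ev X d) u)"
  by (rule sw_pureI) (rule lin|assumption)+
 finally have s: "smul X Y (one C) = sw A (ent ?y (one C)) (\<lambda>u d. umult A (ev X d) u)" .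
 have "counit B (X \<otimes>\<^bsub>B\<^esub> Y) = counit A (ev (X \<otimes>\<^bsub>B\<^esub> Y) (alpha C (one C)))"
  by (simp add: counit_B cl halg_alpha_one alg)
 also have "... = counit A (smul X Y (one C))"
  by (simp add: ev_mult X Y one hcoalg_counit_alpha coalg cl)
 also have "... = sw (scalars K) (ent ?y (one C)) (\<lambda>u d. counit A (umult A (ev X d) u))"
  unfolding s by (rule sw_hom[where g="counit A"]) (rule hcoalg_lin(2) lin|assumption)+
 also have "... = sw (scalars K) (ent ?y (one C)) (\<lambda>u d. counit A (ev X (counit A u \<odot>\<^bsub>C\<^esub> d)))"
 proof (rule sw_cong, (rule lin|assumption)+, goal_cases)
  case ud [lin]: (1 u d)
  have "counit A (umult A (ev X d) u) = counit A (ev X d) \<otimes> counit A u"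
   by (simp add: umult_def hcoalg_counit_alpha_inv coalg halg_mult_multilin alg ud evX hbialg_counit[OF A])
  also have "... = counit A (counit A u \<odot>\<^bsub>A\<^esub> ev X d)"
   by (simp add: lin_smult[OF hcoalg_lin(2)[OF coalg(1)]] evX ud m_comm)
  also have "counit A u \<odot>\<^bsub>A\<^esub> ev X d = ev X (counit A u \<odot>\<^bsub>C\<^esub> d)"
   by (rule lin_smult[OF bil_right[OF ev_bil], symmetric]) (rule lin)+
  finally show ?case .
 qed
 also have "... = counit A (ev X (sw C (ent ?y (one C)) (\<lambda>u d. counit A u \<odot>\<^bsub>C\<^esub> d)))"
  by (rule sw_hom[where g="\<lambda>c. counit A (ev X c)", symmetric]) (rule lin|assumption)+
 also have "... = counit A (ev X (one C)) \<otimes> counit A ?y"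
  using cl by (simp add: ent_unit y lin_smult[OF bil_right[OF ev_bil]] X one lin_smult[OF hcoalg_lin(2)[OF coalg(1)]] m_comm)
 finally show ?thesis by (simp add: counit_B X Y)
qed

lemma smash_hom_bialgebra: "hom_bialgebra K B"
 unfolding hom_bialgebra_def tens_B B_simps(1)
 by (simp add: smash_hom_algebra smash_hom_coalgebra comult_B_mult comult_B_one counit_B_mult counit_B_one)

lemma B_hbialg: "hbialg B"
 using smash_hom_bialgebra hs_B by (simp add: hbialg_def hs_def)

end

section \<open>Tensor products inside the universe\<close>

context ground
begin

definition incl :: "(('k,'s) univ \<times> ('k,'s) univ) list set \<Rightarrow> ('k,'s) univ" where
 "incl X = Formal (tensor_rep X)"

lemma upure_incl: "upure K M N x y = incl (pure K M N x y)"
 by (simp add: upure_def incl_def)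

lemma usweedler_incl: "usweedler U (incl X) b = sw U X b"
 by (simp add: usweedler_def incl_def sweedler_def)

lemma incl_inj: "module K M \<Longrightarrow> module K N \<Longrightarrow> inj_on incl (carrier (tens M N))"
 by (rule inj_onI) (metis incl_def tensor_rep(2) univ.inject(3))

text \<open>
 The tensor product of two objects carries different further structure in the two categories. The
 rules for \<open>upure\<close> and \<open>usweedler\<close> are therefore stated for any record on the space \<open>utensor K M N\<close>.
\<close>

definition utens where
 "utens T M N \<longleftrightarrow> module K M \<and> module K N \<and> same_space T (utensor K M N)"

lemma utensor_simps:
 assumes "module K M" "module K N"
 shows "carrier (utensor K M N) = incl ` carrier (tens M N)"
  "X \<in>. tens M N \<Longrightarrow> Y \<in>. tens M N \<Longrightarrow>
   incl X \<oplus>\<^bsub>utensor K M N\<^esub> incl Y = incl (X \<oplus>\<^bsub>tens M N\<^esub> Y)"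
  "r \<in>. K \<Longrightarrow> X \<in>. tens M N \<Longrightarrow>
   r \<odot>\<^bsub>utensor K M N\<^esub> incl X = incl (r \<odot>\<^bsub>tens M N\<^esub> X)"
  "zero (utensor K M N) = incl (zero (tens M N))"
 using inv_into_f_f[OF incl_inj[OF assms]]
 by (simp_all add: utensor_def transport_def Let_def incl_def[abs_def])

lemma utensor_normal: "normal_space K (utensor K M N)"
 by (auto simp: normal_space_def utensor_def transport_def Let_def fun_eq_iff)

lemma utens_carrier: "utens T M N \<Longrightarrow> carrier T = incl ` carrier (tens M N)"
 by (simp add: utens_def same_space_def utensor_simps)

lemma incl_lin:
 assumes T: "utens T M N" shows "lin (tens M N) T incl"
 using T by (intro linI) (auto simp: utens_def same_space_def utensor_simps)

lemma utens_lin: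
 assumes T: "utens T M N" and f: "lin (tens M N) U (\<lambda>X. f (incl X))"
 shows "lin T U f"
proof (rule linI)
 interpret TT: module K "tens M N" using T by (simp add: utens_def tensor_module)
 note c = utens_carrier[OF T]
 note hom = lin_add[OF incl_lin[OF T], symmetric] lin_smult[OF incl_lin[OF T], symmetric]
 fix x assume "x \<in>. T"
 then obtain X where X: "X \<in>. tens M N" "x = incl X" using c by auto
 then show "f x \<in>. U" using lin_closed[OF f] by simp
 show "f (r \<odot>\<^bsub>T\<^esub> x) = r \<odot>\<^bsub>U\<^esub> f x" if "r \<in>. K" for r
  using X that by (simp add: hom lin_smult[OF f])
 fix y assume "y \<in>. T"
 then obtain Y where Y: "Y \<in>. tens M N" "y = incl Y" using c by auto
 then show "f (x \<oplus>\<^bsub>T\<^esub> y) = f x \<oplus>\<^bsub>U\<^esub> f y"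
  using X by (simp add: hom lin_add[OF f])
qed

lemma transported_module:
 assumes V: "module K V" and bij: "bij_betw h (carrier V) (carrier T)"
  and add: "\<And>x y. x \<in>. V \<Longrightarrow> y \<in>. V \<Longrightarrow> h x \<oplus>\<^bsub>T\<^esub> h y = h (x \<oplus>\<^bsub>V\<^esub> y)"
  and smult: "\<And>r x. r \<in>. K \<Longrightarrow> x \<in>. V \<Longrightarrow> r \<odot>\<^bsub>T\<^esub> h x = h (r \<odot>\<^bsub>V\<^esub> x)"
  and zero: "zero T = h (zero V)"
 shows "module K T"
proof -
 interpret V: module K V by (rule V)
 have ex: "\<And>P. (\<forall>y\<in>carrier T. P y) \<longleftrightarrow> (\<forall>x\<in>carrier V. P (h x))"
  using bij_betw_imp_surj_on[OF bij] by (metis (no_types, lifting) imageE imageI)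
 have hc: "h x \<in>. T" if "x \<in>. V" for x using bij that by (auto simp: bij_betw_def)
 have "abelian_group T"
 proof (rule abelian_groupI)
  have "\<forall>x\<in>carrier T. \<exists>y\<in>carrier T. y \<oplus>\<^bsub>T\<^esub> x = zero T"
   unfolding ex
  proof
   fix x assume x: "x \<in>. V"
   then show "\<exists>y\<in>carrier T. y \<oplus>\<^bsub>T\<^esub> h x = zero T"
    by (intro bexI[of _ "h (\<ominus>\<^bsub>V\<^esub> x)"]) (simp_all add: add zero hc V.l_neg)
  qed
  then show "\<exists>y\<in>carrier T. y \<oplus>\<^bsub>T\<^esub> x = zero T" if "x \<in>. T" for x using that by blast
  have "\<forall>x\<in>carrier T. \<forall>y\<in>carrier T. x \<oplus>\<^bsub>T\<^esub> y \<in>. T \<and> x \<oplus>\<^bsub>T\<^esub> y = y \<oplus>\<^bsub>T\<^esub> x"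
   unfolding ex by (simp add: add hc V.a_comm)
  then show "x \<oplus>\<^bsub>T\<^esub> y \<in>. T" "x \<oplus>\<^bsub>T\<^esub> y = y \<oplus>\<^bsub>T\<^esub> x" if "x \<in>. T" "y \<in>. T" for x y
   using that by blast+
  have "\<forall>x\<in>carrier T. \<forall>y\<in>carrier T. \<forall>z\<in>carrier T. x \<oplus>\<^bsub>T\<^esub> y \<oplus>\<^bsub>T\<^esub> z = x \<oplus>\<^bsub>T\<^esub> (y \<oplus>\<^bsub>T\<^esub> z)"
   unfolding ex by (simp add: add V.a_assoc)
  then show "x \<oplus>\<^bsub>T\<^esub> y \<oplus>\<^bsub>T\<^esub> z = x \<oplus>\<^bsub>T\<^esub> (y \<oplus>\<^bsub>T\<^esub> z)"
   if "x \<in>. T" "y \<in>. T" "z \<in>. T" for x y z using that by blast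
  have "\<forall>x\<in>carrier T. zero T \<oplus>\<^bsub>T\<^esub> x = x" unfolding ex by (simp add: add zero)
  then show "zero T \<oplus>\<^bsub>T\<^esub> x = x" if "x \<in>. T" for x using that by blast
 qed (simp add: zero hc)
 moreover have "\<forall>x\<in>carrier T. \<forall>r\<in>carrier K. \<forall>s\<in>carrier K. r \<odot>\<^bsub>T\<^esub> x \<in>. T \<and>
   (r \<oplus> s) \<odot>\<^bsub>T\<^esub> x = r \<odot>\<^bsub>T\<^esub> x \<oplus>\<^bsub>T\<^esub> s \<odot>\<^bsub>T\<^esub> x \<and> (r \<otimes> s) \<odot>\<^bsub>T\<^esub> x = r \<odot>\<^bsub>T\<^esub> (s \<odot>\<^bsub>T\<^esub> x) \<and> \<one> \<odot>\<^bsub>T\<^esub> x = x"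
  unfolding ex by (simp add: smult add hc V.smult_l_distr V.smult_assoc1)
 moreover have "\<forall>x\<in>carrier T. \<forall>y\<in>carrier T. \<forall>r\<in>carrier K.
   r \<odot>\<^bsub>T\<^esub> (x \<oplus>\<^bsub>T\<^esub> y) = r \<odot>\<^bsub>T\<^esub> x \<oplus>\<^bsub>T\<^esub> r \<odot>\<^bsub>T\<^esub> y"
  unfolding ex by (simp add: smult add V.smult_r_distr)
 ultimately show ?thesis
  by (intro moduleI[OF is_cring]) (simp_all, blast+)
qed

lemma utens_module: assumes T: "utens T M N" shows "module K T"
proof (rule transported_module[where h=incl])
 show "module K (tens M N)" using T by (simp add: utens_def tensor_module)
 show "bij_betw incl (carrier (tens M N)) (carrier T)"
  using T incl_inj[of M N] by (simp add: utens_carrier bij_betw_def) (simp add: utens_def)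
qed (use T in \<open>auto simp: utens_def same_space_def utensor_simps\<close>)

lemma upure_closed: "x \<in>. M \<Longrightarrow> y \<in>. N \<Longrightarrow> utens T M N \<Longrightarrow> upure K M N x y \<in>. T"
 by (simp add: utens_carrier upure_incl pure_closed utens_def)

lemma upure_bil: assumes T: "utens T M N" shows "bil M N T (upure K M N)"
proof -
 have MN: "module K M" "module K N" using T by (auto simp: utens_def)
 show ?thesis
  unfolding upure_incl[abs_def]
  by (rule bilI) (rule lin_comp[OF incl_lin[OF T]] bil_left[OF pure_bil] bil_right[OF pure_bil] MN | assumption)+
qed

lemma lin_upure_left: "lin X M f \<Longrightarrow> y \<in>. N \<Longrightarrow> utens T M N \<Longrightarrow> lin X T (\<lambda>x. upure K M N (f x) y)"
 by (rule lin_bil_left[OF upure_bil])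

lemma lin_upure_right: "x \<in>. M \<Longrightarrow> lin X N f \<Longrightarrow> utens T M N \<Longrightarrow> lin X T (\<lambda>y. upure K M N x (f y))"
 by (rule lin_bil_right[OF upure_bil])

lemma usweedler_closed:
 assumes "z \<in>. T" "utens T M N" "module K U"
  "\<And>x y. x \<in>. M \<Longrightarrow> y \<in>. N \<Longrightarrow> b x y \<in>. U"
 shows "usweedler U z b \<in>. U"
 using assms(1,2) by (auto simp: utens_carrier usweedler_incl utens_def intro!: sw_closed assms(3,4))

lemma usweedler_lin:
 assumes T: "utens T M N" and U: "module K U" and b: "bil M N U b"
 shows "lin T U (\<lambda>z. usweedler U z b)"
proof -
 have MN: "module K M" "module K N" using T by (auto simp: utens_def)
 show ?thesis by (rule utens_lin[OF T], unfold usweedler_incl) (rule sw_lin[OF MN U b])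
qed

lemma usweedler_lin_arg:
 assumes "lin X T f" "utens T M N" "module K U"
  "\<And>x. x \<in>. M \<Longrightarrow> lin N U (b x)" "\<And>y. y \<in>. N \<Longrightarrow> lin M U (\<lambda>x. b x y)"
 shows "lin X U (\<lambda>v. usweedler U (f v) b)"
 by (rule lin_comp[OF usweedler_lin[OF assms(2,3) bilI] assms(1)]) fact+

lemma usweedler_lin_inner:
 assumes "z \<in>. T" "utens T M N" "module K U"
  "\<And>x y. x \<in>. M \<Longrightarrow> y \<in>. N \<Longrightarrow> lin X U (\<lambda>v. b v x y)"
 shows "lin X U (\<lambda>v. usweedler U z (b v))"
 using assms(1,2)
 by (auto simp: utens_carrier usweedler_incl utens_def intro!: sw_lin_inner[where V=M and W=N] assms(3,4))

lemma usweedler_upure: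
 assumes "utens T M N" "x \<in>. M" "y \<in>. N" "module K U"
  "\<And>x. x \<in>. M \<Longrightarrow> lin N U (b x)" "\<And>y. y \<in>. N \<Longrightarrow> lin M U (\<lambda>x. b x y)"
 shows "usweedler U (upure K M N x y) b = b x y"
 unfolding upure_incl usweedler_incl
 by (rule sw_pureI) (use assms in \<open>auto simp: utens_def\<close>)

lemma utens_ext:
 assumes z: "z \<in>. T" and T: "utens T M N" and U: "module K U" and f: "lin T U f" and g: "lin T U g"
  and eq: "\<And>x y. x \<in>. M \<Longrightarrow> y \<in>. N \<Longrightarrow> f (upure K M N x y) = g (upure K M N x y)"
 shows "f z = g z"
proof -
 have MN: "module K M" "module K N" using T by (auto simp: utens_def)
 from z obtain X where X: "X \<in>. tens M N" "z = incl X" using utens_carrier[OF T] by auto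
 show ?thesis
  unfolding X(2)
  by (rule tensor_ext[OF MN X(1) U lin_comp[OF f incl_lin[OF T]] lin_comp[OF g incl_lin[OF T]]])
   (use eq in \<open>simp add: upure_incl\<close>)
qed

lemma utens_utensor: "module K M \<Longrightarrow> module K N \<Longrightarrow> utens (utensor K M N) M N"
 by (simp add: utens_def same_space_refl)

lemma utensor_same_space:
 assumes "same_space M M'" "same_space N N'"
 shows "utensor K M N = utensor K M' N'" "upure K M N = upure K M' N'"
 using tensor_same_space[OF assms] by (simp_all add: utensor_def upure_def fun_eq_iff)

lemma usweedler_same_space: "same_space U U' \<Longrightarrow> usweedler U z b = usweedler U' z b"
 by (simp add: usweedler_def formal_eval_def same_space_def)

lemma lin_restrict: "module K V \<Longrightarrow> lin V W f \<Longrightarrow> lin V W (\<lambda>z\<in>carrier V. f z)"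
 by (rule lin_cong) simp_all

lemmas [lin] =
 upure_closed lin_upure_left lin_upure_right usweedler_closed usweedler_lin_inner usweedler_lin_arg
 utens_utensor

end

section \<open>Modules over a Hom-bialgebra form a monoidal category\<close>

locale hbialg_modules = ground K for K :: "'k ring" (structure) +
 fixes B :: "('k,'b,'m) hom_bialg_scheme"
 assumes B: "hbialg B"
begin

abbreviation "tp \<equiv> hmod_tensor K B"
abbreviation "mor \<equiv> hmod_mor K B"
abbreviation "hm \<equiv> is_hmod K B"

lemmas B_alg [lin] = hbialg_parts(1)[OF B]
lemmas B_coalg [lin] = hbialg_parts(2)[OF B]
lemmas B_hs [lin] = halg_hs[OF B_alg]
lemmas B_mod [lin] = hs_module[OF B_hs]
lemmas B_comod [lin] = hcoalg_hcomod[OF B_coalg]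
lemmas [lin] = halg_mult_multilin halg_one[OF B_alg] lin_multilin[OF hcoalg_lin(1)[OF B_coalg]]
 lin_multilin[OF hcoalg_lin(2)[OF B_coalg]] lin_multilin(1)[OF hcoalg_lin(2)[OF B_coalg], simplified]

lemma hm_hmodule: "hm M \<Longrightarrow> hmodule B M (act M)"
 by (simp add: is_hmod_def hmodule_def B_alg)

lemma hm_hs: "hm M \<Longrightarrow> hs M"
 by (rule hmodule_hs(1)[OF hm_hmodule])

lemma hm_module: "hm M \<Longrightarrow> module K M"
 by (rule hs_module[OF hm_hs])

lemma hm_act_bil: "hm M \<Longrightarrow> bil B M M (act M)"
 by (rule hmodule_act[OF hm_hmodule])

lemma hm_act_multilin:
 "b \<in>. B \<Longrightarrow> m \<in>. M \<Longrightarrow> hm M \<Longrightarrow> act M b m \<in>. M"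
 "lin X B f \<Longrightarrow> m \<in>. M \<Longrightarrow> hm M \<Longrightarrow> lin X M (\<lambda>x. act M (f x) m)"
 "b \<in>. B \<Longrightarrow> lin X M g \<Longrightarrow> hm M \<Longrightarrow> lin X M (\<lambda>x. act M b (g x))"
 by (rule bil_multilin(1)[OF hm_act_bil] bil_multilin(2)[OF hm_act_bil] bil_multilin(3)[OF hm_act_bil]; assumption)+

lemmas [lin] = hm_hs hm_module hm_act_multilin

lemma tp_same_space: "same_space (tp M N) (utensor K M N)"
 by (simp add: same_space_def hmod_tensor_def Let_def)

lemma utens_tp: "module K M \<Longrightarrow> module K N \<Longrightarrow> utens (tp M N) M N"
 by (simp add: utens_def tp_same_space)

lemma tp_module: "module K M \<Longrightarrow> module K N \<Longrightarrow> module K (tp M N)"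
 by (rule utens_module[OF utens_tp])

lemmas [lin] = utens_tp tp_module

lemma alpha_tp: "alpha (tp M N) = (\<lambda>z\<in>carrier (tp M N). usweedler (tp M N) z (\<lambda>m n. upure K M N (alpha M m) (alpha N n)))"
 unfolding usweedler_same_space[OF tp_same_space] by (simp add: hmod_tensor_def Let_def)

lemma act_tp: "act (tp M N) = (\<lambda>b\<in>carrier B. \<lambda>z\<in>carrier (tp M N).
  usweedler (tp M N) z (\<lambda>m n. sw (tp M N) (comult B b) (\<lambda>b1 b2. upure K M N (act M b1 m) (act N b2 n))))"
 unfolding usweedler_same_space[OF tp_same_space] sw_same_space[OF tp_same_space]
 by (simp add: hmod_tensor_def Let_def)

lemma tp_alpha_lin:
 assumes [lin]: "hs M" "hs N" shows "lin (tp M N) (tp M N) (alpha (tp M N))"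
proof -
 note [lin] = hs_module
 show ?thesis unfolding alpha_tp by (rule lin_restrict) (rule lin|assumption)+
qed

lemma tp_alpha_upure:
 assumes [lin]: "hs M" "hs N" "m \<in>. M" "n \<in>. N"
 shows "alpha (tp M N) (upure K M N m n) = upure K M N (alpha M m) (alpha N n)"
proof -
 note [lin] = hs_module
 have [lin]: "utens (tp M N) M N" by (rule lin)+
 have "upure K M N m n \<in>. tp M N" by (rule lin)+
 then have "alpha (tp M N) (upure K M N m n) = usweedler (tp M N) (upure K M N m n) (\<lambda>m n. upure K M N (alpha M m) (alpha N n))"
  by (simp add: alpha_tp)
 also have "... = upure K M N (alpha M m) (alpha N n)"
  by (rule usweedler_upure) (rule lin|assumption)+
 finally show ?thesis .
qed

lemma tp_hs:
 assumes [lin]: "hs M" "hs N" shows "hs (tp M N)"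
proof -
 note [lin] = hs_module
 have u [lin]: "utens (tp M N) M N" by (rule lin)+
 let ?i = "\<lambda>z. usweedler (tp M N) z (\<lambda>m n. upure K M N (alpha_inv M m) (alpha_inv N n))"
 have i: "lin (tp M N) (tp M N) ?i" by (rule lin|assumption)+
 note a = tp_alpha_lin[OF assms]
 have iu: "?i (upure K M N m n) = upure K M N (alpha_inv M m) (alpha_inv N n)"
  if [lin]: "m \<in>. M" "n \<in>. N" for m n
  by (rule usweedler_upure) (rule lin|assumption)+
 have "bij_betw (alpha (tp M N)) (carrier (tp M N)) (carrier (tp M N))"
 proof (rule bij_betw_byWitness[where f' = ?i])
  show "\<forall>z\<in>carrier (tp M N). ?i (alpha (tp M N) z) = z"
   by (intro ballI, rule utens_ext[OF _ u, where U="tp M N"])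
    (rule lin_comp[OF i a] lin | assumption | simp add: tp_alpha_upure assms iu hs_simps)+
  show "\<forall>z\<in>carrier (tp M N). alpha (tp M N) (?i z) = z"
   by (intro ballI, rule utens_ext[OF _ u, where U="tp M N"])
    (rule lin_comp[OF a i] lin | assumption | simp add: tp_alpha_upure assms iu hs_simps)+
 qed (use lin_closed[OF a] lin_closed[OF i] in auto)
 moreover have "module K (tp M N)" by (rule lin)+
 ultimately show ?thesis using a by (simp add: hs_def hom_vector_space_def bijective_alpha_def)
qed

lemma tp_alpha_inv_upure:
 assumes "hs M" "hs N" "m \<in>. M" "n \<in>. N"
 shows "alpha_inv (tp M N) (upure K M N m n) = upure K M N (alpha_inv M m) (alpha_inv N n)"
 by (rule alpha_inv_eqI[OF tp_hs])
  (use assms in \<open>simp_all add: tp_alpha_upure hs_simps upure_closed utens_tp hs_module\<close>)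

lemma tp_act_bil:
 assumes [lin]: "hm M" "hm N" shows "bil B (tp M N) (tp M N) (act (tp M N))"
proof -
 let ?f = "\<lambda>b z. usweedler (tp M N) z (\<lambda>m n. sw (tp M N) (comult B b) (\<lambda>b1 b2. upure K M N (act M b1 m) (act N b2 n)))"
 have [lin]: "utens (tp M N) M N" by (rule lin)+
 have f: "bil B (tp M N) (tp M N) ?f" by (rule lin|assumption)+
 show ?thesis
 proof (rule bilI)
  fix b assume "b \<in>. B"
  then show "lin (tp M N) (tp M N) (act (tp M N) b)"
   using lin_restrict[OF tp_module[OF hm_module[OF assms(1)] hm_module[OF assms(2)]] bil_right[OF f]]
   by (simp add: act_tp)
 next
  fix z assume "z \<in>. tp M N"
  then show "lin B (tp M N) (\<lambda>b. act (tp M N) b z)"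
   using lin_cong[OF B_mod bil_left[OF f, of z], of "\<lambda>b. act (tp M N) b z"] by (simp add: act_tp)
 qed
qed

lemma tp_act_upure:
 assumes [lin]: "hm M" "hm N" "b \<in>. B" "m \<in>. M" "n \<in>. N"
 shows "act (tp M N) b (upure K M N m n) = sw (tp M N) (comult B b) (\<lambda>b1 b2. upure K M N (act M b1 m) (act N b2 n))"
proof -
 have [lin]: "utens (tp M N) M N" by (rule lin)+
 have "upure K M N m n \<in>. tp M N" by (rule lin)+
 then have "act (tp M N) b (upure K M N m n) = usweedler (tp M N) (upure K M N m n)
   (\<lambda>m n. sw (tp M N) (comult B b) (\<lambda>b1 b2. upure K M N (act M b1 m) (act N b2 n)))"
  by (simp add: act_tp assms(3))
 also have "... = sw (tp M N) (comult B b) (\<lambda>b1 b2. upure K M N (act M b1 m) (act N b2 n))"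
  by (rule usweedler_upure) (rule lin|assumption)+
 finally show ?thesis .
qed

lemma tp_act_assoc_upure:
 assumes M [lin]: "hm M" and N [lin]: "hm N"
  and abmn [lin]: "a \<in>. B" "b \<in>. B" "m \<in>. M" "n \<in>. N"
 shows "act (tp M N) (alpha B a) (act (tp M N) b (upure K M N m n)) =
  act (tp M N) (a \<otimes>\<^bsub>B\<^esub> b) (alpha (tp M N) (upure K M N m n))"
proof -
 note [lin] = bil_multilin[OF tp_act_bil[OF M N]]
 have [lin]: "utens (tp M N) M N" by (rule lin)+
 let ?p = "upure K M N" and ?T = "tp M N"
 have "act ?T (alpha B a) (act ?T b (?p m n)) =
   act ?T (alpha B a) (sw ?T (comult B b) (\<lambda>b1 b2. ?p (act M b1 m) (act N b2 n)))"
  by (simp add: tp_act_upure M N abmn)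
 also have "... = sw ?T (comult B b) (\<lambda>b1 b2. act ?T (alpha B a) (?p (act M b1 m) (act N b2 n)))"
  by (rule sw_hom[where g="act ?T (alpha B a)"]) (rule lin|assumption)+
 also have "... = sw ?T (comult B b) (\<lambda>b1 b2. sw ?T (comult B a) (\<lambda>a1 a2.
   ?p (act M (a1 \<otimes>\<^bsub>B\<^esub> b1) (alpha M m)) (act N (a2 \<otimes>\<^bsub>B\<^esub> b2) (alpha N n))))"
 proof (rule sw_cong, (rule lin|assumption)+, goal_cases)
  case b12 [lin]: (1 b1 b2)
  have "act ?T (alpha B a) (?p (act M b1 m) (act N b2 n)) =
    sw ?T (comult B (alpha B a)) (\<lambda>a1 a2. ?p (act M a1 (act M b1 m)) (act N a2 (act N b2 n)))"
   by (rule tp_act_upure) (rule lin)+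
  also have "... = sw ?T (comult B a) (\<lambda>a1 a2. ?p (act M (alpha B a1) (act M b1 m)) (act N (alpha B a2) (act N b2 n)))"
   by (rule coact_alpha[OF B_comod]) (rule lin|assumption)+
  also have "... = sw ?T (comult B a) (\<lambda>a1 a2. ?p (act M (a1 \<otimes>\<^bsub>B\<^esub> b1) (alpha M m)) (act N (a2 \<otimes>\<^bsub>B\<^esub> b2) (alpha N n)))"
   by (rule sw_cong)
    ((rule lin|assumption)+, simp add: hmodule_assoc[OF hm_hmodule[OF M]] hmodule_assoc[OF hm_hmodule[OF N]] abmn b12)
  finally show ?case .
 qed
 also have "... = sw ?T (comult B a) (\<lambda>a1 a2. sw ?T (comult B b) (\<lambda>b1 b2.
   ?p (act M (a1 \<otimes>\<^bsub>B\<^esub> b1) (alpha M m)) (act N (a2 \<otimes>\<^bsub>B\<^esub> b2) (alpha N n))))"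
  by (rule sw_swap) (rule lin|assumption)+
 also have "... = sw ?T (comult B (a \<otimes>\<^bsub>B\<^esub> b)) (\<lambda>c1 c2. ?p (act M c1 (alpha M m)) (act N c2 (alpha N n)))"
  by (rule hbialg_comult_mult[OF B, symmetric]) (rule lin|assumption)+
 also have "... = act ?T (a \<otimes>\<^bsub>B\<^esub> b) (?p (alpha M m) (alpha N n))"
  by (rule tp_act_upure[symmetric]) (rule lin)+
 finally show ?thesis by (simp add: tp_alpha_upure hm_hs M N abmn)
qed

lemma tp_hm:
 assumes M [lin]: "hm M" and N [lin]: "hm N"
 shows "hm (tp M N)"
proof -
 note hsT = tp_hs[OF hm_hs[OF M] hm_hs[OF N]]
 note a = tp_alpha_lin[OF hm_hs[OF M] hm_hs[OF N]]
 note ab = tp_act_bil[OF M N]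
 note [lin] = bil_multilin[OF ab] hsT
 have u [lin]: "utens (tp M N) M N" by (rule lin)+
 have "left_hom_module K B (tp M N) (act (tp M N))"
  unfolding left_hom_module_def
 proof (intro conjI ballI)
  show "hom_vector_space K (tp M N)" using hsT by (simp add: hs_def)
  show "bil B (tp M N) (tp M N) (act (tp M N))" by (rule ab)
  fix z assume z: "z \<in>. tp M N"
  show "act (tp M N) (one B) z = alpha (tp M N) z"
  proof (rule utens_ext[OF z u, where U="tp M N"])
   fix m n assume mn [lin]: "m \<in>. M" "n \<in>. N"
   have "comult B (one B) = pure K B B (one B) (one B)" using B by (simp add: hbialg_def hom_bialgebra_def)
   then have "act (tp M N) (one B) (upure K M N m n) =
     sw (tp M N) (pure K B B (one B) (one B)) (\<lambda>b1 b2. upure K M N (act M b1 m) (act N b2 n))"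
    by (simp add: tp_act_upure M N mn halg_one B_alg)
   also have "... = upure K M N (act M (one B) m) (act N (one B) n)"
    by (rule sw_pureI) (rule lin|assumption)+
   finally show "act (tp M N) (one B) (upure K M N m n) = alpha (tp M N) (upure K M N m n)"
    by (simp add: tp_alpha_upure hm_hs M N mn hmodule_one[OF hm_hmodule[OF M]] hmodule_one[OF hm_hmodule[OF N]])
  qed (rule lin|assumption)+
  fix b assume b [lin]: "b \<in>. B"
  show "alpha (tp M N) (act (tp M N) b z) = act (tp M N) (alpha B b) (alpha (tp M N) z)"
  proof (rule utens_ext[OF z u, where U="tp M N"])
   fix m n assume mn [lin]: "m \<in>. M" "n \<in>. N"
   have "alpha (tp M N) (act (tp M N) b (upure K M N m n)) =
     alpha (tp M N) (sw (tp M N) (comult B b) (\<lambda>b1 b2. upure K M N (act M b1 m) (act N b2 n)))"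
    by (simp add: tp_act_upure M N mn b)
   also have "... = sw (tp M N) (comult B b) (\<lambda>b1 b2. alpha (tp M N) (upure K M N (act M b1 m) (act N b2 n)))"
    by (rule sw_hom[OF _ _ _ _ _ a]) (rule lin|assumption)+
   also have "... = sw (tp M N) (comult B b) (\<lambda>b1 b2. upure K M N (act M (alpha B b1) (alpha M m)) (act N (alpha B b2) (alpha N n)))"
    by (rule sw_cong)
     ((rule lin|assumption)+, simp add: tp_alpha_upure hm_hs M N mn hm_act_multilin
      hmodule_alpha[OF hm_hmodule[OF M]] hmodule_alpha[OF hm_hmodule[OF N]])
   also have "... = sw (tp M N) (comult B (alpha B b)) (\<lambda>b1 b2. upure K M N (act M b1 (alpha M m)) (act N b2 (alpha N n)))"
    by (rule coact_alpha[OF B_comod, symmetric]) (rule lin|assumption)+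
   also have "... = act (tp M N) (alpha B b) (upure K M N (alpha M m) (alpha N n))"
    by (rule tp_act_upure[symmetric]) (rule lin)+
   finally show "alpha (tp M N) (act (tp M N) b (upure K M N m n)) =
     act (tp M N) (alpha B b) (alpha (tp M N) (upure K M N m n))"
    by (simp add: tp_alpha_upure hm_hs M N mn)
  qed (rule lin|assumption)+
 next
  fix a b z assume ab [lin]: "a \<in>. B" "b \<in>. B" and z: "z \<in>. tp M N"
  show "act (tp M N) (alpha B a) (act (tp M N) b z) = act (tp M N) (a \<otimes>\<^bsub>B\<^esub> b) (alpha (tp M N) z)"
   by (rule utens_ext[OF z u, where U="tp M N"]) (rule tp_act_assoc_upure lin|assumption)+
 qed
 moreover have "bijective_alpha (tp M N)" using hsT by (simp add: hs_def)
 moreover have "normal_space K (tp M N)"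
  using utensor_normal[of M N] by (simp add: normal_space_def hmod_tensor_def Let_def)
 moreover have "alpha (tp M N) \<in> extensional (carrier (tp M N))" by (simp add: alpha_tp)
 moreover have "act (tp M N) = (\<lambda>b\<in>carrier B. \<lambda>z\<in>carrier (tp M N). act (tp M N) b z)"
  by (auto simp: act_tp fun_eq_iff)
 ultimately show ?thesis by (simp add: is_hmod_def)
qed

abbreviation unit_obj :: "('k,'b,('k,'s) univ) hmod" where
 "unit_obj \<equiv> hmod_unit K B"

lemma unit_simps:
 "carrier unit_obj = Scalar ` carrier K"
 "r \<in>. K \<Longrightarrow> s \<in>. K \<Longrightarrow> Scalar r \<oplus>\<^bsub>unit_obj\<^esub> Scalar s = Scalar (r \<oplus> s)"
 "r \<in>. K \<Longrightarrow> s \<in>. K \<Longrightarrow> r \<odot>\<^bsub>unit_obj\<^esub> Scalar s = Scalar (r \<otimes> s)"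
 "zero unit_obj = Scalar \<zero>"
 "r \<in>. K \<Longrightarrow> alpha unit_obj (Scalar r) = Scalar r"
 "b \<in>. B \<Longrightarrow> r \<in>. K \<Longrightarrow> act unit_obj b (Scalar r) = Scalar (counit B b \<otimes> r)"
proof -
 have i: "inv_into (carrier K) Scalar (Scalar r :: ('k,'s) univ) = r" if "r \<in>. K" for r
  by (rule inv_into_f_f) (use that in \<open>auto simp: inj_on_def\<close>)
 have e: "\<And>b. b \<in>. B \<Longrightarrow> counit B b \<in>. K" by (rule lin|assumption)+
 show "carrier unit_obj = Scalar ` carrier K"
  "r \<in>. K \<Longrightarrow> s \<in>. K \<Longrightarrow> Scalar r \<oplus>\<^bsub>unit_obj\<^esub> Scalar s = Scalar (r \<oplus> s)"
  "r \<in>. K \<Longrightarrow> s \<in>. K \<Longrightarrow> r \<odot>\<^bsub>unit_obj\<^esub> Scalar s = Scalar (r \<otimes> s)"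
  "zero unit_obj = Scalar \<zero>"
  "r \<in>. K \<Longrightarrow> alpha unit_obj (Scalar r) = Scalar r"
  "b \<in>. B \<Longrightarrow> r \<in>. K \<Longrightarrow> act unit_obj b (Scalar r) = Scalar (counit B b \<otimes> r)"
  for r s b
  by (simp_all add: hmod_unit_def Let_def transport_def i e)
qed

lemma unit_module: "module K (unit_obj :: ('k,'b,('k,'s) univ) hmod)"
 by (rule transported_module[OF scalars_module, where h=Scalar])
  (auto simp: unit_simps bij_betw_def inj_on_def)

lemma Scalar_lin: "lin (scalars K) unit_obj Scalar"
 by (rule linI) (auto simp: unit_simps)

lemma scalar_of_lin: "lin unit_obj (scalars K) scalar_of"
 by (rule linI) (auto simp: unit_simps)

lemma unit_hm: "hm (unit_obj :: ('k,'b,('k,'s) univ) hmod)"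
proof -
 let ?I = "unit_obj :: ('k,'b,('k,'s) univ) hmod"
 interpret BM: module K B by (rule B_mod)
 have e: "\<And>b. b \<in>. B \<Longrightarrow> counit B b \<in>. K" by (rule lin|assumption)+
 note el = hcoalg_lin(2)[OF B_coalg]
 have "hom_vector_space K ?I"
  unfolding hom_vector_space_def by (intro conjI unit_module linI) (auto simp: unit_simps)
 moreover have "bil B ?I ?I (act ?I)"
  by (intro bilI linI)
   (auto simp: unit_simps e lin_add[OF el] lin_smult[OF el] r_distr l_distr m_ac)
 moreover have "counit B (alpha B a) = counit B a" if "a \<in>. B" for a
  by (rule hcoalg_counit_alpha[OF B_coalg that])
 ultimately have "left_hom_module K B ?I (act ?I)"
  unfolding left_hom_module_def using halg_one[OF B_alg] alpha_closed[OF _ B_hs] halg_mult_multilin(1)[OF _ _ B_alg]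
  by (auto simp: unit_simps e hbialg_counit[OF B] m_assoc)
 moreover have "bijective_alpha ?I"
  unfolding bijective_alpha_def bij_betw_def by (auto simp: inj_on_def unit_simps image_iff)
 moreover have "normal_space K ?I"
  by (auto simp: normal_space_def hmod_unit_def Let_def transport_def fun_eq_iff)
 moreover have "alpha ?I \<in> extensional (carrier ?I)" by (simp add: hmod_unit_def Let_def)
 moreover have "act ?I = (\<lambda>b\<in>carrier B. \<lambda>m\<in>carrier ?I. act ?I b m)"
  by (auto simp: hmod_unit_def Let_def fun_eq_iff)
 ultimately show ?thesis by (simp add: is_hmod_def)
qed

lemma mor_lin: "f \<in> mor M N \<Longrightarrow> lin M N f"
 by (simp add: hmod_mor_def)

lemma mor_closed: "f \<in> mor M N \<Longrightarrow> m \<in>. M \<Longrightarrow> f m \<in>. N"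
 by (rule lin_closed[OF mor_lin])

lemma mor_alpha: "f \<in> mor M N \<Longrightarrow> m \<in>. M \<Longrightarrow> f (alpha M m) = alpha N (f m)"
 by (simp add: hmod_mor_def)

lemma mor_alpha_inv:
 assumes f: "f \<in> mor M N" and MN: "hm M" "hm N" and m: "m \<in>. M"
 shows "f (alpha_inv M m) = alpha_inv N (f m)"
proof (rule alpha_inv_eqI[OF hm_hs[OF MN(2)], symmetric])
 have i: "alpha_inv M m \<in>. M" by (rule alpha_inv_closed[OF m hm_hs[OF MN(1)]])
 then show "f (alpha_inv M m) \<in>. N" by (rule mor_closed[OF f])
 show "alpha N (f (alpha_inv M m)) = f m"
  by (simp add: mor_alpha[OF f i, symmetric] alpha_alpha_inv hm_hs MN m)
qed

lemma mor_act: "f \<in> mor M N \<Longrightarrow> b \<in>. B \<Longrightarrow> m \<in>. M \<Longrightarrow> f (act M b m) = act N b (f m)"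
 by (simp add: hmod_mor_def)

lemma mor_extensional: "f \<in> mor M N \<Longrightarrow> f \<in> extensional (carrier M)"
 by (simp add: hmod_mor_def)

lemma id_mor: "hm M \<Longrightarrow> (\<lambda>m\<in>carrier M. m) \<in> mor M M"
 by (auto simp: hmod_mor_def alpha_closed hm_hs hm_act_multilin intro: lin_restrict lin_id hm_module)

lemma comp_mor:
 assumes f: "f \<in> mor M N" and g: "g \<in> mor N P" and M: "hm M"
 shows "compose (carrier M) g f \<in> mor M P"
proof -
 have "lin M P (compose (carrier M) g f)"
  unfolding compose_def by (rule lin_restrict[OF hm_module[OF M] lin_comp[OF mor_lin[OF g] mor_lin[OF f]]])
 then show ?thesis
  using M by (auto simp: hmod_mor_def[of _ _ M P] compose_eq alpha_closed hm_hs hm_act_multilin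
    mor_alpha[OF f] mor_alpha[OF g] mor_act[OF f] mor_act[OF g] mor_closed[OF f])
qed

text \<open>The inverse of a bijective morphism is a morphism, so that linear inverses of the constraints suffice.\<close>

lemma inverse_mor:
 assumes f: "f \<in> mor M N" and M: "hm M" and N: "hm N" and h: "lin N M h"
  and hf: "\<And>m. m \<in>. M \<Longrightarrow> h (f m) = m" and fh: "\<And>n. n \<in>. N \<Longrightarrow> f (h n) = n"
 shows "(\<lambda>n\<in>carrier N. h n) \<in> mor N M"
proof -
 have hc: "n \<in>. N \<Longrightarrow> h n \<in>. M" for n by (rule lin_closed[OF h])
 have "h (alpha N n) = alpha M (h n)" if n: "n \<in>. N" for n
  using hf[of "alpha M (h n)"] mor_alpha[OF f hc[OF n]] n hc fh by (simp add: alpha_closed hm_hs M)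
 moreover have "h (act N b n) = act M b (h n)" if n: "n \<in>. N" and b: "b \<in>. B" for b n
  using hf[of "act M b (h n)"] mor_act[OF f b hc[OF n]] n b hc fh by (simp add: hm_act_multilin M)
 ultimately show ?thesis
  using lin_restrict[OF hm_module[OF N] h]
  by (simp add: hmod_mor_def alpha_closed hm_hs hm_act_multilin N)
qed

lemma tp_upure_closed:
 "hm M \<Longrightarrow> hm N \<Longrightarrow> m \<in>. M \<Longrightarrow> n \<in>. N \<Longrightarrow> upure K M N m n \<in>. tp M N"
 by (simp add: upure_closed utens_tp hm_module)

text \<open>
 Morphisms out of tensor products agree if they agree on pure tensors. This and the versions for
 iterated tensor products reduce all coherence conditions to computations with elements.
\<close>

lemma tp_mor_ext:
 assumes f: "f \<in> mor (tp M N) P" and g: "g \<in> mor (tp M N) P" and M: "hm M" and N: "hm N" and P: "module K P"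
  and eq: "\<And>m n. m \<in>. M \<Longrightarrow> n \<in>. N \<Longrightarrow> f (upure K M N m n) = g (upure K M N m n)"
 shows "f = g"
proof (rule extensionalityI[OF mor_extensional[OF f] mor_extensional[OF g]])
 fix z assume z: "z \<in>. tp M N"
 show "f z = g z"
  by (rule utens_ext[OF z utens_tp[OF hm_module[OF M] hm_module[OF N]] P mor_lin[OF f] mor_lin[OF g] eq])
qed

lemma tp_lin_ext2:
 assumes f: "lin (tp (tp M N) P) Q f" and g: "lin (tp (tp M N) P) Q g"
  and M [lin]: "hm M" and N [lin]: "hm N" and P [lin]: "hm P" and Q: "module K Q"
  and w: "w \<in>. tp (tp M N) P"
  and eq: "\<And>m n p. m \<in>. M \<Longrightarrow> n \<in>. N \<Longrightarrow> p \<in>. P \<Longrightarrow>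
   f (upure K (tp M N) P (upure K M N m n) p) = g (upure K (tp M N) P (upure K M N m n) p)"
 shows "f w = g w"
proof -
 have MN: "module K M" "module K N" "module K P" "module K (tp M N)" by (rule lin)+
 note [lin] = lin_multilin(2)[OF f] lin_multilin(2)[OF g]
 show ?thesis
 proof (rule utens_ext[OF w utens_tp[OF MN(4,3)] Q f g])
  fix z p assume z: "z \<in>. tp M N" and p: "p \<in>. P"
  note [lin] = p
  show "f (upure K (tp M N) P z p) = g (upure K (tp M N) P z p)"
   by (rule utens_ext[OF z utens_tp[OF MN(1,2)] Q]) (rule eq p lin|assumption)+
 qed
qed

lemma tp_mor_ext2:
 assumes f: "f \<in> mor (tp (tp M N) P) Q" and g: "g \<in> mor (tp (tp M N) P) Q"
  and M: "hm M" and N: "hm N" and P: "hm P" and Q: "module K Q"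
  and eq: "\<And>m n p. m \<in>. M \<Longrightarrow> n \<in>. N \<Longrightarrow> p \<in>. P \<Longrightarrow>
   f (upure K (tp M N) P (upure K M N m n) p) = g (upure K (tp M N) P (upure K M N m n) p)"
 shows "f = g"
 by (rule extensionalityI[OF mor_extensional[OF f] mor_extensional[OF g]])
  (rule tp_lin_ext2[OF mor_lin[OF f] mor_lin[OF g] M N P Q _ eq])

lemma tp_mor_ext3:
 assumes f: "f \<in> mor (tp (tp (tp L M) N) P) Q" and g: "g \<in> mor (tp (tp (tp L M) N) P) Q"
  and L: "hm L" and M: "hm M" and N: "hm N" and P: "hm P" and Q: "module K Q"
  and eq: "\<And>l m n p. l \<in>. L \<Longrightarrow> m \<in>. M \<Longrightarrow> n \<in>. N \<Longrightarrow> p \<in>. P \<Longrightarrow>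
   f (upure K (tp (tp L M) N) P (upure K (tp L M) N (upure K L M l m) n) p) =
   g (upure K (tp (tp L M) N) P (upure K (tp L M) N (upure K L M l m) n) p)"
 shows "f = g"
proof (rule tp_mor_ext2[OF f g tp_hm[OF L M] N P Q])
 fix z n p assume z: "z \<in>. tp L M" and np [lin]: "n \<in>. N" "p \<in>. P"
 note [lin] = lin_multilin(2)[OF mor_lin[OF f]] lin_multilin(2)[OF mor_lin[OF g]] tp_hm L M N P
 show "f (upure K (tp (tp L M) N) P (upure K (tp L M) N z n) p) =
   g (upure K (tp (tp L M) N) P (upure K (tp L M) N z n) p)"
  by (rule utens_ext[OF z utens_tp[OF hm_module[OF L] hm_module[OF M]] Q]) (rule eq np lin|assumption)+
qed

lemma tp_morI:
 assumes f: "lin (tp M N) P f" "f \<in> extensional (carrier (tp M N))" and M [lin]: "hm M" and N [lin]: "hm N" and P [lin]: "hm P"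
  and alpha: "\<And>m n. m \<in>. M \<Longrightarrow> n \<in>. N \<Longrightarrow>
   f (upure K M N (alpha M m) (alpha N n)) = alpha P (f (upure K M N m n))"
  and act: "\<And>b m n. b \<in>. B \<Longrightarrow> m \<in>. M \<Longrightarrow> n \<in>. N \<Longrightarrow>
   f (act (tp M N) b (upure K M N m n)) = act P b (f (upure K M N m n))"
 shows "f \<in> mor (tp M N) P"
proof -
 note [lin] = lin_multilin[OF f(1)] tp_hm
 have u: "utens (tp M N) M N" by (rule lin)+
 have "f (alpha (tp M N) z) = alpha P (f z)" if z: "z \<in>. tp M N" for z
  by (rule utens_ext[OF z u, where U=P])
   (rule lin | assumption | simp add: tp_alpha_upure hm_hs M N alpha)+
 moreover have "f (act (tp M N) b z) = act P b (f z)" if z: "z \<in>. tp M N" and b [lin]: "b \<in>. B" for b z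
  by (rule utens_ext[OF z u, where U=P]) (rule act b lin|assumption)+
 ultimately show ?thesis using f by (simp add: hmod_mor_def)
qed

definition ten where
 "ten M N M' N' f g = (\<lambda>z\<in>carrier (tp M N). usweedler (tp M' N') z (\<lambda>m n. upure K M' N' (f m) (g n)))"

lemma ten_lin:
 assumes f: "f \<in> mor M M'" and g: "g \<in> mor N N'" and [lin]: "hm M" "hm N" "hm M'" "hm N'"
 shows "lin (tp M N) (tp M' N') (ten M N M' N' f g)"
proof -
 note [lin] = lin_multilin[OF mor_lin[OF f]] lin_multilin[OF mor_lin[OF g]] tp_hm
 show ?thesis unfolding ten_def by (rule lin_restrict) (rule lin|assumption)+
qed

lemma ten_upure:
 assumes f: "f \<in> mor M M'" and g: "g \<in> mor N N'" and M [lin]: "hm M" "hm N" "hm M'" "hm N'"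
  and mn [lin]: "m \<in>. M" "n \<in>. N"
 shows "ten M N M' N' f g (upure K M N m n) = upure K M' N' (f m) (g n)"
proof -
 note [lin] = lin_multilin[OF mor_lin[OF f]] lin_multilin[OF mor_lin[OF g]] tp_hm
 have u [lin]: "utens (tp M N) M N" by (rule lin)+
 have "usweedler (tp M' N') (upure K M N m n) (\<lambda>m n. upure K M' N' (f m) (g n)) = upure K M' N' (f m) (g n)"
  by (rule usweedler_upure) (rule lin|assumption)+
 then show ?thesis using tp_upure_closed[OF M(1,2) mn] by (simp add: ten_def)
qed

lemma ten_mor:
 assumes f: "f \<in> mor M M'" and g: "g \<in> mor N N'" and M [lin]: "hm M" "hm N" "hm M'" "hm N'"
 shows "ten M N M' N' f g \<in> mor (tp M N) (tp M' N')"
proof (rule tp_morI[OF ten_lin[OF f g M] _ M(1,2) tp_hm[OF M(3,4)]])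
 note [lin] = lin_multilin[OF mor_lin[OF f]] lin_multilin[OF mor_lin[OF g]] tp_hm
 note tu = ten_upure[OF f g M]
 show "ten M N M' N' f g \<in> extensional (carrier (tp M N))" by (simp add: ten_def)
 fix m n assume mn [lin]: "m \<in>. M" "n \<in>. N"
 show "ten M N M' N' f g (upure K M N (alpha M m) (alpha N n)) = alpha (tp M' N') (ten M N M' N' f g (upure K M N m n))"
  using M mn by (simp add: tu alpha_closed hm_hs tp_alpha_upure mor_closed[OF f] mor_closed[OF g]
    mor_alpha[OF f] mor_alpha[OF g])
 fix b assume b [lin]: "b \<in>. B"
 have "ten M N M' N' f g (act (tp M N) b (upure K M N m n)) =
   ten M N M' N' f g (sw (tp M N) (comult B b) (\<lambda>b1 b2. upure K M N (act M b1 m) (act N b2 n)))"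
  by (simp add: tp_act_upure M b mn)
 also have "... = sw (tp M' N') (comult B b) (\<lambda>b1 b2. ten M N M' N' f g (upure K M N (act M b1 m) (act N b2 n)))"
  by (rule sw_hom[OF _ _ _ _ _ ten_lin[OF f g M]]) (rule lin|assumption)+
 also have "... = sw (tp M' N') (comult B b) (\<lambda>b1 b2. upure K M' N' (act M' b1 (f m)) (act N' b2 (g n)))"
  by (rule sw_cong) ((rule lin|assumption)+, simp add: tu hm_act_multilin M mn mor_act[OF f] mor_act[OF g])
 also have "... = act (tp M' N') b (upure K M' N' (f m) (g n))"
  by (rule tp_act_upure[symmetric]) (rule lin)+
 finally show "ten M N M' N' f g (act (tp M N) b (upure K M N m n)) =
   act (tp M' N') b (ten M N M' N' f g (upure K M N m n))" by (simp add: tu mn)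
qed

definition asc where
 "asc M N P = (\<lambda>w\<in>carrier (tp (tp M N) P).
   usweedler (tp M (tp N P)) w (\<lambda>z p. usweedler (tp M (tp N P)) z (\<lambda>m n.
    upure K M (tp N P) (alpha_inv M m) (upure K N P n (alpha P p)))))"

text \<open>The components \<open>\<alpha>\<^sup>-\<^sup>1\<close> and \<open>\<alpha>\<close> of the associator are inverted by exchanging them.\<close>

definition asc_inv where
 "asc_inv M N P w = usweedler (tp (tp M N) P) w (\<lambda>m z. usweedler (tp (tp M N) P) z (\<lambda>n p.
    upure K (tp M N) P (upure K M N (alpha M m) n) (alpha_inv P p)))"

context
 fixes M N P :: "('k,'b,('k,'s) univ) hmod"
 assumes M [lin]: "hm M" and N [lin]: "hm N" and P [lin]: "hm P"
begin

lemma asc_lin: "lin (tp (tp M N) P) (tp M (tp N P)) (asc M N P)"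
proof -
 note [lin] = tp_hm
 show ?thesis unfolding asc_def by (rule lin_restrict) (rule lin|assumption)+
qed

lemma asc_upure:
 assumes mnp [lin]: "m \<in>. M" "n \<in>. N" "p \<in>. P"
 shows "asc M N P (upure K (tp M N) P (upure K M N m n) p) = upure K M (tp N P) (alpha_inv M m) (upure K N P n (alpha P p))"
proof -
 note [lin] = tp_hm
 let ?t = "\<lambda>z p. usweedler (tp M (tp N P)) z (\<lambda>m n. upure K M (tp N P) (alpha_inv M m) (upure K N P n (alpha P p)))"
 have u [lin]: "utens (tp M N) M N" "utens (tp (tp M N) P) (tp M N) P" by (rule lin)+
 have cl: "upure K M N m n \<in>. tp M N" "upure K (tp M N) P (upure K M N m n) p \<in>. tp (tp M N) P"
  by (rule lin)+
 have "usweedler (tp M (tp N P)) (upure K (tp M N) P (upure K M N m n) p) ?t = ?t (upure K M N m n) p"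
  by (rule usweedler_upure) (rule cl lin|assumption)+
 also have "... = upure K M (tp N P) (alpha_inv M m) (upure K N P n (alpha P p))"
  by (rule usweedler_upure) (rule lin|assumption)+
 finally show ?thesis using cl by (simp add: asc_def)
qed

lemma asc_inv_lin: "lin (tp M (tp N P)) (tp (tp M N) P) (asc_inv M N P)"
proof -
 note [lin] = tp_hm
 show ?thesis unfolding asc_inv_def by (rule lin|assumption)+
qed

lemma asc_inv_upure:
 assumes mnp [lin]: "m \<in>. M" "n \<in>. N" "p \<in>. P"
 shows "asc_inv M N P (upure K M (tp N P) m (upure K N P n p)) = upure K (tp M N) P (upure K M N (alpha M m) n) (alpha_inv P p)"
proof -
 note [lin] = tp_hm
 let ?t = "\<lambda>m z. usweedler (tp (tp M N) P) z (\<lambda>n p. upure K (tp M N) P (upure K M N (alpha M m) n) (alpha_inv P p))"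
 have u [lin]: "utens (tp N P) N P" "utens (tp M (tp N P)) M (tp N P)" by (rule lin)+
 have cl: "upure K N P n p \<in>. tp N P" by (rule lin)+
 have "usweedler (tp (tp M N) P) (upure K M (tp N P) m (upure K N P n p)) ?t = ?t m (upure K N P n p)"
  by (rule usweedler_upure) (rule cl lin|assumption)+
 also have "... = upure K (tp M N) P (upure K M N (alpha M m) n) (alpha_inv P p)"
  by (rule usweedler_upure) (rule lin|assumption)+
 finally show ?thesis by (simp add: asc_inv_def)
qed

lemma asc_inv_asc:
 assumes w: "w \<in>. tp (tp M N) P" shows "asc_inv M N P (asc M N P w) = w"
proof -
 note [lin] = tp_hm
 show ?thesis
  by (rule tp_lin_ext2[OF lin_comp[OF asc_inv_lin asc_lin] lin_id M N P _ w])
   (rule lin | simp add: asc_upure asc_inv_upure hs_simps hm_hs M N P)+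
qed

lemma asc_asc_inv:
 assumes w: "w \<in>. tp M (tp N P)" shows "asc M N P (asc_inv M N P w) = w"
proof -
 note [lin] = tp_hm
 note l = lin_comp[OF asc_lin asc_inv_lin]
 note [lin] = lin_multilin(2)[OF l]
 have u: "utens (tp N P) N P" "utens (tp M (tp N P)) M (tp N P)" by (rule lin)+
 show ?thesis
 proof (rule utens_ext[OF w u(2) _ l lin_id])
  fix m z assume m [lin]: "m \<in>. M" and z: "z \<in>. tp N P"
  show "asc M N P (asc_inv M N P (upure K M (tp N P) m z)) = upure K M (tp N P) m z"
   by (rule utens_ext[OF z u(1), where U="tp M (tp N P)"])
    (rule lin | assumption | simp add: asc_upure asc_inv_upure hs_simps hm_hs M N P m)+
 qed (rule lin)+
qed

text \<open>
 The associator moves \<open>\<alpha>\<^sup>-\<^sup>1\<close> and \<open>\<alpha>\<close> onto the outer tensorands of the iterated coproduct, which is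
 precisely the form of Hom-coassociativity.
\<close>

lemma asc_act:
 assumes b [lin]: "b \<in>. B" and mnp [lin]: "m \<in>. M" "n \<in>. N" "p \<in>. P"
 shows "asc M N P (act (tp (tp M N) P) b (upure K (tp M N) P (upure K M N m n) p)) =
  act (tp M (tp N P)) b (asc M N P (upure K (tp M N) P (upure K M N m n) p))"
proof -
 note [lin] = tp_hm lin_multilin[OF asc_lin]
 let ?S = "tp (tp M N) P" and ?T = "tp M (tp N P)" and ?i = "alpha_inv M" and ?j = "alpha_inv B"
 let ?t = "\<lambda>x y z. upure K M (tp N P) (act M (?j x) (?i m)) (upure K N P (act N y n) (act P z (alpha P p)))"
 have cl: "upure K M N m n \<in>. tp M N" "?i m \<in>. M" "alpha P p \<in>. P"
  "upure K N P n (alpha P p) \<in>. tp N P" by (rule lin)+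
 have "act ?S b (upure K (tp M N) P (upure K M N m n) p) =
   sw ?S (comult B b) (\<lambda>b1 b2. upure K (tp M N) P (act (tp M N) b1 (upure K M N m n)) (act P b2 p))"
  by (rule tp_act_upure) (rule lin)+
 then have "asc M N P (act ?S b (upure K (tp M N) P (upure K M N m n) p)) =
   sw ?T (comult B b) (\<lambda>b1 b2. asc M N P (upure K (tp M N) P (act (tp M N) b1 (upure K M N m n)) (act P b2 p)))"
  by (simp only:) (rule sw_hom[OF _ _ _ _ _ asc_lin], (rule lin|assumption)+)
 also have "... = sw ?T (comult B b) (\<lambda>b1 b2. sw ?T (comult B b1) (\<lambda>b11 b12. ?t b11 b12 (alpha B b2)))"
 proof (rule sw_cong, (rule lin|assumption)+, goal_cases)
  case b12 [lin]: (1 b1 b2)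
  have g: "lin (tp M N) ?T (\<lambda>z. asc M N P (upure K (tp M N) P z (act P b2 p)))"
   by (rule lin|assumption)+
  have "asc M N P (upure K (tp M N) P (act (tp M N) b1 (upure K M N m n)) (act P b2 p)) =
    asc M N P (upure K (tp M N) P (sw (tp M N) (comult B b1) (\<lambda>b11 b12. upure K M N (act M b11 m) (act N b12 n))) (act P b2 p))"
   by (simp add: tp_act_upure M N b12 mnp)
  also have "... = sw ?T (comult B b1) (\<lambda>b11 b12. asc M N P (upure K (tp M N) P (upure K M N (act M b11 m) (act N b12 n)) (act P b2 p)))"
   by (rule sw_hom[OF _ _ _ _ _ g]) (rule lin|assumption)+
  also have "... = sw ?T (comult B b1) (\<lambda>b11 b12. ?t b11 b12 (alpha B b2))"
   by (rule sw_cong) ((rule lin|assumption)+, simp add: asc_upure hm_act_multilin M N P mnp b12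
     hmodule_inv[OF hm_hmodule[OF M]] hmodule_alpha[OF hm_hmodule[OF P]])
  finally show ?case .
 qed
 also have "... = sw ?T (comult B b) (\<lambda>b1 b2. sw ?T (comult B b2) (\<lambda>b21 b22. ?t (alpha B b1) b21 b22))"
  by (rule coact_coassoc[OF B_comod]) (rule lin|assumption)+
 also have "... = sw ?T (comult B b) (\<lambda>b1 b2. upure K M (tp N P) (act M b1 (?i m)) (act (tp N P) b2 (upure K N P n (alpha P p))))"
 proof (rule sw_cong, (rule lin|assumption)+, goal_cases)
  case b12 [lin]: (1 b1 b2)
  have "upure K M (tp N P) (act M b1 (?i m)) (act (tp N P) b2 (upure K N P n (alpha P p))) =
    upure K M (tp N P) (act M b1 (?i m)) (sw (tp N P) (comult B b2) (\<lambda>b21 b22. upure K N P (act N b21 n) (act P b22 (alpha P p))))"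
   by (simp add: tp_act_upure N P b12 mnp cl)
  also have "... = sw ?T (comult B b2) (\<lambda>b21 b22. upure K M (tp N P) (act M b1 (?i m)) (upure K N P (act N b21 n) (act P b22 (alpha P p))))"
   by (rule sw_hom[where g="upure K M (tp N P) (act M b1 (?i m))"]) (rule lin|assumption)+
  finally show ?case
   by (simp add: alpha_inv_alpha B_hs b12)
 qed
 also have "... = act ?T b (upure K M (tp N P) (?i m) (upure K N P n (alpha P p)))"
  by (rule tp_act_upure[symmetric]) (rule lin)+
 finally show ?thesis by (simp add: asc_upure mnp)
qed

lemma asc_mor: "asc M N P \<in> mor (tp (tp M N) P) (tp M (tp N P))"
proof (rule tp_morI[OF asc_lin _ tp_hm[OF M N] P tp_hm[OF M tp_hm[OF N P]]])
 note [lin] = tp_hm lin_multilin[OF asc_lin]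
 have u: "utens (tp M N) M N" by (rule lin)+
 show "asc M N P \<in> extensional (carrier (tp (tp M N) P))" by (simp add: asc_def)
 fix z p assume z: "z \<in>. tp M N" and p [lin]: "p \<in>. P"
 show "asc M N P (upure K (tp M N) P (alpha (tp M N) z) (alpha P p)) = alpha (tp M (tp N P)) (asc M N P (upure K (tp M N) P z p))"
  by (rule utens_ext[OF z u, where U="tp M (tp N P)"])
   (rule lin | assumption | simp add: tp_alpha_upure asc_upure hs_simps hm_hs M N P p tp_hm tp_upure_closed)+
 fix b assume b [lin]: "b \<in>. B"
 show "asc M N P (act (tp (tp M N) P) b (upure K (tp M N) P z p)) =
   act (tp M (tp N P)) b (asc M N P (upure K (tp M N) P z p))"
  by (rule utens_ext[OF z u, where U="tp M (tp N P)"]) (rule asc_act b p lin|assumption)+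
qed

end

definition lun where
 "lun M = (\<lambda>z\<in>carrier (tp unit_obj M). usweedler M z (\<lambda>x m. scalar_of x \<odot>\<^bsub>M\<^esub> alpha_inv M m))"

definition run where
 "run M = (\<lambda>z\<in>carrier (tp M unit_obj). usweedler M z (\<lambda>m x. scalar_of x \<odot>\<^bsub>M\<^esub> alpha_inv M m))"

lemmas unit_multilin = unit_hm lin_multilin[OF scalar_of_lin] lin_multilin(1)[OF scalar_of_lin, simplified]
 lin_multilin(1)[OF Scalar_lin] lin_multilin(2)[OF Scalar_lin] one_closed

context
 fixes M :: "('k,'b,('k,'s) univ) hmod"
 assumes M [lin]: "hm M"
begin

interpretation M: module K M by (rule hm_module[OF M])

lemma lun_lin: "lin (tp unit_obj M) M (lun M)"
proof -
 note [lin] = tp_hm unit_multilin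
 show ?thesis unfolding lun_def by (rule lin_restrict) (rule lin|assumption)+
qed

lemma lun_upure:
 assumes r: "r \<in>. K" and m [lin]: "m \<in>. M"
 shows "lun M (upure K unit_obj M (Scalar r) m) = r \<odot>\<^bsub>M\<^esub> alpha_inv M m"
proof -
 note [lin] = tp_hm unit_multilin
 have x [lin]: "Scalar r \<in>. unit_obj" using r by (simp add: unit_simps)
 have u [lin]: "utens (tp unit_obj M) unit_obj M" by (rule lin)+
 have "usweedler M (upure K unit_obj M (Scalar r) m) (\<lambda>x m. scalar_of x \<odot>\<^bsub>M\<^esub> alpha_inv M m) =
   scalar_of (Scalar r :: ('k,'s) univ) \<odot>\<^bsub>M\<^esub> alpha_inv M m"
  by (rule usweedler_upure) (rule lin x | assumption)+
 then show ?thesis using tp_upure_closed[OF unit_hm M x m] by (simp add: lun_def)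
qed

lemma run_lin: "lin (tp M unit_obj) M (run M)"
proof -
 note [lin] = tp_hm unit_multilin
 show ?thesis unfolding run_def by (rule lin_restrict) (rule lin|assumption)+
qed

lemma run_upure:
 assumes r: "r \<in>. K" and m [lin]: "m \<in>. M"
 shows "run M (upure K M unit_obj m (Scalar r)) = r \<odot>\<^bsub>M\<^esub> alpha_inv M m"
proof -
 note [lin] = tp_hm unit_multilin
 have x [lin]: "Scalar r \<in>. unit_obj" using r by (simp add: unit_simps)
 have u [lin]: "utens (tp M unit_obj) M unit_obj" by (rule lin)+
 have "usweedler M (upure K M unit_obj m (Scalar r)) (\<lambda>m x. scalar_of x \<odot>\<^bsub>M\<^esub> alpha_inv M m) =
   scalar_of (Scalar r :: ('k,'s) univ) \<odot>\<^bsub>M\<^esub> alpha_inv M m"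
  by (rule usweedler_upure) (rule lin x | assumption)+
 then show ?thesis using tp_upure_closed[OF M unit_hm m x] by (simp add: run_def)
qed

text \<open>The counit axiom produces one \<open>\<alpha>\<close>, which the factor \<open>\<alpha>\<^sup>-\<^sup>1\<close> of the unit constraints cancels.\<close>

lemma scale_act_alpha_inv:
 assumes b [lin]: "b \<in>. B" and m [lin]: "m \<in>. M" and r [lin]: "r \<in>. K"
 shows "sw M (comult B b) (\<lambda>b1 b2. (counit B b1 \<otimes> r) \<odot>\<^bsub>M\<^esub> alpha_inv M (act M b2 m)) = act M b (r \<odot>\<^bsub>M\<^esub> alpha_inv M m)"
  and "sw M (comult B b) (\<lambda>b1 b2. (counit B b2 \<otimes> r) \<odot>\<^bsub>M\<^esub> alpha_inv M (act M b1 m)) = act M b (r \<odot>\<^bsub>M\<^esub> alpha_inv M m)"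
proof -
 let ?g = "\<lambda>b. r \<odot>\<^bsub>M\<^esub> alpha_inv M (act M b m)"
 have e: "\<And>b. b \<in>. B \<Longrightarrow> counit B b \<in>. K" by (rule lin|assumption)+
 have g: "lin B M ?g" by (rule lin|assumption)+
 have gc: "\<And>b. b \<in>. B \<Longrightarrow> alpha_inv M (act M b m) \<in>. M" by (rule lin|assumption)+
 have gs: "(counit B x \<otimes> r) \<odot>\<^bsub>M\<^esub> alpha_inv M (act M y m) = ?g (counit B x \<odot>\<^bsub>B\<^esub> y)" if "x \<in>. B" "y \<in>. B" for x y
  using lin_smult[OF g e[OF that(1)] that(2)] that e r gc by (simp add: M.smult_assoc1)
 have co: "sw B (comult B b) (\<lambda>b1 b2. counit B b1 \<odot>\<^bsub>B\<^esub> b2) = alpha B b"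
  "sw B (comult B b) (\<lambda>b1 b2. counit B b2 \<odot>\<^bsub>B\<^esub> b1) = alpha B b"
  using B_coalg b by (simp_all add: hcoalg_def hom_coalgebra_def Let_def)
 have fin: "?g (alpha B b) = act M b (r \<odot>\<^bsub>M\<^esub> alpha_inv M m)"
  using lin_smult[OF bil_right[OF hm_act_bil[OF M] b] r, of "alpha_inv M m"]
  by (simp add: hmodule_inv[OF hm_hmodule[OF M]] hs_simps B_hs b m hm_hs M)
 have "sw M (comult B b) (\<lambda>b1 b2. (counit B b1 \<otimes> r) \<odot>\<^bsub>M\<^esub> alpha_inv M (act M b2 m)) = sw M (comult B b) (\<lambda>b1 b2. ?g (counit B b1 \<odot>\<^bsub>B\<^esub> b2))"
  by (rule sw_cong) (rule gs lin|assumption)+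
 also have "... = ?g (sw B (comult B b) (\<lambda>b1 b2. counit B b1 \<odot>\<^bsub>B\<^esub> b2))"
  by (rule sw_hom[OF _ _ _ _ _ g, symmetric]) (rule lin|assumption)+
 finally show "sw M (comult B b) (\<lambda>b1 b2. (counit B b1 \<otimes> r) \<odot>\<^bsub>M\<^esub> alpha_inv M (act M b2 m)) = act M b (r \<odot>\<^bsub>M\<^esub> alpha_inv M m)"
  by (simp only: co fin)
 have "sw M (comult B b) (\<lambda>b1 b2. (counit B b2 \<otimes> r) \<odot>\<^bsub>M\<^esub> alpha_inv M (act M b1 m)) = sw M (comult B b) (\<lambda>b1 b2. ?g (counit B b2 \<odot>\<^bsub>B\<^esub> b1))"
  by (rule sw_cong) (rule gs lin|assumption)+
 also have "... = ?g (sw B (comult B b) (\<lambda>b1 b2. counit B b2 \<odot>\<^bsub>B\<^esub> b1))"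
  by (rule sw_hom[OF _ _ _ _ _ g, symmetric]) (rule lin|assumption)+
 finally show "sw M (comult B b) (\<lambda>b1 b2. (counit B b2 \<otimes> r) \<odot>\<^bsub>M\<^esub> alpha_inv M (act M b1 m)) = act M b (r \<odot>\<^bsub>M\<^esub> alpha_inv M m)"
  by (simp only: co fin)
qed

lemma lun_mor: "lun M \<in> mor (tp unit_obj M) M"
proof (rule tp_morI[OF lun_lin _ unit_hm M M])
 note [lin] = tp_hm unit_multilin
 show "lun M \<in> extensional (carrier (tp unit_obj M))" by (simp add: lun_def)
 fix x m assume x [lin]: "x \<in>. (unit_obj :: ('k,'b,('k,'s) univ) hmod)" and m [lin]: "m \<in>. M"
 then obtain r where r: "r \<in>. K" "x = Scalar r" by (auto simp: unit_simps)
 show "lun M (upure K unit_obj M (alpha unit_obj x) (alpha M m)) = alpha M (lun M (upure K unit_obj M x m))"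
  using r m by (simp add: unit_simps lun_upure hs_simps hm_hs M lin_smult[OF hs_alpha[OF hm_hs[OF M]]])
 fix b assume b [lin]: "b \<in>. B"
 have e: "\<And>b. b \<in>. B \<Longrightarrow> counit B b \<in>. K" by (rule lin|assumption)+
 have "lun M (act (tp unit_obj M) b (upure K unit_obj M x m)) =
   lun M (sw (tp unit_obj M) (comult B b) (\<lambda>b1 b2. upure K unit_obj M (act unit_obj b1 x) (act M b2 m)))"
  by (simp add: tp_act_upure unit_hm M b x m)
 also have "... = sw M (comult B b) (\<lambda>b1 b2. lun M (upure K unit_obj M (act unit_obj b1 x) (act M b2 m)))"
  by (rule sw_hom[OF _ _ _ _ _ lun_lin]) (rule lin|assumption)+
 also have "... = sw M (comult B b) (\<lambda>b1 b2. (counit B b1 \<otimes> r) \<odot>\<^bsub>M\<^esub> alpha_inv M (act M b2 m))"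
  by (rule sw_cong) ((rule lin|assumption)+, simp add: r unit_simps lun_upure e hm_act_multilin M m)
 also have "... = act M b (lun M (upure K unit_obj M x m))"
  using r m b by (simp add: scale_act_alpha_inv lun_upure)
 finally show "lun M (act (tp unit_obj M) b (upure K unit_obj M x m)) = act M b (lun M (upure K unit_obj M x m))" .
qed

lemma run_mor: "run M \<in> mor (tp M unit_obj) M"
proof (rule tp_morI[OF run_lin _ M unit_hm M])
 note [lin] = tp_hm unit_multilin
 show "run M \<in> extensional (carrier (tp M unit_obj))" by (simp add: run_def)
 fix m x assume x [lin]: "x \<in>. (unit_obj :: ('k,'b,('k,'s) univ) hmod)" and m [lin]: "m \<in>. M"
 then obtain r where r: "r \<in>. K" "x = Scalar r" by (auto simp: unit_simps)
 show "run M (upure K M unit_obj (alpha M m) (alpha unit_obj x)) = alpha M (run M (upure K M unit_obj m x))"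
  using r m by (simp add: unit_simps run_upure hs_simps hm_hs M lin_smult[OF hs_alpha[OF hm_hs[OF M]]])
 fix b assume b [lin]: "b \<in>. B"
 have e: "\<And>b. b \<in>. B \<Longrightarrow> counit B b \<in>. K" by (rule lin|assumption)+
 have "run M (act (tp M unit_obj) b (upure K M unit_obj m x)) =
   run M (sw (tp M unit_obj) (comult B b) (\<lambda>b1 b2. upure K M unit_obj (act M b1 m) (act unit_obj b2 x)))"
  by (simp add: tp_act_upure unit_hm M b x m)
 also have "... = sw M (comult B b) (\<lambda>b1 b2. run M (upure K M unit_obj (act M b1 m) (act unit_obj b2 x)))"
  by (rule sw_hom[OF _ _ _ _ _ run_lin]) (rule lin|assumption)+
 also have "... = sw M (comult B b) (\<lambda>b1 b2. (counit B b2 \<otimes> r) \<odot>\<^bsub>M\<^esub> alpha_inv M (act M b1 m))"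
  by (rule sw_cong) ((rule lin|assumption)+, simp add: r unit_simps run_upure e hm_act_multilin M m)
 also have "... = act M b (run M (upure K M unit_obj m x))"
  using r m b by (simp add: scale_act_alpha_inv run_upure)
 finally show "run M (act (tp M unit_obj) b (upure K M unit_obj m x)) = act M b (run M (upure K M unit_obj m x))" .
qed

lemma upure_scale:
 assumes r [lin]: "r \<in>. K" and m [lin]: "m \<in>. M"
 shows "upure K unit_obj M (Scalar \<one>) (r \<odot>\<^bsub>M\<^esub> m) = upure K unit_obj M (Scalar r) m"
  and "upure K M unit_obj (r \<odot>\<^bsub>M\<^esub> m) (Scalar \<one>) = upure K M unit_obj m (Scalar r)"
proof -
 note [lin] = tp_hm unit_multilin
 have [lin]: "(Scalar \<one> :: ('k,'s) univ) \<in>. unit_obj" by (simp add: unit_simps)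
 have u: "utens (tp unit_obj M) unit_obj M" "utens (tp M unit_obj) M unit_obj" by (rule lin)+
 have s: "Scalar r = r \<odot>\<^bsub>unit_obj\<^esub> (Scalar \<one> :: ('k,'s) univ)" using r by (simp add: unit_simps)
 show "upure K unit_obj M (Scalar \<one>) (r \<odot>\<^bsub>M\<^esub> m) = upure K unit_obj M (Scalar r) m"
  unfolding s using lin_smult[OF bil_left[OF upure_bil[OF u(1)]], of m r "Scalar \<one>"]
   lin_smult[OF bil_right[OF upure_bil[OF u(1)]], of "Scalar \<one>" r m] r m by (simp add: unit_simps)
 show "upure K M unit_obj (r \<odot>\<^bsub>M\<^esub> m) (Scalar \<one>) = upure K M unit_obj m (Scalar r)"
  unfolding s using lin_smult[OF bil_left[OF upure_bil[OF u(2)]], of "Scalar \<one>" r m]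
   lin_smult[OF bil_right[OF upure_bil[OF u(2)]], of m r "Scalar \<one>"] r m by (simp add: unit_simps)
qed

definition lun_inv where "lun_inv m = upure K unit_obj M (Scalar \<one>) (alpha M m)"
definition run_inv where "run_inv m = upure K M unit_obj (alpha M m) (Scalar \<one>)"

lemma unit_inv_lin: "lin M (tp unit_obj M) lun_inv" "lin M (tp M unit_obj) run_inv"
proof -
 note [lin] = tp_hm unit_multilin
 have [lin]: "(Scalar \<one> :: ('k,'s) univ) \<in>. unit_obj" by (simp add: unit_simps)
 show "lin M (tp unit_obj M) lun_inv" "lin M (tp M unit_obj) run_inv"
  unfolding lun_inv_def[abs_def] run_inv_def[abs_def] by (rule lin|assumption)+
qed

lemma unit_inv:
 "m \<in>. M \<Longrightarrow> lun M (lun_inv m) = m" "m \<in>. M \<Longrightarrow> run M (run_inv m) = m"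
 "z \<in>. tp unit_obj M \<Longrightarrow> lun_inv (lun M z) = z" "z' \<in>. tp M unit_obj \<Longrightarrow> run_inv (run M z') = z'"
proof -
 note [lin] = tp_hm unit_multilin
 have u: "utens (tp unit_obj M) unit_obj M" "utens (tp M unit_obj) M unit_obj" by (rule lin)+
 show "m \<in>. M \<Longrightarrow> lun M (lun_inv m) = m" "m \<in>. M \<Longrightarrow> run M (run_inv m) = m"
  by (simp_all add: lun_inv_def run_inv_def lun_upure run_upure hs_simps hm_hs M)
 show "z \<in>. tp unit_obj M \<Longrightarrow> lun_inv (lun M z) = z"
  by (rule utens_ext[OF _ u(1) _ lin_comp[OF unit_inv_lin(1) lun_lin] lin_id])
   (assumption | rule lin | auto simp: unit_simps lun_upure lun_inv_def hs_simps hm_hs M upure_scale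
    lin_smult[OF hs_alpha[OF hm_hs[OF M]]])+
 show "z' \<in>. tp M unit_obj \<Longrightarrow> run_inv (run M z') = z'"
  by (rule utens_ext[OF _ u(2) _ lin_comp[OF unit_inv_lin(2) run_lin] lin_id])
   (assumption | rule lin | auto simp: unit_simps run_upure run_inv_def hs_simps hm_hs M upure_scale
    lin_smult[OF hs_alpha[OF hm_hs[OF M]]])+
qed

end

lemma cat_simps:
 "Obj (module_category TYPE('s) K B) = {M. hm M}"
 "Arr (module_category TYPE('s) K B) = {(M, f, N). hm M \<and> hm N \<and> f \<in> mor M N}"
 "Dom (module_category TYPE('s) K B) (M, f, N) = M"
 "Cod (module_category TYPE('s) K B) (M, f, N) = N"
 "Id (module_category TYPE('s) K B) M = (M, \<lambda>m\<in>carrier M. m, M)"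
 "Comp (module_category TYPE('s) K B) (N', g, P) (M, f, N) = (M, compose (carrier M) g f, P)"
 "TObj (module_category TYPE('s) K B) = tp"
 "TArr (module_category TYPE('s) K B) (M, f, M') (N, g, N') = (tp M N, ten M N M' N' f g, tp M' N')"
 "UnitObj (module_category TYPE('s) K B) = unit_obj"
 "Assoc (module_category TYPE('s) K B) M N P = (tp (tp M N) P, asc M N P, tp M (tp N P))"
 "LUnit (module_category TYPE('s) K B) M = (tp unit_obj M, lun M, M)"
 "RUnit (module_category TYPE('s) K B) M = (tp M unit_obj, run M, M)"
 by (simp_all add: module_category_def concrete_moncat_def ten_def asc_def lun_def run_def)

lemma in_hom_iff:
 "in_hom (module_category TYPE('s) K B) F X Y \<longleftrightarrow> (\<exists>f. F = (X, f, Y) \<and> hm X \<and> hm Y \<and> f \<in> mor X Y)"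
 by (cases F) (auto simp: in_hom_def cat_simps)

lemma iso_arrI:
 assumes X: "hm X" and Y: "hm Y" and f: "f \<in> mor X Y" and h: "lin Y X h"
  and hf: "\<And>x. x \<in>. X \<Longrightarrow> h (f x) = x" and fh: "\<And>y. y \<in>. Y \<Longrightarrow> f (h y) = y"
 shows "iso_arr (module_category TYPE('s) K B) (X, f, Y) X Y"
 unfolding iso_arr_def
proof (intro conjI exI[of _ "(Y, \<lambda>y\<in>carrier Y. h y, X)"])
 show "in_hom (module_category TYPE('s) K B) (X, f, Y) X Y"
  using X Y f by (simp add: in_hom_iff)
 show "in_hom (module_category TYPE('s) K B) (Y, \<lambda>y\<in>carrier Y. h y, X) Y X"
  using X Y inverse_mor[OF f X Y h hf fh] by (simp add: in_hom_iff)
 show "(Y, \<lambda>y\<in>carrier Y. h y, X) \<cdot>\<^bsub>module_category TYPE('s) K B\<^esub> (X, f, Y) = Id (module_category TYPE('s) K B) X"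
  using hf mor_closed[OF f] by (auto simp: cat_simps compose_def intro!: restrict_ext)
 show "(X, f, Y) \<cdot>\<^bsub>module_category TYPE('s) K B\<^esub> (Y, \<lambda>y\<in>carrier Y. h y, X) = Id (module_category TYPE('s) K B) Y"
  using fh lin_closed[OF h] by (auto simp: cat_simps compose_def intro!: restrict_ext)
qed

lemma compose_id:
 assumes f: "f \<in> mor X Y"
 shows "compose (carrier X) (\<lambda>m\<in>carrier Y. m) f = f" "compose (carrier X) f (\<lambda>m\<in>carrier X. m) = f"
 by (rule extensionalityI[of _ "carrier X"],
   simp_all add: compose_def mor_extensional[OF f] mor_closed[OF f])+

lemma module_category_monoidal: "monoidal_category (module_category TYPE('s) K B)"
proof (intro monoidal_category.intro category.intro monoidal_category_axioms.intro)
 let ?C = "module_category TYPE('s) K B"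
 note mods = hm_module
 note cl = hs_simps hm_hs tp_hm unit_hm tp_upure_closed
 fix f :: "('k, 'b, ('k, 's) univ) hmod \<times> (('k, 's) univ \<Rightarrow> ('k, 's) univ) \<times> ('k, 'b, ('k, 's) univ) hmod"
  and g h f' g' :: "('k, 'b, ('k, 's) univ) hmod \<times> (('k, 's) univ \<Rightarrow> ('k, 's) univ) \<times> ('k, 'b, ('k, 's) univ) hmod"
  and W X Y Z X' Y' Z' X'' Y'' :: "('k, 'b, ('k, 's) univ) hmod"
 show "f \<in> Arr ?C \<Longrightarrow> Dom ?C f \<in> Obj ?C" "f \<in> Arr ?C \<Longrightarrow> Cod ?C f \<in> Obj ?C"
  by (auto simp: cat_simps)
 show "X \<in> Obj ?C \<Longrightarrow> in_hom ?C (Id ?C X) X X"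
  by (auto simp: cat_simps in_hom_iff id_mor)
 show "in_hom ?C f X Y \<Longrightarrow> in_hom ?C g Y Z \<Longrightarrow> in_hom ?C (g \<cdot>\<^bsub>?C\<^esub> f) X Z"
  by (auto simp: cat_simps in_hom_iff comp_mor)
 show "in_hom ?C f X Y \<Longrightarrow> Id ?C Y \<cdot>\<^bsub>?C\<^esub> f = f" "in_hom ?C f X Y \<Longrightarrow> f \<cdot>\<^bsub>?C\<^esub> Id ?C X = f"
  by (auto simp: cat_simps in_hom_iff compose_id)
 show "in_hom ?C f W X \<Longrightarrow> in_hom ?C g X Y \<Longrightarrow> in_hom ?C h Y Z \<Longrightarrow> (h \<cdot>\<^bsub>?C\<^esub> g) \<cdot>\<^bsub>?C\<^esub> f = h \<cdot>\<^bsub>?C\<^esub> (g \<cdot>\<^bsub>?C\<^esub> f)"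
  by (auto simp: cat_simps in_hom_iff compose_def mor_closed intro!: restrict_ext)
 show "UnitObj ?C \<in> Obj ?C" by (simp add: cat_simps unit_hm)
 show "X \<in> Obj ?C \<Longrightarrow> Y \<in> Obj ?C \<Longrightarrow> X \<boxtimes>\<^bsub>?C\<^esub> Y \<in> Obj ?C" by (simp add: cat_simps tp_hm)
 show "in_hom ?C f X X' \<Longrightarrow> in_hom ?C g Y Y' \<Longrightarrow> in_hom ?C (f \<star>\<^bsub>?C\<^esub> g) (X \<boxtimes>\<^bsub>?C\<^esub> Y) (X' \<boxtimes>\<^bsub>?C\<^esub> Y')"
  by (auto simp: cat_simps in_hom_iff ten_mor tp_hm)
 show "X \<in> Obj ?C \<Longrightarrow> Y \<in> Obj ?C \<Longrightarrow> Id ?C X \<star>\<^bsub>?C\<^esub> Id ?C Y = Id ?C (X \<boxtimes>\<^bsub>?C\<^esub> Y)"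
 proof -
  assume "X \<in> Obj ?C" "Y \<in> Obj ?C"
  then have XY: "hm X" "hm Y" by (auto simp: cat_simps)
  have "ten X Y X Y (\<lambda>m\<in>carrier X. m) (\<lambda>m\<in>carrier Y. m) = (\<lambda>m\<in>carrier (tp X Y). m)"
   by (rule tp_mor_ext[OF ten_mor[OF id_mor id_mor] id_mor[OF tp_hm]])
    (simp_all add: XY hm_module[OF tp_hm] ten_upure[OF id_mor id_mor] tp_upure_closed)
  then show ?thesis by (simp add: cat_simps)
 qed
 show "(f' \<cdot>\<^bsub>?C\<^esub> f) \<star>\<^bsub>?C\<^esub> (g' \<cdot>\<^bsub>?C\<^esub> g) = (f' \<star>\<^bsub>?C\<^esub> g') \<cdot>\<^bsub>?C\<^esub> (f \<star>\<^bsub>?C\<^esub> g)"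
  if hf: "in_hom ?C f X X'" "in_hom ?C f' X' X''" "in_hom ?C g Y Y'" "in_hom ?C g' Y' Y''"
 proof -
  from hf obtain k k' l l' where e: "f = (X, k, X')" "f' = (X', k', X'')" "g = (Y, l, Y')" "g' = (Y', l', Y'')"
   and hm: "hm X" "hm X'" "hm X''" "hm Y" "hm Y'" "hm Y''"
   and k: "k \<in> mor X X'" "k' \<in> mor X' X''" "l \<in> mor Y Y'" "l' \<in> mor Y' Y''"
   by (auto simp: in_hom_iff)
  note kk = comp_mor[OF k(1,2) hm(1)] and ll = comp_mor[OF k(3,4) hm(4)]
  have "ten X Y X'' Y'' (compose (carrier X) k' k) (compose (carrier Y) l' l) =
    compose (carrier (tp X Y)) (ten X' Y' X'' Y'' k' l') (ten X Y X' Y' k l)"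
   by (rule tp_mor_ext[OF ten_mor[OF kk ll] comp_mor[OF ten_mor[OF k(1,3)] ten_mor[OF k(2,4)]]])
    (simp_all add: hm tp_hm hm_module[OF tp_hm] ten_upure[OF kk ll] ten_upure[OF k(1,3)] ten_upure[OF k(2,4)]
     tp_upure_closed compose_eq mor_closed[OF k(1)] mor_closed[OF k(3)])
  then show ?thesis by (simp add: cat_simps e)
 qed
 show "X \<in> Obj ?C \<Longrightarrow> Y \<in> Obj ?C \<Longrightarrow> Z \<in> Obj ?C \<Longrightarrow>
   iso_arr ?C (Assoc ?C X Y Z) ((X \<boxtimes>\<^bsub>?C\<^esub> Y) \<boxtimes>\<^bsub>?C\<^esub> Z) (X \<boxtimes>\<^bsub>?C\<^esub> (Y \<boxtimes>\<^bsub>?C\<^esub> Z))"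
  unfolding cat_simps
  by (rule iso_arrI[where h="asc_inv X Y Z"]) (simp_all add: tp_hm asc_mor asc_inv_lin asc_inv_asc asc_asc_inv)
 show "Assoc ?C X' Y' Z' \<cdot>\<^bsub>?C\<^esub> ((f \<star>\<^bsub>?C\<^esub> g) \<star>\<^bsub>?C\<^esub> h) = (f \<star>\<^bsub>?C\<^esub> (g \<star>\<^bsub>?C\<^esub> h)) \<cdot>\<^bsub>?C\<^esub> Assoc ?C X Y Z"
  if hf: "in_hom ?C f X X'" "in_hom ?C g Y Y'" "in_hom ?C h Z Z'"
 proof -
  from hf obtain j k l where e: "f = (X, j, X')" "g = (Y, k, Y')" "h = (Z, l, Z')"
   and hm: "hm X" "hm X'" "hm Y" "hm Y'" "hm Z" "hm Z'"
   and k: "j \<in> mor X X'" "k \<in> mor Y Y'" "l \<in> mor Z Z'"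
   by (auto simp: in_hom_iff)
  note jk = ten_mor[OF k(1,2) hm(1,3,2,4)] and kl = ten_mor[OF k(2,3) hm(3,5,4,6)]
  note jk_l = ten_mor[OF jk k(3) tp_hm[OF hm(1,3)] hm(5) tp_hm[OF hm(2,4)] hm(6)]
  note j_kl = ten_mor[OF k(1) kl hm(1) tp_hm[OF hm(3,5)] hm(2) tp_hm[OF hm(4,6)]]
  have "compose (carrier (tp (tp X Y) Z)) (asc X' Y' Z') (ten (tp X Y) Z (tp X' Y') Z' (ten X Y X' Y' j k) l) =
    compose (carrier (tp (tp X Y) Z)) (ten X (tp Y Z) X' (tp Y' Z') j (ten Y Z Y' Z' k l)) (asc X Y Z)"
   by (rule tp_mor_ext2[OF comp_mor[OF jk_l asc_mor] comp_mor[OF asc_mor j_kl]])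
    (simp_all add: hm cl hm_module[OF tp_hm] compose_eq asc_upure ten_upure[OF jk k(3)] ten_upure[OF k(1) kl]
     ten_upure[OF k(1,2)] ten_upure[OF k(2,3)] mor_closed[OF k(1)] mor_closed[OF k(2)] mor_closed[OF k(3)]
     mor_alpha_inv[OF k(1)] mor_alpha[OF k(3)])
  then show ?thesis by (simp add: cat_simps e)
 qed
 show "X \<in> Obj ?C \<Longrightarrow> iso_arr ?C (LUnit ?C X) (UnitObj ?C \<boxtimes>\<^bsub>?C\<^esub> X) X"
  unfolding cat_simps
  by (rule iso_arrI[where h="lun_inv X"]) (simp_all add: tp_hm unit_hm lun_mor unit_inv_lin unit_inv)
 show "LUnit ?C X' \<cdot>\<^bsub>?C\<^esub> (Id ?C (UnitObj ?C) \<star>\<^bsub>?C\<^esub> f) = f \<cdot>\<^bsub>?C\<^esub> LUnit ?C X" if hf: "in_hom ?C f X X'"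
 proof -
  from hf obtain k where e: "f = (X, k, X')" and hm: "hm X" "hm X'" and k: "k \<in> mor X X'"
   by (auto simp: in_hom_iff)
  note ik = ten_mor[OF id_mor[OF unit_hm] k unit_hm hm(1) unit_hm hm(2)]
  have "compose (carrier (tp unit_obj X)) (lun X') (ten unit_obj X unit_obj X' (\<lambda>m\<in>carrier unit_obj. m) k) =
    compose (carrier (tp unit_obj X)) k (lun X)"
  proof (rule tp_mor_ext[OF comp_mor[OF ik lun_mor] comp_mor[OF lun_mor k]])
   fix i x assume x: "x \<in>. X" and i: "i \<in>. (unit_obj :: ('k, 'b, ('k, 's) univ) hmod)"
   then obtain r where r: "r \<in>. K" "i = Scalar r" by (auto simp: unit_simps)
   show "compose (carrier (tp unit_obj X)) (lun X') (ten unit_obj X unit_obj X' (\<lambda>m\<in>carrier unit_obj. m) k) (upure K unit_obj X i x) =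
     compose (carrier (tp unit_obj X)) k (lun X) (upure K unit_obj X i x)"
    using x i[unfolded r(2)] r(1) by (simp add: r(2) hm cl compose_eq ten_upure[OF id_mor[OF unit_hm] k]
     lun_upure mor_closed[OF k] mor_alpha_inv[OF k] lin_smult[OF mor_lin[OF k]])
  qed (simp_all add: hm cl hm_module)
  then show ?thesis by (simp add: cat_simps e)
 qed
 show "X \<in> Obj ?C \<Longrightarrow> iso_arr ?C (RUnit ?C X) (X \<boxtimes>\<^bsub>?C\<^esub> UnitObj ?C) X"
  unfolding cat_simps
  by (rule iso_arrI[where h="run_inv X"]) (simp_all add: tp_hm unit_hm run_mor unit_inv_lin unit_inv)
 show "RUnit ?C X' \<cdot>\<^bsub>?C\<^esub> (f \<star>\<^bsub>?C\<^esub> Id ?C (UnitObj ?C)) = f \<cdot>\<^bsub>?C\<^esub> RUnit ?C X" if hf: "in_hom ?C f X X'"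
 proof -
  from hf obtain k where e: "f = (X, k, X')" and hm: "hm X" "hm X'" and k: "k \<in> mor X X'"
   by (auto simp: in_hom_iff)
  note ki = ten_mor[OF k id_mor[OF unit_hm] hm(1) unit_hm hm(2) unit_hm]
  have "compose (carrier (tp X unit_obj)) (run X') (ten X unit_obj X' unit_obj k (\<lambda>m\<in>carrier unit_obj. m)) =
    compose (carrier (tp X unit_obj)) k (run X)"
  proof (rule tp_mor_ext[OF comp_mor[OF ki run_mor] comp_mor[OF run_mor k]])
   fix i x assume x: "x \<in>. X" and i: "i \<in>. (unit_obj :: ('k, 'b, ('k, 's) univ) hmod)"
   then obtain r where r: "r \<in>. K" "i = Scalar r" by (auto simp: unit_simps)
   show "compose (carrier (tp X unit_obj)) (run X') (ten X unit_obj X' unit_obj k (\<lambda>m\<in>carrier unit_obj. m)) (upure K X unit_obj x i) =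
     compose (carrier (tp X unit_obj)) k (run X) (upure K X unit_obj x i)"
    using x i[unfolded r(2)] r(1) by (simp add: r(2) hm cl compose_eq ten_upure[OF k id_mor[OF unit_hm]]
     run_upure mor_closed[OF k] mor_alpha_inv[OF k] lin_smult[OF mor_lin[OF k]])
  qed (simp_all add: hm cl hm_module)
  then show ?thesis by (simp add: cat_simps e)
 qed
 show "(Id ?C W \<star>\<^bsub>?C\<^esub> Assoc ?C X Y Z) \<cdot>\<^bsub>?C\<^esub> (Assoc ?C W (X \<boxtimes>\<^bsub>?C\<^esub> Y) Z \<cdot>\<^bsub>?C\<^esub> (Assoc ?C W X Y \<star>\<^bsub>?C\<^esub> Id ?C Z)) =
   Assoc ?C W X (Y \<boxtimes>\<^bsub>?C\<^esub> Z) \<cdot>\<^bsub>?C\<^esub> Assoc ?C (W \<boxtimes>\<^bsub>?C\<^esub> X) Y Z"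
  if "W \<in> Obj ?C" "X \<in> Obj ?C" "Y \<in> Obj ?C" "Z \<in> Obj ?C"
 proof -
  have hm: "hm W" "hm X" "hm Y" "hm Z" using that by (auto simp: cat_simps)
  note T = tp_hm hm
  let ?S = "tp (tp (tp W X) Y) Z"
  have m1: "ten (tp (tp W X) Y) Z (tp W (tp X Y)) Z (asc W X Y) (\<lambda>m\<in>carrier Z. m) \<in> mor ?S (tp (tp W (tp X Y)) Z)"
   by (intro ten_mor asc_mor id_mor T)
  have m2: "asc W (tp X Y) Z \<in> mor (tp (tp W (tp X Y)) Z) (tp W (tp (tp X Y) Z))"
   by (intro asc_mor T)
  have m3: "ten W (tp (tp X Y) Z) W (tp X (tp Y Z)) (\<lambda>m\<in>carrier W. m) (asc X Y Z) \<in>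
    mor (tp W (tp (tp X Y) Z)) (tp W (tp X (tp Y Z)))"
   by (intro ten_mor asc_mor id_mor T)
  have m4: "asc (tp W X) Y Z \<in> mor ?S (tp (tp W X) (tp Y Z))" by (intro asc_mor T)
  have m5: "asc W X (tp Y Z) \<in> mor (tp (tp W X) (tp Y Z)) (tp W (tp X (tp Y Z)))" by (intro asc_mor T)
  have "compose (carrier ?S) (ten W (tp (tp X Y) Z) W (tp X (tp Y Z)) (\<lambda>m\<in>carrier W. m) (asc X Y Z))
     (compose (carrier ?S) (asc W (tp X Y) Z) (ten (tp (tp W X) Y) Z (tp W (tp X Y)) Z (asc W X Y) (\<lambda>m\<in>carrier Z. m))) =
    compose (carrier ?S) (asc W X (tp Y Z)) (asc (tp W X) Y Z)"
   by (rule tp_mor_ext3[OF comp_mor[OF comp_mor[OF m1 m2] m3] comp_mor[OF m4 m5]])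
    (simp_all add: T hm_module[OF tp_hm] compose_eq cl asc_upure ten_upure[OF asc_mor id_mor] ten_upure[OF id_mor asc_mor]
     tp_alpha_upure tp_alpha_inv_upure)
  then show ?thesis by (simp add: cat_simps)
 qed
 show "(Id ?C X \<star>\<^bsub>?C\<^esub> LUnit ?C Y) \<cdot>\<^bsub>?C\<^esub> Assoc ?C X (UnitObj ?C) Y = RUnit ?C X \<star>\<^bsub>?C\<^esub> Id ?C Y"
  if "X \<in> Obj ?C" "Y \<in> Obj ?C"
 proof -
  have hm: "hm X" "hm Y" using that by (auto simp: cat_simps)
  note T = tp_hm unit_hm hm
  have m1: "asc X unit_obj Y \<in> mor (tp (tp X unit_obj) Y) (tp X (tp unit_obj Y))" by (intro asc_mor T)
  have m2: "ten X (tp unit_obj Y) X Y (\<lambda>m\<in>carrier X. m) (lun Y) \<in> mor (tp X (tp unit_obj Y)) (tp X Y)"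
   by (intro ten_mor id_mor lun_mor T)
  have m3: "ten (tp X unit_obj) Y X Y (run X) (\<lambda>m\<in>carrier Y. m) \<in> mor (tp (tp X unit_obj) Y) (tp X Y)"
   by (intro ten_mor id_mor run_mor T)
  have u: "utens (tp X Y) X Y" by (intro utens_tp hm_module hm)
  have "compose (carrier (tp (tp X unit_obj) Y)) (ten X (tp unit_obj Y) X Y (\<lambda>m\<in>carrier X. m) (lun Y)) (asc X unit_obj Y) =
    ten (tp X unit_obj) Y X Y (run X) (\<lambda>m\<in>carrier Y. m)"
  proof (rule tp_mor_ext2[OF comp_mor[OF m1 m2] m3])
   fix x i y assume xy: "x \<in>. X" "y \<in>. Y" and i: "i \<in>. (unit_obj :: ('k, 'b, ('k, 's) univ) hmod)"
   then obtain r where r: "r \<in>. K" "i = Scalar r" by (auto simp: unit_simps)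
   note c = xy i[unfolded r(2)] r(1)
   have "upure K X Y (alpha_inv X x) (r \<odot>\<^bsub>Y\<^esub> y) = upure K X Y (r \<odot>\<^bsub>X\<^esub> alpha_inv X x) y"
    using lin_smult[OF bil_left[OF upure_bil[OF u] xy(2)] r(1), of "alpha_inv X x"]
     lin_smult[OF bil_right[OF upure_bil[OF u]] r(1) xy(2), of "alpha_inv X x"]
    by (simp add: cl xy hm)
   then show "compose (carrier (tp (tp X unit_obj) Y)) (ten X (tp unit_obj Y) X Y (\<lambda>m\<in>carrier X. m) (lun Y)) (asc X unit_obj Y)
      (upure K (tp X unit_obj) Y (upure K X unit_obj x i) y) =
     ten (tp X unit_obj) Y X Y (run X) (\<lambda>m\<in>carrier Y. m) (upure K (tp X unit_obj) Y (upure K X unit_obj x i) y)"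
    using c by (simp add: r(2) T compose_eq cl asc_upure ten_upure[OF id_mor lun_mor] ten_upure[OF run_mor id_mor]
      lun_upure run_upure)
  qed (intro T hm_module)+
  then show ?thesis by (simp add: cat_simps)
 qed
qed

end

section \<open>From Doi-Hopf modules to modules over the smash product\<close>

context ground
begin

text \<open>As for algebras, it suffices to check the axioms of the untwisted action.\<close>

lemma left_hom_moduleI:
 assumes A: "halg A" and M: "hs M" and bil: "bil A M M ac"
  and one: "\<And>m. m \<in>. M \<Longrightarrow> uact M ac (one A) m = m"
  and alpha: "\<And>a m. a \<in>. A \<Longrightarrow> m \<in>. M \<Longrightarrow> alpha M (uact M ac a m) = uact M ac (alpha A a) (alpha M m)"
  and assoc: "\<And>a b m. a \<in>. A \<Longrightarrow> b \<in>. A \<Longrightarrow> m \<in>. M \<Longrightarrow>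
   uact M ac a (uact M ac b m) = uact M ac (umult A a b) m"
 shows "left_hom_module K A M ac"
proof -
 have cl: "ac a m \<in>. M" if "a \<in>. A" "m \<in>. M" for a m
  by (rule bil_closed[OF bil that])
 have twist: "ac a m = alpha M (uact M ac a m)" if "a \<in>. A" "m \<in>. M" for a m
  using cl[OF that] by (simp add: uact_def alpha_alpha_inv M)
 have ucl: "uact M ac a m \<in>. M" if "a \<in>. A" "m \<in>. M" for a m
  using cl[OF that] by (simp add: uact_def alpha_inv_closed M)
 have hv: "hom_vector_space K M" using M by (simp add: hs_def)
 have "ac (alpha A a) (ac b m) = ac (a \<otimes>\<^bsub>A\<^esub> b) (alpha M m)"
  if abm: "a \<in>. A" "b \<in>. A" "m \<in>. M" for a b m
 proof -
  have "ac (alpha A a) (ac b m) = alpha M (alpha M (uact M ac a (uact M ac b m)))"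
   using abm by (simp add: twist ucl alpha_closed M halg_hs A alpha)
  also have "... = alpha M (uact M ac (alpha A (umult A a b)) (alpha M m))"
   using abm by (simp add: assoc alpha umult_multilin A)
  also have "... = ac (a \<otimes>\<^bsub>A\<^esub> b) (alpha M m)"
   using abm by (simp add: alpha_umult A twist halg_mult_multilin alpha_closed M)
  finally show ?thesis .
 qed
 then show ?thesis
  unfolding left_hom_module_def
  using hv bil by (auto simp: twist one alpha ucl alpha_closed halg_hs A M halg_one)
qed

end

sublocale smash_datum \<subseteq> AM: hbialg_modules K "AA D"
 by unfold_locales (rule A)

sublocale smash_datum \<subseteq> BM: hbialg_modules K "smash K D"
 by unfold_locales (rule B_hbialg)

context smash_datum
begin

text \<open>
 An element of the smash product acts by its value at \<open>m\<^sub>(\<^sub>1\<^sub>)\<close>, on the same space. On \<open>a # f\<close> this is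
 \<open>a \<cdot> \<alpha>\<^sup>-\<^sup>1(f(m\<^sub>(\<^sub>1\<^sub>)) m\<^sub>(\<^sub>0\<^sub>))\<close> (\<open>Fo_act_pure\<close>).
\<close>

definition Fo :: "('k,'a,'c,'v) dhmod \<Rightarrow> ('k, ('a \<times> ('c \<Rightarrow> 'k)) list set, 'v) hmod" where
 "Fo M = \<lparr>carrier = carrier M, mult = mult M, one = one M, zero = zero M, add = add M, smult = smult M,
   alpha = alpha M,
   act = (\<lambda>X\<in>carrier B. \<lambda>m\<in>carrier M.
    sw M (coact M m) (\<lambda>m0 c. act M (evl A c X) (alpha_inv M m0)))\<rparr>"

lemma Fo_simps:
 "carrier (Fo M) = carrier M" "alpha (Fo M) = alpha M" "same_space (Fo M) M"
 by (simp_all add: Fo_def same_space_def)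

lemma Fo_alpha_inv: "alpha_inv (Fo M) = alpha_inv M"
 by (simp add: alpha_inv_def Fo_simps)

text \<open>
 A module with a counital linear map in place of the coaction. This is enough for \<open>Fo\<close> and \<open>Go\<close>
 to be inverse to each other. For a tensor product of Doi-Hopf modules the remaining axioms are
 deduced afterwards: it is \<open>Go\<close> of the tensor product of modules over the smash product.
\<close>

definition pre_dh :: "('k,'a,'c,'v) dhmod \<Rightarrow> bool" where
 "pre_dh M \<longleftrightarrow> AM.hm M \<and> coact M \<in> extensional (carrier M) \<and> lin M (tens M C) (coact M) \<and>
   (\<forall>m\<in>carrier M. sw M (coact M m) (\<lambda>m0 c. counit C c \<odot>\<^bsub>M\<^esub> m0) = alpha M m)"

lemma pre_dh_hm: "pre_dh M \<Longrightarrow> AM.hm M"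
 by (simp add: pre_dh_def)

lemma pre_dh_coact: "pre_dh M \<Longrightarrow> lin M (tens M C) (coact M)"
 by (simp add: pre_dh_def)

lemma pre_dh_coact_multilin:
 "m \<in>. M \<Longrightarrow> pre_dh M \<Longrightarrow> coact M m \<in>. tens M C"
 "lin X M f \<Longrightarrow> pre_dh M \<Longrightarrow> lin X (tens M C) (\<lambda>x. coact M (f x))"
 by (rule lin_closed[OF pre_dh_coact] lin_comp[OF pre_dh_coact]; assumption)+

lemma dh_hcomod: "is_dhmod K D M \<Longrightarrow> hcomod C M (coact M)"
 using hcoalg_lin[OF coalg(2)]
 by (simp add: is_dhmod_def is_hmod_def hcomod_def hs)

lemma dh_pre_dh: "is_dhmod K D M \<Longrightarrow> pre_dh M"
proof -
 assume M: "is_dhmod K D M"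
 then show "pre_dh M"
  using coact_counit[OF dh_hcomod[OF M]] hcomod_coact[OF dh_hcomod[OF M]]
  by (simp add: pre_dh_def is_dhmod_def)
qed

lemmas evl_multilin [lin] = bil_multilin[OF evl_bil[OF mods(1) mods(2)]]

lemma Fo_act:
 "X \<in>. T \<Longrightarrow> m \<in>. M \<Longrightarrow>
  act (Fo M) X m = sw M (coact M m) (\<lambda>m0 c. act M (evl A c X) (alpha_inv M m0))"
 by (simp add: Fo_def B_simps(1))

lemma Fo_act_bil:
 assumes M [lin]: "pre_dh M"
 shows "bil T M M (act (Fo M))"
proof -
 note [lin] = pre_dh_hm pre_dh_coact_multilin
 have f: "bil T M M (\<lambda>X m. sw M (coact M m) (\<lambda>m0 c. act M (evl A c X) (alpha_inv M m0)))"
  by (rule lin|assumption)+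
 have Mm: "module K M" by (rule lin)+
 have Tm: "module K T" by (rule lin)+
 show ?thesis
 proof (rule bilI)
  fix X assume X: "X \<in>. T"
  show "lin M M (act (Fo M) X)"
   by (rule lin_cong[OF Mm bil_right[OF f X]]) (simp add: Fo_act X)
 next
  fix m assume m: "m \<in>. M"
  show "lin T M (\<lambda>X. act (Fo M) X m)"
   by (rule lin_cong[OF Tm bil_left[OF f m]]) (simp add: Fo_act m)
 qed
qed

text \<open>
 \<open>A\<close> and \<open>C\<^sup>*\<close> embed into the smash product by \<open>a \<mapsto> a # \<epsilon>\<close> and \<open>f \<mapsto> 1 # f\<close>; the action and the
 coaction of \<open>M\<close> are recovered from the action of these elements.
\<close>

abbreviation "ia a \<equiv> sm a (one Cd)"
abbreviation "ic f \<equiv> sm (one A) f"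

lemma dp_one_Cd: "c \<in>. C \<Longrightarrow> dp (one Cd) c = counit C c"
 by (simp add: Cd_simps dp_def)

lemma Fo_act_pure:
 assumes M [lin]: "pre_dh M" and af [lin]: "a \<in>. A" "f \<in>. dual C" and m [lin]: "m \<in>. M"
 shows "act (Fo M) (sm a f) m = act M a (alpha_inv M (con M f (coact M m)))"
proof -
 note [lin] = pre_dh_hm pre_dh_coact_multilin
 have g: "lin M M (\<lambda>x. act M a (alpha_inv M x))" by (rule lin)+
 have gx: "\<And>x. x \<in>. M \<Longrightarrow> alpha_inv M x \<in>. M" "\<And>c. c \<in>. C \<Longrightarrow> dp f c \<in>. K"
  by (rule lin|assumption)+
 have "act (Fo M) (sm a f) m = sw M (coact M m) (\<lambda>m0 c. act M (evl A c (sm a f)) (alpha_inv M m0))"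
  by (rule Fo_act) (rule lin)+
 also have "... = sw M (coact M m) (\<lambda>m0 c. act M a (alpha_inv M (dp f c \<odot>\<^bsub>M\<^esub> m0)))"
 proof (rule sw_cong, (rule lin|assumption)+, goal_cases)
  case mc: (1 m0 c)
  have "act M (dp f c \<odot>\<^bsub>A\<^esub> a) (alpha_inv M m0) = dp f c \<odot>\<^bsub>M\<^esub> act M a (alpha_inv M m0)"
   by (rule lin_smult[OF bil_left[OF AM.hm_act_bil[OF pre_dh_hm[OF M]]]]) (rule gx mc af)+
  also have "... = act M a (alpha_inv M (dp f c \<odot>\<^bsub>M\<^esub> m0))"
   by (rule lin_smult[OF g, symmetric]) (rule gx mc)+
  finally show ?case
   by (simp add: evl_pure mods af mc)
 qed
 also have "... = act M a (alpha_inv M (con M f (coact M m)))"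
  unfolding con_def by (rule sw_hom[OF _ _ _ _ _ g, symmetric]) (rule lin|assumption)+
 finally show ?thesis .
qed

lemma con_counit:
 assumes M: "pre_dh M" and m: "m \<in>. M"
 shows "con M (one Cd) (coact M m) = alpha M m"
proof -
 note [lin] = pre_dh_hm[OF M] pre_dh_coact_multilin M m
 have "con M (one Cd) (coact M m) = sw M (coact M m) (\<lambda>m0 c. counit C c \<odot>\<^bsub>M\<^esub> m0)"
  unfolding con_def by (rule sw_cong) ((rule lin|assumption)+, simp add: dp_one_Cd)
 then show ?thesis using M m by (simp add: pre_dh_def)
qed

lemma con_closed:
 assumes [lin]: "pre_dh M" "m \<in>. M" "f \<in>. dual C"
 shows "con M f (coact M m) \<in>. M"
proof -
 note [lin] = pre_dh_hm pre_dh_coact_multilin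
 show ?thesis unfolding con_def by (rule lin|assumption)+
qed

lemma Fo_act_ia:
 assumes M: "pre_dh M" and a: "a \<in>. A" and m: "m \<in>. M"
 shows "act (Fo M) (ia a) m = act M a m"
 using Fo_act_pure[OF M a one_Cd m] m by (simp add: con_counit M alpha_inv_alpha AM.hm_hs pre_dh_hm)

lemma Fo_act_ic:
 assumes M: "pre_dh M" and f: "f \<in>. dual C" and m: "m \<in>. M"
 shows "act (Fo M) (ic f) m = con M f (coact M m)"
 using Fo_act_pure[OF M halg_one[OF alg(1)] f m] con_closed[OF M m f]
 by (simp add: hmodule_one[OF AM.hm_hmodule[OF pre_dh_hm[OF M]]] hs_simps AM.hm_hs pre_dh_hm M)

context
 fixes M :: "('k,'a,'c,'v) dhmod"
 assumes M: "is_dhmod K D M"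
begin

lemma Mp [lin]: "pre_dh M" by (rule dh_pre_dh[OF M])
lemma Mc [lin]: "hcomod C M (coact M)" by (rule dh_hcomod[OF M])
lemma Mhm [lin]: "AM.hm M" by (rule pre_dh_hm[OF Mp])
lemma Mact [lin]: "hmodule A M (act M)" by (rule AM.hm_hmodule[OF Mhm])

text \<open>The compatibility of action and coaction, expressed by the entwining.\<close>

lemma ucoact_uact_dh:
 assumes am [lin]: "a \<in>. A" "m \<in>. M" and t: "bil M C U t" and U [lin]: "module K U"
 shows "sw U (ucoact M (coact M) (uact M (act M) a m)) t =
  sw U (ucoact M (coact M) m) (\<lambda>m0 m1. sw U (ent a m1) (\<lambda>u d. t (uact M (act M) u m0) d))"
proof -
 note [lin] = bil_multilin[OF t] uact_multilin pre_dh_coact_multilin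
 have "sw U (ucoact M (coact M) (uact M (act M) a m)) t =
   sw U (ucoact A \<rho>A a) (\<lambda>a0 a1. sw U (ucoact M (coact M) m)
    (\<lambda>m0 m1. t (uact M (act M) a0 m0) (uact C hact a1 m1)))"
  unfolding uact_def
  by (rule ucoact_op[OF comodA Mc Mc AM.hm_act_bil[OF Mhm] hmodule_act[OF actC]])
   (use M am t U in \<open>simp_all add: hmodule_inv[OF actC] hmodule_inv[OF Mact] is_dhmod_def\<close>)
 also have "... = sw U (ucoact M (coact M) m) (\<lambda>m0 m1. sw U (ucoact A \<rho>A a)
    (\<lambda>a0 a1. t (uact M (act M) a0 m0) (uact C hact a1 m1)))"
  by (rule sw_swap) (rule lin|assumption)+
 also have "... = sw U (ucoact M (coact M) m) (\<lambda>m0 m1. sw U (ent a m1) (\<lambda>u d. t (uact M (act M) u m0) d))"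
  by (rule sw_cong) (rule sw_ent[symmetric] lin|assumption)+
 finally show ?thesis .
qed

lemma uact_Fo:
 assumes X [lin]: "X \<in>. T" and m [lin]: "m \<in>. M"
 shows "uact (Fo M) (act (Fo M)) X m = sw M (ucoact M (coact M) m) (\<lambda>m0 c. uact M (act M) (ev X c) m0)"
proof -
 note [lin] = pre_dh_coact_multilin uact_multilin
 have "act (Fo M) X m = sw M (ucoact M (coact M) m) (\<lambda>m0 c. act M (evl A (alpha C c) X) (alpha_inv M (alpha M m0)))"
  unfolding Fo_act[OF X m] by (rule coact_ucoact[OF Mc]) (rule lin|assumption)+
 also have "... = sw M (ucoact M (coact M) m) (\<lambda>m0 c. act M (ev X c) m0)"
  by (rule sw_cong) ((rule lin|assumption)+, simp add: ev_def alpha_inv_alpha AM.hm_hs Mhm)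
 finally have "uact (Fo M) (act (Fo M)) X m = alpha_inv M (sw M (ucoact M (coact M) m) (\<lambda>m0 c. act M (ev X c) m0))"
  by (simp add: uact_def Fo_alpha_inv)
 also have "... = sw M (ucoact M (coact M) m) (\<lambda>m0 c. alpha_inv M (act M (ev X c) m0))"
  by (rule sw_hom[where g="alpha_inv M"]) (rule hs_alpha_inv lin|assumption)+
 finally show ?thesis by (simp add: uact_def)
qed

lemma uact_Fo_closed:
 assumes [lin]: "X \<in>. T" "m \<in>. M"
 shows "uact (Fo M) (act (Fo M)) X m \<in>. M"
 unfolding uact_Fo[OF assms] by (rule lin uact_multilin|assumption)+

text \<open>
 The coaction of \<open>Y \<cdot> m\<close> entwines \<open>Y(m\<^sub>(\<^sub>1\<^sub>))\<close> with the coefficient of the remaining coaction. After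
 coassociativity this is the product of functions.
\<close>

lemma uact_Fo_assoc:
 assumes X [lin]: "X \<in>. T" and Y [lin]: "Y \<in>. T" and m [lin]: "m \<in>. M"
 shows "uact (Fo M) (act (Fo M)) X (uact (Fo M) (act (Fo M)) Y m) = uact (Fo M) (act (Fo M)) (umult B X Y) m"
proof -
 note [lin] = pre_dh_coact_multilin uact_multilin
 let ?u = "uact M (act M)" and ?\<delta> = "ucoact M (coact M)"
 let ?g = "\<lambda>m. sw M (?\<delta> m) (\<lambda>m0 c. ?u (ev X c) m0)"
 have g: "lin M M ?g" by (rule lin|assumption)+
 have evX: "\<And>d. d \<in>. C \<Longrightarrow> ev X d \<in>. A" by (rule lin|assumption)+
 have "uact (Fo M) (act (Fo M)) X (uact (Fo M) (act (Fo M)) Y m) = ?g (sw M (?\<delta> m) (\<lambda>m0 c. ?u (ev Y c) m0))"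
  by (subst uact_Fo[OF X uact_Fo_closed[OF Y m]]) (simp only: uact_Fo[OF Y m])
 also have "... = sw M (?\<delta> m) (\<lambda>m0 m1. ?g (?u (ev Y m1) m0))"
  by (rule sw_hom[OF _ _ _ _ _ g]) (rule lin|assumption)+
 also have "... = sw M (?\<delta> m) (\<lambda>m0 m1. sw M (?\<delta> m0) (\<lambda>m00 m01. sw M (ent (ev Y m1) m01)
   (\<lambda>u d. ?u (umult A (ev X d) u) m00)))"
 proof (rule sw_cong, (rule lin|assumption)+, goal_cases)
  case [lin]: (1 m0 m1)
  have "?g (?u (ev Y m1) m0) = sw M (?\<delta> m0) (\<lambda>m00 m01. sw M (ent (ev Y m1) m01) (\<lambda>u d. ?u (ev X d) (?u u m00)))"
   by (rule ucoact_uact_dh) (rule lin|assumption)+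
  also have "... = sw M (?\<delta> m0) (\<lambda>m00 m01. sw M (ent (ev Y m1) m01) (\<lambda>u d. ?u (umult A (ev X d) u) m00))"
   by (rule sw_cong, (rule lin|assumption)+, rule sw_cong)
    ((rule lin|assumption)+, simp add: uact_assoc[OF Mact] evX)
  finally show ?case .
 qed
 also have "... = sw M (?\<delta> m) (\<lambda>m0 m1. sw M (\<delta>C m1) (\<lambda>c1 c2. sw M (ent (ev Y c2) c1)
   (\<lambda>u d. ?u (umult A (ev X d) u) m0)))"
  by (rule ucoact_coassoc[OF Mc comod(2)]) (rule lin|assumption)+
 also have "... = sw M (?\<delta> m) (\<lambda>m0 m1. ?u (ev (umult B X Y) m1) m0)"
 proof (rule sw_cong, (rule lin|assumption)+, goal_cases)
  case m01 [lin]: (1 m0 m1)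
  have "?u (ev (umult B X Y) m1) m0 = ?u (sw A (\<delta>C m1) (\<lambda>c1 c2. act_on X (ev Y c2) c1)) m0"
   by (simp add: ev_umult X Y m01 smul_def)
  also have "... = sw M (\<delta>C m1) (\<lambda>c1 c2. ?u (act_on X (ev Y c2) c1) m0)"
   by (rule sw_hom[where g="\<lambda>a. ?u a m0"]) (rule lin|assumption)+
  also have "... = sw M (\<delta>C m1) (\<lambda>c1 c2. sw M (ent (ev Y c2) c1) (\<lambda>u d. ?u (umult A (ev X d) u) m0))"
   by (rule sw_cong) (rule sw_hom[where g="\<lambda>a. ?u a m0"] lin|assumption)+
  finally show ?case by simp
 qed
 also have "... = uact (Fo M) (act (Fo M)) (umult B X Y) m"
  by (rule uact_Fo[symmetric]) (rule lin)+
 finally show ?thesis .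
qed

lemma uact_Fo_alpha:
 assumes X [lin]: "X \<in>. T" and m [lin]: "m \<in>. M"
 shows "alpha M (uact (Fo M) (act (Fo M)) X m) = uact (Fo M) (act (Fo M)) (alpha B X) (alpha M m)"
proof -
 note [lin] = pre_dh_coact_multilin uact_multilin
 let ?u = "uact M (act M)" and ?\<delta> = "ucoact M (coact M)"
 have cl: "alpha B X \<in>. T" "alpha M m \<in>. M" "\<And>d. d \<in>. C \<Longrightarrow> ev X d \<in>. A" by (rule lin|assumption)+
 have "uact (Fo M) (act (Fo M)) (alpha B X) (alpha M m) = sw M (?\<delta> (alpha M m)) (\<lambda>m0 c. ?u (ev (alpha B X) c) m0)"
  by (rule uact_Fo[OF cl(1,2)])
 also have "... = sw M (?\<delta> m) (\<lambda>m0 c. ?u (ev (alpha B X) (alpha C c)) (alpha M m0))"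
  by (rule ucoact_alpha[OF Mc]) (rule lin|assumption)+
 also have "... = sw M (?\<delta> m) (\<lambda>m0 c. alpha M (?u (ev X c) m0))"
  by (rule sw_cong) ((rule lin|assumption)+, simp add: ev_alpha X hs_simps hs uact_alpha[OF Mact] cl)
 also have "... = alpha M (sw M (?\<delta> m) (\<lambda>m0 c. ?u (ev X c) m0))"
  by (rule sw_hom[symmetric]) (rule hs_alpha lin|assumption)+
 finally show ?thesis by (simp add: uact_Fo X m)
qed

lemma uact_Fo_one:
 assumes m: "m \<in>. M"
 shows "uact (Fo M) (act (Fo M)) (one B) m = m"
proof -
 have "act (Fo M) (one B) m = alpha M m"
  unfolding B_simps using Fo_act_ia[OF Mp halg_one[OF alg(1)] m] m by (simp add: hmodule_one[OF Mact])
 then show ?thesis using m by (simp add: uact_def Fo_alpha_inv alpha_inv_alpha AM.hm_hs Mhm)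
qed

lemma Fo_hm: "BM.hm (Fo M)"
proof -
 have sM: "same_space (Fo M) M" by (rule Fo_simps)
 have hsM: "hs M" by (rule lin)+
 have "module K (Fo M)" by (rule module_same_space[OF same_space_sym[OF sM]]) (rule lin)+
 then have hsF: "hs (Fo M)"
  using hsM lin_same_space[OF sM sM, of "alpha M"]
  by (simp add: hs_def hom_vector_space_def bijective_alpha_def Fo_simps)
 have bilF: "bil B (Fo M) (Fo M) (act (Fo M))"
  using Fo_act_bil[OF Mp] bil_same_space[OF same_B sM sM] by simp
 have "left_hom_module K B (Fo M) (act (Fo M))"
  by (rule left_hom_moduleI[OF B_halg hsF bilF])
   (simp_all add: Fo_simps B_simps(1) uact_Fo_one uact_Fo_alpha uact_Fo_assoc)
 moreover have "normal_space K (Fo M)" "alpha (Fo M) \<in> extensional (carrier (Fo M))"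
  using M by (simp_all add: is_dhmod_def is_hmod_def normal_space_def Fo_def)
 moreover have "act (Fo M) = (\<lambda>b\<in>carrier B. \<lambda>m\<in>carrier (Fo M). act (Fo M) b m)"
  by (auto simp: Fo_def fun_eq_iff)
 moreover have "bijective_alpha (Fo M)" using hsF by (simp add: hs_def)
 ultimately show ?thesis by (simp add: is_hmod_def)
qed

end

section \<open>From modules over the smash product to Doi-Hopf modules\<close>

lemma ev_ia: "a \<in>. A \<Longrightarrow> c \<in>. C \<Longrightarrow> ev (ia a) c = counit C c \<odot>\<^bsub>A\<^esub> a"
 by (simp add: ev_pure one_Cd dp_one_Cd alpha_closed hs hcoalg_counit_alpha coalg)

lemma umult_ia_ia:
 assumes ab [lin]: "a \<in>. A" "b \<in>. A"
 shows "umult B (ia a) (ia b) = ia (umult A a b)"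
proof (rule ev_eqI)
 fix c assume c [lin]: "c \<in>. C"
 have e: "\<And>d. d \<in>. C \<Longrightarrow> counit C d \<in>. K" and pT: "ia a \<in>. T" "ia b \<in>. T"
  by (rule lin|assumption)+
 let ?g = "umult A a"
 have g: "lin A A ?g" by (rule lin)+
 have h: "lin C A (\<lambda>c. counit C c \<odot>\<^bsub>A\<^esub> umult A a b)" by (rule lin)+
 have "ev (umult B (ia a) (ia b)) c = sw A (\<delta>C c) (\<lambda>c1 c2. act_on (ia a) (ev (ia b) c2) c1)"
  by (simp add: ev_umult pT c smul_def)
 also have "... = sw A (\<delta>C c) (\<lambda>c1 c2. counit C (counit C c1 \<odot>\<^bsub>C\<^esub> c2) \<odot>\<^bsub>A\<^esub> umult A a b)"
 proof (rule sw_cong, (rule lin|assumption)+, goal_cases)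
  case c12 [lin]: (1 c1 c2)
  interpret A: module K A by (rule mods)
  have ab': "umult A a b \<in>. A" by (rule lin)+
  have evb: "ev (ia b) c2 \<in>. A" by (rule lin)+
  have "act_on (ia a) (ev (ia b) c2) c1 =
    sw A (ent (ev (ia b) c2) c1) (\<lambda>u d. ?g (counit C d \<odot>\<^bsub>A\<^esub> u))"
   by (rule sw_cong) ((rule lin|assumption)+, simp add: ev_ia ab umult_smult e lin_smult[OF g])
  also have "... = ?g (sw A (ent (ev (ia b) c2) c1) (\<lambda>u d. counit C d \<odot>\<^bsub>A\<^esub> u))"
   by (rule sw_hom[OF _ _ _ _ _ g, symmetric]) (rule lin|assumption)+
  also have "... = counit C (counit C c1 \<odot>\<^bsub>C\<^esub> c2) \<odot>\<^bsub>A\<^esub> umult A a b"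
   using c12 ab ab' evb
   by (simp add: ent_counit ev_ia e lin_smult[OF g] A.smult_assoc1 lin_smult[OF hcoalg_lin(2)[OF coalg(2)]])
  finally show ?case .
 qed
 also have "... = counit C (sw C (\<delta>C c) (\<lambda>c1 c2. counit C c1 \<odot>\<^bsub>C\<^esub> c2)) \<odot>\<^bsub>A\<^esub> umult A a b"
  by (rule sw_hom[OF _ _ _ _ _ h, symmetric]) (rule lin|assumption)+
 finally show "ev (umult B (ia a) (ia b)) c = ev (ia (umult A a b)) c"
  by (simp add: hcoalg_counit_left coalg c ev_ia umult_multilin alg ab)
qed (rule lin|assumption)+

lemma ev_umult_ic_right:
 assumes X [lin]: "X \<in>. T" and f [lin]: "f \<in>. dual C" and c [lin]: "c \<in>. C"
 shows "ev (umult B X (ic f)) c = sw A (\<delta>C c) (\<lambda>c1 c2. dp f (alpha C c2) \<odot>\<^bsub>A\<^esub> ev X c1)"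
proof -
 have pT: "ic f \<in>. T" by (rule lin)+
 have "ev (umult B X (ic f)) c = sw A (\<delta>C c) (\<lambda>c1 c2. act_on X (ev (ic f) c2) c1)"
  by (simp add: ev_umult pT X c smul_def)
 also have "... = sw A (\<delta>C c) (\<lambda>c1 c2. dp f (alpha C c2) \<odot>\<^bsub>A\<^esub> ev X c1)"
 proof (rule sw_cong, (rule lin|assumption)+, goal_cases)
  case c12 [lin]: (1 c1 c2)
  let ?h = "\<lambda>b. act_on X b c1"
  have "?h (dp f (alpha C c2) \<odot>\<^bsub>A\<^esub> one A) = dp f (alpha C c2) \<odot>\<^bsub>A\<^esub> ?h (one A)"
   by (rule lin_smult[where f="?h"]) (rule lin|assumption)+
  also have "?h (one A) = umult A (ev X c1) (one A)"
   unfolding ent_one[OF c12(1)] by (rule sw_pureI) (rule lin|assumption)+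
  also have "... = ev X c1" by (rule umult_one(2)) (rule lin)+
  finally show ?case
   by (simp add: ev_pure f c12 halg_one alg)
 qed
 finally show ?thesis .
qed

text \<open>The elements \<open>a # \<epsilon>\<close> and \<open>1 # f\<close> generate the smash product.\<close>

lemma umult_ia_ic:
 assumes [lin]: "a \<in>. A" "f \<in>. dual C"
 shows "umult B (ia a) (ic f) = sm a f"
proof (rule ev_eqI)
 fix c assume c [lin]: "c \<in>. C"
 interpret A: module K A by (rule mods)
 have h: "lin C A (\<lambda>c. dp f (alpha C c) \<odot>\<^bsub>A\<^esub> a)" by (rule lin)+
 have e: "\<And>c. c \<in>. C \<Longrightarrow> dp f (alpha C c) \<in>. K" "\<And>c. c \<in>. C \<Longrightarrow> counit C c \<in>. K"
  by (rule lin|assumption)+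
 have "ev (umult B (ia a) (ic f)) c = sw A (\<delta>C c) (\<lambda>c1 c2. dp f (alpha C c2) \<odot>\<^bsub>A\<^esub> ev (ia a) c1)"
  by (rule ev_umult_ic_right) (rule lin)+
 also have "... = sw A (\<delta>C c) (\<lambda>c1 c2. dp f (alpha C (counit C c1 \<odot>\<^bsub>C\<^esub> c2)) \<odot>\<^bsub>A\<^esub> a)"
 proof (rule sw_cong, (rule lin|assumption)+, goal_cases)
  case c12: (1 c1 c2)
  have "dp f (alpha C (counit C c1 \<odot>\<^bsub>C\<^esub> c2)) \<odot>\<^bsub>A\<^esub> a = counit C c1 \<odot>\<^bsub>A\<^esub> (dp f (alpha C c2) \<odot>\<^bsub>A\<^esub> a)"
   by (rule lin_smult[OF h]) (rule e c12)+
  then show ?case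
   using c12 assms by (simp add: ev_ia e A.smult_assoc1[symmetric] m_comm)
 qed
 also have "... = dp f (alpha C (sw C (\<delta>C c) (\<lambda>c1 c2. counit C c1 \<odot>\<^bsub>C\<^esub> c2))) \<odot>\<^bsub>A\<^esub> a"
  by (rule sw_hom[OF _ _ _ _ _ h, symmetric]) (rule lin|assumption)+
 finally show "ev (umult B (ia a) (ic f)) c = ev (sm a f) c"
  by (simp add: hcoalg_counit_left coalg c ev_pure assms)
qed (rule lin|assumption)+

text \<open>
 The convolution product. The product of \<open>C\<^sup>*\<close> differs from it by the structure map, which accounts
 for \<open>\<alpha>\<^sup>-\<^sup>1\<close> in the lemma \<open>umult_ic_ic\<close>.
\<close>

definition conv where
 "conv f g = (\<lambda>c\<in>carrier C. sw (scalars K) (comult C c) (\<lambda>c1 c2. dp f c1 \<otimes> dp g c2))"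

lemma conv_closed: "f \<in>. dual C \<Longrightarrow> g \<in>. dual C \<Longrightarrow> conv f g \<in>. dual C"
 unfolding conv_def by (rule lin|assumption)+

lemma dp_conv: "c \<in>. C \<Longrightarrow> dp (conv f g) c = sw (scalars K) (comult C c) (\<lambda>c1 c2. dp f c1 \<otimes> dp g c2)"
 by (simp add: conv_def dp_restrict)

lemma umult_ic_ic:
 assumes f [lin]: "f \<in>. dual C" and g [lin]: "g \<in>. dual C"
 shows "umult B (ic (alpha_inv Cd f)) (ic (alpha_inv Cd g)) = ic (conv f g)"
proof (rule ev_eqI)
 fix c assume c [lin]: "c \<in>. C"
 interpret A: module K A by (rule mods)
 let ?f = "alpha_inv Cd f" and ?g = "alpha_inv Cd g"
 have h: "lin (scalars K) A (\<lambda>r. r \<odot>\<^bsub>A\<^esub> one A)" by (rule lin)+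
 have e: "\<And>c. c \<in>. C \<Longrightarrow> dp f c \<in>. K" "\<And>c. c \<in>. C \<Longrightarrow> dp g c \<in>. K"
  by (rule lin|assumption)+
 have "ev (umult B (ic ?f) (ic ?g)) c = sw A (\<delta>C c) (\<lambda>c1 c2. dp ?g (alpha C c2) \<odot>\<^bsub>A\<^esub> ev (ic ?f) c1)"
  by (rule ev_umult_ic_right) (rule lin)+
 also have "... = sw A (\<delta>C c) (\<lambda>c1 c2. (dp f (alpha C (alpha C c1)) \<otimes> dp g (alpha C (alpha C c2))) \<odot>\<^bsub>A\<^esub> one A)"
  by (rule sw_cong) ((rule lin|assumption)+, simp add: ev_pure f g Cd_multilin halg_one alg
    dp_alpha_inv_Cd alpha_closed hs e A.smult_assoc1[symmetric] m_comm)
 also have "... = sw (scalars K) (\<delta>C c) (\<lambda>c1 c2. dp f (alpha C (alpha C c1)) \<otimes> dp g (alpha C (alpha C c2))) \<odot>\<^bsub>A\<^esub> one A"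
  by (rule sw_hom[OF _ _ _ _ _ h, symmetric]) (rule lin|assumption)+
 also have "sw (scalars K) (\<delta>C c) (\<lambda>c1 c2. dp f (alpha C (alpha C c1)) \<otimes> dp g (alpha C (alpha C c2))) =
   sw (scalars K) (comult C c) (\<lambda>c1 c2. dp f (alpha C c1) \<otimes> dp g (alpha C c2))"
  by (rule coact_ucoact[OF comod(2), symmetric]) (rule lin|assumption)+
 also have "... = sw (scalars K) (comult C (alpha C c)) (\<lambda>c1 c2. dp f c1 \<otimes> dp g c2)"
  by (rule coact_alpha[OF comod(2), symmetric]) (rule lin|assumption)+
 also have "... = dp (conv f g) (alpha C c)" by (simp add: dp_conv alpha_closed hs c)
 finally show "ev (umult B (ic ?f) (ic ?g)) c = ev (ic (conv f g)) c"
  by (simp add: ev_pure conv_closed f g halg_one alg c)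
qed (rule lin conv_closed | assumption)+

text \<open>
 The commutation relation between the two kinds of generators. In a module it becomes the
 compatibility of the action with the coaction (\<open>cact_act\<close>).
\<close>

lemma umult_ic_ia:
 assumes g [lin]: "g \<in>. dual C" and a [lin]: "a \<in>. A"
 shows "umult B (ic (alpha_inv Cd g)) (ia a) =
  sw T (\<rho>A a) (\<lambda>a0 h. sm (alpha_inv A a0) (\<lambda>c\<in>carrier C. dp g (hact h c)))"
proof (rule ev_eqI)
 fix c assume c [lin]: "c \<in>. C"
 let ?g = "alpha_inv Cd g"
 interpret A: module K A by (rule mods)
 have pT: "ic ?g \<in>. T" "ia a \<in>. T" by (rule lin)+
 have e: "\<And>d. d \<in>. C \<Longrightarrow> dp g d \<in>. K" "\<And>c. c \<in>. C \<Longrightarrow> counit C c \<in>. K"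
  and cl: "\<And>h. h \<in>. H \<Longrightarrow> hact h (alpha C c) \<in>. C" "\<And>h. h \<in>. H \<Longrightarrow> hact h c \<in>. C"
  and du: "\<And>h. h \<in>. H \<Longrightarrow> (\<lambda>c\<in>carrier C. dp g (hact h c)) \<in>. dual C"
  by (rule lin|assumption)+
 let ?k = "\<lambda>c. sw A (ent a c) (\<lambda>u d. dp g (alpha C (alpha C d)) \<odot>\<^bsub>A\<^esub> u)"
 have k: "lin C A ?k" by (rule lin|assumption)+
 have "ev (umult B (ic ?g) (ia a)) c = sw A (\<delta>C c) (\<lambda>c1 c2. act_on (ic ?g) (ev (ia a) c2) c1)"
  by (simp add: ev_umult pT c smul_def)
 also have "... = sw A (\<delta>C c) (\<lambda>c1 c2. ?k (counit C c2 \<odot>\<^bsub>C\<^esub> c1))"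
 proof (rule sw_cong, (rule lin|assumption)+, goal_cases)
  case c12 [lin]: (1 c1 c2)
  let ?h = "\<lambda>b. act_on (ic ?g) b c1"
  have h: "lin A A ?h" by (rule lin|assumption)+
  have "?h (ev (ia a) c2) = counit C c2 \<odot>\<^bsub>A\<^esub> ?h a"
   unfolding ev_ia[OF a c12(2)] by (rule lin_smult[OF h]) (rule e c12 a)+
  also have "?h a = ?k c1"
   by (rule sw_cong) ((rule lin|assumption)+, simp add: ev_pure g Cd_multilin halg_one alg
    dp_alpha_inv_Cd alpha_closed hs e umult_smult umult_one)
  also have "counit C c2 \<odot>\<^bsub>A\<^esub> ?k c1 = ?k (counit C c2 \<odot>\<^bsub>C\<^esub> c1)"
   by (rule lin_smult[OF k, symmetric]) (rule e c12)+
  finally show ?case .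
 qed
 also have "... = ?k (sw C (\<delta>C c) (\<lambda>c1 c2. counit C c2 \<odot>\<^bsub>C\<^esub> c1))"
  by (rule sw_hom[OF _ _ _ _ _ k, symmetric]) (rule lin|assumption)+
 also have "... = ?k c" by (simp add: ucoact_counit[OF comod(2)] c)
 also have "... = sw A (ucoact A \<rho>A a) (\<lambda>u h. dp g (alpha C (alpha C (uact C hact h c))) \<odot>\<^bsub>A\<^esub> u)"
  by (rule sw_ent) (rule lin|assumption)+
 also have "... = sw A (\<rho>A (alpha_inv A a)) (\<lambda>u h. dp g (hact (alpha H h) (alpha C c)) \<odot>\<^bsub>A\<^esub> u)"
  unfolding ucoact_def
  by (rule sw_cong) ((rule lin|assumption)+, simp add: uact_def hs_simps hs cl c hmodule_alpha[OF actC])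
 also have "... = sw A (\<rho>A a) (\<lambda>u h. dp g (hact (alpha H (alpha_inv H h)) (alpha C c)) \<odot>\<^bsub>A\<^esub> alpha_inv A u)"
  by (rule coact_alpha_inv[OF comodA]) (rule lin|assumption)+
 also have "... = sw A (\<rho>A a) (\<lambda>a0 h. ev (sm (alpha_inv A a0) (\<lambda>c\<in>carrier C. dp g (hact h c))) c)"
  by (rule sw_cong) ((rule lin|assumption)+, simp add: ev_pure du hs_simps hs c dp_restrict)
 also have "... = ev (sw T (\<rho>A a) (\<lambda>a0 h. sm (alpha_inv A a0) (\<lambda>c\<in>carrier C. dp g (hact h c)))) c"
  by (rule sw_hom[where g="\<lambda>X. ev X c", symmetric]) (rule lin|assumption)+
 finally show "ev (umult B (ic ?g) (ia a)) c =
  ev (sw T (\<rho>A a) (\<lambda>a0 h. sm (alpha_inv A a0) (\<lambda>c\<in>carrier C. dp g (hact h c)))) c" .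
qed (rule lin|assumption)+

lemma alpha_ia: "a \<in>. A \<Longrightarrow> alpha B (ia a) = ia (alpha A a)"
proof -
 assume a: "a \<in>. A"
 have "alpha Cd (one Cd) = one Cd"
 proof (rule dual_ext[of _ C])
  show "alpha Cd (one Cd) \<in>. dual C" "one Cd \<in>. dual C" by (rule lin)+
 qed (simp add: dp_alpha_Cd one_Cd dp_one_Cd alpha_inv_closed hs hcoalg_counit_alpha_inv coalg)
 then show "alpha B (ia a) = ia (alpha A a)" using a by (simp add: T_alpha_pure one_Cd)
qed

lemma alpha_ic: "f \<in>. dual C \<Longrightarrow> alpha B (ic (alpha_inv Cd f)) = ic f"
 using alpha_alpha_inv[OF hs_Cd, of f] by (simp add: T_alpha_pure halg_one alg Cd_multilin halg_alpha_one Cd_simps(1))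

text \<open>
 The only possible coaction: contracting it with \<open>f\<close> must give the action of \<open>1 # f\<close>, and dual bases
 assemble the contractions.
\<close>

definition cact :: "('k, ('a \<times> ('c \<Rightarrow> 'k)) list set, 'v) hmod \<Rightarrow> 'v \<Rightarrow> ('v \<times> 'c) list set" where
 "cact N m = sw (tens N C) \<Omega> (\<lambda>x f. pure K N C (act N (ic f) m) x)"

definition Go :: "('k, ('a \<times> ('c \<Rightarrow> 'k)) list set, 'v) hmod \<Rightarrow> ('k,'a,'c,'v) dhmod" where
 "Go N = \<lparr>carrier = carrier N, mult = mult N, one = one N, zero = zero N, add = add N, smult = smult N,
   alpha = alpha N, act = (\<lambda>a\<in>carrier A. \<lambda>m\<in>carrier N. act N (ia a) m),
   coact = (\<lambda>m\<in>carrier N. cact N m)\<rparr>"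

lemma Go_simps:
 "carrier (Go N) = carrier N" "alpha (Go N) = alpha N" "same_space (Go N) N"
 "a \<in>. A \<Longrightarrow> m \<in>. N \<Longrightarrow> act (Go N) a m = act N (ia a) m"
 "m \<in>. N \<Longrightarrow> coact (Go N) m = cact N m"
 by (simp_all add: Go_def same_space_def)

context
 fixes N :: "('k, ('a \<times> ('c \<Rightarrow> 'k)) list set, 'v) hmod"
 assumes N [lin]: "BM.hm N"
begin

lemma Nm: "module K N" and Nhs: "hs N" by (rule lin)+

lemma Nact_bil: "bil T N N (act N)"
 using BM.hm_act_bil[OF N] bil_same_space[OF same_B same_space_refl same_space_refl] by blast

lemmas N_multilin [lin] = bil_multilin[OF Nact_bil]

lemma cact_lin: "lin N (tens N C) (cact N)"
 unfolding cact_def by (rule lin|assumption)+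

lemmas [lin] = lin_multilin[OF cact_lin]

text \<open>
 By this lemma the axioms of the coaction can be tested by contraction with functionals (\<open>con_eqI\<close>),
 where they become identities in the smash product.
\<close>

lemma con_cact:
 assumes g [lin]: "g \<in>. dual C" and m [lin]: "m \<in>. N"
 shows "con N g (cact N m) = act N (ic g) m"
proof -
 note [lin] = bil_multilin[OF con_bil[OF Nm mods(2)]]
 have h: "lin (dual C) N (\<lambda>f. act N (ic f) m)" by (rule lin|assumption)+
 have cl: "\<And>x. x \<in>. C \<Longrightarrow> dp g x \<in>. K" "\<And>f. f \<in>. dual C \<Longrightarrow> act N (ic f) m \<in>. N"
  by (rule lin|assumption)+
 have "con N g (cact N m) = sw N \<Omega> (\<lambda>x f. con N g (pure K N C (act N (ic f) m) x))"
  unfolding cact_def by (rule sw_hom[where g="con N g"]) (rule lin|assumption)+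
 also have "... = sw N \<Omega> (\<lambda>x f. act N (ic (dp g x \<odot>\<^bsub>dual C\<^esub> f)) m)"
  by (rule sw_cong) ((rule lin|assumption)+, simp add: con_pure Nm mods g cl lin_smult[OF h])
 also have "... = act N (ic (sw (dual C) \<Omega> (\<lambda>x f. dp g x \<odot>\<^bsub>dual C\<^esub> f))) m"
  by (rule sw_hom[OF _ _ _ _ _ h, symmetric]) (rule lin|assumption)+
 finally show ?thesis by (simp add: coev_dual[OF mods(2) \<Omega>] g)
qed

lemma con_eqI:
 assumes "Z \<in>. tens N C" "Z' \<in>. tens N C" "\<And>g. g \<in>. dual C \<Longrightarrow> con N g Z = con N g Z'"
 shows "Z = Z'"
 by (rule recovers_separates[OF recovers_con[OF mods(2) \<Omega> Nm]]) fact+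

lemma con2_eqI:
 assumes Z: "Z \<in>. tens N (tens C C)" "Z' \<in>. tens N (tens C C)"
  and eq: "\<And>f g. f \<in>. dual C \<Longrightarrow> g \<in>. dual C \<Longrightarrow>
   con N f (tmap N C (\<lambda>x. x) (con C g) Z) = con N f (tmap N C (\<lambda>x. x) (con C g) Z')"
 shows "Z = Z'"
proof (rule recovers_separates[OF recovers_tensor_right[OF recovers_con[OF mods(2) \<Omega> mods(2)] Nm] Z])
 fix g assume g [lin]: "g \<in>. dual C"
 note [lin] = bil_multilin[OF con_bil[OF mods(2) mods(2)]]
 have cl: "tmap N C (\<lambda>x. x) (con C g) Y \<in>. tens N C" if "Y \<in>. tens N (tens C C)" for Y
  by (rule tmap_closed[OF that]) (rule lin|assumption)+
 show "tmap N C (\<lambda>x. x) (con C g) Z = tmap N C (\<lambda>x. x) (con C g) Z'"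
  by (rule con_eqI[OF cl[OF Z(1)] cl[OF Z(2)]]) (rule eq[OF _ g])
qed

text \<open>Module associativity in terms of the untwisted product.\<close>

lemma Nact_twist:
 assumes X: "X \<in>. T" and Y: "Y \<in>. T" and m: "m \<in>. N"
 shows "act N (alpha B X) (act N Y m) = alpha N (act N (umult B X Y) m)"
proof -
 have XY: "umult B X Y \<in>. B" unfolding B_simps(1) by (rule lin X Y)+
 have "act N (alpha B X) (act N Y m) = act N (X \<otimes>\<^bsub>B\<^esub> Y) (alpha N m)"
  by (rule hmodule_assoc[OF BM.hm_hmodule[OF N]]) (simp_all add: B_simps(1) X Y m)
 also have "... = alpha N (act N (umult B X Y) m)"
  using hmodule_alpha[OF BM.hm_hmodule[OF N] XY m] by (simp add: alpha_umult_B X Y)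
 finally show ?thesis .
qed

lemma Nact_alpha: "X \<in>. T \<Longrightarrow> m \<in>. N \<Longrightarrow> alpha N (act N X m) = act N (alpha B X) (alpha N m)"
 by (rule hmodule_alpha[OF BM.hm_hmodule[OF N]]) (simp_all add: B_simps(1))

lemma cact_counit:
 assumes m [lin]: "m \<in>. N"
 shows "sw N (cact N m) (\<lambda>m0 m1. counit C m1 \<odot>\<^bsub>N\<^esub> m0) = alpha N m"
proof -
 have "sw N (cact N m) (\<lambda>m0 m1. counit C m1 \<odot>\<^bsub>N\<^esub> m0) = con N (one Cd) (cact N m)"
  unfolding con_def by (rule sw_cong) ((rule lin)+, simp add: dp_one_Cd)
 also have "... = act N (one B) m" by (simp add: con_cact one_Cd m B_simps(4))
 also have "... = alpha N m" by (rule hmodule_one[OF BM.hm_hmodule[OF N] m])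
 finally show ?thesis .
qed

lemma cact_alpha:
 assumes m [lin]: "m \<in>. N"
 shows "sw (tens N C) (cact N m) (\<lambda>m0 m1. pure K N C (alpha N m0) (alpha C m1)) = cact N (alpha N m)"
proof (rule con_eqI)
 fix g assume g [lin]: "g \<in>. dual C"
 note [lin] = bil_multilin[OF con_bil[OF Nm mods(2)]]
 let ?g = "alpha_inv Cd g"
 have g': "?g \<in>. dual C" and icg: "ic ?g \<in>. T" by (rule lin)+
 have cl: "\<And>x. x \<in>. C \<Longrightarrow> dp g x \<in>. K" "\<And>x. x \<in>. N \<Longrightarrow> alpha N x \<in>. N"
  by (rule lin|assumption)+
 have "con N g (sw (tens N C) (cact N m) (\<lambda>m0 m1. pure K N C (alpha N m0) (alpha C m1))) =
   sw N (cact N m) (\<lambda>m0 m1. con N g (pure K N C (alpha N m0) (alpha C m1)))"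
  by (rule sw_hom[where g="con N g"]) (rule lin|assumption)+
 also have "... = sw N (cact N m) (\<lambda>m0 m1. alpha N (dp ?g m1 \<odot>\<^bsub>N\<^esub> m0))"
  by (rule sw_cong) ((rule lin|assumption)+, simp add: con_pure Nm mods g cl alpha_closed hs
    dp_alpha_inv_Cd lin_smult[OF hs_alpha[OF Nhs]])
 also have "... = alpha N (con N ?g (cact N m))"
  unfolding con_def by (rule sw_hom[symmetric]) (rule hs_alpha lin|assumption)+
 also have "... = con N g (cact N (alpha N m))"
  using m g g' icg by (simp add: con_cact cl Nact_alpha alpha_ic)
 finally show "con N g (sw (tens N C) (cact N m) (\<lambda>m0 m1. pure K N C (alpha N m0) (alpha C m1))) =
  con N g (cact N (alpha N m))" .
qed (rule lin|assumption)+

text \<open>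
 Contracted with \<open>f\<close> and \<open>g\<close>, one side is a product of the actions of \<open>1 # f\<close> and \<open>1 # g\<close>, the other
 the action of their convolution product, and \<open>umult_ic_ic\<close> compares them.
\<close>

lemma cact_coassoc:
 assumes m [lin]: "m \<in>. N"
 shows "sw (tens N (tens C C)) (cact N m) (\<lambda>m0 m1. sw (tens N (tens C C)) (cact N m0)
      (\<lambda>m00 m01. pure K N (tens C C) m00 (pure K C C m01 (alpha C m1)))) =
    sw (tens N (tens C C)) (cact N m) (\<lambda>m0 m1. pure K N (tens C C) (alpha N m0) (comult C m1))"
proof (rule con2_eqI)
 fix f g assume f [lin]: "f \<in>. dual C" and g [lin]: "g \<in>. dual C"
 note [lin] = bil_multilin[OF con_bil[OF Nm mods(2)]] bil_multilin[OF con_bil[OF mods(2) mods(2)]]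
 let ?T = "tens N (tens C C)" and ?fi = "alpha_inv Cd f" and ?gi = "alpha_inv Cd g"
 let ?k = "tmap N C (\<lambda>x. x) (con C g)"
 let ?q = "\<lambda>Z. con N f (?k Z)"
 have k: "lin ?T (tens N C) ?k" by (rule tmap_lin) (rule lin|assumption)+
 note [lin] = lin_multilin[OF k]
 have q: "lin ?T N ?q" by (rule lin|assumption)+
 have cl: "\<And>x. x \<in>. C \<Longrightarrow> dp f x \<in>. K" "\<And>x. x \<in>. C \<Longrightarrow> dp g x \<in>. K" "ic f \<in>. T"
  "ic ?fi \<in>. T" "ic ?gi \<in>. T" "?gi \<in>. dual C" "?fi \<in>. dual C" by (rule lin|assumption)+
 interpret Nmod: module K N by (rule Nm)
 have qp: "?q (pure K N (tens C C) n Z) = dp f (con C g Z) \<odot>\<^bsub>N\<^esub> n" if n: "n \<in>. N" and Z: "Z \<in>. tens C C" for n Z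
 proof -
  have "?k (pure K N (tens C C) n Z) = pure K N C n (con C g Z)"
   by (rule tmap_pure) (rule n Z lin|assumption)+
  moreover have "con C g Z \<in>. C" by (rule lin Z)+
  ultimately show ?thesis using n by (simp add: con_pure Nm mods f)
 qed
 have qpp: "?q (pure K N (tens C C) n (pure K C C c d)) = dp g d \<odot>\<^bsub>N\<^esub> (dp f c \<odot>\<^bsub>N\<^esub> n)"
  if ncd: "n \<in>. N" "c \<in>. C" "d \<in>. C" for n c d
  using ncd cl by (simp add: qp pure_closed mods con_pure g dp_smult_right[OF mods(2)] f Nmod.smult_assoc1)
 have "?q (sw ?T (cact N m) (\<lambda>m0 m1. sw ?T (cact N m0) (\<lambda>m00 m01. pure K N (tens C C) m00 (pure K C C m01 (alpha C m1))))) =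
   sw N (cact N m) (\<lambda>m0 m1. ?q (sw ?T (cact N m0) (\<lambda>m00 m01. pure K N (tens C C) m00 (pure K C C m01 (alpha C m1)))))"
  by (rule sw_hom[OF _ _ _ _ _ q]) (rule lin|assumption)+
 also have "... = sw N (cact N m) (\<lambda>m0 m1. act N (ic f) (dp ?gi m1 \<odot>\<^bsub>N\<^esub> m0))"
 proof (rule sw_cong)
  fix m0 m1 assume m01 [lin]: "m0 \<in>. N" "m1 \<in>. C"
  let ?h = "\<lambda>x. dp ?gi m1 \<odot>\<^bsub>N\<^esub> x"
  have r: "dp ?gi m1 \<in>. K" by (rule lin)+
  have h: "lin N N ?h" by (rule lin)+
  have "?q (sw ?T (cact N m0) (\<lambda>m00 m01. pure K N (tens C C) m00 (pure K C C m01 (alpha C m1)))) =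
    sw N (cact N m0) (\<lambda>m00 m01. ?q (pure K N (tens C C) m00 (pure K C C m01 (alpha C m1))))"
   by (rule sw_hom[OF _ _ _ _ _ q]) (rule lin|assumption)+
  also have "... = sw N (cact N m0) (\<lambda>m00 m01. ?h (dp f m01 \<odot>\<^bsub>N\<^esub> m00))"
   by (rule sw_cong) ((rule lin|assumption)+, simp add: qpp m01 alpha_closed hs dp_alpha_inv_Cd g)
  also have "... = ?h (con N f (cact N m0))"
   unfolding con_def by (rule sw_hom[OF _ _ _ _ _ h, symmetric]) (rule lin|assumption)+
  also have "... = act N (ic f) (dp ?gi m1 \<odot>\<^bsub>N\<^esub> m0)"
   using lin_smult[OF bil_right[OF Nact_bil cl(3)] r m01(1)] by (simp add: con_cact f m01)
  finally show "?q (sw ?T (cact N m0) (\<lambda>m00 m01. pure K N (tens C C) m00 (pure K C C m01 (alpha C m1)))) =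
   act N (ic f) (dp ?gi m1 \<odot>\<^bsub>N\<^esub> m0)" .
 qed (rule lin|assumption)+
 also have "... = act N (ic f) (con N ?gi (cact N m))"
  unfolding con_def by (rule sw_hom[OF _ _ _ _ _ bil_right[OF Nact_bil cl(3)], symmetric]) (rule lin|assumption)+
 also have "... = act N (alpha B (ic ?fi)) (act N (ic ?gi) m)"
  by (simp add: con_cact cl m alpha_ic f)
 also have "... = alpha N (con N (conv f g) (cact N m))"
  by (simp add: Nact_twist cl m umult_ic_ic f g con_cact conv_closed)
 also have "... = sw N (cact N m) (\<lambda>m0 m1. alpha N (dp (conv f g) m1 \<odot>\<^bsub>N\<^esub> m0))"
  unfolding con_def by (rule sw_hom) (rule hs_alpha lin conv_closed | assumption)+
 also have "... = sw N (cact N m) (\<lambda>m0 m1. ?q (pure K N (tens C C) (alpha N m0) (comult C m1)))"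
 proof (rule sw_cong)
  fix m0 m1 assume m01 [lin]: "m0 \<in>. N" "m1 \<in>. C"
  have r: "dp (conv f g) m1 \<in>. K" by (rule lin conv_closed)+
  have cl': "alpha N m0 \<in>. N" "comult C m1 \<in>. tens C C" by (rule lin)+
  have "dp f (con C g (comult C m1)) = sw (scalars K) (comult C m1) (\<lambda>c1 c2. dp f (dp g c2 \<odot>\<^bsub>C\<^esub> c1))"
   unfolding con_def by (rule sw_hom[where g="dp f"]) (rule lin|assumption)+
  also have "... = dp (conv f g) m1"
   unfolding dp_conv[OF m01(2)]
   by (rule sw_cong) ((rule lin|assumption)+, simp add: dp_smult_right[OF mods(2)] cl f m_comm)
  finally show "alpha N (dp (conv f g) m1 \<odot>\<^bsub>N\<^esub> m0) = ?q (pure K N (tens C C) (alpha N m0) (comult C m1))"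
   using cl' m01 r by (simp add: qp lin_smult[OF hs_alpha[OF Nhs]])
 qed (rule lin|assumption)+
 also have "... = ?q (sw ?T (cact N m) (\<lambda>m0 m1. pure K N (tens C C) (alpha N m0) (comult C m1)))"
  by (rule sw_hom[OF _ _ _ _ _ q, symmetric]) (rule lin|assumption)+
 finally show "?q (sw ?T (cact N m) (\<lambda>m0 m1. sw ?T (cact N m0) (\<lambda>m00 m01. pure K N (tens C C) m00 (pure K C C m01 (alpha C m1))))) =
  ?q (sw ?T (cact N m) (\<lambda>m0 m1. pure K N (tens C C) (alpha N m0) (comult C m1)))" .
qed (rule lin|assumption)+

lemma cact_act:
 assumes a [lin]: "a \<in>. A" and m [lin]: "m \<in>. N"
 shows "cact N (act N (ia a) m) = sw (tens N C) (\<rho>A a) (\<lambda>a0 a1. sw (tens N C) (cact N m)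
  (\<lambda>m0 m1. pure K N C (act N (ia a0) m0) (hact a1 m1)))"
proof (rule con_eqI)
 fix g assume g [lin]: "g \<in>. dual C"
 note [lin] = bil_multilin[OF con_bil[OF Nm mods(2)]]
 let ?gi = "alpha_inv Cd g" and ?k = "\<lambda>h. \<lambda>c\<in>carrier C. dp g (hact h c)" and ?pa = "sm"
 have cl: "ic ?gi \<in>. T" "ia a \<in>. T" "act N (ia a) m \<in>. N" by (rule lin)+
 have k: "\<And>h. h \<in>. H \<Longrightarrow> ?k h \<in>. dual C" by (rule lin|assumption)+
 have cn: "lin (tens N C) N (con N g)" by (rule lin)+
 have "con N g (cact N (act N (ia a) m)) = act N (alpha B (ic ?gi)) (act N (ia a) m)"
  by (simp add: con_cact g cl alpha_ic)
 also have "... = alpha N (act N (sw T (\<rho>A a) (\<lambda>a0 h. ?pa (alpha_inv A a0) (?k h))) m)"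
  by (simp only: Nact_twist[OF cl(1,2) m] umult_ic_ia[OF g a])
 also have "... = sw N (\<rho>A a) (\<lambda>a0 h. alpha N (act N (?pa (alpha_inv A a0) (?k h)) m))"
  by (rule sw_hom[where g="\<lambda>X. alpha N (act N X m)"]) (rule lin|assumption)+
 also have "... = sw N (\<rho>A a) (\<lambda>a0 h. con N g (sw (tens N C) (cact N m) (\<lambda>m0 m1. pure K N C (act N (ia a0) m0) (hact h m1))))"
 proof (rule sw_cong, (rule lin|assumption)+, goal_cases)
  case ah [lin]: (1 a0 h)
  have kh [lin]: "?k h \<in>. dual C" by (rule k) fact
  have cl': "ia a0 \<in>. T" "alpha_inv A a0 \<in>. A" "ia (alpha_inv A a0) \<in>. T" "ic (?k h) \<in>. T"
   "\<And>m0. m0 \<in>. N \<Longrightarrow> act N (ia a0) m0 \<in>. N" "\<And>c. c \<in>. C \<Longrightarrow> hact h c \<in>. C"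
   "\<And>c. c \<in>. C \<Longrightarrow> dp g (hact h c) \<in>. K"
   by (rule lin|assumption)+
  have "alpha N (act N (?pa (alpha_inv A a0) (?k h)) m) = act N (alpha B (ia (alpha_inv A a0))) (act N (ic (?k h)) m)"
   by (simp only: Nact_twist[OF cl'(3,4) m] umult_ia_ic[OF cl'(2) kh])
  also have "... = act N (ia a0) (con N (?k h) (cact N m))"
   by (simp add: alpha_ia cl' alpha_alpha_inv hs ah con_cact[OF kh m])
  also have "... = sw N (cact N m) (\<lambda>m0 m1. act N (ia a0) (dp (?k h) m1 \<odot>\<^bsub>N\<^esub> m0))"
   unfolding con_def by (rule sw_hom[OF _ _ _ _ _ bil_right[OF Nact_bil cl'(1)]]) (rule lin|assumption)+
  also have "... = sw N (cact N m) (\<lambda>m0 m1. con N g (pure K N C (act N (ia a0) m0) (hact h m1)))"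
   by (rule sw_cong) ((rule lin|assumption)+, simp add: con_pure Nm mods g cl' dp_restrict
     lin_smult[OF bil_right[OF Nact_bil cl'(1)]])
  also have "... = con N g (sw (tens N C) (cact N m) (\<lambda>m0 m1. pure K N C (act N (ia a0) m0) (hact h m1)))"
   by (rule sw_hom[OF _ _ _ _ _ cn, symmetric]) (rule lin|assumption)+
  finally show ?case .
 qed
 also have "... = con N g (sw (tens N C) (\<rho>A a) (\<lambda>a0 h. sw (tens N C) (cact N m) (\<lambda>m0 m1. pure K N C (act N (ia a0) m0) (hact h m1))))"
  by (rule sw_hom[OF _ _ _ _ _ cn, symmetric]) (rule lin|assumption)+
 finally show "con N g (cact N (act N (ia a) m)) = con N g (sw (tens N C) (\<rho>A a) (\<lambda>a0 a1. sw (tens N C) (cact N m)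
  (\<lambda>m0 m1. pure K N C (act N (ia a0) m0) (hact a1 m1))))" .
qed (rule lin|assumption)+

lemma Go_act_module: "left_hom_module K A (Go N) (act (Go N))"
proof -
 note sN = Go_simps(3)[of N]
 have sm: "same_space N (Go N)" by (rule same_space_sym[OF sN])
 have bil: "bil A N N (\<lambda>a m. act N (ia a) m)" by (rule lin|assumption)+
 have "bil A N N (act (Go N))"
 proof (rule bilI)
  fix a assume a: "a \<in>. A"
  show "lin N N (act (Go N) a)"
   by (rule lin_cong[OF Nm bil_right[OF bil a]]) (simp add: Go_simps a)
 next
  fix m assume m: "m \<in>. N"
  show "lin A N (\<lambda>a. act (Go N) a m)"
   by (rule lin_cong[OF mods(1) bil_left[OF bil m]]) (simp add: Go_simps m)
 qed
 then have "bil A (Go N) (Go N) (act (Go N))"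
  using bil_same_space[OF same_space_refl sm sm] by blast
 moreover have "hom_vector_space K (Go N)"
  using Nhs module_same_space[OF sm Nm] lin_same_space[OF sm sm, of "alpha N"]
  by (simp add: hs_def hom_vector_space_def Go_simps)
 moreover have "act (Go N) (one A) m = alpha (Go N) m" if "m \<in>. N" for m
  using hmodule_one[OF BM.hm_hmodule[OF N] that] that by (simp add: Go_simps halg_one alg B_simps(4))
 moreover have ia: "\<And>a. a \<in>. A \<Longrightarrow> ia a \<in>. T" by (rule lin|assumption)+
 moreover have cl: "\<And>a m. a \<in>. A \<Longrightarrow> m \<in>. N \<Longrightarrow> act N (ia a) m \<in>. N" "\<And>m. m \<in>. N \<Longrightarrow> alpha N m \<in>. N"
  by (rule lin|assumption)+
 moreover have "alpha (Go N) (act (Go N) a m) = act (Go N) (alpha A a) (alpha (Go N) m)" if "a \<in>. A" "m \<in>. N" for a m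
  using that by (simp add: Go_simps Nact_alpha ia alpha_ia alpha_closed hs cl)
 moreover have "act (Go N) (alpha A a) (act (Go N) b m) = act (Go N) (a \<otimes>\<^bsub>A\<^esub> b) (alpha (Go N) m)"
  if abm: "a \<in>. A" "b \<in>. A" "m \<in>. N" for a b m
 proof -
  have ab: "umult A a b \<in>. A" using abm by (simp add: umult_multilin alg)
  have "act (Go N) (alpha A a) (act (Go N) b m) = act N (alpha B (ia a)) (act N (ia b) m)"
   using abm by (simp add: Go_simps cl alpha_closed hs alpha_ia)
  also have "... = act N (alpha B (ia (umult A a b))) (alpha N m)"
   using abm ab by (simp add: Nact_twist ia umult_ia_ia Nact_alpha)
  also have "... = act (Go N) (a \<otimes>\<^bsub>A\<^esub> b) (alpha (Go N) m)"
   using abm ab by (simp add: alpha_ia alpha_umult alg Go_simps cl halg_mult_multilin)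
  finally show ?thesis .
 qed
 ultimately show ?thesis by (simp add: left_hom_module_def Go_simps(1))
qed

lemma Go_dh: "is_dhmod K D (Go N)"
proof -
 note sN = Go_simps(3)[of N]
 note eqs = tensor_same_space[OF sN same_space_refl] sw_same_space[OF sN] lin_same_space[OF sN same_space_refl]
 have "bijective_alpha (Go N)" "normal_space K (Go N)" "alpha (Go N) \<in> extensional (carrier (Go N))"
  using N by (simp_all add: is_hmod_def bijective_alpha_def normal_space_def Go_def)
 moreover have "act (Go N) = (\<lambda>b\<in>carrier A. \<lambda>m\<in>carrier (Go N). act (Go N) b m)"
  by (auto simp: Go_def fun_eq_iff)
 ultimately have hmG: "AM.hm (Go N)" using Go_act_module by (simp add: is_hmod_def)
 have cN: "cact N m \<in>. tens N C" if "m \<in>. N" for m by (rule lin that)+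
 have sc: "sw U (cact N m) (\<lambda>m0 m1. f (coact (Go N) m0) m1) = sw U (cact N m) (\<lambda>m0 m1. f (cact N m0) m1)"
  if "m \<in>. N" for U m f
  by (rule sw_cong[OF Nm mods(2) cN[OF that]]) (simp add: Go_simps)
 have "right_hom_comodule K C (Go N) (coact (Go N))"
  unfolding right_hom_comodule_def Let_def
 proof (intro conjI ballI)
  show "hom_vector_space K (Go N)" using Go_act_module by (simp add: left_hom_module_def)
  show "lin (Go N) (tens (Go N) C) (coact (Go N))"
   unfolding eqs by (rule lin_cong[OF Nm cact_lin]) (simp add: Go_simps)
  fix m assume m: "m \<in>. Go N"
  then have m': "m \<in>. N" by (simp add: Go_simps)
  have sm: "(\<odot>\<^bsub>Go N\<^esub>) = (\<odot>\<^bsub>N\<^esub>)" using sN by (simp add: same_space_def)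
  show "sw (Go N) (coact (Go N) m) (\<lambda>m0 m1. counit C m1 \<odot>\<^bsub>Go N\<^esub> m0) = alpha (Go N) m"
   using m' by (simp add: eqs Go_simps sm cact_counit)
  have am: "alpha N m \<in>. N" by (rule lin m')+
  show "sw (tens (Go N) C) (coact (Go N) m) (\<lambda>m0 m1. pure K (Go N) C (alpha (Go N) m0) (alpha C m1)) = coact (Go N) (alpha (Go N) m)"
   using m' am by (simp add: eqs Go_simps cact_alpha)
  have eqs2: "tens (Go N) (tens C C) = tens N (tens C C)" "pure K (Go N) (tens C C) = pure K N (tens C C)"
   by (rule tensor_same_space[OF sN same_space_refl])+
  show "sw (tens (Go N) (tens C C)) (coact (Go N) m) (\<lambda>m0 m1. sw (tens (Go N) (tens C C)) (coact (Go N) m0)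
      (\<lambda>m00 m01. pure K (Go N) (tens C C) m00 (pure K C C m01 (alpha C m1)))) =
    sw (tens (Go N) (tens C C)) (coact (Go N) m) (\<lambda>m0 m1. pure K (Go N) (tens C C) (alpha (Go N) m0) (comult C m1))"
   using m' sc[OF m', of "tens N (tens C C)" "\<lambda>Z m1. sw (tens N (tens C C)) Z
    (\<lambda>m00 m01. pure K N (tens C C) m00 (pure K C C m01 (alpha C m1)))"]
   by (simp add: eqs2 Go_simps cact_coassoc)
 qed
 moreover have "coact (Go N) \<in> extensional (carrier (Go N))" by (simp add: Go_def)
 moreover have "coact (Go N) (act (Go N) a m) =
   sw (tens (Go N) C) (\<rho>A a) (\<lambda>a0 a1. sw (tens (Go N) C) (coact (Go N) m)
    (\<lambda>m0 m1. pure K (Go N) C (act (Go N) a0 m0) (hact a1 m1)))"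
  if a: "a \<in>. A" and m: "m \<in>. Go N" for a m
 proof -
  have m': "m \<in>. N" using m by (simp add: Go_simps)
  have cl: "act N (ia a) m \<in>. N" by (rule lin a m')+
  have "sw (tens N C) (\<rho>A a) (\<lambda>a0 a1. sw (tens N C) (cact N m) (\<lambda>m0 m1. pure K N C (act (Go N) a0 m0) (hact a1 m1))) =
    sw (tens N C) (\<rho>A a) (\<lambda>a0 a1. sw (tens N C) (cact N m) (\<lambda>m0 m1. pure K N C (act N (ia a0) m0) (hact a1 m1)))"
   by (rule sw_cong, (rule lin a)+, rule sw_cong[OF Nm mods(2) cN[OF m']]) (simp add: Go_simps)
  then show ?thesis using a m' cl by (simp add: eqs Go_simps cact_act)
 qed
 ultimately show ?thesis using hmG by (simp add: is_dhmod_def)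
qed

end

section \<open>The two constructions are inverse to each other\<close>

lemma hmod_eqI:
 fixes M N :: "('k,'b,'v) hmod"
 assumes "carrier M = carrier N" "mult M = mult N" "one M = one N" "zero M = zero N" "add M = add N"
  "smult M = smult N" "alpha M = alpha N"
  and M: "act M = (\<lambda>b\<in>S. \<lambda>m\<in>carrier M. act M b m)" and N: "act N = (\<lambda>b\<in>S. \<lambda>m\<in>carrier N. act N b m)"
  and eq: "\<And>b m. b \<in> S \<Longrightarrow> m \<in>. M \<Longrightarrow> act M b m = act N b m"
 shows "M = N"
proof -
 have "act M = act N" by (subst M, subst N) (use assms(1) eq in \<open>auto intro!: restrict_ext\<close>)
 with assms show ?thesis by (intro hmod.equality) simp_all
qed

lemma con_same_space: "same_space M M' \<Longrightarrow> con M f Z = con M' f Z"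
 by (simp add: con_def sweedler_def formal_eval_def same_space_def)

text \<open>Both actions agree on \<open>a # f\<close>, which is the product of \<open>a # \<epsilon>\<close> and \<open>1 # f\<close> by \<open>umult_ia_ic\<close>.\<close>

lemma Fo_Go:
 assumes N: "BM.hm N" shows "Fo (Go N) = N"
proof (rule hmod_eqI[where S="carrier B"])
 let ?F = "Fo (Go N)"
 note [lin] = N N_multilin[OF N]
 note sG = Go_simps(3)[of N] and pG = dh_pre_dh[OF Go_dh[OF N]]
 have bG: "bil T N N (act ?F)"
  using Fo_act_bil[OF pG] bil_same_space[OF same_space_refl sG sG] by blast
 fix X m assume "X \<in>. B" and m: "m \<in>. ?F"
 then have X: "X \<in>. T" by (simp add: B_simps)
 have m [lin]: "m \<in>. N" using m by (simp add: Fo_simps Go_simps)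
 show "act ?F X m = act N X m"
 proof (rule tensor_ext[OF mods(1) dual_module[OF mods(2)] X _ bil_left[OF bG m] bil_left[OF Nact_bil[OF N] m]])
  fix a f assume [lin]: "a \<in>. A" and f [lin]: "f \<in>. dual C"
  let ?a = "alpha_inv A a" and ?f = "alpha_inv Cd f" and ?m = "alpha_inv N m"
  have cl: "?a \<in>. A" "?f \<in>. dual C" "?m \<in>. N" "ic ?f \<in>. T" "ia ?a \<in>. T"
   "act N (ic ?f) ?m \<in>. N" "act N (ic f) m \<in>. N" "sm ?a ?f \<in>. T"
   "alpha_inv N (act N (ic f) m) \<in>. N"
   by (rule lin)+
  have hsN: "hs N" by (rule lin)+
  have "act N (ic f) m = alpha N (act N (ic ?f) ?m)"
   using f m by (simp add: Nact_alpha[OF N] cl alpha_ic alpha_alpha_inv hsN)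
  then have i: "alpha_inv N (act N (ic f) m) = act N (ic ?f) ?m" by (simp add: alpha_inv_alpha hsN cl)
  have "act ?F (sm a f) m = act (Go N) a (alpha_inv (Go N) (con (Go N) f (coact (Go N) m)))"
   by (rule Fo_act_pure[OF pG]) (simp_all add: Go_simps m f \<open>a \<in>. A\<close>)
  also have "alpha_inv (Go N) (con (Go N) f (coact (Go N) m)) = alpha_inv N (act N (ic f) m)"
   by (simp add: alpha_inv_def[abs_def] Go_simps con_same_space[OF sG] con_cact[OF N] f m)
  also have "act (Go N) a (alpha_inv N (act N (ic f) m)) = act N (alpha B (ia ?a)) (act N (ic ?f) ?m)"
   using \<open>a \<in>. A\<close> cl by (simp add: Go_simps i alpha_ia alpha_alpha_inv hs)
  also have "... = act N (sm a f) m"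
   using \<open>a \<in>. A\<close> f m hs_Cd
   by (simp add: Nact_twist[OF N] cl umult_ia_ic Nact_alpha[OF N] T_alpha_pure alpha_alpha_inv hs hsN Cd_simps(1))
  finally show "act ?F (sm a f) m = act N (sm a f) m" .
 qed (rule lin)+
next
 show "act N = (\<lambda>b\<in>carrier B. \<lambda>m\<in>carrier N. act N b m)" using N by (simp add: is_hmod_def)
qed (auto simp: Fo_def Go_def fun_eq_iff)

text \<open>
 The coaction returns because a tensor in \<open>M \<otimes> C\<close> is the expansion of its contractions in dual
 bases (\<open>coev_pure\<close>).
\<close>

lemma Go_Fo:
 assumes M [lin]: "pre_dh M" shows "Go (Fo M) = M"
proof -
 note [lin] = pre_dh_hm pre_dh_coact_multilin
 note sF = Fo_simps(3)[of M]
 have "act M = (\<lambda>b\<in>carrier A. \<lambda>m\<in>carrier M. act M b m)" using pre_dh_hm[OF M] by (simp add: is_hmod_def)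
 also have "... = act (Go (Fo M))"
  unfolding Go_def by (auto simp: Fo_simps Fo_act_ia[OF M] fun_eq_iff)
 finally have "act (Go (Fo M)) = act M" ..
 moreover have "coact (Go (Fo M)) = coact M"
 proof (rule extensionalityI)
  show "coact (Go (Fo M)) \<in> extensional (carrier M)" by (simp add: Go_def Fo_simps)
  show "coact M \<in> extensional (carrier M)" using M by (simp add: pre_dh_def)
  fix m assume m [lin]: "m \<in>. M"
  have Mm: "module K M" and cm: "coact M m \<in>. tens M C" by (rule lin)+
  have "coact (Go (Fo M)) m = sw (tens M C) \<Omega> (\<lambda>x f. pure K M C (act (Fo M) (ic f) m) x)"
   by (simp add: Go_simps Fo_simps m cact_def tensor_same_space[OF sF same_space_refl])
  also have "... = sw (tens M C) \<Omega> (\<lambda>x f. pure K M C (con M f (coact M m)) x)"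
   by (rule sw_cong[OF mods(2) dual_module[OF mods(2)] \<Omega>_closed]) (simp add: Fo_act_ic[OF M] m)
  also have "... = coact M m" by (rule coev_pure[OF mods(2) \<Omega> Mm cm])
  finally show "coact (Go (Fo M)) m = coact M m" .
 qed
 ultimately show ?thesis by (intro dhmod.equality) (simp_all add: Go_def Fo_def)
qed

text \<open>
 A linear map commutes with the action of the smash product if and only if it commutes with the
 actions of \<open>a # \<epsilon>\<close> and \<open>1 # f\<close>, that is, with the action of \<open>A\<close> and with all contractions of the
 coaction.
\<close>

lemma Fo_mor:
 assumes M [lin]: "pre_dh M" and N [lin]: "pre_dh N"
 shows "hmod_mor K B (Fo M) (Fo N) = dhmod_mor K D M N"
proof (intro equalityI subsetI)
 note [lin] = pre_dh_hm pre_dh_coact_multilin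
 note bF = bil_multilin[OF con_bil[OF _ mods(2)]]
 have Nm: "module K N" by (rule lin)+
 note lFo = lin_same_space[OF Fo_simps(3)[of M] Fo_simps(3)[of N]]
 {
  fix f assume f: "f \<in> hmod_mor K B (Fo M) (Fo N)"
  then have flin: "lin M N f" and fact: "\<And>X m. X \<in>. T \<Longrightarrow> m \<in>. M \<Longrightarrow> f (act (Fo M) X m) = act (Fo N) X (f m)"
   by (simp_all add: hmod_mor_def lFo Fo_simps B_simps)
  note [lin] = lin_multilin[OF flin] bF
  have "f (act M a m) = act N a (f m)" if am [lin]: "a \<in>. A" "m \<in>. M" for a m
  proof -
   have "ia a \<in>. T" "f m \<in>. N" by (rule lin)+
   then show ?thesis using fact[of "ia a" m] am by (simp add: Fo_act_ia M N)
  qed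
  moreover have "coact N (f m) = sw (tens N C) (coact M m) (\<lambda>m0 m1. pure K N C (f m0) m1)"
   if m [lin]: "m \<in>. M" for m
  proof (rule recovers_separates[OF recovers_con[OF mods(2) \<Omega> Nm]])
   fix g assume g [lin]: "g \<in>. dual C"
   have cl: "ic g \<in>. T" "f m \<in>. N" "\<And>m. m \<in>. M \<Longrightarrow> f m \<in>. N"
    "\<And>c. c \<in>. C \<Longrightarrow> dp g c \<in>. K" by (rule lin|assumption)+
   have cN: "lin (tens N C) N (con N g)" by (rule lin)+
   have "con N g (coact N (f m)) = f (con M g (coact M m))"
    using fact[OF cl(1) m] by (simp add: Fo_act_ic M N g m cl)
   also have "... = sw N (coact M m) (\<lambda>m0 m1. f (dp g m1 \<odot>\<^bsub>M\<^esub> m0))"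
    unfolding con_def by (rule sw_hom[OF _ _ _ _ _ flin]) (rule lin|assumption)+
   also have "... = sw N (coact M m) (\<lambda>m0 m1. con N g (pure K N C (f m0) m1))"
    by (rule sw_cong) ((rule lin|assumption)+, simp add: con_pure Nm mods g cl lin_smult[OF flin])
   also have "... = con N g (sw (tens N C) (coact M m) (\<lambda>m0 m1. pure K N C (f m0) m1))"
    by (rule sw_hom[OF _ _ _ _ _ cN, symmetric]) (rule lin|assumption)+
   finally show "con N g (coact N (f m)) = con N g (sw (tens N C) (coact M m) (\<lambda>m0 m1. pure K N C (f m0) m1))" .
  qed (rule lin|assumption)+
  ultimately show "f \<in> dhmod_mor K D M N"
   using f flin by (simp add: dhmod_mor_def hmod_mor_def Fo_simps)
 next
  fix f assume f: "f \<in> dhmod_mor K D M N"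
  then have fm: "f \<in> AM.mor M N" and fco: "\<And>m. m \<in>. M \<Longrightarrow>
    coact N (f m) = sw (tens N C) (coact M m) (\<lambda>m0 m1. pure K N C (f m0) m1)"
   by (simp_all add: dhmod_mor_def)
  note flin = AM.mor_lin[OF fm]
  note [lin] = lin_multilin[OF flin]
  have "f (act (Fo M) X m) = act (Fo N) X (f m)" if X [lin]: "X \<in>. T" and m [lin]: "m \<in>. M" for X m
  proof -
   have fmN: "f m \<in>. N" by (rule lin)+
   have cl: "\<And>c. c \<in>. C \<Longrightarrow> evl A c X \<in>. A" "\<And>x. x \<in>. M \<Longrightarrow> alpha_inv M x \<in>. M"
    by (rule lin|assumption)+
   have "f (act (Fo M) X m) = sw N (coact M m) (\<lambda>m0 c. f (act M (evl A c X) (alpha_inv M m0)))"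
    unfolding Fo_act[OF X m] by (rule sw_hom[OF _ _ _ _ _ flin]) (rule lin|assumption)+
   also have "... = sw N (coact M m) (\<lambda>m0 c. act N (evl A c X) (alpha_inv N (f m0)))"
    by (rule sw_cong) ((rule lin|assumption)+,
      simp add: AM.mor_act[OF fm] cl AM.mor_alpha_inv[OF fm] pre_dh_hm M N)
   also have "... = sw N (sw (tens N C) (coact M m) (\<lambda>m0 m1. pure K N C (f m0) m1))
     (\<lambda>m0 c. act N (evl A c X) (alpha_inv N m0))"
    by (rule sw_sweedler_pure[symmetric]) (rule lin|assumption)+
   finally show ?thesis by (simp add: Fo_act[OF X fmN] fco m)
  qed
  with fm show "f \<in> hmod_mor K B (Fo M) (Fo N)"
   by (simp add: hmod_mor_def lFo Fo_simps B_simps)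
 }
qed

section \<open>Tensor products and the unit object\<close>

lemma (in ground) is_hmod_cong:
 assumes "same_space M M'" "alpha M = alpha M'" "act M = act M'" "normal_space K M'" and M: "is_hmod K X M"
 shows "is_hmod K X M'"
proof -
 have "left_hom_module K X M (act M)" using M by (simp add: is_hmod_def)
 then have "left_hom_module K X M' (act M')"
  using assms(1-3) module_same_space[OF assms(1)] lin_same_space[OF assms(1,1)]
   bil_same_space[OF same_space_refl[of X] assms(1,1), of "act M'"]
  by (simp add: left_hom_module_def hom_vector_space_def same_space_def)
 then show ?thesis using assms by (simp add: is_hmod_def same_space_def bijective_alpha_def)
qed

lemma (in ground) hmod_extend_simps:
 "same_space (hmod.extend h x) h" "alpha (hmod.extend h x) = alpha h" "act (hmod.extend h x) = act h"
 "normal_space K h \<Longrightarrow> normal_space K (hmod.extend h x)"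
 by (simp_all add: same_space_def hmod.extend_def normal_space_def)

abbreviation "dtp \<equiv> dhmod_tensor K D"

definition diag_coact where
 "diag_coact M N m n = sw (tens (AM.tp M N) C) (coact M m) (\<lambda>m0 m1. sw (tens (AM.tp M N) C) (coact N n)
   (\<lambda>n0 n1. pure K (AM.tp M N) C (upure K M N m0 n0) (alpha_inv C (alpha_inv C (m1 \<otimes>\<^bsub>C\<^esub> n1)))))"

lemma dtp_simps:
 "same_space (dtp M N) (AM.tp M N)" "alpha (dtp M N) = alpha (AM.tp M N)" "act (dtp M N) = act (AM.tp M N)"
 "coact (dtp M N) = (\<lambda>z\<in>carrier (AM.tp M N). usweedler (tens (AM.tp M N) C) z (diag_coact M N))"
proof -
 show "same_space (dtp M N) (AM.tp M N)" "alpha (dtp M N) = alpha (AM.tp M N)" "act (dtp M N) = act (AM.tp M N)"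
  by (simp_all add: dhmod_tensor_def Let_def hmod_extend_simps)
 show "coact (dtp M N) = (\<lambda>z\<in>carrier (AM.tp M N). usweedler (tens (AM.tp M N) C) z (diag_coact M N))"
  unfolding diag_coact_def[abs_def] tensor_same_space[OF AM.tp_same_space same_space_refl]
  using AM.tp_same_space[of M N]
  by (simp add: dhmod_tensor_def Let_def hmod.extend_def dhmod.fields_def same_space_def)
qed

context
 fixes M N :: "('k,'a,'c,('k,'s) univ) dhmod"
 assumes Mp [lin]: "pre_dh M" and Np [lin]: "pre_dh N"
begin

abbreviation "P \<equiv> AM.tp M N"

lemma Mhm2 [lin]: "AM.hm M" and Nhm2 [lin]: "AM.hm N" and Phm [lin]: "AM.hm P"
 using pre_dh_hm[OF Mp] pre_dh_hm[OF Np] by (auto intro: AM.tp_hm)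

lemma utens_P [lin]: "utens P M N" by (rule lin)+

lemmas MN_multilin [lin] = pre_dh_coact_multilin

lemma diag_bil: "bil M N (tens P C) (diag_coact M N)"
 unfolding diag_coact_def by (rule lin|assumption)+

lemma dtp_coact_lin: "lin P (tens P C) (coact (dtp M N))"
proof -
 note [lin] = bil_multilin[OF diag_bil]
 show ?thesis unfolding dtp_simps by (rule lin_restrict) (rule lin|assumption)+
qed

lemma dtp_coact_upure:
 assumes mn [lin]: "m \<in>. M" "n \<in>. N"
 shows "coact (dtp M N) (upure K M N m n) = diag_coact M N m n"
proof -
 note [lin] = bil_multilin[OF diag_bil]
 have "upure K M N m n \<in>. P" by (rule lin)+
 then have "coact (dtp M N) (upure K M N m n) = usweedler (tens P C) (upure K M N m n) (diag_coact M N)"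
  by (simp add: dtp_simps)
 also have "... = diag_coact M N m n" by (rule usweedler_upure) (rule lin|assumption)+
 finally show ?thesis .
qed

lemma sw_diag_coact:
 assumes [lin]: "m \<in>. M" "n \<in>. N" and t: "bil P C U t" and [lin]: "module K U"
 shows "sw U (diag_coact M N m n) t = sw U (coact M m) (\<lambda>m0 m1. sw U (coact N n)
  (\<lambda>n0 n1. t (upure K M N m0 n0) (alpha_inv C (alpha_inv C (m1 \<otimes>\<^bsub>C\<^esub> n1)))))"
 unfolding diag_coact_def by (rule sw_double_pure[OF _ _ _ _ _ _ _ _ _ _ _ t]) (rule lin|assumption)+

lemma dtp_counit_upure:
 assumes mn [lin]: "m \<in>. M" "n \<in>. N"
 shows "sw P (diag_coact M N m n) (\<lambda>z c. counit C c \<odot>\<^bsub>P\<^esub> z) = alpha P (upure K M N m n)"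
proof -
 let ?p = "upure K M N"
 have pm: "module K P" by (rule lin)+
 interpret P: module K P by (rule pm)
 have co: "coact M m \<in>. tens M C" "coact N n \<in>. tens N C" by (rule lin)+
 have cl: "\<And>c. c \<in>. C \<Longrightarrow> counit C c \<in>. K" "\<And>m n. m \<in>. M \<Longrightarrow> n \<in>. N \<Longrightarrow> ?p m n \<in>. P"
  "\<And>r n. r \<in>. K \<Longrightarrow> n \<in>. N \<Longrightarrow> r \<odot>\<^bsub>N\<^esub> n \<in>. N"
  by (rule lin|assumption)+
 have "sw P (diag_coact M N m n) (\<lambda>z c. counit C c \<odot>\<^bsub>P\<^esub> z) =
   sw P (coact M m) (\<lambda>m0 m1. sw P (coact N n) (\<lambda>n0 n1. counit C (alpha_inv C (alpha_inv C (m1 \<otimes>\<^bsub>C\<^esub> n1))) \<odot>\<^bsub>P\<^esub> ?p m0 n0))"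
  by (rule sw_diag_coact) (rule lin|assumption)+
 also have "... = sw P (coact M m) (\<lambda>m0 m1. sw P (coact N n) (\<lambda>n0 n1. ?p (counit C m1 \<odot>\<^bsub>M\<^esub> m0) (counit C n1 \<odot>\<^bsub>N\<^esub> n0)))"
 proof (rule sw_cong, (rule lin|assumption)+, rule sw_cong)
  fix m0 m1 n0 n1 assume e [lin]: "m0 \<in>. M" "m1 \<in>. C" "n0 \<in>. N" "n1 \<in>. C"
  have c: "m1 \<otimes>\<^bsub>C\<^esub> n1 \<in>. C" "alpha_inv C (m1 \<otimes>\<^bsub>C\<^esub> n1) \<in>. C" by (rule lin)+
  show "counit C (alpha_inv C (alpha_inv C (m1 \<otimes>\<^bsub>C\<^esub> n1))) \<odot>\<^bsub>P\<^esub> ?p m0 n0 = ?p (counit C m1 \<odot>\<^bsub>M\<^esub> m0) (counit C n1 \<odot>\<^bsub>N\<^esub> n0)"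
   using lin_smult[OF bil_left[OF upure_bil[OF utens_P]], of "counit C n1 \<odot>\<^bsub>N\<^esub> n0" "counit C m1" m0]
    lin_smult[OF bil_right[OF upure_bil[OF utens_P]], of m0 "counit C n1" n0] e
   by (simp add: hcoalg_counit_alpha_inv coalg c hbialg_counit[OF C] cl P.smult_assoc1)
 qed (rule lin co | assumption)+
 also have "... = sw P (coact M m) (\<lambda>m0 m1. ?p (counit C m1 \<odot>\<^bsub>M\<^esub> m0) (alpha N n))"
 proof (rule sw_cong)
  fix m0 m1 assume [lin]: "m0 \<in>. M" "m1 \<in>. C"
  have "sw P (coact N n) (\<lambda>n0 n1. ?p (counit C m1 \<odot>\<^bsub>M\<^esub> m0) (counit C n1 \<odot>\<^bsub>N\<^esub> n0)) =
    ?p (counit C m1 \<odot>\<^bsub>M\<^esub> m0) (sw N (coact N n) (\<lambda>n0 n1. counit C n1 \<odot>\<^bsub>N\<^esub> n0))"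
   by (rule sw_hom[where g="?p (counit C m1 \<odot>\<^bsub>M\<^esub> m0)", symmetric]) (rule lin|assumption)+
  then show "sw P (coact N n) (\<lambda>n0 n1. ?p (counit C m1 \<odot>\<^bsub>M\<^esub> m0) (counit C n1 \<odot>\<^bsub>N\<^esub> n0)) = ?p (counit C m1 \<odot>\<^bsub>M\<^esub> m0) (alpha N n)"
   using Np mn by (simp add: pre_dh_def)
 qed (rule lin|assumption)+
 also have "... = ?p (sw M (coact M m) (\<lambda>m0 m1. counit C m1 \<odot>\<^bsub>M\<^esub> m0)) (alpha N n)"
  by (rule sw_hom[where g="\<lambda>x. ?p x (alpha N n)", symmetric]) (rule lin|assumption)+
 finally have "sw P (diag_coact M N m n) (\<lambda>z c. counit C c \<odot>\<^bsub>P\<^esub> z) = ?p (alpha M m) (alpha N n)"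
  using Mp mn by (simp add: pre_dh_def)
 moreover have "hs M" "hs N" by (rule lin)+
 ultimately show ?thesis using mn by (simp add: AM.tp_alpha_upure)
qed

lemma dtp_pre_dh: "pre_dh (dtp M N)"
proof -
 note eqs = tensor_same_space[OF dtp_simps(1) same_space_refl] sw_same_space[OF dtp_simps(1)]
  lin_same_space[OF dtp_simps(1) same_space_refl]
 have c: "carrier (dtp M N) = carrier P" and s: "smult (dtp M N) = smult P"
  using dtp_simps(1)[of M N] by (simp_all add: same_space_def)
 have "normal_space K (dtp M N)"
  using Phm unfolding dhmod_tensor_def Let_def by (intro hmod_extend_simps) (simp add: is_hmod_def)
 then have "AM.hm (dtp M N)"
  by (rule is_hmod_cong[OF same_space_sym[OF dtp_simps(1)] dtp_simps(2,3)[symmetric] _ Phm])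
 moreover have "coact (dtp M N) \<in> extensional (carrier (dtp M N))" by (simp add: c dtp_simps)
 moreover have "sw P (coact (dtp M N) z) (\<lambda>z c. counit C c \<odot>\<^bsub>P\<^esub> z) = alpha P z" if z: "z \<in>. P" for z
 proof -
  note [lin] = lin_multilin[OF dtp_coact_lin]
  show ?thesis
   by (rule utens_ext[OF z utens_P, where U=P])
    ((simp add: dtp_coact_upure dtp_counit_upure; fail) | rule lin|assumption)+
 qed
 ultimately show ?thesis by (simp add: pre_dh_def eqs c s dtp_simps(2) dtp_coact_lin)
qed

text \<open>
 On \<open>m \<otimes> n\<close> both actions of \<open>X\<close> are given by the coproduct in \<open>A\<close> of the value of \<open>X\<close> at
 \<open>\<alpha>\<^sup>-\<^sup>2(m\<^sub>(\<^sub>1\<^sub>) n\<^sub>(\<^sub>1\<^sub>))\<close>: on the side of Doi-Hopf modules by the definition of the coaction, on the other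
 side by \<open>ev2_comult\<close>.
\<close>

lemma Fo_dtp: "Fo (dtp M N) = BM.tp (Fo M) (Fo N)"
proof (rule hmod_eqI[where S="carrier B"])
 let ?F = "Fo (dtp M N)" and ?Q = "BM.tp (Fo M) (Fo N)" and ?p = "upure K M N"
 let ?i = "alpha_inv M" and ?j = "alpha_inv N"
 let ?t = "\<lambda>m n a1 a2. ?p (act M a1 (?i m)) (act N a2 (?j n))"
 note eq = utensor_same_space[OF Fo_simps(3)[of M] Fo_simps(3)[of N]]
 have sQ: "same_space ?Q P" by (simp add: same_space_def hmod_tensor_def Let_def eq)
 have sF: "same_space ?F P" using Fo_simps(3)[of "dtp M N"] dtp_simps(1)[of M N] by (simp add: same_space_def)
 show "carrier ?F = carrier ?Q" "zero ?F = zero ?Q" "add ?F = add ?Q" "smult ?F = smult ?Q"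
  using sQ sF by (simp_all add: same_space_def)
 have "mult ?F = mult (dtp M N)" "one ?F = one (dtp M N)" by (simp_all add: Fo_def)
 then show "mult ?F = mult ?Q" "one ?F = one ?Q" "alpha ?F = alpha ?Q"
  by (simp_all add: Fo_simps dhmod_tensor_def hmod_tensor_def Let_def hmod.extend_def eq)
 show "act ?F = (\<lambda>b\<in>carrier B. \<lambda>m\<in>carrier ?F. act ?F b m)" by (auto simp: Fo_def fun_eq_iff)
 show "act ?Q = (\<lambda>b\<in>carrier B. \<lambda>m\<in>carrier ?Q. act ?Q b m)" by (auto simp: BM.act_tp fun_eq_iff)
 fix X z assume "X \<in>. B" and "z \<in>. ?F"
 then have X [lin]: "X \<in>. T" and z: "z \<in>. P" using sF by (simp_all add: B_simps same_space_def)
 have FM [lin]: "module K (Fo M)" "module K (Fo N)"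
  using module_same_space[OF same_space_sym[OF Fo_simps(3)[of M]]] module_same_space[OF same_space_sym[OF Fo_simps(3)[of N]]]
   AM.hm_module[OF Mhm2] AM.hm_module[OF Nhm2] by blast+
 have pm: "module K P" by (rule lin)+
 note [lin] = bil_multilin[OF Fo_act_bil[OF Mp]] bil_multilin[OF Fo_act_bil[OF Np]]
 have aQ: "act ?Q X z = usweedler P z (\<lambda>m n. sw P (comult B X) (\<lambda>X1 X2. ?p (act (Fo M) X1 m) (act (Fo N) X2 n)))"
  if "z \<in>. P" for z
  using that X sQ unfolding BM.act_tp eq usweedler_same_space[OF sQ] sw_same_space[OF sQ]
  by (simp add: B_simps same_space_def)
 have f: "lin P P (act ?F X)"
  using bil_right[OF Fo_act_bil[OF dtp_pre_dh] X] lin_same_space[OF dtp_simps(1) dtp_simps(1)] by blast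
 have g: "lin P P (\<lambda>z. usweedler P z (\<lambda>m n. sw P (comult B X) (\<lambda>X1 X2. ?p (act (Fo M) X1 m) (act (Fo N) X2 n))))"
  by (rule lin|assumption)+
 have "act ?F X z = usweedler P z (\<lambda>m n. sw P (comult B X) (\<lambda>X1 X2. ?p (act (Fo M) X1 m) (act (Fo N) X2 n)))"
 proof (rule utens_ext[OF z utens_P pm f g])
  fix m n assume mn [lin]: "m \<in>. M" "n \<in>. N"
  have pc: "?p m n \<in>. P" by (rule lin)+
  note [lin] = pre_dh_coact_multilin
  have "act ?F X (?p m n) = sw (dtp M N) (coact (dtp M N) (?p m n)) (\<lambda>z c. act (dtp M N) (evl A c X) (alpha_inv (dtp M N) z))"
   by (rule Fo_act[OF X]) (use pc dtp_simps(1)[of M N] in \<open>simp add: same_space_def\<close>)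
  also have "... = sw P (diag_coact M N m n) (\<lambda>z c. act P (evl A c X) (alpha_inv P z))"
   using dtp_simps(1)[of M N]
   by (simp add: dtp_coact_upure mn sw_same_space[OF dtp_simps(1)] dtp_simps(2,3) alpha_inv_def same_space_def)
  also have "... = sw P (coact M m) (\<lambda>m0 m1. sw P (coact N n) (\<lambda>n0 n1.
    act P (evl A (alpha_inv C (alpha_inv C (m1 \<otimes>\<^bsub>C\<^esub> n1))) X) (alpha_inv P (?p m0 n0))))"
   by (rule sw_diag_coact) (rule lin|assumption)+
  also have "... = sw P (coact M m) (\<lambda>m0 m1. sw P (coact N n) (\<lambda>n0 n1.
    sw P (comult B X) (\<lambda>X1 X2. ?p (act M (evl A m1 X1) (?i m0)) (act N (evl A n1 X2) (?j n0)))))"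
  proof (rule sw_cong, (rule lin|assumption)+, rule sw_cong)
   fix m0 m1 n0 n1 assume e [lin]: "m0 \<in>. M" "m1 \<in>. C" "n0 \<in>. N" "n1 \<in>. C"
   let ?x = "alpha_inv C (umult C (alpha_inv C m1) (alpha_inv C n1))"
   have hsMN: "hs M" "hs N" by (rule lin)+
   have cl: "evl A (alpha_inv C (alpha_inv C (m1 \<otimes>\<^bsub>C\<^esub> n1))) X \<in>. A" "?i m0 \<in>. M" "?j n0 \<in>. N"
    "alpha_inv C m1 \<in>. C" "alpha_inv C n1 \<in>. C" "umult C (alpha_inv C m1) (alpha_inv C n1) \<in>. C"
    "comult B X \<in>. TT" by (rule lin)+
   have "alpha_inv C (alpha_inv C (m1 \<otimes>\<^bsub>C\<^esub> n1)) = alpha C ?x"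
    using e cl by (simp add: umult_def halg_inv_mult halg_alpha_mult alg hs_simps hs)
   then have evx: "evl A (alpha_inv C (alpha_inv C (m1 \<otimes>\<^bsub>C\<^esub> n1))) X = ev X ?x" by (simp add: ev_def)
   have "act P (evl A (alpha_inv C (alpha_inv C (m1 \<otimes>\<^bsub>C\<^esub> n1))) X) (alpha_inv P (?p m0 n0)) =
     sw P (comult A (ev X ?x)) (?t m0 n0)"
    using cl e by (simp add: AM.tp_alpha_inv_upure hsMN AM.tp_act_upure pre_dh_hm Mp Np evx)
   also have "comult A (ev X ?x) = tmap A A (evl A m1) (evl A n1) (comult B X)"
    using e cl by (simp add: tmap_ev_alpha_inv ev2_comult X)
   also have "sw P ... (?t m0 n0) = sw P (comult B X) (\<lambda>X1 X2. ?t m0 n0 (evl A m1 X1) (evl A n1 X2))"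
    by (rule sw_tmap) (rule lin|assumption)+
   finally show "act P (evl A (alpha_inv C (alpha_inv C (m1 \<otimes>\<^bsub>C\<^esub> n1))) X) (alpha_inv P (?p m0 n0)) =
    sw P (comult B X) (\<lambda>X1 X2. ?t m0 n0 (evl A m1 X1) (evl A n1 X2))" .
  qed (rule lin pre_dh_coact_multilin(1) mn | assumption)+
  also have "... = sw P (coact M m) (\<lambda>m0 m1. sw P (comult B X) (\<lambda>X1 X2.
    ?p (act M (evl A m1 X1) (?i m0)) (act (Fo N) X2 n)))"
  proof (rule sw_cong)
   fix m0 m1 assume [lin]: "m0 \<in>. M" "m1 \<in>. C"
   have "sw P (coact N n) (\<lambda>n0 n1. sw P (comult B X) (\<lambda>X1 X2. ?t m0 n0 (evl A m1 X1) (evl A n1 X2))) =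
     sw P (comult B X) (\<lambda>X1 X2. sw P (coact N n) (\<lambda>n0 n1. ?t m0 n0 (evl A m1 X1) (evl A n1 X2)))"
    by (rule sw_swap) (rule lin|assumption)+
   also have "... = sw P (comult B X) (\<lambda>X1 X2. ?p (act M (evl A m1 X1) (?i m0)) (act (Fo N) X2 n))"
   proof (rule sw_cong)
    fix X1 X2 assume [lin]: "X1 \<in>. T" and X2 [lin]: "X2 \<in>. T"
    let ?g = "?p (act M (evl A m1 X1) (?i m0))"
    have g: "lin N P ?g" by (rule lin)+
    show "sw P (coact N n) (\<lambda>n0 n1. ?t m0 n0 (evl A m1 X1) (evl A n1 X2)) = ?g (act (Fo N) X2 n)"
     unfolding Fo_act[OF X2 mn(2)] by (rule sw_hom[OF _ _ _ _ _ g, symmetric]) (rule lin|assumption)+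
   qed (rule lin|assumption)+
   finally show "sw P (coact N n) (\<lambda>n0 n1. sw P (comult B X) (\<lambda>X1 X2. ?t m0 n0 (evl A m1 X1) (evl A n1 X2))) =
     sw P (comult B X) (\<lambda>X1 X2. ?p (act M (evl A m1 X1) (?i m0)) (act (Fo N) X2 n))" .
  qed (rule lin|assumption)+
  also have "... = sw P (comult B X) (\<lambda>X1 X2. sw P (coact M m) (\<lambda>m0 m1. ?p (act M (evl A m1 X1) (?i m0)) (act (Fo N) X2 n)))"
   by (rule sw_swap) (rule lin|assumption)+
  also have "... = sw P (comult B X) (\<lambda>X1 X2. ?p (act (Fo M) X1 m) (act (Fo N) X2 n))"
  proof (rule sw_cong)
   fix X1 X2 assume X1 [lin]: "X1 \<in>. T" and [lin]: "X2 \<in>. T"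
   let ?g = "\<lambda>y. ?p y (act (Fo N) X2 n)"
   have g: "lin M P ?g" by (rule lin)+
   show "sw P (coact M m) (\<lambda>m0 m1. ?p (act M (evl A m1 X1) (?i m0)) (act (Fo N) X2 n)) = ?g (act (Fo M) X1 m)"
    unfolding Fo_act[OF X1 mn(1)] by (rule sw_hom[OF _ _ _ _ _ g, symmetric]) (rule lin|assumption)+
  qed (rule lin|assumption)+
  also have "... = usweedler P (?p m n) (\<lambda>m n. sw P (comult B X) (\<lambda>X1 X2. ?p (act (Fo M) X1 m) (act (Fo N) X2 n)))"
   by (rule usweedler_upure[symmetric]) (rule lin|assumption)+
  finally show "act ?F X (?p m n) = usweedler P (?p m n) (\<lambda>m n. sw P (comult B X) (\<lambda>X1 X2. ?p (act (Fo M) X1 m) (act (Fo N) X2 n)))" .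
 qed
 then show "act ?F X z = act ?Q X z" by (simp add: aQ z)
qed

end

text \<open>
 The Doi-Hopf axioms of a tensor product are not checked directly. It is a module over the smash
 product, to which \<open>Go\<close> applies.
\<close>

lemma dtp_dh:
 assumes "is_dhmod K D M" "is_dhmod K D N" shows "is_dhmod K D (dtp M N)"
proof -
 note p = dh_pre_dh[OF assms(1)] dh_pre_dh[OF assms(2)]
 have "BM.hm (Fo (dtp M N))" unfolding Fo_dtp[OF p] by (rule BM.tp_hm[OF Fo_hm[OF assms(1)] Fo_hm[OF assms(2)]])
 then show ?thesis using Go_dh[of "Fo (dtp M N)"] by (simp add: Go_Fo[OF dtp_pre_dh[OF p]])
qed

abbreviation dunit :: "('k,'a,'c,('k,'s) univ) dhmod" where
 "dunit \<equiv> dhmod_unit K D"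

lemma dunit_simps:
 "same_space (dunit :: ('k,'a,'c,('k,'s) univ) dhmod) AM.unit_obj"
 "alpha (dunit :: ('k,'a,'c,('k,'s) univ) dhmod) = alpha (AM.unit_obj)"
 "act (dunit :: ('k,'a,'c,('k,'s) univ) dhmod) = act AM.unit_obj"
 "coact (dunit :: ('k,'a,'c,('k,'s) univ) dhmod) = (\<lambda>x\<in>carrier AM.unit_obj. pure K AM.unit_obj C x (one C))"
proof -
 let ?U = "AM.unit_obj :: ('k,'a,('k,'s) univ) hmod"
 have s: "same_space (transport K Scalar (scalars K)) ?U" by (simp add: same_space_def hmod_unit_def Let_def)
 show "same_space (dunit :: ('k,'a,'c,('k,'s) univ) dhmod) ?U" "alpha (dunit :: ('k,'a,'c,('k,'s) univ) dhmod) = alpha ?U"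
  "act (dunit :: ('k,'a,'c,('k,'s) univ) dhmod) = act ?U"
  by (simp_all add: dhmod_unit_def Let_def hmod_extend_simps)
 show "coact (dunit :: ('k,'a,'c,('k,'s) univ) dhmod) = (\<lambda>x\<in>carrier ?U. pure K ?U C x (one C))"
  using s unfolding tensor_same_space(3)[OF s same_space_refl, symmetric]
  by (simp add: dhmod_unit_def Let_def hmod.extend_def dhmod.fields_def same_space_def)
qed

lemma dunit_pre_dh: "pre_dh (dunit :: ('k,'a,'c,('k,'s) univ) dhmod)"
proof -
 let ?U = "AM.unit_obj :: ('k,'a,('k,'s) univ) hmod" and ?D = "dunit :: ('k,'a,'c,('k,'s) univ) dhmod"
 have sD: "same_space ?D ?U" by (rule dunit_simps)
 note eqs = tensor_same_space[OF sD same_space_refl] sw_same_space[OF sD]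
  lin_same_space[OF sD same_space_refl]
 have c: "carrier ?D = carrier ?U" and s: "smult ?D = smult ?U"
  using sD by (simp_all add: same_space_def)
 have Uhm [lin]: "AM.hm ?U" by (rule AM.unit_hm)
 have "normal_space K ?D"
  using Uhm unfolding dhmod_unit_def Let_def by (intro hmod_extend_simps) (simp add: is_hmod_def)
 then have "AM.hm ?D"
  by (rule is_hmod_cong[OF same_space_sym[OF sD] dunit_simps(2,3)[symmetric] _ Uhm])
 moreover have "coact ?D \<in> extensional (carrier ?D)" by (simp add: c dunit_simps)
 moreover have "lin ?U (tens ?U C) (coact ?D)"
  unfolding dunit_simps by (rule lin_restrict) (rule lin|assumption)+
 moreover have "sw ?U (coact ?D x) (\<lambda>x c. counit C c \<odot>\<^bsub>?U\<^esub> x) = alpha ?U x" if x [lin]: "x \<in>. ?U" for x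
 proof -
  have "sw ?U (coact ?D x) (\<lambda>x c. counit C c \<odot>\<^bsub>?U\<^esub> x) = counit C (one C) \<odot>\<^bsub>?U\<^esub> x"
   using x by (simp add: dunit_simps) (rule sw_pureI; (rule lin|assumption)+)
  then show ?thesis using x hbialg_counit(2)[OF C] by (auto simp: AM.unit_simps)
 qed
 ultimately show ?thesis by (simp add: pre_dh_def eqs c s dunit_simps(2))
qed

lemma Fo_dunit: "Fo (dunit :: ('k,'a,'c,('k,'s) univ) dhmod) = BM.unit_obj"
proof (rule hmod_eqI[where S="carrier B"])
 let ?U = "AM.unit_obj :: ('k,'a,('k,'s) univ) hmod" and ?D = "dunit :: ('k,'a,'c,('k,'s) univ) dhmod"
 let ?F = "Fo ?D" and ?Q = "BM.unit_obj :: ('k, ('a \<times> ('c \<Rightarrow> 'k)) list set, ('k,'s) univ) hmod"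
 show "carrier ?F = carrier ?Q" "zero ?F = zero ?Q" "add ?F = add ?Q" "smult ?F = smult ?Q"
  "mult ?F = mult ?Q" "one ?F = one ?Q" "alpha ?F = alpha ?Q"
  by (simp_all add: Fo_def dhmod_unit_def hmod_unit_def Let_def hmod.extend_def)
 show "act ?F = (\<lambda>b\<in>carrier B. \<lambda>m\<in>carrier ?F. act ?F b m)" by (auto simp: Fo_def fun_eq_iff)
 show "act ?Q = (\<lambda>b\<in>carrier B. \<lambda>m\<in>carrier ?Q. act ?Q b m)" by (auto simp: hmod_unit_def Let_def fun_eq_iff)
 have sD: "same_space ?D ?U" by (rule dunit_simps)
 have Uhm [lin]: "AM.hm ?U" by (rule AM.unit_hm)
 fix X x assume X': "X \<in>. B" and x: "x \<in>. ?F"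
 then have X [lin]: "X \<in>. T" and x [lin]: "x \<in>. ?U" and xD: "x \<in>. ?D"
  using sD by (simp_all add: B_simps same_space_def Fo_simps)
 have "act ?F X x = sw ?U (pure K ?U C x (one C)) (\<lambda>x c. act ?U (evl A c X) (alpha_inv ?U x))"
  using x sD unfolding Fo_act[OF X xD] sw_same_space[OF sD]
  by (simp add: dunit_simps alpha_inv_def same_space_def)
 also have "... = act ?U (evl A (one C) X) (alpha_inv ?U x)"
  by (rule sw_pureI) (rule lin|assumption)+
 also have "alpha_inv ?U x = x"
  using x by (intro alpha_inv_eqI AM.hm_hs Uhm) (auto simp: AM.unit_simps)
 also have "act ?U (evl A (one C) X) x = act ?Q X x"
 proof -
  have e: "evl A (one C) X = ev X (one C)" by (simp add: ev_def halg_alpha_one alg)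
  have "ev X (one C) \<in>. A" by (rule lin)+
  then show ?thesis using x X' by (auto simp: AM.unit_simps BM.unit_simps e counit_B X)
 qed
 finally show "act ?F X x = act ?Q X x" .
qed

lemma dunit_dh: "is_dhmod K D (dunit :: ('k,'a,'c,('k,'s) univ) dhmod)"
 using Go_dh[OF BM.unit_hm] Go_Fo[OF dunit_pre_dh] by (metis Fo_dunit)

end

section \<open>Transport of a monoidal structure\<close>

text \<open>
 A graph with operations and constraints that is mapped isomorphically, and strictly compatibly
 with everything, onto a monoidal category. The axioms hold in \<open>C\<close> because they
 hold in \<open>D\<close> and \<open>Fa\<close> is faithful.
\<close>

locale monoidal_transport = target: monoidal_category D
 for C :: "('o,'m,'z) moncat_scheme" and D :: "('p,'n,'y) moncat_scheme" +
 fixes Fo :: "'o \<Rightarrow> 'p" and Fa :: "'m \<Rightarrow> 'n"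
 assumes Fo_bij: "bij_betw Fo (Obj C) (Obj D)"
  and in_hom_iff: "in_hom C f X Y \<longleftrightarrow> X \<in> Obj C \<and> Y \<in> Obj C \<and> Dom C f = X \<and> Cod C f = Y \<and>
   in_hom D (Fa f) (Fo X) (Fo Y)"
  and faithful: "in_hom C f X Y \<Longrightarrow> in_hom C g X Y \<Longrightarrow> Fa f = Fa g \<Longrightarrow> f = g"
  and full: "X \<in> Obj C \<Longrightarrow> Y \<in> Obj C \<Longrightarrow> in_hom D h (Fo X) (Fo Y) \<Longrightarrow> \<exists>f. in_hom C f X Y \<and> Fa f = h"
  and Id: "Dom C (Id C X) = X" "Cod C (Id C X) = X" "Fa (Id C X) = Id D (Fo X)"
  and Comp: "Dom C (g \<cdot>\<^bsub>C\<^esub> f) = Dom C f" "Cod C (g \<cdot>\<^bsub>C\<^esub> f) = Cod C g" "Fa (g \<cdot>\<^bsub>C\<^esub> f) = Fa g \<cdot>\<^bsub>D\<^esub> Fa f"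
  and UnitObj: "UnitObj C \<in> Obj C" "Fo (UnitObj C) = UnitObj D"
  and TObj: "X \<in> Obj C \<Longrightarrow> Y \<in> Obj C \<Longrightarrow> X \<boxtimes>\<^bsub>C\<^esub> Y \<in> Obj C"
   "X \<in> Obj C \<Longrightarrow> Y \<in> Obj C \<Longrightarrow> Fo (X \<boxtimes>\<^bsub>C\<^esub> Y) = Fo X \<boxtimes>\<^bsub>D\<^esub> Fo Y"
  and TArr: "Dom C (f \<star>\<^bsub>C\<^esub> g) = Dom C f \<boxtimes>\<^bsub>C\<^esub> Dom C g" "Cod C (f \<star>\<^bsub>C\<^esub> g) = Cod C f \<boxtimes>\<^bsub>C\<^esub> Cod C g"
   "f \<in> Arr C \<Longrightarrow> g \<in> Arr C \<Longrightarrow> Fa (f \<star>\<^bsub>C\<^esub> g) = Fa f \<star>\<^bsub>D\<^esub> Fa g"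
  and Assoc: "Dom C (Assoc C X Y Z) = (X \<boxtimes>\<^bsub>C\<^esub> Y) \<boxtimes>\<^bsub>C\<^esub> Z" "Cod C (Assoc C X Y Z) = X \<boxtimes>\<^bsub>C\<^esub> (Y \<boxtimes>\<^bsub>C\<^esub> Z)"
   "X \<in> Obj C \<Longrightarrow> Y \<in> Obj C \<Longrightarrow> Z \<in> Obj C \<Longrightarrow> Fa (Assoc C X Y Z) = Assoc D (Fo X) (Fo Y) (Fo Z)"
  and LUnit: "Dom C (LUnit C X) = UnitObj C \<boxtimes>\<^bsub>C\<^esub> X" "Cod C (LUnit C X) = X"
   "X \<in> Obj C \<Longrightarrow> Fa (LUnit C X) = LUnit D (Fo X)"
  and RUnit: "Dom C (RUnit C X) = X \<boxtimes>\<^bsub>C\<^esub> UnitObj C" "Cod C (RUnit C X) = X"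
   "X \<in> Obj C \<Longrightarrow> Fa (RUnit C X) = RUnit D (Fo X)"
begin

lemma Fo_Obj: "X \<in> Obj C \<Longrightarrow> Fo X \<in> Obj D"
 using Fo_bij by (auto simp: bij_betw_def)

lemma arr_in_hom: "f \<in> Arr C \<Longrightarrow> in_hom C f (Dom C f) (Cod C f)"
 by (simp add: in_hom_def)

lemma arrD: "f \<in> Arr C \<Longrightarrow> Dom C f \<in> Obj C" "f \<in> Arr C \<Longrightarrow> Cod C f \<in> Obj C"
 using arr_in_hom[unfolded in_hom_iff] by blast+

lemma hom_arr: "in_hom C f X Y \<Longrightarrow> f \<in> Arr C"
 by (simp add: in_hom_def)

lemma homD: "in_hom C f X Y \<Longrightarrow> in_hom D (Fa f) (Fo X) (Fo Y)" "in_hom C f X Y \<Longrightarrow> Dom C f = X"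
 "in_hom C f X Y \<Longrightarrow> Cod C f = Y" "in_hom C f X Y \<Longrightarrow> X \<in> Obj C" "in_hom C f X Y \<Longrightarrow> Y \<in> Obj C"
 by (simp_all add: in_hom_iff)

lemma Id_hom: "X \<in> Obj C \<Longrightarrow> in_hom C (Id C X) X X"
 by (simp add: in_hom_iff[of "Id C X"] Id target.Id_in Fo_Obj)

lemma Comp_hom: "in_hom C f X Y \<Longrightarrow> in_hom C g Y Z \<Longrightarrow> in_hom C (g \<cdot>\<^bsub>C\<^esub> f) X Z"
 by (subst in_hom_iff) (auto simp: Comp homD intro: target.Comp_in[OF homD(1) homD(1)])

lemma TArr_hom: "in_hom C f X X' \<Longrightarrow> in_hom C g Y Y' \<Longrightarrow> in_hom C (f \<star>\<^bsub>C\<^esub> g) (X \<boxtimes>\<^bsub>C\<^esub> Y) (X' \<boxtimes>\<^bsub>C\<^esub> Y')"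
 by (subst in_hom_iff) (auto simp: TArr TObj homD hom_arr intro: target.TArr_in homD(1))

text \<open>Isomorphisms lift because the inverse lifts by fullness and its equations by faithfulness.\<close>

lemma iso_lift:
 assumes "Dom C f = X" "Cod C f = Y" "X \<in> Obj C" "Y \<in> Obj C" "iso_arr D (Fa f) (Fo X) (Fo Y)"
 shows "iso_arr C f X Y"
proof -
 obtain h where h: "in_hom D (Fa f) (Fo X) (Fo Y)" "in_hom D h (Fo Y) (Fo X)"
  "h \<cdot>\<^bsub>D\<^esub> Fa f = Id D (Fo X)" "Fa f \<cdot>\<^bsub>D\<^esub> h = Id D (Fo Y)"
  using assms(5) by (auto simp: iso_arr_def)
 have f: "in_hom C f X Y" using h(1) assms by (simp add: in_hom_iff)
 obtain g where g: "in_hom C g Y X" "Fa g = h" using full[OF assms(4,3) h(2)] by blast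
 have "g \<cdot>\<^bsub>C\<^esub> f = Id C X" "f \<cdot>\<^bsub>C\<^esub> g = Id C Y"
  by (rule faithful; (rule Comp_hom f g Id_hom assms | simp add: Comp Id g h)+)+
 with f g show ?thesis by (auto simp: iso_arr_def)
qed

lemma Assoc_iso': "X \<in> Obj C \<Longrightarrow> Y \<in> Obj C \<Longrightarrow> Z \<in> Obj C \<Longrightarrow>
  iso_arr C (Assoc C X Y Z) ((X \<boxtimes>\<^bsub>C\<^esub> Y) \<boxtimes>\<^bsub>C\<^esub> Z) (X \<boxtimes>\<^bsub>C\<^esub> (Y \<boxtimes>\<^bsub>C\<^esub> Z))"
 by (rule iso_lift) (simp_all add: Assoc TObj Fo_Obj target.Assoc_iso)

lemma LUnit_iso': "X \<in> Obj C \<Longrightarrow> iso_arr C (LUnit C X) (UnitObj C \<boxtimes>\<^bsub>C\<^esub> X) X"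
 by (rule iso_lift) (simp_all add: LUnit TObj UnitObj Fo_Obj target.LUnit_iso)

lemma RUnit_iso': "X \<in> Obj C \<Longrightarrow> iso_arr C (RUnit C X) (X \<boxtimes>\<^bsub>C\<^esub> UnitObj C) X"
 by (rule iso_lift) (simp_all add: RUnit TObj UnitObj Fo_Obj target.RUnit_iso)

lemma iso_hom: "iso_arr C f X Y \<Longrightarrow> in_hom C f X Y"
 by (simp add: iso_arr_def)

lemmas homs = Id_hom Comp_hom TArr_hom iso_hom[OF Assoc_iso'] iso_hom[OF LUnit_iso'] iso_hom[OF RUnit_iso']
 UnitObj(1) TObj(1)

lemmas arrs = hom_arr[OF Id_hom] hom_arr[OF TArr_hom[OF arr_in_hom arr_in_hom]]
 hom_arr[OF homs(4)] hom_arr[OF homs(5)] hom_arr[OF homs(6)]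

lemmas Fa_simps = Id Comp UnitObj TObj TArr Assoc LUnit RUnit Fo_Obj arrs

lemma source_monoidal: "monoidal_category C"
proof (intro monoidal_category.intro category.intro monoidal_category_axioms.intro)
 fix f g h f' g' W X Y Z X' Y' Z' X'' Y''
 show "f \<in> Arr C \<Longrightarrow> Dom C f \<in> Obj C" "f \<in> Arr C \<Longrightarrow> Cod C f \<in> Obj C" by (rule arrD; assumption)+
 show "Id C Y \<cdot>\<^bsub>C\<^esub> f = f" "f \<cdot>\<^bsub>C\<^esub> Id C X = f" if f: "in_hom C f X Y"
  by (rule faithful; (rule homs f homD(4,5)[OF f] |
    simp add: Fa_simps target.Id_left[OF homD(1)[OF f]] target.Id_right[OF homD(1)[OF f]])+)+
 show "(h \<cdot>\<^bsub>C\<^esub> g) \<cdot>\<^bsub>C\<^esub> f = h \<cdot>\<^bsub>C\<^esub> (g \<cdot>\<^bsub>C\<^esub> f)"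
  if fgh: "in_hom C f W X" "in_hom C g X Y" "in_hom C h Y Z"
  by (rule faithful) (rule homs fgh | simp add: Fa_simps target.Comp_assoc[OF fgh[THEN homD(1)]])+
 show "X \<in> Obj C \<Longrightarrow> Y \<in> Obj C \<Longrightarrow> Id C X \<star>\<^bsub>C\<^esub> Id C Y = Id C (X \<boxtimes>\<^bsub>C\<^esub> Y)"
  by (rule faithful) (rule homs | assumption | simp add: Fa_simps target.TArr_Id)+
 show "(f' \<cdot>\<^bsub>C\<^esub> f) \<star>\<^bsub>C\<^esub> (g' \<cdot>\<^bsub>C\<^esub> g) = (f' \<star>\<^bsub>C\<^esub> g') \<cdot>\<^bsub>C\<^esub> (f \<star>\<^bsub>C\<^esub> g)"
  if fg: "in_hom C f X X'" "in_hom C f' X' X''" "in_hom C g Y Y'" "in_hom C g' Y' Y''"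
  by (rule faithful) (rule homs fg | simp add: Fa_simps fg[THEN hom_arr] hom_arr[OF Comp_hom[OF fg(1,2)]]
    hom_arr[OF Comp_hom[OF fg(3,4)]] target.TArr_Comp[OF fg[THEN homD(1)]])+
 show "Assoc C X' Y' Z' \<cdot>\<^bsub>C\<^esub> ((f \<star>\<^bsub>C\<^esub> g) \<star>\<^bsub>C\<^esub> h) = (f \<star>\<^bsub>C\<^esub> (g \<star>\<^bsub>C\<^esub> h)) \<cdot>\<^bsub>C\<^esub> Assoc C X Y Z"
  if fgh: "in_hom C f X X'" "in_hom C g Y Y'" "in_hom C h Z Z'"
  by (rule faithful) (rule homs fgh fgh[THEN homD(4)] fgh[THEN homD(5)] |
    simp add: Fa_simps fgh[THEN hom_arr] fgh[THEN homD(4)] fgh[THEN homD(5)] target.Assoc_natural[OF fgh[THEN homD(1)]])+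
 show "LUnit C X' \<cdot>\<^bsub>C\<^esub> (Id C (UnitObj C) \<star>\<^bsub>C\<^esub> f) = f \<cdot>\<^bsub>C\<^esub> LUnit C X" if f: "in_hom C f X X'"
  by (rule faithful) (rule homs f homD(4)[OF f] homD(5)[OF f] |
    simp add: Fa_simps hom_arr[OF f] homD(4)[OF f] homD(5)[OF f] target.LUnit_natural[OF homD(1)[OF f]])+
 show "RUnit C X' \<cdot>\<^bsub>C\<^esub> (f \<star>\<^bsub>C\<^esub> Id C (UnitObj C)) = f \<cdot>\<^bsub>C\<^esub> RUnit C X" if f: "in_hom C f X X'"
  by (rule faithful) (rule homs f homD(4)[OF f] homD(5)[OF f] |
    simp add: Fa_simps hom_arr[OF f] homD(4)[OF f] homD(5)[OF f] target.RUnit_natural[OF homD(1)[OF f]])+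
 show "W \<in> Obj C \<Longrightarrow> X \<in> Obj C \<Longrightarrow> Y \<in> Obj C \<Longrightarrow> Z \<in> Obj C \<Longrightarrow>
   (Id C W \<star>\<^bsub>C\<^esub> Assoc C X Y Z) \<cdot>\<^bsub>C\<^esub> (Assoc C W (X \<boxtimes>\<^bsub>C\<^esub> Y) Z \<cdot>\<^bsub>C\<^esub> (Assoc C W X Y \<star>\<^bsub>C\<^esub> Id C Z)) =
   Assoc C W X (Y \<boxtimes>\<^bsub>C\<^esub> Z) \<cdot>\<^bsub>C\<^esub> Assoc C (W \<boxtimes>\<^bsub>C\<^esub> X) Y Z"
  by (rule faithful) (rule homs | assumption | simp add: Fa_simps target.pentagon)+
 show "X \<in> Obj C \<Longrightarrow> Y \<in> Obj C \<Longrightarrow>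
   (Id C X \<star>\<^bsub>C\<^esub> LUnit C Y) \<cdot>\<^bsub>C\<^esub> Assoc C X (UnitObj C) Y = RUnit C X \<star>\<^bsub>C\<^esub> Id C Y"
  by (rule faithful) (rule homs | assumption | simp add: Fa_simps target.triangle)+
qed (rule homs Assoc_iso' LUnit_iso' RUnit_iso'; assumption)+

lemma Fa_bij: "bij_betw Fa (Arr C) (Arr D)"
 unfolding bij_betw_def
proof (intro conjI inj_onI equalityI subsetI)
 fix f g assume fg: "f \<in> Arr C" "g \<in> Arr C" and eq: "Fa f = Fa g"
 note f = arr_in_hom[OF fg(1)] and g = arr_in_hom[OF fg(2)]
 have "Fo (Dom C f) = Fo (Dom C g)" "Fo (Cod C f) = Fo (Cod C g)"
  using homD(1)[OF f] homD(1)[OF g] eq by (auto simp: in_hom_def)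
 then have "Dom C f = Dom C g" "Cod C f = Cod C g"
  using Fo_bij arrD fg by (auto simp: bij_betw_def dest: inj_onD)
 then show "f = g" using faithful[OF f _ eq] g by simp
next
 fix h assume "h \<in> Fa ` Arr C"
 then show "h \<in> Arr D" using homD(1)[OF arr_in_hom] by (auto simp: in_hom_def)
next
 fix h assume h: "h \<in> Arr D"
 then have "Dom D h \<in> Fo ` Obj C" "Cod D h \<in> Fo ` Obj C"
  using Fo_bij target.Dom_in target.Cod_in by (auto simp: bij_betw_def)
 then obtain X Y where XY: "X \<in> Obj C" "Y \<in> Obj C" "Dom D h = Fo X" "Cod D h = Fo Y" by auto
 with h full[of X Y h] show "h \<in> Fa ` Arr C" by (auto simp: in_hom_def)
qed

lemma target_iso_Id: "X \<in> Obj D \<Longrightarrow> iso_arr D (Id D X) X X"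
 using target.Id_in[of X] target.Id_left[of "Id D X" X X] by (auto simp: iso_arr_def)

lemma isomorphic: "isomorphic_monoidal_categories C D"
proof -
 interpret source: monoidal_category C by (rule source_monoidal)
 have "monoidal_functor C D Fo Fa (\<lambda>X Y. Id D (Fo X \<boxtimes>\<^bsub>D\<^esub> Fo Y)) (Id D (UnitObj D))"
 proof unfold_locales
  fix f g X Y Z X' Y'
  note tob = target.TObj_in target.UnitObj_in Fo_Obj
  show "X \<in> Obj C \<Longrightarrow> Fo X \<in> Obj D" by (rule Fo_Obj)
  show "in_hom C f X Y \<Longrightarrow> in_hom D (Fa f) (Fo X) (Fo Y)" by (rule homD)
  show "Fa (Id C X) = Id D (Fo X)" "Fa (g \<cdot>\<^bsub>C\<^esub> f) = Fa g \<cdot>\<^bsub>D\<^esub> Fa f" by (simp_all add: Id Comp)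
  show "X \<in> Obj C \<Longrightarrow> Y \<in> Obj C \<Longrightarrow>
    iso_arr D (Id D (Fo X \<boxtimes>\<^bsub>D\<^esub> Fo Y)) (Fo X \<boxtimes>\<^bsub>D\<^esub> Fo Y) (Fo (X \<boxtimes>\<^bsub>C\<^esub> Y))"
   by (simp add: TObj target_iso_Id tob)
  show "iso_arr D (Id D (UnitObj D)) (UnitObj D) (Fo (UnitObj C))"
   by (simp add: UnitObj target_iso_Id tob)
  show "Id D (Fo X' \<boxtimes>\<^bsub>D\<^esub> Fo Y') \<cdot>\<^bsub>D\<^esub> (Fa f \<star>\<^bsub>D\<^esub> Fa g) = Fa (f \<star>\<^bsub>C\<^esub> g) \<cdot>\<^bsub>D\<^esub> Id D (Fo X \<boxtimes>\<^bsub>D\<^esub> Fo Y)"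
   if f: "in_hom C f X X'" and g: "in_hom C g Y Y'"
   using target.TArr_in[OF homD(1)[OF f] homD(1)[OF g]]
   by (simp add: TArr hom_arr[OF f] hom_arr[OF g] target.Id_left target.Id_right)
  note isos = target.Assoc_iso[unfolded iso_arr_def, THEN conjunct1]
   target.LUnit_iso[unfolded iso_arr_def, THEN conjunct1] target.RUnit_iso[unfolded iso_arr_def, THEN conjunct1]
  show "Fa (Assoc C X Y Z) \<cdot>\<^bsub>D\<^esub> (Id D (Fo (X \<boxtimes>\<^bsub>C\<^esub> Y) \<boxtimes>\<^bsub>D\<^esub> Fo Z) \<cdot>\<^bsub>D\<^esub> (Id D (Fo X \<boxtimes>\<^bsub>D\<^esub> Fo Y) \<star>\<^bsub>D\<^esub> Id D (Fo Z))) =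
    Id D (Fo X \<boxtimes>\<^bsub>D\<^esub> Fo (Y \<boxtimes>\<^bsub>C\<^esub> Z)) \<cdot>\<^bsub>D\<^esub> ((Id D (Fo X) \<star>\<^bsub>D\<^esub> Id D (Fo Y \<boxtimes>\<^bsub>D\<^esub> Fo Z)) \<cdot>\<^bsub>D\<^esub> Assoc D (Fo X) (Fo Y) (Fo Z))"
   if "X \<in> Obj C" "Y \<in> Obj C" "Z \<in> Obj C"
   using that isos(1)[of "Fo X" "Fo Y" "Fo Z"]
   by (simp add: Fa_simps tob target.TArr_Id target.Id_left[OF target.Id_in] target.Id_left target.Id_right)
  show "Fa (LUnit C X) \<cdot>\<^bsub>D\<^esub> (Id D (Fo (UnitObj C) \<boxtimes>\<^bsub>D\<^esub> Fo X) \<cdot>\<^bsub>D\<^esub> (Id D (UnitObj D) \<star>\<^bsub>D\<^esub> Id D (Fo X))) = LUnit D (Fo X)"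
   if "X \<in> Obj C"
   using that isos(2)[of "Fo X"]
   by (simp add: Fa_simps tob target.TArr_Id target.Id_left[OF target.Id_in] target.Id_right)
  show "Fa (RUnit C X) \<cdot>\<^bsub>D\<^esub> (Id D (Fo X \<boxtimes>\<^bsub>D\<^esub> Fo (UnitObj C)) \<cdot>\<^bsub>D\<^esub> (Id D (Fo X) \<star>\<^bsub>D\<^esub> Id D (UnitObj D))) = RUnit D (Fo X)"
   if "X \<in> Obj C"
   using that isos(3)[of "Fo X"]
   by (simp add: Fa_simps tob target.TArr_Id target.Id_left[OF target.Id_in] target.Id_right)
 qed
 then show ?thesis using Fo_bij Fa_bij by (auto simp: isomorphic_monoidal_categories_def)
qed

end

section \<open>The monoidal isomorphism\<close>

context smash_datum
begin

definition Fa where "Fa = (\<lambda>(M, f, N). (Fo M, f, Fo N))"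

text \<open>
 The constraints are formed from the underlying spaces and structure maps, which \<open>Fo\<close> does not
 change. This is why it preserves them strictly.
\<close>

lemma Fo_space_ops: "usweedler (Fo M) z t = usweedler M z t" "upure K (Fo M) (Fo N) = upure K M N" "smult (Fo M) = smult M"
 using Fo_simps(3)[of M] utensor_same_space[OF Fo_simps(3)[of M] Fo_simps(3)[of N]]
 by (simp_all add: usweedler_same_space[OF Fo_simps(3)]) (simp add: same_space_def)

lemma Fo_bij: "bij_betw Fo {M. is_dhmod K D M} {N. BM.hm N}"
 by (rule bij_betw_byWitness[where f'=Go]) (auto simp: Go_Fo[OF dh_pre_dh] Fo_Go Fo_hm Go_dh)

lemma dcat_simps:
 "Obj (doi_hopf_category TYPE('s) K D) = {M. is_dhmod K D M}"
 "Arr (doi_hopf_category TYPE('s) K D) = {(M, f, N). is_dhmod K D M \<and> is_dhmod K D N \<and> f \<in> dhmod_mor K D M N}"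
 "Dom (doi_hopf_category TYPE('s) K D) = fst"
 "Cod (doi_hopf_category TYPE('s) K D) = (\<lambda>f. snd (snd f))"
 by (auto simp: doi_hopf_category_def concrete_moncat_def)

lemma Doi_Hopf_isomorphic:
 "isomorphic_monoidal_categories (doi_hopf_category TYPE('s) K D) (module_category TYPE('s) K B)"
proof (rule monoidal_transport.isomorphic[where Fo=Fo and Fa=Fa])
 let ?C = "doi_hopf_category TYPE('s) K D" and ?D = "module_category TYPE('s) K B"
 note cd = doi_hopf_category_def concrete_moncat_def
 interpret target: monoidal_category ?D by (rule BM.module_category_monoidal)
 show "monoidal_transport ?C ?D Fo Fa"
 proof unfold_locales
  show "bij_betw Fo (Obj ?C) (Obj ?D)" using Fo_bij by (simp add: dcat_simps BM.cat_simps)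
  fix f g :: "('k,'a,'c,('k,'s) univ) dhmod \<times> (('k,'s) univ \<Rightarrow> ('k,'s) univ) \<times> ('k,'a,'c,('k,'s) univ) dhmod"
   and X Y Z :: "('k,'a,'c,('k,'s) univ) dhmod"
  show "in_hom ?C f X Y \<longleftrightarrow> X \<in> Obj ?C \<and> Y \<in> Obj ?C \<and> Dom ?C f = X \<and> Cod ?C f = Y \<and> in_hom ?D (Fa f) (Fo X) (Fo Y)"
   by (cases f) (auto simp: in_hom_def dcat_simps BM.cat_simps Fa_def Fo_hm Fo_mor dh_pre_dh)
  show "in_hom ?C f X Y \<Longrightarrow> in_hom ?C g X Y \<Longrightarrow> Fa f = Fa g \<Longrightarrow> f = g"
   by (cases f; cases g) (auto simp: in_hom_def dcat_simps Fa_def)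
  show "\<exists>f. in_hom ?C f X Y \<and> Fa f = h" if XY: "X \<in> Obj ?C" "Y \<in> Obj ?C" and h: "in_hom ?D h (Fo X) (Fo Y)" for h
  proof -
   obtain k where "h = (Fo X, k, Fo Y)" "k \<in> BM.mor (Fo X) (Fo Y)" using h by (auto simp: BM.in_hom_iff)
   then show ?thesis
    using XY by (intro exI[of _ "(X, k, Y)"]) (auto simp: in_hom_def dcat_simps Fa_def Fo_mor dh_pre_dh)
  qed
  show "Dom ?C (Id ?C X) = X" "Cod ?C (Id ?C X) = X" "Fa (Id ?C X) = Id ?D (Fo X)"
   by (simp_all add: dcat_simps BM.cat_simps Fa_def Fo_simps) (simp_all add: cd)
  show "Dom ?C (g \<cdot>\<^bsub>?C\<^esub> f) = Dom ?C f" "Cod ?C (g \<cdot>\<^bsub>?C\<^esub> f) = Cod ?C g" "Fa (g \<cdot>\<^bsub>?C\<^esub> f) = Fa g \<cdot>\<^bsub>?D\<^esub> Fa f"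
   by (cases f; cases g; simp add: cd Fa_def BM.cat_simps Fo_simps)+
  show "UnitObj ?C \<in> Obj ?C" "Fo (UnitObj ?C) = UnitObj ?D"
   by (simp_all add: cd BM.cat_simps dunit_dh Fo_dunit)
  show "X \<in> Obj ?C \<Longrightarrow> Y \<in> Obj ?C \<Longrightarrow> X \<boxtimes>\<^bsub>?C\<^esub> Y \<in> Obj ?C"
   "X \<in> Obj ?C \<Longrightarrow> Y \<in> Obj ?C \<Longrightarrow> Fo (X \<boxtimes>\<^bsub>?C\<^esub> Y) = Fo X \<boxtimes>\<^bsub>?D\<^esub> Fo Y"
   by (simp_all add: cd BM.cat_simps dtp_dh Fo_dtp dh_pre_dh)
  show "Dom ?C (f \<star>\<^bsub>?C\<^esub> g) = Dom ?C f \<boxtimes>\<^bsub>?C\<^esub> Dom ?C g" "Cod ?C (f \<star>\<^bsub>?C\<^esub> g) = Cod ?C f \<boxtimes>\<^bsub>?C\<^esub> Cod ?C g"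
   "f \<in> Arr ?C \<Longrightarrow> g \<in> Arr ?C \<Longrightarrow> Fa (f \<star>\<^bsub>?C\<^esub> g) = Fa f \<star>\<^bsub>?D\<^esub> Fa g"
   by (cases f; cases g; simp add: cd Fa_def BM.cat_simps BM.ten_def Fo_dtp[symmetric] dh_pre_dh Fo_simps Fo_space_ops)+
  show "Dom ?C (Assoc ?C X Y Z) = (X \<boxtimes>\<^bsub>?C\<^esub> Y) \<boxtimes>\<^bsub>?C\<^esub> Z" "Cod ?C (Assoc ?C X Y Z) = X \<boxtimes>\<^bsub>?C\<^esub> (Y \<boxtimes>\<^bsub>?C\<^esub> Z)"
   "X \<in> Obj ?C \<Longrightarrow> Y \<in> Obj ?C \<Longrightarrow> Z \<in> Obj ?C \<Longrightarrow> Fa (Assoc ?C X Y Z) = Assoc ?D (Fo X) (Fo Y) (Fo Z)"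
   by (simp_all add: cd Fa_def BM.cat_simps BM.asc_def Fo_dtp[symmetric] dh_pre_dh dtp_dh Fo_simps Fo_space_ops Fo_alpha_inv)
  show "Dom ?C (LUnit ?C X) = UnitObj ?C \<boxtimes>\<^bsub>?C\<^esub> X" "Cod ?C (LUnit ?C X) = X"
   "X \<in> Obj ?C \<Longrightarrow> Fa (LUnit ?C X) = LUnit ?D (Fo X)"
   by (simp_all add: cd Fa_def BM.cat_simps BM.lun_def Fo_dunit[symmetric] Fo_dtp[symmetric] dh_pre_dh dunit_pre_dh Fo_simps Fo_space_ops Fo_alpha_inv)
  show "Dom ?C (RUnit ?C X) = X \<boxtimes>\<^bsub>?C\<^esub> UnitObj ?C" "Cod ?C (RUnit ?C X) = X"
   "X \<in> Obj ?C \<Longrightarrow> Fa (RUnit ?C X) = RUnit ?D (Fo X)"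
   by (simp_all add: cd Fa_def BM.cat_simps BM.run_def Fo_dunit[symmetric] Fo_dtp[symmetric] dh_pre_dh dunit_pre_dh Fo_simps Fo_space_ops Fo_alpha_inv)
 qed
qed

end

theorem proposition4p4:
  fixes K :: "'k ring" and D :: "('k,'h,'a,'c) doi_hopf_datum"
  assumes field: "field K"
    and datum: "monoidal_doi_hopf K D"
    and "bijective_alpha (HH D)" and "bijective_alpha (AA D)" and "bijective_alpha (CC D)"
    and fin_dim: "finite_dimensional K (CC D)"
  shows "hom_bialgebra K (smash K D) \<and>
    isomorphic_monoidal_categories
      (doi_hopf_category TYPE('s) K D) (module_category TYPE('s) K (smash K D))"
proof -
  interpret monoidal_datum K D
    using assms by (intro monoidal_datum.intro ground.intro monoidal_datum_axioms.intro)
  obtain \<Omega> where "coevaluation (CC D) \<Omega>" using coevaluation_exists[OF mods(2) fin_dim] by blast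
  then interpret smash_datum K D \<Omega> by unfold_locales
  show ?thesis using smash_hom_bialgebra Doi_Hopf_isomorphic by blast
qed

end
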